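(* Let $L,H>0$ and $D=\mathbb T_L\times(0,H)$. Suppose that $\bar\psi\in C^2(\bar D)$ satisfies, for some $g\in C^1(\mathbb R)$ and some $\lambda\in\mathbb R$, $$-\Delta\bar\psi=g(\bar\psi-\lambda x_2)\ \text{ in } D,\qquad \bar\psi \text{ is constant on each of } \{x_2=0\} \text{ and } \{x_2=H\}.$$ Denote $\bar\omega:=-\Delta\bar\psi$ and fix $1<p<\infty$. If $$0\le \min_{\bar D}g'(\bar\psi-\lambda x_2)\le\max_{\bar D}g'(\bar\psi-\lambda x_2)\le\Lambda_1,$$ then: (i) $\bar\psi$ can be decomposed as $\bar\psi=\bar\psi^e+\bar\psi^s$, where $\bar\psi^e\in\mathbb E_1$ and $\bar\psi^s$ depends only on $x_2$; and (ii) the associated steady/traveling flow is orbitally stable in the following sense: for any $\varepsilon>0$ there exists $\delta>0$ such that for any sufficiently smooth Euler flow in $D$ with vorticity $\omega(t,\mathbf x)$, if $$\|\omega(0,\cdot)-\bar\omega\|_{L^p(D)}<\delta,$$ then for any $t\in\mathbb R$ there exists $\alpha_t\in\mathbb R$ such that $$\|\omega(t,\cdot)-\bar\omega(\cdot+\alpha_t\mathbf e_1)\|_{L^p(D)}<\varepsilon.$$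
   Context: $\mathbb T_L=\mathbb R/L\mathbb Z$, $D=\mathbb T_L\times(0,H)$ is a periodic channel with coordinates $\mathbf x=(x_1,x_2)$, $\bar D=\mathbb T_L\times[0,H]$, $\mathbf e_1=(1,0)$. Euler flow: a solution, defined for all $t\in\mathbb R$, of $\partial_t\mathbf v+(\mathbf v\cdot\nabla)\mathbf v=-\nabla P$, $\nabla\cdot\mathbf v=0$ in $D$, with $v_2=0$ on $\{x_2=0\}\cup\{x_2=H\}$, where $\mathbf v=(v_1,v_2)$ and $P$ are functions on $\mathbb R\times D$ (so periodic in $x_1$). "Sufficiently smooth" means a classical solution, e.g. $\mathbf v\in C^2(\mathbb R\times\bar D)$, $P\in C^1(\mathbb R\times\bar D)$. Its vorticity is $\omega=\partial_{x_1}v_2-\partial_{x_2}v_1$. The flux $Q=\int_0^Hv_1\,dx_2$ of the flow is arbitrary. The flow associated with the stream function $\bar\psi$ is $\mathbf v=\nabla^\perp\psi$, $\nabla^\perp=(\partial_{x_2},-\partial_{x_1})$, $\psi(t,x_1,x_2)=\bar\psi(x_1-\lambda t,x_2)$; it is steady if $\lambda=0$ or $\bar\psi$ depends only on $x_2$, and otherwise traveling. $\Lambda_1$ is the first (smallest) eigenvalue, and $\mathbb E_1$ the corresponding eigenspace, of the problem $$-\Delta u=\Lambda u\ \text{ in } D,\qquad u|_{x_2=0}=u|_{x_2=H}=\text{constant},\qquad \int_Du\,d\mathbf x=0$$ (the constant is not prescribed but is the same on both boundary components). Explicitly: if $H/L>\sqrt3/2$, then $\Lambda_1=\frac{4\pi^2}{H^2}$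 and $\mathbb E_1=\mathrm{span}\{\sin\frac{2\pi x_2}{H},\cos\frac{2\pi x_2}{H}\}$; if $H/L<\sqrt3/2$, then $\Lambda_1=\frac{4\pi^2}{L^2}+\frac{\pi^2}{H^2}$ and $\mathbb E_1=\mathrm{span}\{\cos\frac{2\pi x_1}{L}\sin\frac{\pi x_2}{H},\sin\frac{2\pi x_1}{L}\sin\frac{\pi x_2}{H}\}$; if $H/L=\sqrt3/2$, then $\Lambda_1=\frac{4\pi^2}{H^2}=\frac{4\pi^2}{L^2}+\frac{\pi^2}{H^2}$ and $\mathbb E_1$ is the span of all four functions. *)

theory Defs
  imports "HOL-Analysis.Analysis"
begin

(* Functions on T_L x [0,H] are represented by functions on the covering strip R x [0,H] that are
   L-periodic in the first coordinate.  Values outside the closed strip are irrelevant: every notion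
   below only looks at the strip, and derivatives are taken within it. *)

definition strip :: "real \<Rightarrow> (real \<times> real) set" where
  "strip H = UNIV \<times> {0<..<H}"

definition cl_strip :: "real \<Rightarrow> (real \<times> real) set" where
  "cl_strip H = UNIV \<times> {0..H}"

definition x1_periodic :: "real \<Rightarrow> real \<Rightarrow> (real \<times> real \<Rightarrow> 'a) \<Rightarrow> bool" where
  "x1_periodic L H u \<longleftrightarrow> (\<forall>x\<in>cl_strip H. u (x + (L, 0)) = u x)"

(* A fundamental domain for D; integrals over D are integrals over this set. *)
definition cell :: "real \<Rightarrow> real \<Rightarrow> (real \<times> real) set" where
  "cell L H = {0..<L} \<times> {0<..<H}"

(* The derivative of f at x within S in direction b.  It is the ordinary partial derivative at
   interior points of S, and one-sided in the normal direction at boundary points of a strip.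
   On the sets S used here (strips and products of R with strips, H > 0) the derivative within S
   is unique. *)
definition partial ::
    "'a::euclidean_space set \<Rightarrow> 'a \<Rightarrow> ('a \<Rightarrow> real) \<Rightarrow> 'a \<Rightarrow> real" where
  "partial S b f x = frechet_derivative f (at x within S) b"

(* f is of class C^k on S: all iterated partial derivatives of order up to k exist and are
   continuous on S (up to the boundary, if S is closed). *)
primrec Ck_on :: "nat \<Rightarrow> 'a::euclidean_space set \<Rightarrow> ('a \<Rightarrow> real) \<Rightarrow> bool" where
  "Ck_on 0 S f \<longleftrightarrow> continuous_on S f"
| "Ck_on (Suc k) S f \<longleftrightarrow> f differentiable_on S \<and> (\<forall>b\<in>Basis. Ck_on k S (partial S b f))"

definition laplacian :: "real \<Rightarrow> (real \<times> real \<Rightarrow> real) \<Rightarrow> real \<times> real \<Rightarrow> real" where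
  "laplacian H u x =
     partial (cl_strip H) (1, 0) (partial (cl_strip H) (1, 0) u) x
   + partial (cl_strip H) (0, 1) (partial (cl_strip H) (0, 1) u) x"

definition Lp_norm :: "real \<Rightarrow> real \<Rightarrow> real \<Rightarrow> (real \<times> real \<Rightarrow> real) \<Rightarrow> real" where
  "Lp_norm L H p f = (LINT x:cell L H|lborel. \<bar>f x\<bar> powr p) powr (1 / p)"

definition eigenspace :: "real \<Rightarrow> real \<Rightarrow> real \<Rightarrow> (real \<times> real \<Rightarrow> real) set" where
  "eigenspace L H \<Lambda> = {u.
     x1_periodic L H u \<and> Ck_on 2 (cl_strip H) u \<and>
     (\<forall>x\<in>strip H. - laplacian H u x = \<Lambda> * u x) \<and>
     (\<exists>c. \<forall>x1. u (x1, 0) = c \<and> u (x1, H) = c) \<and>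
     (LINT x:cell L H|lborel. u x) = 0}"

definition is_eigenvalue :: "real \<Rightarrow> real \<Rightarrow> real \<Rightarrow> bool" where
  "is_eigenvalue L H \<Lambda> \<longleftrightarrow> (\<exists>u\<in>eigenspace L H \<Lambda>. \<exists>x\<in>cl_strip H. u x \<noteq> 0)"

definition Lambda1 :: "real \<Rightarrow> real \<Rightarrow> real" where
  "Lambda1 L H = (LEAST \<Lambda>. is_eigenvalue L H \<Lambda>)"

definition E1 :: "real \<Rightarrow> real \<Rightarrow> (real \<times> real \<Rightarrow> real) set" where
  "E1 L H = eigenspace L H (Lambda1 L H)"

(* Space-time fields are functions of (t, x1, x2) = (t, x) on R x [closed strip]. *)
definition spacetime :: "real \<Rightarrow> (real \<times> real \<times> real) set" where
  "spacetime H = UNIV \<times> cl_strip H"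

abbreviation dt :: "real \<Rightarrow> (real \<times> real \<times> real \<Rightarrow> real) \<Rightarrow> real \<times> real \<times> real \<Rightarrow> real" where
  "dt H \<equiv> partial (spacetime H) (1, 0, 0)"

abbreviation dx1 :: "real \<Rightarrow> (real \<times> real \<times> real \<Rightarrow> real) \<Rightarrow> real \<times> real \<times> real \<Rightarrow> real" where
  "dx1 H \<equiv> partial (spacetime H) (0, 1, 0)"

abbreviation dx2 :: "real \<Rightarrow> (real \<times> real \<times> real \<Rightarrow> real) \<Rightarrow> real \<times> real \<times> real \<Rightarrow> real" where
  "dx2 H \<equiv> partial (spacetime H) (0, 0, 1)"

definition euler_flow ::
    "real \<Rightarrow> real \<Rightarrow> (real \<times> real \<times> real \<Rightarrow> real) \<Rightarrow> (real \<times> real \<times> real \<Rightarrow> real)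
      \<Rightarrow> (real \<times> real \<times> real \<Rightarrow> real) \<Rightarrow> bool" where
  "euler_flow L H v1 v2 P \<longleftrightarrow>
     Ck_on 2 (spacetime H) v1 \<and> Ck_on 2 (spacetime H) v2 \<and> Ck_on 1 (spacetime H) P \<and>
     (\<forall>t. x1_periodic L H (\<lambda>x. v1 (t, x)) \<and> x1_periodic L H (\<lambda>x. v2 (t, x)) \<and>
          x1_periodic L H (\<lambda>x. P (t, x))) \<and>
     (\<forall>z\<in>UNIV \<times> strip H.
        dt H v1 z + (v1 z * dx1 H v1 z + v2 z * dx2 H v1 z) = - dx1 H P z \<and>
        dt H v2 z + (v1 z * dx1 H v2 z + v2 z * dx2 H v2 z) = - dx2 H P z \<and>
        dx1 H v1 z + dx2 H v2 z = 0) \<and>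
     (\<forall>t x1. v2 (t, x1, 0) = 0 \<and> v2 (t, x1, H) = 0)"

definition vorticity ::
    "real \<Rightarrow> (real \<times> real \<times> real \<Rightarrow> real) \<Rightarrow> (real \<times> real \<times> real \<Rightarrow> real)
      \<Rightarrow> real \<times> real \<times> real \<Rightarrow> real" where
  "vorticity H v1 v2 z = dx1 H v2 z - dx2 H v1 z"

definition orbitally_stable ::
    "real \<Rightarrow> real \<Rightarrow> real \<Rightarrow> (real \<times> real \<Rightarrow> real) \<Rightarrow> bool" where
  "orbitally_stable L H p \<omega>bar \<longleftrightarrow>
     (\<forall>\<epsilon>>0. \<exists>\<delta>>0. \<forall>v1 v2 P. euler_flow L H v1 v2 P \<longrightarrow>
        Lp_norm L H p (\<lambda>x. vorticity H v1 v2 (0, x) - \<omega>bar x) < \<delta> \<longrightarrow>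
        (\<forall>t. \<exists>\<alpha>. Lp_norm L H p (\<lambda>x. vorticity H v1 v2 (t, x) - \<omega>bar (x + (\<alpha>, 0))) < \<epsilon>))"

end

(*
  Work with the relative stream function phi = psi - lam x_2, which solves - Delta phi = g(phi).

  (i) A horizontal translate of phi solves the same equation; the difference d of the two vanishes on
  the boundary, has mean zero in x_1, and satisfies int |grad d|^2 <= Lambda_1 int d^2. Hence d attains
  equality in the Poincare inequality, and averaging over all translates gives the decomposition.

  (ii) Truncate the vorticity w(t) of an Euler flow to the range of the steady vorticity wb. The error
  of the truncation is a Casimir, so it stays small in L^p. With F the convex dual of a primitive
  of g, conservation of int F and of the energy (in a frame in which the perturbation carries no flux)
  shows that (1 / Lambda_1) int b^2 - int |grad chi|^2 stays small, where b = eta - wb for the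
  truncation eta, and chi is the stream function of the perturbation. By the gap in the Poincare
  inequality, b stays L^2-close to the first eigenspace. There the impulse int x_2 w fixes the
  coefficient of sin(2 pi x_2 / H), and the second and third moments of the vorticity give a
  polynomial equation for the coefficient of cos(2 pi x_2 / H) that has an isolated zero at the
  steady flow, so by continuity in time that coefficient cannot move. The second moment then fixes the
  amplitude of the x_1-dependent mode; its phase is the horizontal translation.
*)

theory Submission
  imports Defs
begin

section \<open>Wirtinger inequalities on an interval\<close>

text \<open>Since g' may reach Lambda_1, the second variation of the energy-Casimir functional can
  degenerate on the first eigenspace: convexity controls the perturbation only modulo that space,
  and the at most four remaining coefficients must be caught by further invariants. The cosine
  coefficient is the delicate one. Neither the mean nor the impulse sees it, its polynomial equation
  may have other zeros, and the zero at the steady flow may be multiple. Only continuity in time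
  excludes a jump, so this coefficient has to be an explicit continuous function of time, while the
  others may be chosen anew at each instant. For this reason the inequalities with remainder are
  proved without Fourier series: in one variable the trigonometric coefficients are point values of
  the function. The exponent p may be close to 1, where the L^p norm does not control second and
  third moments of the perturbation. Hence the truncation, and a Sobolev embedding into every finite
  exponent, to pair the stream function with the truncation error.\<close>

lemma FTC_continuous:
  fixes F f :: "real \<Rightarrow> real"
  assumes "a \<le> b" and "\<And>x. x \<in> {a..b} \<Longrightarrow> (F has_real_derivative f x) (at x within {a..b})"
  shows "integral {a..b} f = F b - F a"
  using fundamental_theorem_of_calculus[OF assms(1), of F f] assms(2)
  by (simp add: has_real_derivative_iff_has_vector_derivative integral_unique)

text \<open>The derivative is an explicit argument and one-sided at the endpoints, so that
  regularity up to the walls of the channel can be fed in directly.\<close>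

definition C1_Icc :: "real \<Rightarrow> real \<Rightarrow> (real \<Rightarrow> real) \<Rightarrow> (real \<Rightarrow> real) \<Rightarrow> bool" where
  "C1_Icc a b u u' \<longleftrightarrow> continuous_on {a..b} u' \<and>
     (\<forall>x\<in>{a..b}. (u has_real_derivative u' x) (at x within {a..b}))"

lemma C1_IccD:
  assumes "C1_Icc a b u u'"
  shows "x \<in> {a..b} \<Longrightarrow> (u has_real_derivative u' x) (at x within {a..b})"
    "continuous_on {a..b} u" "continuous_on {a..b} u'"
  using assms unfolding C1_Icc_def by (auto intro!: DERIV_continuous_on)

lemma C1_Icc_subset:
  assumes "C1_Icc a b u u'" "a \<le> a'" "b' \<le> b"
  shows "C1_Icc a' b' u u'"
proof -
  have s: "{a'..b'} \<subseteq> {a..b}" using assms by auto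
  show ?thesis using assms(1) unfolding C1_Icc_def
    using s by (meson continuous_on_subset has_field_derivative_subset subsetD)
qed

lemma C1_Icc_shift:
  assumes "C1_Icc (a + h) (b + h) u u'"
  shows "C1_Icc a b (\<lambda>x. u (x + h)) (\<lambda>x. u' (x + h))"
proof -
  have im: "(\<lambda>x. x + h) ` {a..b} \<subseteq> {a + h..b + h}" by auto
  have "continuous_on {a..b} (\<lambda>x. u' (x + h))"
    by (rule continuous_on_compose2[OF C1_IccD(3)[OF assms]]) (use im in \<open>auto intro!: continuous_intros\<close>)
  moreover have "((\<lambda>x. u (x + h)) has_real_derivative u' (x + h)) (at x within {a..b})" if "x \<in> {a..b}" for x
  proof -
    have "(u has_real_derivative u' (x + h)) (at (x + h) within (\<lambda>x. x + h) ` {a..b})"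
      using C1_IccD(1)[OF assms, of "x + h"] that im by (auto intro: has_field_derivative_subset)
    moreover have "((\<lambda>x. x + h) has_real_derivative 1) (at x within {a..b})"
      by (auto intro!: derivative_eq_intros)
    ultimately show ?thesis
      using DERIV_image_chain[of u "u' (x + h)" "\<lambda>x. x + h" x "{a..b}" 1] by (simp add: o_def)
  qed
  ultimately show ?thesis unfolding C1_Icc_def by blast
qed

lemma C1_Icc_add:
  "C1_Icc a b u u' \<Longrightarrow> C1_Icc a b v v' \<Longrightarrow> C1_Icc a b (\<lambda>x. u x + v x) (\<lambda>x. u' x + v' x)"
  unfolding C1_Icc_def by (auto intro!: continuous_intros derivative_eq_intros)

lemma C1_Icc_diff:
  "C1_Icc a b u u' \<Longrightarrow> C1_Icc a b v v' \<Longrightarrow> C1_Icc a b (\<lambda>x. u x - v x) (\<lambda>x. u' x - v' x)"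
  unfolding C1_Icc_def by (auto intro!: continuous_intros derivative_eq_intros)

lemma C1_Icc_cmult:
  "C1_Icc a b u u' \<Longrightarrow> C1_Icc a b (\<lambda>x. c * u x) (\<lambda>x. c * u' x)"
  unfolding C1_Icc_def by (auto intro!: continuous_intros derivative_eq_intros)

lemma C1_Icc_const: "C1_Icc a b (\<lambda>x. c) (\<lambda>x. 0)"
  unfolding C1_Icc_def by (auto intro!: continuous_intros derivative_eq_intros)

lemma C1_Icc_sin: "C1_Icc a b (\<lambda>x. sin (k * x)) (\<lambda>x. k * cos (k * x))"
  unfolding C1_Icc_def by (auto intro!: continuous_intros derivative_eq_intros)

lemma C1_Icc_cos: "C1_Icc a b (\<lambda>x. cos (k * x)) (\<lambda>x. - (k * sin (k * x)))"
  unfolding C1_Icc_def by (auto intro!: continuous_intros derivative_eq_intros)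

lemma integrable_C1:
  assumes "C1_Icc a b u u'"
  shows "(\<lambda>x. (u x)\<^sup>2) integrable_on {a..b}" "(\<lambda>x. (u' x)\<^sup>2) integrable_on {a..b}"
  using C1_IccD(2,3)[OF assms] by (auto intro!: integrable_continuous_interval continuous_intros)

text \<open>The Wirtinger deficit at frequency \<open>k\<close>. Keeping it as one form lets
  intervals be glued and eigenfunctions be split off without loss.\<close>

definition Qf :: "real \<Rightarrow> real \<Rightarrow> real \<Rightarrow> (real \<Rightarrow> real) \<Rightarrow> (real \<Rightarrow> real) \<Rightarrow> real" where
  "Qf k a b u u' = integral {a..b} (\<lambda>x. (u' x)\<^sup>2 - k\<^sup>2 * (u x)\<^sup>2)"

lemma Qf_eq:
  assumes "C1_Icc a b u u'"
  shows "Qf k a b u u' = integral {a..b} (\<lambda>x. (u' x)\<^sup>2) - k\<^sup>2 * integral {a..b} (\<lambda>x. (u x)\<^sup>2)"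
  unfolding Qf_def using integrable_C1[OF assms]
  by (intro integral_unique has_integral_diff has_integral_mult_right integrable_integral)

lemma Qf_combine:
  assumes "C1_Icc a b u u'" "a \<le> c" "c \<le> b"
  shows "Qf k a b u u' = Qf k a c u u' + Qf k c b u u'"
  unfolding Qf_def
  by (rule Henstock_Kurzweil_Integration.integral_combine[symmetric])
    (use assms C1_IccD(2,3)[OF assms(1)] in \<open>auto intro!: integrable_continuous_interval continuous_intros\<close>)

text \<open>The field \<open>k tan (k (x - c))\<close> solves the Riccati equation, so
  \<open>u'\<^sup>2 - k\<^sup>2 u\<^sup>2 = (u' + k tan (k (x - c)) u)\<^sup>2 - (k tan (k (x - c)) u\<^sup>2)'\<close>.\<close>

lemma Qf_field:
  assumes u: "C1_Icc a b u u'" and ab: "a \<le> b"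
    and c: "\<And>x. x \<in> {a..b} \<Longrightarrow> cos (k * (x - c)) \<noteq> 0"
  shows "Qf k a b u u' \<ge> k * tan (k * (a - c)) * (u a)\<^sup>2 - k * tan (k * (b - c)) * (u b)\<^sup>2"
proof -
  define G where "G x = k * tan (k * (x - c)) * (u x)\<^sup>2" for x
  define g where "g x = k\<^sup>2 * (1 + (tan (k * (x - c)))\<^sup>2) * (u x)\<^sup>2 + 2 * k * tan (k * (x - c)) * u x * u' x" for x
  have Gd: "(G has_real_derivative g x) (at x within {a..b})" if "x \<in> {a..b}" for x
  proof -
    have "((\<lambda>x. tan (k * (x - c))) has_real_derivative k * (1 + (tan (k * (x - c)))\<^sup>2)) (at x within {a..b})"
      using c[OF that] by (auto intro!: derivative_eq_intros simp: tan_sec power_inverse)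
    from DERIV_mult[OF DERIV_cmult[OF this, of k] DERIV_power[OF C1_IccD(1)[OF u that], of 2]]
    show ?thesis
      unfolding G_def[abs_def] by (rule DERIV_cong) (simp add: g_def, algebra)
  qed
  have Gint: "integral {a..b} g = G b - G a"
    by (rule FTC_continuous[OF ab Gd])
  have tanc: "continuous_on {a..b} (\<lambda>x. tan (k * (x - c)))"
    using c by (auto intro!: continuous_intros)
  have gint: "g integrable_on {a..b}"
    unfolding g_def[abs_def]
    by (intro integrable_continuous_interval continuous_intros tanc C1_IccD[OF u])
  have qint: "(\<lambda>x. (u' x)\<^sup>2 - k\<^sup>2 * (u x)\<^sup>2) integrable_on {a..b}"
    by (intro integrable_continuous_interval continuous_intros C1_IccD[OF u])
  have "0 \<le> integral {a..b} (\<lambda>x. ((u' x)\<^sup>2 - k\<^sup>2 * (u x)\<^sup>2) + g x)"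
  proof (rule integral_nonneg)
    show "(\<lambda>x. ((u' x)\<^sup>2 - k\<^sup>2 * (u x)\<^sup>2) + g x) integrable_on {a..b}"
      using qint gint by (rule Henstock_Kurzweil_Integration.integrable_add)
    fix x
    have "((u' x)\<^sup>2 - k\<^sup>2 * (u x)\<^sup>2) + g x = (u' x + k * tan (k * (x - c)) * u x)\<^sup>2"
      unfolding g_def by (simp add: algebra_simps power2_eq_square)
    then show "0 \<le> ((u' x)\<^sup>2 - k\<^sup>2 * (u x)\<^sup>2) + g x" by simp
  qed
  also have "\<dots> = Qf k a b u u' + (G b - G a)"
    unfolding Qf_def Gint[symmetric] using qint gint by (rule Henstock_Kurzweil_Integration.integral_add)
  finally show ?thesis unfolding G_def by simp
qed

text \<open>At the critical frequency the tangent field blows up at the endpoints. The inequalities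
  are therefore proved for every smaller frequency and passed to the limit.\<close>

lemma le_limit_from_below:
  fixes A B k :: real
  assumes "0 < k" and "\<And>j. 0 < j \<Longrightarrow> j < k \<Longrightarrow> j\<^sup>2 * A \<le> B"
  shows "k\<^sup>2 * A \<le> B"
proof (rule tendsto_upperbound[of "\<lambda>j. j\<^sup>2 * A" _ "at_left k"])
  show "((\<lambda>j. j\<^sup>2 * A) \<longlongrightarrow> k\<^sup>2 * A) (at_left k)"
    by (auto intro!: tendsto_intros)
  show "\<forall>\<^sub>F j in at_left k. j\<^sup>2 * A \<le> B"
    unfolding eventually_at_left[OF assms(1)] using assms by (intro exI[of _ 0]) auto
qed simp

text \<open>The field is centred at the midpoint. For \<open>j < k\<close> its argument stays
  strictly between -pi/2 and pi/2 on the whole interval, and the boundary terms vanish together with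
  \<open>u\<close>.\<close>

lemma Wirtinger_Dirichlet:
  assumes u: "C1_Icc a b u u'" and ab: "a < b" and k: "k = pi / (b - a)"
    and u0: "u a = 0" "u b = 0"
  shows "0 \<le> Qf k a b u u'"
proof -
  have kpos: "0 < k" using ab k by simp
  have "k\<^sup>2 * integral {a..b} (\<lambda>x. (u x)\<^sup>2) \<le> integral {a..b} (\<lambda>x. (u' x)\<^sup>2)"
  proof (rule le_limit_from_below[OF kpos])
    fix j assume j: "0 < j" "j < k"
    define c where "c = (a + b) / 2"
    have "cos (j * (x - c)) \<noteq> 0" if "x \<in> {a..b}" for x
    proof -
      have "\<bar>x - c\<bar> \<le> (b - a) / 2" using that unfolding c_def by (auto simp: abs_le_iff field_simps)
      then have "\<bar>j * (x - c)\<bar> \<le> j * ((b - a) / 2)" using j by (simp add: abs_mult)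
      also have "\<dots> < k * ((b - a) / 2)" using j ab by simp
      also have "\<dots> = pi / 2" using ab k by simp
      finally have "cos (j * (x - c)) > 0" by (intro cos_gt_zero_pi) auto
      then show ?thesis by simp
    qed
    from Qf_field[OF u _ this] ab u0 have "0 \<le> Qf j a b u u'" by simp
    then show "j\<^sup>2 * integral {a..b} (\<lambda>x. (u x)\<^sup>2) \<le> integral {a..b} (\<lambda>x. (u' x)\<^sup>2)"
      unfolding Qf_eq[OF u] by simp
  qed
  then show ?thesis unfolding Qf_eq[OF u] by simp
qed

text \<open>Subtracting the value at a point \<open>c\<close> with \<open>u c = u (c + l/2)\<close> reduces to two
  Dirichlet problems on half periods, one of which wraps around the end of the interval.\<close>

lemma Wirtinger_periodic_aux:
  assumes u: "C1_Icc 0 l u u'" and l: "0 < l" and k: "k = 2 * pi / l"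
    and per: "u 0 = u l" and c: "0 \<le> c" "c \<le> l / 2" "u c = 0" "u (c + l / 2) = 0"
  shows "0 \<le> Qf k 0 l u u'"
proof -
  have kpos: "0 < k" using l k by simp
  have kl: "k * l = 2 * pi" using l k by simp
  have mid: "0 \<le> Qf k c (c + l / 2) u u'"
    by (rule Wirtinger_Dirichlet) (use c l k in \<open>auto intro: C1_Icc_subset[OF u]\<close>)
  have outer: "0 \<le> Qf k 0 c u u' + Qf k (c + l / 2) l u u'"
  proof -
    have 1: "C1_Icc 0 c u u'" "C1_Icc (c + l / 2) l u u'"
      by (rule C1_Icc_subset[OF u]; use c l in auto)+
    have "k\<^sup>2 * (integral {0..c} (\<lambda>x. (u x)\<^sup>2) + integral {c + l / 2..l} (\<lambda>x. (u x)\<^sup>2))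
      \<le> integral {0..c} (\<lambda>x. (u' x)\<^sup>2) + integral {c + l / 2..l} (\<lambda>x. (u' x)\<^sup>2)"
    proof (rule le_limit_from_below[OF kpos])
      fix j assume j: "0 < j" "j < k"
      define d where "d = c - l / 4"
      have nz: "cos (j * y) \<noteq> 0" if "- (l / 4) \<le> y" "y \<le> l / 4" for y
      proof -
        have "\<bar>y\<bar> \<le> l / 4" using that by linarith
        then have "\<bar>j * y\<bar> \<le> j * (l / 4)" using j by (simp add: abs_mult)
        also have "\<dots> < k * (l / 4)" using j l by simp
        also have "\<dots> = pi / 2" using kl by simp
        finally have "cos (j * y) > 0" by (intro cos_gt_zero_pi) auto
        then show ?thesis by simp
      qed
      \<comment> \<open>The two pieces of the wrapped half period use one and the same field up to a
        translation: the centres \<open>c - l / 4\<close> and \<open>c + 3 * l / 4\<close> differ by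
        the period, so the boundary terms at 0 and \<open>l\<close> cancel by periodicity.\<close>
      have A: "Qf j 0 c u u' \<ge> j * tan (j * (0 - (c - l / 4))) * (u 0)\<^sup>2 - j * tan (j * (c - (c - l / 4))) * (u c)\<^sup>2"
        by (rule Qf_field[OF 1(1) c(1)], rule nz) (use c in auto)
      have B: "Qf j (c + l / 2) l u u' \<ge> j * tan (j * (c + l / 2 - (c + 3 * l / 4))) * (u (c + l / 2))\<^sup>2
          - j * tan (j * (l - (c + 3 * l / 4))) * (u l)\<^sup>2"
        by (rule Qf_field[OF 1(2)], use c in simp, rule nz) (use c in auto)
      have "l - (c + 3 * l / 4) = 0 - (c - l / 4)" by simp
      then have "0 \<le> Qf j 0 c u u' + Qf j (c + l / 2) l u u'"
        using A B c per by simp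
      then show "j\<^sup>2 * (integral {0..c} (\<lambda>x. (u x)\<^sup>2) + integral {c + l / 2..l} (\<lambda>x. (u x)\<^sup>2))
        \<le> integral {0..c} (\<lambda>x. (u' x)\<^sup>2) + integral {c + l / 2..l} (\<lambda>x. (u' x)\<^sup>2)"
        unfolding Qf_eq[OF 1(1)] Qf_eq[OF 1(2)] by (simp add: algebra_simps)
    qed
    then show ?thesis unfolding Qf_eq[OF 1(1)] Qf_eq[OF 1(2)] by (simp add: algebra_simps)
  qed
  have "Qf k 0 l u u' = Qf k 0 c u u' + (Qf k c (c + l / 2) u u' + Qf k (c + l / 2) l u u')"
    using Qf_combine[OF u c(1)] Qf_combine[OF C1_Icc_subset[OF u c(1) order_refl], of "c + l / 2"] c l
    by simp
  with mid outer show ?thesis by simp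
qed

text \<open>The difference between \<open>u\<close> and its half-period translate changes sign over
  a half period, which yields the point \<open>c\<close>. As \<open>u\<close> has mean zero,
  subtracting the constant \<open>u c\<close> can only increase the L^2 norm, hence decrease
  \<open>Qf\<close>.\<close>

lemma Wirtinger_periodic:
  assumes u: "C1_Icc 0 l u u'" and l: "0 < l" and k: "k = 2 * pi / l"
    and per: "u 0 = u l" and mean: "integral {0..l} u = 0"
  shows "0 \<le> Qf k 0 l u u'"
proof -
  define d where "d x = u x - u (x + l / 2)" for x
  have uc: "continuous_on {0..l} u" using C1_IccD[OF u] by simp
  have dc: "continuous_on {0..l / 2} d"
    unfolding d_def[abs_def] using l
    by (auto intro!: continuous_intros continuous_on_subset[OF uc] continuous_on_compose2[OF uc])
  have d: "d (l / 2) = - d 0" unfolding d_def using per by simp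
  have "\<exists>c. 0 \<le> c \<and> c \<le> l / 2 \<and> d c = 0"
  proof (cases "d 0 \<le> 0")
    case True
    then show ?thesis using IVT'[of d 0 0 "l / 2"] d dc l by auto
  next
    case False
    then show ?thesis using IVT2'[of d "l / 2" 0 0] d dc l by auto
  qed
  then obtain c where c: "0 \<le> c" "c \<le> l / 2" "u c = u (c + l / 2)" unfolding d_def by auto
  define w where "w x = u x - u c" for x
  have w: "C1_Icc 0 l w u'"
    using C1_Icc_diff[OF u C1_Icc_const[of 0 l "u c"]] unfolding w_def[abs_def] by simp
  have "0 \<le> Qf k 0 l w u'"
    by (rule Wirtinger_periodic_aux[OF w l k _ c(1,2)]) (use c per in \<open>auto simp: w_def\<close>)
  also have "\<dots> \<le> Qf k 0 l u u'"
  proof -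
    have "integral {0..l} (\<lambda>x. (w x)\<^sup>2) = integral {0..l} (\<lambda>x. (u x)\<^sup>2 - 2 * u c * u x + (u c)\<^sup>2)"
      unfolding w_def by (simp add: power2_diff algebra_simps)
    also have "\<dots> = integral {0..l} (\<lambda>x. (u x)\<^sup>2) - 2 * u c * integral {0..l} u + l * (u c)\<^sup>2"
    proof (intro integral_unique has_integral_add has_integral_diff has_integral_mult_right integrable_integral
        integrable_continuous_interval continuous_intros uc)
      show "((\<lambda>x. (u c)\<^sup>2) has_integral l * (u c)\<^sup>2) {0..l}"
        using has_integral_const_real[of "(u c)\<^sup>2" 0 l] l by simp
    qed
    finally show ?thesis unfolding Qf_eq[OF w] Qf_eq[OF u] using mean l by (simp add: mult_left_mono)
  qed
  finally show ?thesis .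
qed

lemma Qf_add_orthogonal:
  assumes u: "C1_Icc a b u u'" and v: "C1_Icc a b v v'"
    and 0: "integral {a..b} (\<lambda>x. u' x * v' x - k\<^sup>2 * (u x * v x)) = 0"
  shows "Qf k a b (\<lambda>x. u x + v x) (\<lambda>x. u' x + v' x) = Qf k a b u u' + Qf k a b v v'"
proof -
  note c = C1_IccD(2,3)[OF u] C1_IccD(2,3)[OF v]
  have "Qf k a b (\<lambda>x. u x + v x) (\<lambda>x. u' x + v' x) =
     integral {a..b} (\<lambda>x. ((u' x)\<^sup>2 - k\<^sup>2 * (u x)\<^sup>2) + ((v' x)\<^sup>2 - k\<^sup>2 * (v x)\<^sup>2)
        + 2 * (u' x * v' x - k\<^sup>2 * (u x * v x)))"
    unfolding Qf_def by (rule arg_cong[where f="integral {a..b}"]) (auto simp: power2_eq_square algebra_simps)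
  also have "\<dots> = Qf k a b u u' + Qf k a b v v' + 2 * integral {a..b} (\<lambda>x. u' x * v' x - k\<^sup>2 * (u x * v x))"
    unfolding Qf_def
    by (intro integral_unique has_integral_add has_integral_mult_right integrable_integral
      integrable_continuous_interval continuous_intros c)
  finally show ?thesis using 0 by simp
qed

text \<open>The integrand is the derivative of \<open>s' * v\<close>, because
  \<open>s'' = - k^2 s\<close>. Cross terms between a trigonometric profile and any \<open>v\<close>
  thus reduce to boundary values.\<close>

lemma integral_parts_eigen:
  assumes v: "C1_Icc a b v v'" and ab: "a \<le> b"
    and s: "C1_Icc a b s s'" and s': "C1_Icc a b s' (\<lambda>x. - (k\<^sup>2 * s x))"
  shows "integral {a..b} (\<lambda>x. s' x * v' x - k\<^sup>2 * (s x * v x)) = s' b * v b - s' a * v a"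
  by (rule FTC_continuous[OF ab])
    (use C1_IccD(1)[OF v] C1_IccD(1)[OF s'] in \<open>auto intro!: derivative_eq_intros simp: algebra_simps\<close>)

text \<open>Removing the multiple of the first eigenfunction that interpolates \<open>u\<close> at
  the midpoint leaves \<open>Qf\<close> unchanged and produces a third zero. The Dirichlet
  inequality on each half then holds with frequency \<open>2 * k\<close>, and the surplus is
  \<open>4 - 1 = 3\<close> times \<open>k^2\<close>.\<close>

lemma Wirtinger_Dirichlet_gap:
  assumes u: "C1_Icc 0 l u u'" and l: "0 < l" and k: "k = pi / l" and u0: "u 0 = 0" "u l = 0"
  shows "3 * k\<^sup>2 * integral {0..l} (\<lambda>x. (u x - u (l / 2) * sin (k * x))\<^sup>2) \<le> Qf k 0 l u u'"
proof -
  define A where "A = u (l / 2)"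
  define h where "h x = u x - A * sin (k * x)" for x
  define h' where "h' x = u' x - A * (k * cos (k * x))" for x
  define s where "s x = A * sin (k * x)" for x
  define s' where "s' x = A * (k * cos (k * x))" for x
  have hC: "C1_Icc 0 l h h'"
    unfolding h_def[abs_def] h'_def[abs_def] by (intro C1_Icc_diff C1_Icc_cmult C1_Icc_sin u)
  have sC: "C1_Icc 0 l s s'"
    unfolding s_def[abs_def] s'_def[abs_def] by (intro C1_Icc_cmult C1_Icc_sin)
  have sC': "C1_Icc 0 l s' (\<lambda>x. - (k\<^sup>2 * s x))"
    using C1_Icc_cmult[OF C1_Icc_cmult[OF C1_Icc_cos[of 0 l k]], of A k]
    unfolding s_def[abs_def] s'_def[abs_def] by (simp add: power2_eq_square mult_ac)
  have kl: "k * l = pi" using k l by simp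
  have h0: "h 0 = 0" "h (l / 2) = 0" "h l = 0"
    using u0 kl unfolding h_def A_def by auto
  have Qs: "Qf k 0 l s s' = 0"
    using integral_parts_eigen[OF sC _ sC sC'] l kl unfolding Qf_def s_def by (simp add: power2_eq_square)
  have "Qf k 0 l (\<lambda>x. s x + h x) (\<lambda>x. s' x + h' x) = Qf k 0 l s s' + Qf k 0 l h h'"
    by (rule Qf_add_orthogonal[OF sC hC]) (use integral_parts_eigen[OF hC _ sC sC'] l h0 in auto)
  then have Qu: "Qf k 0 l u u' = Qf k 0 l h h'"
    unfolding Qs by (simp add: s_def h_def s'_def h'_def)
  have "0 \<le> Qf (2 * k) 0 (l / 2) h h'" "0 \<le> Qf (2 * k) (l / 2) l h h'"
    by (rule Wirtinger_Dirichlet; use k l h0 in \<open>auto intro: C1_Icc_subset[OF hC]\<close>)+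
  then have "0 \<le> Qf (2 * k) 0 l h h'"
    using Qf_combine[OF hC, of "l / 2"] l by simp
  then show ?thesis
    unfolding Qu Qf_eq[OF hC] unfolding h_def[symmetric] A_def[symmetric] by simp
qed

lemma integral_fold_half:
  fixes f :: "real \<Rightarrow> real"
  assumes f: "continuous_on {0..l} f" and l: "0 < l"
  shows "integral {0..l} f = integral {0..l / 2} (\<lambda>x. f x + f (x + l / 2))"
proof -
  have s: "integral {l / 2..l} f = integral {0..l / 2} (\<lambda>x. f (x + l / 2))"
    using integral_shift_real_ivl[of "l/2" "l/2" l f] by simp
  have "integral {0..l} f = integral {0..l / 2} f + integral {l / 2..l} f"
    using l by (intro Henstock_Kurzweil_Integration.integral_combine[symmetric] integrable_continuous_interval f) auto
  also have "\<dots> = integral {0..l / 2} (\<lambda>x. f x + f (x + l / 2))"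
    unfolding s using l
    by (intro Henstock_Kurzweil_Integration.integral_add[symmetric] integrable_continuous_interval)
       (auto intro!: continuous_intros continuous_on_subset[OF f] continuous_on_compose2[OF f])
  finally show ?thesis .
qed

text \<open>The part of \<open>u\<close> that is invariant under the half-period shift has twice the frequency;
  the antiperiodic part minus the trigonometric polynomial vanishes at all multiples of a quarter
  period.\<close>

lemma Wirtinger_periodic_gap:
  assumes u: "C1_Icc 0 l u u'" and l: "0 < l" and k: "k = 2 * pi / l"
    and per: "u 0 = u l" and mean: "integral {0..l} u = 0"
    and A: "A = (u 0 - u (l / 2)) / 2" and B: "B = (u (l / 4) - u (3 * l / 4)) / 2"
  shows "3 * k\<^sup>2 * integral {0..l} (\<lambda>x. (u x - A * cos (k * x) - B * sin (k * x))\<^sup>2) \<le> Qf k 0 l u u'"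
proof -
  have kl: "k * l = 2 * pi" "k * (l / 2) = pi" "k * (l / 4) = pi / 2" using k l by auto
  have hshift: "C1_Icc 0 (l / 2) (\<lambda>x. w (x + l / 2)) (\<lambda>x. w' (x + l / 2))" "C1_Icc 0 (l / 2) w w'"
    if "C1_Icc 0 l w w'" for w w'
    by (rule C1_Icc_shift, rule C1_Icc_subset[OF that]; use l in simp)
       (rule C1_Icc_subset[OF that]; use l in simp)
  define s where "s x = A * cos (k * x) + B * sin (k * x)" for x
  define s' where "s' x = A * - (k * sin (k * x)) + B * (k * cos (k * x))" for x
  define h where "h x = u x - s x" for x
  define h' where "h' x = u' x - s' x" for x
  have sC: "C1_Icc 0 l s s'"
    unfolding s_def[abs_def] s'_def[abs_def] by (intro C1_Icc_add C1_Icc_cmult C1_Icc_sin C1_Icc_cos)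
  have sC': "C1_Icc 0 l s' (\<lambda>x. - (k\<^sup>2 * s x))"
    unfolding C1_Icc_def s'_def s_def
    by (auto intro!: continuous_intros derivative_eq_intros simp: algebra_simps power2_eq_square)
  have hC: "C1_Icc 0 l h h'"
    unfolding h_def[abs_def] h'_def[abs_def] by (intro C1_Icc_diff u sC)
  have s0: "s 0 = A" "s l = A" "s' l = s' 0"
    unfolding s_def s'_def using kl by auto
  have sh: "s (x + l / 2) = - s x" "s' (x + l / 2) = - s' x" for x
  proof -
    have "k * (x + l / 2) = k * x + pi" using kl by (simp add: algebra_simps)
    then show "s (x + l / 2) = - s x" "s' (x + l / 2) = - s' x"
      unfolding s_def s'_def by (simp_all add: algebra_simps)
  qed
  have h0: "h 0 = h l" unfolding h_def using s0 per by simp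
  have Qs: "Qf k 0 l s s' = 0"
    using integral_parts_eigen[OF sC _ sC sC'] l s0 unfolding Qf_def by (simp add: power2_eq_square)
  have "Qf k 0 l (\<lambda>x. s x + h x) (\<lambda>x. s' x + h' x) = Qf k 0 l s s' + Qf k 0 l h h'"
    by (rule Qf_add_orthogonal[OF sC hC]) (use integral_parts_eigen[OF hC _ sC sC'] l h0 s0 in auto)
  then have Qu: "Qf k 0 l u u' = Qf k 0 l h h'"
    unfolding Qs by (simp add: h_def h'_def)
  define hp where "hp x = (1 / 2) * (h x + h (x + l / 2))" for x
  define hp' where "hp' x = (1 / 2) * (h' x + h' (x + l / 2))" for x
  define hm where "hm x = (1 / 2) * (h x - h (x + l / 2))" for x
  define hm' where "hm' x = (1 / 2) * (h' x - h' (x + l / 2))" for x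
  have pC: "C1_Icc 0 (l / 2) hp hp'"
    unfolding hp_def[abs_def] hp'_def[abs_def] by (intro C1_Icc_cmult C1_Icc_add hshift[OF hC])
  have mC: "C1_Icc 0 (l / 2) hm hm'"
    unfolding hm_def[abs_def] hm'_def[abs_def] by (intro C1_Icc_cmult C1_Icc_diff hshift[OF hC])
  have par: "integral {0..l} (\<lambda>x. (w x)\<^sup>2) = 2 * integral {0..l / 2} (\<lambda>x. ((1 / 2) * (w x + w (x + l / 2)))\<^sup>2)
      + 2 * integral {0..l / 2} (\<lambda>x. ((1 / 2) * (w x - w (x + l / 2)))\<^sup>2)"
    if w: "continuous_on {0..l} w" for w :: "real \<Rightarrow> real"
  proof -
    have w2: "continuous_on {0..l / 2} w" "continuous_on {0..l / 2} (\<lambda>x. w (x + l / 2))"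
      using l by (auto intro!: continuous_intros continuous_on_subset[OF w] continuous_on_compose2[OF w])
    have "integral {0..l} (\<lambda>x. (w x)\<^sup>2) = integral {0..l / 2} (\<lambda>x. (w x)\<^sup>2 + (w (x + l / 2))\<^sup>2)"
      by (rule integral_fold_half) (use l w in \<open>auto intro!: continuous_intros\<close>)
    also have "\<dots> = integral {0..l / 2} (\<lambda>x. 2 * ((1 / 2) * (w x + w (x + l / 2)))\<^sup>2 + 2 * ((1 / 2) * (w x - w (x + l / 2)))\<^sup>2)"
      by (rule arg_cong[where f="integral {0..l/2}"]) (auto simp: power2_eq_square field_simps)
    also have "\<dots> = 2 * integral {0..l / 2} (\<lambda>x. ((1 / 2) * (w x + w (x + l / 2)))\<^sup>2)
      + 2 * integral {0..l / 2} (\<lambda>x. ((1 / 2) * (w x - w (x + l / 2)))\<^sup>2)"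
      unfolding Henstock_Kurzweil_Integration.integral_mult_right[symmetric]
      by (rule Henstock_Kurzweil_Integration.integral_add)
         (intro integrable_continuous_interval continuous_intros w2)+
    finally show ?thesis .
  qed
  have P: "0 \<le> Qf (2 * k) 0 (l / 2) hp hp'"
  proof (rule Wirtinger_periodic[OF pC])
    show "hp 0 = hp (l / 2)" unfolding hp_def using h0 by simp
    have "integral {0..l} h = integral {0..l} u - integral {0..l} s"
      unfolding h_def[abs_def]
      by (intro Henstock_Kurzweil_Integration.integral_diff integrable_continuous_interval C1_IccD(2)[OF u] C1_IccD(2)[OF sC])
    also have "integral {0..l} s = 0"
      using integral_fold_half[OF C1_IccD(2)[OF sC] l] by (simp add: sh)
    finally have "integral {0..l} h = 0" using mean by simp
    then show "integral {0..l / 2} hp = 0"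
      unfolding hp_def[abs_def] using integral_fold_half[OF C1_IccD(2)[OF hC] l]
      by (simp only: Henstock_Kurzweil_Integration.integral_mult_right)
  qed (use l k in auto)
  have hm0: "hm 0 = 0" "hm (l / 4) = 0" "hm (l / 2) = 0"
  proof -
    show "hm 0 = 0" unfolding hm_def h_def using sh[of 0] s0 A by (simp add: field_simps)
    then show "hm (l / 2) = 0" unfolding hm_def using h0 by simp
    have "s (l / 4) = B" unfolding s_def using kl by simp
    moreover have "l / 4 + l / 2 = 3 * l / 4" by simp
    ultimately show "hm (l / 4) = 0" unfolding hm_def h_def using sh[of "l/4"] B by (simp add: field_simps)
  qed
  have "0 \<le> Qf (2 * k) 0 (l / 4) hm hm'" "0 \<le> Qf (2 * k) (l / 4) (l / 2) hm hm'"
    by (rule Wirtinger_Dirichlet; use k l hm0 in \<open>auto intro: C1_Icc_subset[OF mC] simp: field_simps\<close>)+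
  then have M: "0 \<le> Qf (2 * k) 0 (l / 2) hm hm'"
    using Qf_combine[OF mC, of "l / 4"] l by simp
  have "0 \<le> 2 * Qf (2 * k) 0 (l / 2) hp hp' + 2 * Qf (2 * k) 0 (l / 2) hm hm'"
    using P M by simp
  also have "\<dots> = Qf (2 * k) 0 l h h'"
    unfolding Qf_eq[OF pC] Qf_eq[OF mC] Qf_eq[OF hC] par[OF C1_IccD(2)[OF hC]] par[OF C1_IccD(3)[OF hC]]
    by (simp add: hp_def hm_def hp'_def hm'_def algebra_simps)
  finally show ?thesis
    unfolding Qu Qf_eq[OF hC] by (simp add: h_def s_def diff_diff_eq[symmetric])
qed

section \<open>Integrals over the periodicity cell\<close>

locale channel =
  fixes L H :: real
  assumes L_pos: "0 < L" and H_pos: "0 < H"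
begin

text \<open>Integration is over the closed cell, where continuity alone gives integrability. The
  sides are not identified: periodicity appears as equality of the values at x_1 = 0 and x_1 =
  L.\<close>

definition K :: "(real \<times> real) set" where
  "K = {0..L} \<times> {0..H}"

definition I :: "(real \<times> real \<Rightarrow> real) \<Rightarrow> real" where
  "I f = integral K f"

lemma K_cbox: "K = cbox (0, 0) (L, H)"
  unfolding K_def by (simp add: cbox_Pair_eq)

lemma compact_K: "compact K"
  unfolding K_cbox by (rule compact_cbox)

lemma mem_K: "(x, y) \<in> K \<longleftrightarrow> x \<in> {0..L} \<and> y \<in> {0..H}"
  unfolding K_def by auto

lemma K_integrable: "continuous_on K f \<Longrightarrow> (f :: _ \<Rightarrow> real) integrable_on K"
  unfolding K_cbox by (rule integrable_continuous)

lemma I_has_integral: "continuous_on K f \<Longrightarrow> (f has_integral I f) K"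
  unfolding I_def by (intro integrable_integral K_integrable)

lemma I_unique: "(f has_integral c) K \<Longrightarrow> I f = c"
  unfolding I_def by (rule integral_unique)

lemma I_add: "continuous_on K f \<Longrightarrow> continuous_on K g \<Longrightarrow> I (\<lambda>z. f z + g z) = I f + I g"
  by (intro I_unique has_integral_add I_has_integral)

lemma I_diff: "continuous_on K f \<Longrightarrow> continuous_on K g \<Longrightarrow> I (\<lambda>z. f z - g z) = I f - I g"
  by (intro I_unique has_integral_diff I_has_integral)

lemma I_cmult: "I (\<lambda>z. c * f z) = c * I f"
  unfolding I_def by (rule Henstock_Kurzweil_Integration.integral_mult_right)

lemma I_cong: "(\<And>x y. (x, y) \<in> K \<Longrightarrow> f (x, y) = g (x, y)) \<Longrightarrow> I f = I g"
  unfolding I_def by (rule Henstock_Kurzweil_Integration.integral_cong) auto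

lemma I_mono:
  "continuous_on K f \<Longrightarrow> continuous_on K g \<Longrightarrow> (\<And>z. z \<in> K \<Longrightarrow> f z \<le> g z) \<Longrightarrow> I f \<le> I g"
  unfolding I_def by (intro integral_le K_integrable)

lemma I_nonneg: "continuous_on K f \<Longrightarrow> (\<And>z. z \<in> K \<Longrightarrow> 0 \<le> f z) \<Longrightarrow> 0 \<le> I f"
  unfolding I_def by (intro integral_nonneg K_integrable)

lemma I_const: "I (\<lambda>z. c) = c * (L * H)"
  unfolding I_def K_cbox using L_pos H_pos by (simp add: content_Pair mult.commute)

lemma I_abs: "continuous_on K f \<Longrightarrow> \<bar>I f\<bar> \<le> I (\<lambda>z. \<bar>f z\<bar>)"
  unfolding I_def using integral_norm_bound_integral[of f K "\<lambda>z. \<bar>f z\<bar>"]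
  by (auto intro!: K_integrable continuous_intros)

lemma I_iterated:
  "continuous_on K f \<Longrightarrow> I f = integral {0..L} (\<lambda>x. integral {0..H} (\<lambda>y. f (x, y)))"
  unfolding I_def K_cbox by (subst integral_prod_continuous) auto

lemma I_iterated':
  assumes "continuous_on K f"
  shows "I f = integral {0..H} (\<lambda>y. integral {0..L} (\<lambda>x. f (x, y)))"
  unfolding I_iterated[OF assms]
  using integral_swap_continuous[of 0 0 L H "\<lambda>x y. f (x, y)"] assms
  by (simp add: K_cbox split_def)

lemma slice1: "continuous_on K f \<Longrightarrow> y \<in> {0..H} \<Longrightarrow> continuous_on {0..L} (\<lambda>x. f (x, y))"
  by (erule continuous_on_compose2) (auto intro!: continuous_intros simp: mem_K)

lemma slice2: "continuous_on K f \<Longrightarrow> x \<in> {0..L} \<Longrightarrow> continuous_on {0..H} (\<lambda>y. f (x, y))"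
  by (erule continuous_on_compose2) (auto intro!: continuous_intros simp: mem_K)

lemma integral1_continuous:
  fixes f :: "real \<times> real \<Rightarrow> real"
  assumes "continuous_on K f"
  shows "continuous_on {0..H} (\<lambda>y. integral {0..L} (\<lambda>x. f (x, y)))"
proof -
  have "continuous_on ({0..H} \<times> cbox 0 L) (\<lambda>(y, x). f (x, y))"
    unfolding split_def
    by (rule continuous_on_compose2[OF assms]) (auto intro!: continuous_intros simp: mem_K)
  from integral_continuous_on_param[OF this] show ?thesis by simp
qed

lemma integral2_continuous:
  fixes f :: "real \<times> real \<Rightarrow> real"
  assumes "continuous_on K f"
  shows "continuous_on {0..L} (\<lambda>x. integral {0..H} (\<lambda>y. f (x, y)))"
proof -
  have "continuous_on ({0..L} \<times> cbox 0 H) (\<lambda>(x, y). f (x, y))"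
    using assms by (simp add: K_def)
  from integral_continuous_on_param[OF this] show ?thesis by simp
qed

lemma cont_fst: "continuous_on {0..L} f \<Longrightarrow> continuous_on K (\<lambda>z. f (fst z))"
  by (erule continuous_on_compose2) (auto intro!: continuous_intros simp: K_def)

lemma cont_snd: "continuous_on {0..H} f \<Longrightarrow> continuous_on K (\<lambda>z. f (snd z))"
  by (erule continuous_on_compose2) (auto intro!: continuous_intros simp: K_def)

lemma I_prod:
  fixes f h :: "real \<Rightarrow> real"
  assumes f: "continuous_on {0..L} f" and h: "continuous_on {0..H} h"
  shows "I (\<lambda>z. f (fst z) * h (snd z)) = integral {0..L} f * integral {0..H} h"
proof -
  have "I (\<lambda>z. f (fst z) * h (snd z)) = integral {0..L} (\<lambda>x. f x * integral {0..H} h)"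
    by (subst I_iterated) (auto intro!: continuous_intros cont_fst[OF f] cont_snd[OF h])
  then show ?thesis by simp
qed

lemma I_snd:
  fixes h :: "real \<Rightarrow> real"
  assumes h: "continuous_on {0..H} h"
  shows "I (\<lambda>z. h (snd z)) = L * integral {0..H} h"
  using I_prod[OF continuous_on_const[of _ 1] h] L_pos by simp

lemma I_Cauchy_Schwarz:
  assumes f: "continuous_on K f" and g: "continuous_on K g"
  shows "(I (\<lambda>z. f z * g z))\<^sup>2 \<le> I (\<lambda>z. (f z)\<^sup>2) * I (\<lambda>z. (g z)\<^sup>2)"
proof -
  define A B C where "A = I (\<lambda>z. (f z)\<^sup>2)" and "B = I (\<lambda>z. f z * g z)" and "C = I (\<lambda>z. (g z)\<^sup>2)"
  have A0: "0 \<le> A" unfolding A_def using f by (intro I_nonneg) (auto intro!: continuous_intros)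
  have ineq: "0 \<le> t\<^sup>2 * A + (2 * t) * B + C" for t
  proof -
    have "0 \<le> I (\<lambda>z. (t * f z + g z)\<^sup>2)"
      using f g by (intro I_nonneg) (auto intro!: continuous_intros)
    also have "\<dots> = I (\<lambda>z. t\<^sup>2 * (f z)\<^sup>2 + (2 * t) * (f z * g z) + (g z)\<^sup>2)"
      by (rule I_cong) (simp add: power2_eq_square algebra_simps)
    also have "\<dots> = t\<^sup>2 * A + (2 * t) * B + C"
      unfolding A_def B_def C_def using f g
      by (intro I_unique has_integral_add has_integral_mult_right I_has_integral continuous_intros)
    finally show ?thesis .
  qed
  have "B\<^sup>2 \<le> A * C"
  proof (cases "A = 0")
    case True
    have "B = 0"
    proof (rule ccontr)
      assume "B \<noteq> 0"
      \<comment> \<open>This value of \<open>t\<close> turns \<open>2 * t * B + C\<close> into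
        -1.\<close>
      then show False using ineq[of "- (C + 1) / (2 * B)"] True by (simp add: field_simps)
    qed
    then show ?thesis using True by simp
  next
    case False
    have "0 \<le> A * ((- B / A)\<^sup>2 * A + (2 * (- B / A)) * B + C)"
      using ineq[of "- B / A"] A0 by (intro mult_nonneg_nonneg) auto
    also have "\<dots> = A * C - B\<^sup>2" using False by (simp add: field_simps power2_eq_square)
    finally show ?thesis by simp
  qed
  then show ?thesis unfolding A_def B_def C_def .
qed

section \<open>Partial derivatives on the cell and integration by parts\<close>

definition D1 :: "(real \<times> real \<Rightarrow> real) \<Rightarrow> (real \<times> real \<Rightarrow> real) \<Rightarrow> bool" where
  "D1 f f' \<longleftrightarrow> continuous_on K f \<and> continuous_on K f' \<and>
     (\<forall>x\<in>{0..L}. \<forall>y\<in>{0..H}. ((\<lambda>s. f (s, y)) has_real_derivative f' (x, y)) (at x within {0..L}))"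

definition D2 :: "(real \<times> real \<Rightarrow> real) \<Rightarrow> (real \<times> real \<Rightarrow> real) \<Rightarrow> bool" where
  "D2 f f' \<longleftrightarrow> continuous_on K f \<and> continuous_on K f' \<and>
     (\<forall>x\<in>{0..L}. \<forall>y\<in>{0..H}. ((\<lambda>s. f (x, s)) has_real_derivative f' (x, y)) (at y within {0..H}))"

lemma D_cont:
  "D1 f f' \<Longrightarrow> continuous_on K f" "D1 f f' \<Longrightarrow> continuous_on K f'"
  "D2 f f' \<Longrightarrow> continuous_on K f" "D2 f f' \<Longrightarrow> continuous_on K f'"
  unfolding D1_def D2_def by auto

lemma D1_C1: "D1 f f' \<Longrightarrow> y \<in> {0..H} \<Longrightarrow> C1_Icc 0 L (\<lambda>x. f (x, y)) (\<lambda>x. f' (x, y))"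
  unfolding D1_def C1_Icc_def using slice1[of f' y] by auto

lemma D2_C1: "D2 f f' \<Longrightarrow> x \<in> {0..L} \<Longrightarrow> C1_Icc 0 H (\<lambda>y. f (x, y)) (\<lambda>y. f' (x, y))"
  unfolding D2_def C1_Icc_def using slice2[of f' x] by auto

lemma D1_mult: "D1 f f' \<Longrightarrow> D1 g g' \<Longrightarrow> D1 (\<lambda>z. f z * g z) (\<lambda>z. f' z * g z + f z * g' z)"
  unfolding D1_def by (auto intro!: continuous_intros derivative_eq_intros simp: algebra_simps)

lemma D2_mult: "D2 f f' \<Longrightarrow> D2 g g' \<Longrightarrow> D2 (\<lambda>z. f z * g z) (\<lambda>z. f' z * g z + f z * g' z)"
  unfolding D2_def by (auto intro!: continuous_intros derivative_eq_intros simp: algebra_simps)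

lemma D1_add: "D1 f f' \<Longrightarrow> D1 g g' \<Longrightarrow> D1 (\<lambda>z. f z + g z) (\<lambda>z. f' z + g' z)"
  unfolding D1_def by (auto intro!: continuous_intros derivative_eq_intros)

lemma D2_add: "D2 f f' \<Longrightarrow> D2 g g' \<Longrightarrow> D2 (\<lambda>z. f z + g z) (\<lambda>z. f' z + g' z)"
  unfolding D2_def by (auto intro!: continuous_intros derivative_eq_intros)

lemma D1_diff: "D1 f f' \<Longrightarrow> D1 g g' \<Longrightarrow> D1 (\<lambda>z. f z - g z) (\<lambda>z. f' z - g' z)"
  unfolding D1_def by (auto intro!: continuous_intros derivative_eq_intros)

lemma D2_diff: "D2 f f' \<Longrightarrow> D2 g g' \<Longrightarrow> D2 (\<lambda>z. f z - g z) (\<lambda>z. f' z - g' z)"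
  unfolding D2_def by (auto intro!: continuous_intros derivative_eq_intros)

lemma D1_uminus: "D1 f f' \<Longrightarrow> D1 (\<lambda>z. - f z) (\<lambda>z. - f' z)"
  unfolding D1_def by (auto intro!: continuous_intros derivative_eq_intros)

lemma D1_power: "D1 f f' \<Longrightarrow> D1 (\<lambda>z. f z ^ n) (\<lambda>z. real n * f z ^ (n - 1) * f' z)"
  unfolding D1_def by (auto intro!: continuous_intros derivative_eq_intros)

lemma D2_power: "D2 f f' \<Longrightarrow> D2 (\<lambda>z. f z ^ n) (\<lambda>z. real n * f z ^ (n - 1) * f' z)"
  unfolding D2_def by (auto intro!: continuous_intros derivative_eq_intros)

lemma D1_snd: "continuous_on {0..H} h \<Longrightarrow> D1 (\<lambda>z. h (snd z)) (\<lambda>z. 0)"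
  unfolding D1_def using cont_snd by (auto intro!: continuous_intros derivative_eq_intros)

lemma D2_snd: "C1_Icc 0 H h h' \<Longrightarrow> D2 (\<lambda>z. h (snd z)) (\<lambda>z. h' (snd z))"
  unfolding D2_def using C1_IccD[of 0 H h h'] by (auto intro!: cont_snd)

lemma I_D1:
  assumes D: "D1 f f'" and per: "\<And>y. y \<in> {0..H} \<Longrightarrow> f (0, y) = f (L, y)"
  shows "I f' = 0"
proof -
  have "integral {0..L} (\<lambda>x. f' (x, y)) = 0" if "y \<in> {0..H}" for y
    using FTC_continuous[of 0 L "\<lambda>x. f (x, y)" "\<lambda>x. f' (x, y)"] C1_IccD(1)[OF D1_C1[OF D that]]
      L_pos per[OF that] by simp
  then have "integral {0..H} (\<lambda>y. integral {0..L} (\<lambda>x. f' (x, y))) = integral {0..H} (\<lambda>y. 0)"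
    by (intro Henstock_Kurzweil_Integration.integral_cong) auto
  then show ?thesis using I_iterated'[OF D_cont(2)[OF D]] by simp
qed

lemma I_D2:
  assumes D: "D2 f f'" and per: "\<And>x. x \<in> {0..L} \<Longrightarrow> f (x, 0) = f (x, H)"
  shows "I f' = 0"
proof -
  have "integral {0..H} (\<lambda>y. f' (x, y)) = 0" if "x \<in> {0..L}" for x
    using FTC_continuous[of 0 H "\<lambda>y. f (x, y)" "\<lambda>y. f' (x, y)"] C1_IccD(1)[OF D2_C1[OF D that]]
      H_pos per[OF that] by simp
  then have "integral {0..L} (\<lambda>x. integral {0..H} (\<lambda>y. f' (x, y))) = integral {0..L} (\<lambda>y. 0)"
    by (intro Henstock_Kurzweil_Integration.integral_cong) auto
  then show ?thesis using I_iterated[OF D_cont(4)[OF D]] by simp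
qed

text \<open>Wave numbers of the lowest modes. \<open>La\<close> is the eigenvalue of the periodic
  modes in x_2 alone, \<open>Lb\<close> that of the modes cos or sin of \<open>k1 * x_1\<close>
  times sin of \<open>k2 * x_2\<close>.\<close>

definition k1 :: real where "k1 = 2 * pi / L"
definition k2 :: real where "k2 = pi / H"
definition La :: real where "La = (2 * k2)\<^sup>2"
definition Lb :: real where "Lb = k1\<^sup>2 + k2\<^sup>2"

lemma k_pos: "0 < k1" "0 < k2" "0 < La" "0 < Lb"
  unfolding k1_def k2_def La_def Lb_def using L_pos H_pos by (auto intro!: add_pos_pos)

lemma k_mult: "k1 * L = 2 * pi" "k2 * H = pi" "2 * k2 * H = 2 * pi" "k2 * (H / 2) = pi / 2"
  unfolding k1_def k2_def using L_pos H_pos by auto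

lemma trig_integrals:
  "integral {0..L} (\<lambda>x. cos (k1 * x)) = 0"
  "integral {0..L} (\<lambda>x. sin (k1 * x)) = 0"
  "integral {0..L} (\<lambda>x. cos (k1 * x) * cos (k1 * x)) = L / 2"
  "integral {0..L} (\<lambda>x. sin (k1 * x) * sin (k1 * x)) = L / 2"
  "integral {0..L} (\<lambda>x. sin (k1 * x) * cos (k1 * x)) = 0"
proof -
  have nz: "k1 \<noteq> 0" using k_pos by simp
  have km: "k1 * L = 2 * pi" "L * k1 = 2 * pi" using k_mult by (auto simp: mult.commute)
  have "integral {0..L} (\<lambda>x. cos (k1 * x)) = sin (k1 * L) / k1 - sin (k1 * 0) / k1"
    by (rule FTC_continuous) (use L_pos nz in \<open>auto intro!: derivative_eq_intros\<close>)
  then show "integral {0..L} (\<lambda>x. cos (k1 * x)) = 0" using km by simp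
  have "integral {0..L} (\<lambda>x. sin (k1 * x)) = - cos (k1 * L) / k1 - - cos (k1 * 0) / k1"
    by (rule FTC_continuous) (use L_pos nz in \<open>auto intro!: derivative_eq_intros\<close>)
  then show "integral {0..L} (\<lambda>x. sin (k1 * x)) = 0" using km by simp
  have "integral {0..L} (\<lambda>x. cos (k1 * x) * cos (k1 * x)) = (L / 2 + sin (k1 * L) * cos (k1 * L) / (2 * k1))
      - (0 / 2 + sin (k1 * 0) * cos (k1 * 0) / (2 * k1))"
  proof (rule FTC_continuous)
    fix x
    have "((\<lambda>x. x / 2 + sin (k1 * x) * cos (k1 * x) / (2 * k1)) has_real_derivative
        1 / 2 + (k1 * cos (k1 * x) * cos (k1 * x) - sin (k1 * x) * (k1 * sin (k1 * x))) / (2 * k1)) (at x within {0..L})"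
      by (rule derivative_eq_intros refl | simp add: nz)+ (simp add: nz field_simps)
    moreover have "1 / 2 + (k1 * cos (k1 * x) * cos (k1 * x) - sin (k1 * x) * (k1 * sin (k1 * x))) / (2 * k1)
        = cos (k1 * x) * cos (k1 * x)"
    proof -
      have "(k1 * cos (k1 * x) * cos (k1 * x) - sin (k1 * x) * (k1 * sin (k1 * x))) / (2 * k1)
          = (cos (k1 * x) * cos (k1 * x) - sin (k1 * x) * sin (k1 * x)) / 2"
        using nz by (simp add: field_simps)
      then show ?thesis using sin_cos_squared_add3[of "k1 * x"] by argo
    qed
    ultimately show "((\<lambda>x. x / 2 + sin (k1 * x) * cos (k1 * x) / (2 * k1)) has_real_derivative
        cos (k1 * x) * cos (k1 * x)) (at x within {0..L})" by simp
  qed (use L_pos in auto)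
  then show cc: "integral {0..L} (\<lambda>x. cos (k1 * x) * cos (k1 * x)) = L / 2" using km by simp
  have "integral {0..L} (\<lambda>x. sin (k1 * x) * sin (k1 * x)) = integral {0..L} (\<lambda>x. 1 - cos (k1 * x) * cos (k1 * x))"
    by (rule Henstock_Kurzweil_Integration.integral_cong) 
       (use sin_cos_squared_add3 in \<open>auto simp: algebra_simps\<close>)
  also have "\<dots> = L - L / 2"
    unfolding cc[symmetric] using has_integral_const_real[of "1::real" 0 L] L_pos
    by (intro integral_unique has_integral_diff integrable_integral integrable_continuous_interval continuous_intros) simp
  finally show "integral {0..L} (\<lambda>x. sin (k1 * x) * sin (k1 * x)) = L / 2" by simp
  have "integral {0..L} (\<lambda>x. sin (k1 * x) * cos (k1 * x)) = (sin (k1 * L))\<^sup>2 / (2 * k1) - (sin (k1 * 0))\<^sup>2 / (2 * k1)"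
    by (rule FTC_continuous) (use L_pos nz in \<open>auto intro!: derivative_eq_intros\<close>)
  then show "integral {0..L} (\<lambda>x. sin (k1 * x) * cos (k1 * x)) = 0" using km by simp
qed

end

context channel
begin

lemma I_sum_sq:
  assumes "continuous_on K f" "continuous_on K g"
  shows "I (\<lambda>z. (f z + g z)\<^sup>2) \<le> 2 * I (\<lambda>z. (f z)\<^sup>2) + 2 * I (\<lambda>z. (g z)\<^sup>2)"
proof -
  have "I (\<lambda>z. (f z + g z)\<^sup>2) \<le> I (\<lambda>z. 2 * (f z)\<^sup>2 + 2 * (g z)\<^sup>2)"
  proof (rule I_mono)
    fix z
    have "0 \<le> (f z - g z)\<^sup>2" by simp
    then show "(f z + g z)\<^sup>2 \<le> 2 * (f z)\<^sup>2 + 2 * (g z)\<^sup>2"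
      by (simp add: power2_eq_square algebra_simps)
  qed (use assms in \<open>auto intro!: continuous_intros\<close>)
  also have "\<dots> = 2 * I (\<lambda>z. (f z)\<^sup>2) + 2 * I (\<lambda>z. (g z)\<^sup>2)"
    by (intro I_unique has_integral_add has_integral_mult_right I_has_integral continuous_intros assms)
  finally show ?thesis .
qed

lemma Qf_integrate1:
  assumes D: "D1 v v1" and f: "continuous_on K f"
    and le: "\<And>y. y \<in> {0..H} \<Longrightarrow> c * integral {0..L} (\<lambda>x. (f (x, y))\<^sup>2) \<le> Qf k 0 L (\<lambda>x. v (x, y)) (\<lambda>x. v1 (x, y))"
  shows "c * I (\<lambda>z. (f z)\<^sup>2) \<le> I (\<lambda>z. (v1 z)\<^sup>2) - k\<^sup>2 * I (\<lambda>z. (v z)\<^sup>2)"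
proof -
  note c = D_cont(1,2)[OF D]
  have cc: "continuous_on K (\<lambda>z. (v1 z)\<^sup>2 - k\<^sup>2 * (v z)\<^sup>2)" "continuous_on K (\<lambda>z. (f z)\<^sup>2)"
    by (intro continuous_intros c f)+
  have "c * I (\<lambda>z. (f z)\<^sup>2) = integral {0..H} (\<lambda>y. c * integral {0..L} (\<lambda>x. (f (x, y))\<^sup>2))"
    by (subst I_iterated'[OF cc(2)]) (simp add: Henstock_Kurzweil_Integration.integral_mult_right)
  also have "\<dots> \<le> integral {0..H} (\<lambda>y. Qf k 0 L (\<lambda>x. v (x, y)) (\<lambda>x. v1 (x, y)))"
  proof (rule integral_le)
    show "(\<lambda>y. c * integral {0..L} (\<lambda>x. (f (x, y))\<^sup>2)) integrable_on {0..H}"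
      by (intro integrable_continuous_interval continuous_on_mult_left integral1_continuous[OF cc(2)])
    show "(\<lambda>y. Qf k 0 L (\<lambda>x. v (x, y)) (\<lambda>x. v1 (x, y))) integrable_on {0..H}"
      unfolding Qf_def by (intro integrable_continuous_interval integral1_continuous[OF cc(1)])
  qed (rule le)
  also have "\<dots> = I (\<lambda>z. (v1 z)\<^sup>2 - k\<^sup>2 * (v z)\<^sup>2)"
    unfolding Qf_def by (subst I_iterated'[OF cc(1)]) simp
  also have "\<dots> = I (\<lambda>z. (v1 z)\<^sup>2) - k\<^sup>2 * I (\<lambda>z. (v z)\<^sup>2)"
    by (intro I_unique has_integral_diff has_integral_mult_right I_has_integral continuous_intros c)
  finally show ?thesis .
qed

lemma Qf_integrate2:
  assumes D: "D2 v v2" and f: "continuous_on K f"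
    and le: "\<And>x. x \<in> {0..L} \<Longrightarrow> c * integral {0..H} (\<lambda>y. (f (x, y))\<^sup>2) \<le> Qf k 0 H (\<lambda>y. v (x, y)) (\<lambda>y. v2 (x, y))"
  shows "c * I (\<lambda>z. (f z)\<^sup>2) \<le> I (\<lambda>z. (v2 z)\<^sup>2) - k\<^sup>2 * I (\<lambda>z. (v z)\<^sup>2)"
proof -
  note c = D_cont(3,4)[OF D]
  have cc: "continuous_on K (\<lambda>z. (v2 z)\<^sup>2 - k\<^sup>2 * (v z)\<^sup>2)" "continuous_on K (\<lambda>z. (f z)\<^sup>2)"
    by (intro continuous_intros c f)+
  have "c * I (\<lambda>z. (f z)\<^sup>2) = integral {0..L} (\<lambda>x. c * integral {0..H} (\<lambda>y. (f (x, y))\<^sup>2))"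
    by (subst I_iterated[OF cc(2)]) (simp add: Henstock_Kurzweil_Integration.integral_mult_right)
  also have "\<dots> \<le> integral {0..L} (\<lambda>x. Qf k 0 H (\<lambda>y. v (x, y)) (\<lambda>y. v2 (x, y)))"
  proof (rule integral_le)
    show "(\<lambda>x. c * integral {0..H} (\<lambda>y. (f (x, y))\<^sup>2)) integrable_on {0..L}"
      by (intro integrable_continuous_interval continuous_on_mult_left integral2_continuous[OF cc(2)])
    show "(\<lambda>x. Qf k 0 H (\<lambda>y. v (x, y)) (\<lambda>y. v2 (x, y))) integrable_on {0..L}"
      unfolding Qf_def by (intro integrable_continuous_interval integral2_continuous[OF cc(1)])
  qed (rule le)
  also have "\<dots> = I (\<lambda>z. (v2 z)\<^sup>2 - k\<^sup>2 * (v z)\<^sup>2)"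
    unfolding Qf_def by (subst I_iterated[OF cc(1)]) simp
  also have "\<dots> = I (\<lambda>z. (v2 z)\<^sup>2) - k\<^sup>2 * I (\<lambda>z. (v z)\<^sup>2)"
    by (intro I_unique has_integral_diff has_integral_mult_right I_has_integral continuous_intros c)
  finally show ?thesis .
qed

definition trig1 :: "real \<Rightarrow> real \<Rightarrow> real \<times> real \<Rightarrow> real" where
  "trig1 c d z = (c * cos (k1 * fst z) + d * sin (k1 * fst z)) * sin (k2 * snd z)"

definition trig2 :: "real \<Rightarrow> real \<Rightarrow> real \<times> real \<Rightarrow> real" where
  "trig2 a b z = a * sin (2 * k2 * snd z) + b * cos (2 * k2 * snd z)"

lemma trig_cont: "continuous_on S (trig1 c d)" "continuous_on S (trig2 a b)"
  unfolding trig1_def trig2_def by (intro continuous_intros)+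

text \<open>Below, the squared distance is at most four times the horizontal plus six times the
  vertical remainder, and these are at most the deficit divided by \<open>3 * k1^2\<close> and
  \<open>3 * k2^2\<close>. The constant is the resulting sum, rounded up.\<close>

definition Cgap :: real where "Cgap = 2 / k2\<^sup>2 + 2 / k1\<^sup>2"

text \<open>Fibrewise, \<open>v\<close> is close to the first Fourier mode in each variable; projecting the
  vertical profile \<open>v (x, H/2)\<close> onto the first horizontal mode combines both facts.\<close>

lemma Poincare_mean_zero:
  assumes D1: "D1 v v1" and D2: "D2 v v2"
    and per: "\<And>y. y \<in> {0..H} \<Longrightarrow> v (0, y) = v (L, y)"
    and bd: "\<And>x. x \<in> {0..L} \<Longrightarrow> v (x, 0) = 0" "\<And>x. x \<in> {0..L} \<Longrightarrow> v (x, H) = 0"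
    and mean: "\<And>y. y \<in> {0..H} \<Longrightarrow> integral {0..L} (\<lambda>x. v (x, y)) = 0"
  shows "\<exists>c d. I (\<lambda>z. (v z - trig1 c d z)\<^sup>2) \<le> Cgap * (I (\<lambda>z. (v1 z)\<^sup>2) + I (\<lambda>z. (v2 z)\<^sup>2) - Lb * I (\<lambda>z. (v z)\<^sup>2))"
proof -
  define \<alpha> where "\<alpha> y = (v (0, y) - v (L / 2, y)) / 2" for y
  define \<beta> where "\<beta> y = (v (L / 4, y) - v (3 * L / 4, y)) / 2" for y
  define \<gamma> where "\<gamma> x = v (x, H / 2)" for x
  define c where "c = 2 / L * integral {0..L} (\<lambda>x. \<gamma> x * cos (k1 * x))"
  define d where "d = 2 / L * integral {0..L} (\<lambda>x. \<gamma> x * sin (k1 * x))"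
  define r where "r x = \<gamma> x - c * cos (k1 * x) - d * sin (k1 * x)" for x
  define s where "s y = sin (k2 * y)" for y
  note vc = D_cont(1)[OF D1]
  have inL: "0 \<in> {0..L}" "L / 2 \<in> {0..L}" "L / 4 \<in> {0..L}" "3 * L / 4 \<in> {0..L}" "H / 2 \<in> {0..H}"
    using L_pos H_pos by auto
  have \<alpha>c: "continuous_on {0..H} \<alpha>" and \<beta>c: "continuous_on {0..H} \<beta>"
    unfolding \<alpha>_def \<beta>_def by (intro continuous_intros slice2[OF vc] inL | simp)+
  have \<gamma>c: "continuous_on {0..L} \<gamma>" unfolding \<gamma>_def by (intro slice1[OF vc] inL)
  have cosc: "continuous_on S (\<lambda>x::real. cos (k1 * x))" "continuous_on S (\<lambda>x::real. sin (k1 * x))" for S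
    by (intro continuous_intros)+
  have sc: "continuous_on {0..H} s" unfolding s_def by (intro continuous_intros)
  have rc: "continuous_on {0..L} r" unfolding r_def by (intro continuous_intros \<gamma>c)
  note kc = cont_snd[OF \<alpha>c] cont_snd[OF \<beta>c] cont_fst[OF \<gamma>c] cont_snd[OF sc] cont_fst[OF rc]
    cont_fst[OF cosc(1)] cont_fst[OF cosc(2)] vc
  define f1 where "f1 z = v z - \<alpha> (snd z) * cos (k1 * fst z) - \<beta> (snd z) * sin (k1 * fst z)" for z
  define f2 where "f2 z = v z - \<gamma> (fst z) * s (snd z)" for z
  have f1c: "continuous_on K f1" and f2c: "continuous_on K f2"
    unfolding f1_def[abs_def] f2_def[abs_def] by (intro continuous_intros kc)+
  define Q where "Q = I (\<lambda>z. (v1 z)\<^sup>2) + I (\<lambda>z. (v2 z)\<^sup>2) - Lb * I (\<lambda>z. (v z)\<^sup>2)"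
  have A: "(3 * k1\<^sup>2) * I (\<lambda>z. (f1 z)\<^sup>2) \<le> I (\<lambda>z. (v1 z)\<^sup>2) - k1\<^sup>2 * I (\<lambda>z. (v z)\<^sup>2)"
  proof (rule Qf_integrate1[OF D1 f1c])
    fix y assume y: "y \<in> {0..H}"
    show "3 * k1\<^sup>2 * integral {0..L} (\<lambda>x. (f1 (x, y))\<^sup>2) \<le> Qf k1 0 L (\<lambda>x. v (x, y)) (\<lambda>x. v1 (x, y))"
      using Wirtinger_periodic_gap[OF D1_C1[OF D1 y] L_pos k1_def per[OF y] mean[OF y] \<alpha>_def \<beta>_def]
      unfolding f1_def by simp
  qed
  have B: "(3 * k2\<^sup>2) * I (\<lambda>z. (f2 z)\<^sup>2) \<le> I (\<lambda>z. (v2 z)\<^sup>2) - k2\<^sup>2 * I (\<lambda>z. (v z)\<^sup>2)"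
  proof (rule Qf_integrate2[OF D2 f2c])
    fix x assume x: "x \<in> {0..L}"
    show "3 * k2\<^sup>2 * integral {0..H} (\<lambda>y. (f2 (x, y))\<^sup>2) \<le> Qf k2 0 H (\<lambda>y. v (x, y)) (\<lambda>y. v2 (x, y))"
      using Wirtinger_Dirichlet_gap[OF D2_C1[OF D2 x] H_pos k2_def bd(1)[OF x] bd(2)[OF x]]
      unfolding f2_def \<gamma>_def s_def by simp
  qed
  have n1: "0 \<le> I (\<lambda>z. (f1 z)\<^sup>2)" and n2: "0 \<le> I (\<lambda>z. (f2 z)\<^sup>2)"
    by (intro I_nonneg continuous_intros f1c f2c; simp)+
  have Q1: "(3 * k1\<^sup>2) * I (\<lambda>z. (f1 z)\<^sup>2) + (3 * k2\<^sup>2) * I (\<lambda>z. (f2 z)\<^sup>2) \<le> Q"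
    using A B unfolding Q_def Lb_def by (simp add: algebra_simps)
  have trig_has: "((\<lambda>x. cos (k1 * x) * cos (k1 * x)) has_integral L / 2) {0..L}"
      "((\<lambda>x. sin (k1 * x) * sin (k1 * x)) has_integral L / 2) {0..L}"
      "((\<lambda>x. sin (k1 * x) * cos (k1 * x)) has_integral 0) {0..L}"
    unfolding has_integral_integrable_integral
    by (auto simp: trig_integrals intro!: integrable_continuous_interval continuous_intros)
  have rcos: "integral {0..L} (\<lambda>x. r x * cos (k1 * x)) = 0"
  proof -
    have "integral {0..L} (\<lambda>x. r x * cos (k1 * x)) = integral {0..L} (\<lambda>x. \<gamma> x * cos (k1 * x)
        - c * (cos (k1 * x) * cos (k1 * x)) - d * (sin (k1 * x) * cos (k1 * x)))"
      unfolding r_def by (simp add: algebra_simps)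
    also have "\<dots> = integral {0..L} (\<lambda>x. \<gamma> x * cos (k1 * x)) - c * (L / 2) - d * 0"
      by (intro trig_has integral_unique has_integral_diff has_integral_mult_right integrable_integral
          integrable_continuous_interval continuous_intros \<gamma>c)
    finally show ?thesis unfolding c_def using L_pos by simp
  qed
  have rsin: "integral {0..L} (\<lambda>x. r x * sin (k1 * x)) = 0"
  proof -
    have "integral {0..L} (\<lambda>x. r x * sin (k1 * x)) = integral {0..L} (\<lambda>x. \<gamma> x * sin (k1 * x)
        - c * (sin (k1 * x) * cos (k1 * x)) - d * (sin (k1 * x) * sin (k1 * x)))"
      unfolding r_def by (simp add: algebra_simps)
    also have "\<dots> = integral {0..L} (\<lambda>x. \<gamma> x * sin (k1 * x)) - c * 0 - d * (L / 2)"
      by (intro trig_has integral_unique has_integral_diff has_integral_mult_right integrable_integral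
          integrable_continuous_interval continuous_intros \<gamma>c)
    finally show ?thesis unfolding d_def using L_pos by simp
  qed
  define X where "X z = r (fst z) * s (snd z)" for z :: "real \<times> real"
  have Xc: "continuous_on K X" unfolding X_def[abs_def] by (intro continuous_intros kc)
  \<comment> \<open>\<open>X\<close> differs from \<open>f1 - f2\<close> only by functions of x_2
    times cos and sin of \<open>k1 * x_1\<close>. The factor \<open>r\<close> is orthogonal to both,
    so the square of \<open>X\<close> integrates like \<open>X * (f1 - f2)\<close> and can be
    absorbed.\<close>
  have X2: "I (\<lambda>z. (X z)\<^sup>2) = I (\<lambda>z. X z * f1 z - X z * f2 z)"
  proof -
    have "(X z)\<^sup>2 = (X z * f1 z - X z * f2 z)
       + ((r (fst z) * cos (k1 * fst z)) * ((\<alpha> (snd z) - c * s (snd z)) * s (snd z))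
       + (r (fst z) * sin (k1 * fst z)) * ((\<beta> (snd z) - d * s (snd z)) * s (snd z)))" for z
    proof -
      have "X z = f1 z - f2 z + (\<alpha> (snd z) - c * s (snd z)) * cos (k1 * fst z) + (\<beta> (snd z) - d * s (snd z)) * sin (k1 * fst z)"
        unfolding X_def f1_def f2_def r_def by (simp add: algebra_simps)
      then have "(X z)\<^sup>2 = X z * (f1 z - f2 z + (\<alpha> (snd z) - c * s (snd z)) * cos (k1 * fst z) + (\<beta> (snd z) - d * s (snd z)) * sin (k1 * fst z))"
        by (metis power2_eq_square)
      also have "\<dots> = (X z * f1 z - X z * f2 z) + X z * ((\<alpha> (snd z) - c * s (snd z)) * cos (k1 * fst z)) + X z * ((\<beta> (snd z) - d * s (snd z)) * sin (k1 * fst z))"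
        by (simp add: algebra_simps)
      finally show ?thesis unfolding X_def by (simp add: mult_ac)
    qed
    then have "I (\<lambda>z. (X z)\<^sup>2) = I (\<lambda>z. X z * f1 z - X z * f2 z)
       + (I (\<lambda>z. (r (fst z) * cos (k1 * fst z)) * ((\<alpha> (snd z) - c * s (snd z)) * s (snd z)))
       + I (\<lambda>z. (r (fst z) * sin (k1 * fst z)) * ((\<beta> (snd z) - d * s (snd z)) * s (snd z))))"
      by (simp only:) (intro I_unique has_integral_add I_has_integral continuous_intros Xc f1c f2c kc)
    also have "I (\<lambda>z. (r (fst z) * cos (k1 * fst z)) * ((\<alpha> (snd z) - c * s (snd z)) * s (snd z))) = 0"
      by (subst I_prod[of "\<lambda>x. r x * cos (k1 * x)" "\<lambda>y. (\<alpha> y - c * s y) * s y"])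
        (auto intro!: continuous_intros rc \<alpha>c sc simp: rcos)
    also have "I (\<lambda>z. (r (fst z) * sin (k1 * fst z)) * ((\<beta> (snd z) - d * s (snd z)) * s (snd z))) = 0"
      by (subst I_prod[of "\<lambda>x. r x * sin (k1 * x)" "\<lambda>y. (\<beta> y - d * s y) * s y"])
        (auto intro!: continuous_intros rc \<beta>c sc simp: rsin)
    finally show ?thesis by simp
  qed
  have "I (\<lambda>z. (X z)\<^sup>2) \<le> I (\<lambda>z. (1 / 2) * (X z)\<^sup>2 + (f1 z)\<^sup>2 + (f2 z)\<^sup>2)"
    unfolding X2
  proof (rule I_mono)
    fix z
    have "0 \<le> (X z / 2 - f1 z)\<^sup>2 + (X z / 2 + f2 z)\<^sup>2" by simp
    then show "X z * f1 z - X z * f2 z \<le> (1 / 2) * (X z)\<^sup>2 + (f1 z)\<^sup>2 + (f2 z)\<^sup>2"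
      by (simp add: power2_eq_square algebra_simps)
  qed (intro continuous_intros Xc f1c f2c)+
  also have "\<dots> = (1 / 2) * I (\<lambda>z. (X z)\<^sup>2) + I (\<lambda>z. (f1 z)\<^sup>2) + I (\<lambda>z. (f2 z)\<^sup>2)"
    by (intro I_unique has_integral_add has_integral_mult_right I_has_integral continuous_intros Xc f1c f2c)
  finally have X3: "I (\<lambda>z. (X z)\<^sup>2) \<le> 2 * I (\<lambda>z. (f1 z)\<^sup>2) + 2 * I (\<lambda>z. (f2 z)\<^sup>2)" by simp
  have "v z - trig1 c d z = f2 z + X z" for z
    unfolding trig1_def f2_def X_def r_def s_def by (simp add: algebra_simps)
  then have "I (\<lambda>z. (v z - trig1 c d z)\<^sup>2) \<le> 2 * I (\<lambda>z. (f2 z)\<^sup>2) + 2 * I (\<lambda>z. (X z)\<^sup>2)"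
    using I_sum_sq[OF f2c Xc] by simp
  also have "\<dots> \<le> 4 * I (\<lambda>z. (f1 z)\<^sup>2) + 6 * I (\<lambda>z. (f2 z)\<^sup>2)" using X3 by simp
  also have "\<dots> \<le> Cgap * Q"
  proof -
    have p1: "0 \<le> (3 * k1\<^sup>2) * I (\<lambda>z. (f1 z)\<^sup>2)" and p2: "0 \<le> (3 * k2\<^sup>2) * I (\<lambda>z. (f2 z)\<^sup>2)"
      using n1 n2 by auto
    have "I (\<lambda>z. (f1 z)\<^sup>2) * (3 * k1\<^sup>2) \<le> Q" "I (\<lambda>z. (f2 z)\<^sup>2) * (3 * k2\<^sup>2) \<le> Q"
      unfolding mult.commute[of "I _"] using Q1 p1 p2 by linarith+
    then have "I (\<lambda>z. (f1 z)\<^sup>2) \<le> (1 / 3) * (Q / k1\<^sup>2)" "I (\<lambda>z. (f2 z)\<^sup>2) \<le> (1 / 3) * (Q / k2\<^sup>2)"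
      using k_pos by (simp_all add: pos_le_divide_eq mult_ac)
    moreover have "0 \<le> Q" using Q1 p1 p2 by linarith
    moreover have "0 \<le> Q / k1\<^sup>2" using \<open>0 \<le> Q\<close> by simp
    moreover have "Cgap * Q = 2 * (Q / k2\<^sup>2) + 2 * (Q / k1\<^sup>2)"
      unfolding Cgap_def by (simp add: algebra_simps)
    ultimately show ?thesis by linarith
  qed
  finally show ?thesis unfolding Q_def by blast
qed

end

section \<open>The Poincare inequality in the channel\<close>

context channel
begin

text \<open>The explicit value of \<open>Lambda1 L H\<close>, as \<open>Lambda1_eq\<close> shows.
  The Poincare estimates come first and are what proves that equality.\<close>

definition La1 :: real where "La1 = min La Lb"

lemma La1_pos: "0 < La1"
  unfolding La1_def using k_pos by auto

definition havg :: "(real \<times> real \<Rightarrow> real) \<Rightarrow> real \<Rightarrow> real" where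
  "havg u y = integral {0..L} (\<lambda>x. u (x, y)) / L"

lemma havg_cont: "continuous_on K u \<Longrightarrow> continuous_on {0..H} (havg u)"
  unfolding havg_def by (intro continuous_intros integral1_continuous) (use L_pos in auto)

lemma havg_C1:
  assumes D: "D2 u u2"
  shows "C1_Icc 0 H (havg u) (havg u2)"
proof -
  have "((\<lambda>y. integral {0..L} (\<lambda>x. u (x, y))) has_real_derivative integral {0..L} (\<lambda>x. u2 (x, y))) (at y within {0..H})"
    if y: "y \<in> {0..H}" for y
  proof -
    have "((\<lambda>y. integral (cbox 0 L) (\<lambda>x. u (x, y))) has_real_derivative integral (cbox 0 L) (\<lambda>x. u2 (x, y))) (at y within {0..H})"
    proof (rule leibniz_rule_field_derivative)
      fix y x assume "y \<in> {0..H}" "x \<in> cbox 0 L"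
      then show "((\<lambda>y. u (x, y)) has_real_derivative u2 (x, y)) (at y within {0..H})"
        using D unfolding D2_def by auto
    next
      fix y assume "y \<in> {0..H}"
      then show "(\<lambda>x. u (x, y)) integrable_on cbox 0 L"
        using slice1[OF D_cont(3)[OF D]] by (simp add: integrable_continuous_interval)
    next
      show "continuous_on ({0..H} \<times> cbox 0 L) (\<lambda>(y, x). u2 (x, y))"
        unfolding split_def
        by (rule continuous_on_compose2[OF D_cont(4)[OF D]]) (auto intro!: continuous_intros simp: mem_K)
    qed (use y in auto)
    then show ?thesis by simp
  qed
  then show ?thesis
    unfolding C1_Icc_def havg_def
    using havg_cont[OF D_cont(4)[OF D]] L_pos unfolding havg_def
    by (auto intro!: DERIV_cdivide)
qed

lemma I_havg:
  assumes u: "continuous_on K u" and h: "continuous_on {0..H} h"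
  shows "I (\<lambda>z. u z * h (snd z)) = L * integral {0..H} (\<lambda>y. havg u y * h y)"
proof -
  have "I (\<lambda>z. u z * h (snd z)) = integral {0..H} (\<lambda>y. L * (havg u y * h y))"
    using L_pos by (subst I_iterated')
      (auto intro!: continuous_intros u cont_snd[OF h] simp: havg_def)
  then show ?thesis by (simp add: Henstock_Kurzweil_Integration.integral_mult_right)
qed

text \<open>Pythagoras: \<open>havg\<close> is the L^2 projection onto functions of x_2, so the
  cross term vanishes.\<close>

lemma I_split:
  assumes u: "continuous_on K u" and h: "continuous_on {0..H} h"
  shows "I (\<lambda>z. (u z - h (snd z))\<^sup>2) = I (\<lambda>z. (u z - havg u (snd z))\<^sup>2) + L * integral {0..H} (\<lambda>y. (havg u y - h y)\<^sup>2)"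
proof -
  note a = havg_cont[OF u]
  note ca = cont_snd[OF a] cont_snd[OF h]
  have e: "(u z - h (snd z))\<^sup>2 = (u z - havg u (snd z))\<^sup>2 + (havg u (snd z) - h (snd z))\<^sup>2
      + 2 * (u z * (havg u (snd z) - h (snd z)) - havg u (snd z) * (havg u (snd z) - h (snd z)))" for z
    by (simp add: power2_eq_square algebra_simps)
  have "I (\<lambda>z. (u z - h (snd z))\<^sup>2) = I (\<lambda>z. (u z - havg u (snd z))\<^sup>2) + I (\<lambda>z. (havg u (snd z) - h (snd z))\<^sup>2)
      + 2 * (I (\<lambda>z. u z * (havg u (snd z) - h (snd z))) - I (\<lambda>z. havg u (snd z) * (havg u (snd z) - h (snd z))))"
    unfolding e
    by (intro I_unique has_integral_add has_integral_diff has_integral_mult_right I_has_integral continuous_intros u ca)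
  also have "I (\<lambda>z. u z * (havg u (snd z) - h (snd z))) = L * integral {0..H} (\<lambda>y. havg u y * (havg u y - h y))"
    using I_havg[OF u, of "\<lambda>y. havg u y - h y"] a h by (auto intro!: continuous_intros)
  also have "I (\<lambda>z. havg u (snd z) * (havg u (snd z) - h (snd z))) = L * integral {0..H} (\<lambda>y. havg u y * (havg u y - h y))"
    by (rule I_snd[of "\<lambda>y. havg u y * (havg u y - h y)"]) (intro continuous_intros a h)
  also have "I (\<lambda>z. (havg u (snd z) - h (snd z))\<^sup>2) = L * integral {0..H} (\<lambda>y. (havg u y - h y)\<^sup>2)"
    by (rule I_snd[of "\<lambda>y. (havg u y - h y)\<^sup>2"]) (intro continuous_intros a h)
  finally show ?thesis by simp
qed

definition Energy :: "(real \<times> real \<Rightarrow> real) \<Rightarrow> (real \<times> real \<Rightarrow> real) \<Rightarrow> real" where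
  "Energy u1 u2 = I (\<lambda>z. (u1 z)\<^sup>2) + I (\<lambda>z. (u2 z)\<^sup>2)"

definition mean :: "(real \<times> real \<Rightarrow> real) \<Rightarrow> real" where
  "mean u = I u / (L * H)"

text \<open>The first two terms serve a family whose eigenvalue equals \<open>La1\<close>. A family
  lying strictly above \<open>La1\<close> contributes the inverse of its spectral gap instead, and
  the factor 2 comes from squaring the sum of the two components.\<close>

definition CP :: real where
  "CP = 2 * (Cgap + 1 / (3 * La) + (if La1 < La then 1 / (La - La1) else 0) + (if La1 < Lb then 1 / (Lb - La1) else 0))"

lemma Cgap_pos: "0 < Cgap"
  unfolding Cgap_def using k_pos by (intro add_pos_pos) auto

lemma CP_pos: "0 < CP"
  unfolding CP_def using Cgap_pos k_pos by (intro mult_pos_pos add_pos_nonneg) auto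

text \<open>The case distinction common to both families. If \<open>M\<close> exceeds \<Lambda>,
  then \<open>(M - \<Lambda>) * W\<close> is below the deficit, so the whole component is controlled
  and no mode is subtracted. If they agree, the inequality with remainder applies as it
  stands.\<close>

lemma bound_cases:
  fixes X G \<Lambda> M W C :: real
  assumes gap: "X \<le> C * (G - M * W)" and X: "0 \<le> X" and C: "0 < C" and W: "0 \<le> W" and \<Lambda>: "\<Lambda> \<le> M"
    and T: "T = (if \<Lambda> < M then W else X)" and C': "C + (if \<Lambda> < M then 1 / (M - \<Lambda>) else 0) \<le> C'"
  shows "T \<le> C' * (G - \<Lambda> * W)" "0 \<le> G - \<Lambda> * W"
proof -
  have 0: "0 \<le> G - M * W" using order_trans[OF X gap] C by (simp add: zero_le_mult_iff)
  moreover have m: "\<Lambda> * W \<le> M * W" using W \<Lambda> by (rule mult_right_mono[rotated])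
  ultimately show 1: "0 \<le> G - \<Lambda> * W" by simp
  have C'C: "C' * (G - \<Lambda> * W) \<ge> (C + (if \<Lambda> < M then 1 / (M - \<Lambda>) else 0)) * (G - \<Lambda> * W)"
    using C' 1 by (rule mult_right_mono)
  show "T \<le> C' * (G - \<Lambda> * W)"
  proof (cases "\<Lambda> < M")
    case True
    have "W * (M - \<Lambda>) \<le> G - \<Lambda> * W" using 0 by (simp add: algebra_simps)
    then have "W \<le> (G - \<Lambda> * W) / (M - \<Lambda>)" using True by (simp add: pos_le_divide_eq)
    also have "\<dots> \<le> C * (G - \<Lambda> * W) + (1 / (M - \<Lambda>)) * (G - \<Lambda> * W)" using C 1 by simp
    finally show ?thesis using C'C True T by (simp add: algebra_simps)
  next
    case False
    then have "X \<le> C * (G - \<Lambda> * W)" using gap \<Lambda> by simp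
    then show ?thesis using C'C False T by simp
  qed
qed

text \<open>The horizontal average of \<open>u\<close> minus the mean is a periodic function of \<open>x\<^sub>2\<close>, with first
  eigenvalue \<open>La\<close>; the rest has mean zero in \<open>x\<^sub>1\<close>, with first eigenvalue \<open>Lb\<close>.\<close>

theorem channel_Poincare:
  assumes D1: "D1 u u1" and D2: "D2 u u2"
    and per: "\<And>y. y \<in> {0..H} \<Longrightarrow> u (0, y) = u (L, y)"
    and bd: "\<And>x. x \<in> {0..L} \<Longrightarrow> u (x, 0) = 0" "\<And>x. x \<in> {0..L} \<Longrightarrow> u (x, H) = 0"
  shows "\<exists>a c d. (La1 < La \<longrightarrow> a = 0) \<and> (La1 < Lb \<longrightarrow> c = 0 \<and> d = 0) \<and>
     I (\<lambda>z. (u z - mean u - (trig2 a (if La1 < La then 0 else - havg u (H / 2) / 2) z + trig1 c d z))\<^sup>2)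
       \<le> CP * (Energy u1 u2 - La1 * I (\<lambda>z. (u z - mean u)\<^sup>2))"
proof -
  note uc = D_cont(1)[OF D1] and u1c = D_cont(2)[OF D1] and u2c = D_cont(4)[OF D2]
  define w where "w y = havg u y - mean u" for y
  define w' where "w' = havg u2"
  define v where "v z = u z - havg u (snd z)" for z
  define v2 where "v2 z = u2 z - havg u2 (snd z)" for z
  have wC: "C1_Icc 0 H w w'"
    using C1_Icc_diff[OF havg_C1[OF D2] C1_Icc_const[of _ _ "mean u"]] unfolding w_def[abs_def] w'_def by simp
  have vD1: "D1 v u1"
    using D1_diff[OF D1 D1_snd[OF havg_cont[OF uc]]] unfolding v_def[abs_def] by simp
  have vD2: "D2 v v2"
    unfolding v_def[abs_def] v2_def[abs_def] by (intro D2_diff D2 D2_snd havg_C1)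
  have ends: "havg u 0 = 0" "havg u H = 0"
  proof -
    have "integral {0..L} (\<lambda>x. u (x, 0)) = integral {0..L} (\<lambda>x. 0)"
      "integral {0..L} (\<lambda>x. u (x, H)) = integral {0..L} (\<lambda>x. 0)"
      by (rule Henstock_Kurzweil_Integration.integral_cong; use bd in auto)+
    then show "havg u 0 = 0" "havg u H = 0" unfolding havg_def by auto
  qed
  have vmean: "integral {0..L} (\<lambda>x. v (x, y)) = 0" if y: "y \<in> {0..H}" for y
  proof -
    have "integral {0..L} (\<lambda>x. v (x, y)) = integral {0..L} (\<lambda>x. u (x, y)) - integral {0..L} (\<lambda>x. havg u y)"
      unfolding v_def snd_conv by (intro Henstock_Kurzweil_Integration.integral_diff integrable_continuous_interval
          slice1[OF uc y] continuous_intros)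
    then show ?thesis using L_pos by (simp add: havg_def)
  qed
  have wmean: "integral {0..H} w = 0"
  proof -
    have "I u = L * integral {0..H} (havg u)"
      using I_havg[OF uc continuous_on_const[of _ 1]] by simp
    then have "integral {0..H} (havg u) = mean u * H" unfolding mean_def using L_pos H_pos by (simp add: field_simps)
    moreover have "integral {0..H} w = integral {0..H} (havg u) - integral {0..H} (\<lambda>x. mean u)"
      unfolding w_def[abs_def] by (intro Henstock_Kurzweil_Integration.integral_diff integrable_continuous_interval
          havg_cont[OF uc] continuous_intros)
    ultimately show ?thesis using H_pos by simp
  qed
  \<comment> \<open>The gap lemma asks for half the difference of the values at 0 and
    \<open>H / 2\<close>. The mean cancels and \<open>u\<close> vanishes at the wall, so one value
    of \<open>havg u\<close> is left; this explicit form later yields continuity in time.\<close>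
  define b0 where "b0 = - havg u (H / 2) / 2"
  define a0 where "a0 = (w (H / 4) - w (3 * H / 4)) / 2"
  have wends: "w 0 = w H" "b0 = (w 0 - w (H / 2)) / 2"
    using ends unfolding w_def b0_def by auto
  have k: "2 * k2 = 2 * pi / H" unfolding k2_def by simp
  have gapw: "3 * La * integral {0..H} (\<lambda>x. (w x - b0 * cos (2 * k2 * x) - a0 * sin (2 * k2 * x))\<^sup>2)
     \<le> integral {0..H} (\<lambda>x. (w' x)\<^sup>2) - La * integral {0..H} (\<lambda>x. (w x)\<^sup>2)"
    using Wirtinger_periodic_gap[OF wC H_pos k wends(1) wmean wends(2) a0_def]
    unfolding Qf_eq[OF wC] La_def by simp
  obtain c0 d0 where gapv: "I (\<lambda>z. (v z - trig1 c0 d0 z)\<^sup>2) \<le> Cgap * (Energy u1 v2 - Lb * I (\<lambda>z. (v z)\<^sup>2))"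
    using Poincare_mean_zero[OF vD1 vD2 _ _ _ vmean] per bd ends unfolding Energy_def v_def by auto
  define a where "a = (if La1 < La then 0 else a0)"
  define b where "b = (if La1 < La then 0 else b0)"
  define c where "c = (if La1 < Lb then 0 else c0)"
  define d where "d = (if La1 < Lb then 0 else d0)"
  define X where "X = integral {0..H} (\<lambda>x. (w x - b0 * cos (2 * k2 * x) - a0 * sin (2 * k2 * x))\<^sup>2)"
  note wc = C1_IccD(2,3)[OF wC]
  note vc = D_cont(1)[OF vD1] D_cont(4)[OF vD2]
  have X0: "0 \<le> X" unfolding X_def
    by (intro integral_nonneg integrable_continuous_interval continuous_intros wc) auto
  have W0: "0 \<le> integral {0..H} (\<lambda>x. (w x)\<^sup>2)"
    by (intro integral_nonneg integrable_continuous_interval continuous_intros wc) auto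
  have V0: "0 \<le> I (\<lambda>z. (v z)\<^sup>2)" "0 \<le> I (\<lambda>z. (v z - trig1 c0 d0 z)\<^sup>2)"
    by (intro I_nonneg continuous_intros vc trig_cont; simp)+
  have CPge: "1 / (3 * La) + (if La1 < La then 1 / (La - La1) else 0) \<le> CP / 2"
      "Cgap + (if La1 < Lb then 1 / (Lb - La1) else 0) \<le> CP / 2"
    unfolding CP_def using Cgap_pos k_pos by auto
  have Xle: "X \<le> 1 / (3 * La) * (integral {0..H} (\<lambda>x. (w' x)\<^sup>2) - La * integral {0..H} (\<lambda>x. (w x)\<^sup>2))"
    using gapw k_pos unfolding X_def by (simp add: field_simps)
  have wT: "integral {0..H} (\<lambda>x. (w x - b * cos (2 * k2 * x) - a * sin (2 * k2 * x))\<^sup>2) =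
      (if La1 < La then integral {0..H} (\<lambda>x. (w x)\<^sup>2) else X)"
    unfolding X_def a_def b_def by simp
  have w_res: "integral {0..H} (\<lambda>x. (w x - b * cos (2 * k2 * x) - a * sin (2 * k2 * x))\<^sup>2)
      \<le> CP / 2 * (integral {0..H} (\<lambda>x. (w' x)\<^sup>2) - La1 * integral {0..H} (\<lambda>x. (w x)\<^sup>2))"
    by (rule bound_cases(1)[OF Xle X0 _ W0 _ wT CPge(1)]) (use k_pos in \<open>auto simp: La1_def\<close>)
  have vT: "I (\<lambda>z. (v z - trig1 c d z)\<^sup>2) = (if La1 < Lb then I (\<lambda>z. (v z)\<^sup>2) else I (\<lambda>z. (v z - trig1 c0 d0 z)\<^sup>2))"
    unfolding c_def d_def by (simp add: trig1_def)
  have v_res: "I (\<lambda>z. (v z - trig1 c d z)\<^sup>2) \<le> CP / 2 * (Energy u1 v2 - La1 * I (\<lambda>z. (v z)\<^sup>2))"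
    by (rule bound_cases(1)[OF gapv V0(2) Cgap_pos V0(1) _ vT CPge(2)]) (auto simp: La1_def)
  have e1: "I (\<lambda>z. (u2 z)\<^sup>2) = I (\<lambda>z. (v2 z)\<^sup>2) + L * integral {0..H} (\<lambda>x. (w' x)\<^sup>2)"
    using I_split[OF u2c continuous_on_const[of _ 0]] unfolding v2_def w'_def by simp
  have e2: "I (\<lambda>z. (u z - mean u)\<^sup>2) = I (\<lambda>z. (v z)\<^sup>2) + L * integral {0..H} (\<lambda>x. (w x)\<^sup>2)"
    using I_split[OF uc continuous_on_const[of _ "mean u"]] unfolding v_def w_def by simp
  define fw where "fw y = w y - b * cos (2 * k2 * y) - a * sin (2 * k2 * y)" for y
  have fwc: "continuous_on {0..H} fw" unfolding fw_def[abs_def] by (intro continuous_intros wc)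
  have "u z - mean u - (trig2 a b z + trig1 c d z) = (v z - trig1 c d z) + fw (snd z)" for z
    unfolding v_def fw_def w_def trig2_def by simp
  then have "I (\<lambda>z. (u z - mean u - (trig2 a b z + trig1 c d z))\<^sup>2) = I (\<lambda>z. ((v z - trig1 c d z) + fw (snd z))\<^sup>2)"
    by (simp only:)
  also have "\<dots> \<le> 2 * I (\<lambda>z. (v z - trig1 c d z)\<^sup>2) + 2 * I (\<lambda>z. (fw (snd z))\<^sup>2)"
    by (rule I_sum_sq) (intro continuous_intros vc trig_cont cont_snd fwc)+
  also have "I (\<lambda>z. (fw (snd z))\<^sup>2) = L * integral {0..H} (\<lambda>y. (fw y)\<^sup>2)"
    by (rule I_snd[of "\<lambda>y. (fw y)\<^sup>2"]) (intro continuous_intros fwc)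
  also have "2 * I (\<lambda>z. (v z - trig1 c d z)\<^sup>2) + 2 * (L * integral {0..H} (\<lambda>y. (fw y)\<^sup>2))
     \<le> 2 * (CP / 2 * (Energy u1 v2 - La1 * I (\<lambda>z. (v z)\<^sup>2)))
       + 2 * (L * (CP / 2 * (integral {0..H} (\<lambda>x. (w' x)\<^sup>2) - La1 * integral {0..H} (\<lambda>x. (w x)\<^sup>2))))"
    using v_res w_res L_pos unfolding fw_def by (intro add_mono mult_left_mono) auto
  also have "\<dots> = CP * (Energy u1 u2 - La1 * I (\<lambda>z. (u z - mean u)\<^sup>2))"
    unfolding Energy_def e1 e2 by (simp add: algebra_simps)
  finally have "I (\<lambda>z. (u z - mean u - (trig2 a b z + trig1 c d z))\<^sup>2) \<le> CP * (Energy u1 u2 - La1 * I (\<lambda>z. (u z - mean u)\<^sup>2))" .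
  then show ?thesis
    by (intro exI[of _ a] exI[of _ c] exI[of _ d]) (auto simp: a_def b_def c_def d_def b0_def)
qed

corollary channel_Poincare_ge:
  assumes D1: "D1 u u1" and D2: "D2 u u2"
    and per: "\<And>y. y \<in> {0..H} \<Longrightarrow> u (0, y) = u (L, y)"
    and bd: "\<And>x. x \<in> {0..L} \<Longrightarrow> u (x, 0) = 0" "\<And>x. x \<in> {0..L} \<Longrightarrow> u (x, H) = 0"
  shows "La1 * I (\<lambda>z. (u z - mean u)\<^sup>2) \<le> Energy u1 u2"
proof -
  obtain a c d where *: "I (\<lambda>z. (u z - mean u - (trig2 a (if La1 < La then 0 else - havg u (H / 2) / 2) z + trig1 c d z))\<^sup>2)
       \<le> CP * (Energy u1 u2 - La1 * I (\<lambda>z. (u z - mean u)\<^sup>2))"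
    using channel_Poincare[OF assms] by auto
  have "0 \<le> I (\<lambda>z. (u z - mean u - (trig2 a (if La1 < La then 0 else - havg u (H / 2) / 2) z + trig1 c d z))\<^sup>2)"
    by (intro I_nonneg continuous_intros trig_cont D_cont(1)[OF D1]) simp
  from order_trans[OF this *] CP_pos show ?thesis by (simp add: zero_le_mult_iff)
qed

end

section \<open>Sobolev embedding\<close>

lemma C1_Icc_variation:
  assumes u: "C1_Icc a b u u'" and x: "x \<in> {a..b}" and y: "y \<in> {a..b}"
  shows "\<bar>u x - u y\<bar> \<le> integral {a..b} (\<lambda>s. \<bar>u' s\<bar>)"
  using x y
proof (induction x y rule: linorder_wlog)
  case (le x y)
  have c: "continuous_on {x..y} u'" and c': "continuous_on {a..b} (\<lambda>s. \<bar>u' s\<bar>)"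
    using le C1_IccD(3)[OF u] by (auto intro: continuous_on_subset intro!: continuous_intros)
  have "integral {x..y} u' = u y - u x"
    by (rule FTC_continuous) (use le C1_IccD(1)[OF C1_Icc_subset[OF u, of x y]] in auto)
  then have "\<bar>u x - u y\<bar> = norm (integral {x..y} u')" by simp
  also have "\<dots> \<le> integral {x..y} (\<lambda>s. \<bar>u' s\<bar>)"
    by (rule integral_norm_bound_integral) (auto intro!: integrable_continuous_interval continuous_intros c)
  also have "\<dots> \<le> integral {a..b} (\<lambda>s. \<bar>u' s\<bar>)"
    by (rule integral_subset_le)
      (use le in \<open>auto intro!: integrable_continuous_interval c' continuous_on_subset[OF c']\<close>)
  finally show ?case .
next
  case (sym x y)
  then show ?case by (simp add: abs_minus_commute)
qed

text \<open>Lets a norm that may vanish be replaced by any strictly larger number, by which one can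
  divide.\<close>

lemma le_mult_limit:
  fixes a c X :: real
  assumes "\<And>e. a < e \<Longrightarrow> X \<le> e * c"
  shows "X \<le> a * c"
proof (rule tendsto_lowerbound[of "\<lambda>e. e * c" _ "at_right a"])
  show "((\<lambda>e. e * c) \<longlongrightarrow> a * c) (at_right a)" by (auto intro!: tendsto_intros)
  show "\<forall>\<^sub>F e in at_right a. X \<le> e * c"
    using assms by (auto simp: eventually_at_right_field intro!: exI[of _ "a + 1"])
qed simp

context channel
begin

definition Dirichlet :: "(real \<times> real \<Rightarrow> real) \<Rightarrow> (real \<times> real \<Rightarrow> real) \<Rightarrow> (real \<times> real \<Rightarrow> real) \<Rightarrow> bool" where
  "Dirichlet u u1 u2 \<longleftrightarrow> D1 u u1 \<and> D2 u u2 \<and> (\<forall>y\<in>{0..H}. u (0, y) = u (L, y)) \<and>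
     (\<forall>x\<in>{0..L}. u (x, 0) = 0 \<and> u (x, H) = 0)"

lemma DirichletD:
  assumes "Dirichlet u u1 u2"
  shows "D1 u u1" "D2 u u2" "\<And>y. y \<in> {0..H} \<Longrightarrow> u (0, y) = u (L, y)"
    "\<And>x. x \<in> {0..L} \<Longrightarrow> u (x, 0) = 0" "\<And>x. x \<in> {0..L} \<Longrightarrow> u (x, H) = 0"
    "continuous_on K u" "continuous_on K u1" "continuous_on K u2"
  using assms D_cont unfolding Dirichlet_def by blast+

lemma Energy_nonneg:
  assumes "continuous_on K u1" "continuous_on K u2"
  shows "0 \<le> I (\<lambda>z. (u1 z)\<^sup>2)" "0 \<le> I (\<lambda>z. (u2 z)\<^sup>2)" "0 \<le> Energy u1 u2"
proof -
  show "0 \<le> I (\<lambda>z. (u1 z)\<^sup>2)" "0 \<le> I (\<lambda>z. (u2 z)\<^sup>2)"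
    by (intro I_nonneg continuous_intros assms; simp)+
  then show "0 \<le> Energy u1 u2" unfolding Energy_def by simp
qed

text \<open>The Dirichlet inequality in x_2 alone. Unlike in the channel inequality, no mean is
  subtracted.\<close>

lemma Friedrichs:
  assumes u: "Dirichlet u u1 u2"
  shows "k2\<^sup>2 * I (\<lambda>z. (u z)\<^sup>2) \<le> Energy u1 u2"
proof -
  note d = DirichletD[OF u]
  have "0 * I (\<lambda>z. (u z)\<^sup>2) \<le> I (\<lambda>z. (u2 z)\<^sup>2) - k2\<^sup>2 * I (\<lambda>z. (u z)\<^sup>2)"
  proof (rule Qf_integrate2[OF d(2) d(6)])
    fix x assume x: "x \<in> {0..L}"
    show "0 * integral {0..H} (\<lambda>y. (u (x, y))\<^sup>2) \<le> Qf k2 0 H (\<lambda>y. u (x, y)) (\<lambda>y. u2 (x, y))"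
      using Wirtinger_Dirichlet[OF D2_C1[OF d(2) x] H_pos] d(4,5)[OF x] by (simp add: k2_def)
  qed
  then show ?thesis using Energy_nonneg[OF d(7,8)] unfolding Energy_def by simp
qed

text \<open>The Gagliardo-Nirenberg argument in the plane: |U| is bounded by a function of x_1,
  through its vertical variation from the lower wall, and by a function of x_2, through its
  horizontal mean and variation. The integral of the product of the two bounds factorizes.\<close>

lemma Sobolev_product:
  assumes D1: "D1 U U1" and D2: "D2 U U2" and bd: "\<And>x. x \<in> {0..L} \<Longrightarrow> U (x, 0) = 0"
  shows "I (\<lambda>z. (U z)\<^sup>2) \<le> (I (\<lambda>z. \<bar>U z\<bar>) / L + I (\<lambda>z. \<bar>U1 z\<bar>)) * I (\<lambda>z. \<bar>U2 z\<bar>)"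
proof -
  note c = D_cont(1,2)[OF D1] D_cont(4)[OF D2]
  have ac: "continuous_on K (\<lambda>z. \<bar>U z\<bar>)" "continuous_on K (\<lambda>z. \<bar>U1 z\<bar>)" "continuous_on K (\<lambda>z. \<bar>U2 z\<bar>)"
    by (intro continuous_intros c)+
  define A where "A y = integral {0..L} (\<lambda>x. \<bar>U (x, y)\<bar>) / L + integral {0..L} (\<lambda>x. \<bar>U1 (x, y)\<bar>)" for y
  define B where "B x = integral {0..H} (\<lambda>y. \<bar>U2 (x, y)\<bar>)" for x
  have Ac: "continuous_on {0..H} A" unfolding A_def[abs_def]
    using integral1_continuous[OF ac(1)] integral1_continuous[OF ac(2)] L_pos
    by (intro continuous_on_add continuous_on_divide continuous_on_const) auto
  have Bc: "continuous_on {0..L} B" unfolding B_def[abs_def] by (rule integral2_continuous[OF ac(3)])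
  have UB: "\<bar>U (x, y)\<bar> \<le> B x" if "x \<in> {0..L}" "y \<in> {0..H}" for x y
    using C1_Icc_variation[OF D2_C1[OF D2 that(1)] that(2), of 0] bd[OF that(1)] H_pos unfolding B_def by simp
  have UA: "\<bar>U (x, y)\<bar> \<le> A y" if x: "x \<in> {0..L}" and y: "y \<in> {0..H}" for x y
  proof -
    define J where "J = integral {0..L} (\<lambda>x. \<bar>U1 (x, y)\<bar>)"
    have "\<bar>U (x, y)\<bar> \<le> \<bar>U (s, y)\<bar> + J" if "s \<in> {0..L}" for s
      using C1_Icc_variation[OF D1_C1[OF D1 y] x that] unfolding J_def by linarith
    then have "integral {0..L} (\<lambda>s. \<bar>U (x, y)\<bar>) \<le> integral {0..L} (\<lambda>s. \<bar>U (s, y)\<bar> + J)"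
      by (intro integral_le integrable_continuous_interval continuous_intros slice1[OF c(1) y]) auto
    also have "\<dots> = integral {0..L} (\<lambda>s. \<bar>U (s, y)\<bar>) + integral {0..L} (\<lambda>s. J)"
      by (intro Henstock_Kurzweil_Integration.integral_add integrable_continuous_interval continuous_intros slice1[OF c(1) y])
    finally have "L * \<bar>U (x, y)\<bar> \<le> integral {0..L} (\<lambda>s. \<bar>U (s, y)\<bar>) + L * J"
      using L_pos by simp
    then show ?thesis unfolding A_def J_def[symmetric] using L_pos by (simp add: field_simps)
  qed
  have "I (\<lambda>z. (U z)\<^sup>2) \<le> I (\<lambda>z. B (fst z) * A (snd z))"
  proof (rule I_mono)
    fix z assume z: "z \<in> K"
    obtain x y where xy: "z = (x, y)" by (cases z)
    have "\<bar>U z\<bar> * \<bar>U z\<bar> \<le> B x * A y"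
      using UB[of x y] UA[of x y] z unfolding xy mem_K by (intro mult_mono) auto
    then show "(U z)\<^sup>2 \<le> B (fst z) * A (snd z)" unfolding xy by (simp add: power2_eq_square)
  qed (intro continuous_intros c cont_fst[OF Bc] cont_snd[OF Ac])+
  also have "\<dots> = integral {0..L} B * integral {0..H} A" by (rule I_prod[OF Bc Ac])
  also have "integral {0..L} B = I (\<lambda>z. \<bar>U2 z\<bar>)" unfolding B_def by (rule I_iterated[OF ac(3), symmetric])
  also have "integral {0..H} A = I (\<lambda>z. \<bar>U z\<bar>) / L + I (\<lambda>z. \<bar>U1 z\<bar>)"
    unfolding I_iterated'[OF ac(1)] I_iterated'[OF ac(2)] A_def divide_inverse
    by (intro integral_unique has_integral_add has_integral_mult_left integrable_integral
      integrable_continuous_interval integral1_continuous[OF ac(1)] integral1_continuous[OF ac(2)])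
  finally show ?thesis by (simp add: mult.commute)
qed

text \<open>The power \<open>u^m\<close> is again admissible in the product inequality, which lets the exponent
  climb by two at each step.\<close>

lemma Sobolev_even:
  "\<exists>C\<ge>0. \<forall>u u1 u2. Dirichlet u u1 u2 \<longrightarrow> I (\<lambda>z. u z ^ (2 * Suc n)) \<le> C * Energy u1 u2 ^ Suc n"
proof (induction n)
  case 0
  have "I (\<lambda>z. u z ^ 2) \<le> 1 / k2\<^sup>2 * Energy u1 u2" if "Dirichlet u u1 u2" for u u1 u2
    using Friedrichs[OF that] k_pos by (simp add: field_simps)
  then show ?case by (intro exI[of _ "1 / k2\<^sup>2"]) auto
next
  case (Suc n)
  define m where "m = Suc n"
  from Suc obtain C where C: "0 \<le> C"
    "\<And>u u1 u2. Dirichlet u u1 u2 \<Longrightarrow> I (\<lambda>z. u z ^ (2 * m)) \<le> C * Energy u1 u2 ^ m" unfolding m_def by blast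
  define C' where "C' = C / (L\<^sup>2 * k2\<^sup>2) + real (Suc m)^2 * C + real (Suc m)^2 * C / 2"
  have "I (\<lambda>z. u z ^ (2 * Suc m)) \<le> C' * Energy u1 u2 ^ Suc m" if u: "Dirichlet u u1 u2" for u u1 u2
  proof -
    note d = DirichletD[OF u]
    define E where "E = Energy u1 u2"
    have E0: "0 \<le> E" unfolding E_def by (rule Energy_nonneg[OF d(7,8)])
    note P1 = D1_power[OF d(1), of "Suc m"] and P2 = D2_power[OF d(2), of "Suc m"]
    have CS: "(I (\<lambda>z. \<bar>u z ^ m * f z\<bar>))\<^sup>2 \<le> C * E ^ m * I (\<lambda>z. (f z)\<^sup>2)" if f: "continuous_on K f" for f
    proof -
      have "(I (\<lambda>z. \<bar>u z ^ m\<bar> * \<bar>f z\<bar>))\<^sup>2 \<le> I (\<lambda>z. \<bar>u z ^ m\<bar>\<^sup>2) * I (\<lambda>z. \<bar>f z\<bar>\<^sup>2)"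
        by (rule I_Cauchy_Schwarz) (intro continuous_intros d f)+
      also have "\<dots> \<le> (C * E ^ m) * I (\<lambda>z. (f z)\<^sup>2)"
        using C(2)[OF u] Energy_nonneg(1)[OF f f]
        by (intro mult_mono) (auto simp: E_def power_mult[symmetric] mult.commute C(1) intro!: mult_nonneg_nonneg zero_le_power Energy_nonneg(3)[OF d(7,8)])
      finally show ?thesis by (simp add: abs_mult)
    qed
    define P where "P = I (\<lambda>z. \<bar>u z ^ Suc m\<bar>)"
    define Q where "Q = I (\<lambda>z. \<bar>real (Suc m) * u z ^ (Suc m - 1) * u1 z\<bar>)"
    define R where "R = I (\<lambda>z. \<bar>real (Suc m) * u z ^ (Suc m - 1) * u2 z\<bar>)"
    have PP: "P\<^sup>2 \<le> C / k2\<^sup>2 * E ^ Suc m"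
    proof -
      have "P\<^sup>2 \<le> C * E ^ m * I (\<lambda>z. (u z)\<^sup>2)" using CS[OF d(6)] unfolding P_def by (simp add: mult.commute)
      also have "\<dots> \<le> C * E ^ m * (E / k2\<^sup>2)"
        using Friedrichs[OF u] C(1) E0 k_pos unfolding E_def[symmetric]
        by (intro mult_left_mono) (auto simp: field_simps)
      finally show ?thesis by (simp add: mult_ac)
    qed
    have QR: "(I (\<lambda>z. \<bar>real (Suc m) * u z ^ (Suc m - 1) * f z\<bar>))\<^sup>2 \<le> (real (Suc m))\<^sup>2 * C * E ^ Suc m"
      if f: "continuous_on K f" and le: "I (\<lambda>z. (f z)\<^sup>2) \<le> E" for f
    proof -
      have "I (\<lambda>z. \<bar>real (Suc m) * u z ^ (Suc m - 1) * f z\<bar>) = real (Suc m) * I (\<lambda>z. \<bar>u z ^ m * f z\<bar>)"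
        unfolding I_cmult[symmetric] by (rule I_cong) (simp add: abs_mult)
      then have "(I (\<lambda>z. \<bar>real (Suc m) * u z ^ (Suc m - 1) * f z\<bar>))\<^sup>2 = (real (Suc m))\<^sup>2 * (I (\<lambda>z. \<bar>u z ^ m * f z\<bar>))\<^sup>2"
        by (simp only: power_mult_distrib)
      also have "\<dots> \<le> (real (Suc m))\<^sup>2 * (C * E ^ m * E)"
        using CS[OF f] le C(1) E0 by (intro mult_left_mono order_trans[OF CS[OF f]]) auto
      finally show ?thesis by (simp add: mult_ac)
    qed
    have le: "I (\<lambda>z. (u1 z)\<^sup>2) \<le> E" "I (\<lambda>z. (u2 z)\<^sup>2) \<le> E"
      using Energy_nonneg[OF d(7,8)] unfolding E_def Energy_def by auto
    have QQ: "Q\<^sup>2 \<le> (real (Suc m))\<^sup>2 * C * E ^ Suc m" unfolding Q_def by (rule QR[OF d(7) le(1)])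
    have RR: "R\<^sup>2 \<le> (real (Suc m))\<^sup>2 * C * E ^ Suc m" unfolding R_def by (rule QR[OF d(8) le(2)])
    have "I (\<lambda>z. u z ^ (2 * Suc m)) = I (\<lambda>z. (u z ^ Suc m)\<^sup>2)"
      by (rule I_cong) (simp only: power_mult[symmetric] mult.commute[of 2 "Suc m"])
    also have "\<dots> \<le> (P / L + Q) * R"
      unfolding P_def Q_def R_def by (rule Sobolev_product[OF P1 P2]) (simp add: d(4))
    also have "\<dots> \<le> (P / L)\<^sup>2 + Q\<^sup>2 + R\<^sup>2 / 2"
    proof -
      have "(x + y) * z \<le> x\<^sup>2 + y\<^sup>2 + z\<^sup>2 / 2" for x y z :: real
      proof -
        have "0 \<le> (x + y - z)\<^sup>2 + (x - y)\<^sup>2" by simp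
        then show ?thesis by (simp add: power2_eq_square algebra_simps)
      qed
      then show ?thesis .
    qed
    also have "\<dots> \<le> (C / k2\<^sup>2 * E ^ Suc m) / L\<^sup>2 + (real (Suc m))\<^sup>2 * C * E ^ Suc m + ((real (Suc m))\<^sup>2 * C * E ^ Suc m) / 2"
      unfolding power_divide using PP QQ RR L_pos by (intro add_mono divide_right_mono) auto
    also have "\<dots> = C' * E ^ Suc m" unfolding C'_def by (simp add: field_simps)
    finally show ?thesis unfolding E_def .
  qed
  moreover have "0 \<le> C'" unfolding C'_def using C(1) by simp
  ultimately show ?case unfolding m_def by blast
qed

text \<open>Kept without the root, so that pointwise bounds and conservation of Casimirs apply to it
  directly.\<close>

definition Np :: "real \<Rightarrow> (real \<times> real \<Rightarrow> real) \<Rightarrow> real" where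
  "Np p f = I (\<lambda>z. \<bar>f z\<bar> powr p)"

lemma powr_cont:
  fixes f :: "real \<times> real \<Rightarrow> real"
  assumes "continuous_on S f" "0 < p"
  shows "continuous_on S (\<lambda>z. \<bar>f z\<bar> powr p)"
  by (rule continuous_on_powr') (use assms in \<open>auto intro!: continuous_intros\<close>)

lemma Np_nonneg: "continuous_on K f \<Longrightarrow> 0 < p \<Longrightarrow> 0 \<le> Np p f"
  unfolding Np_def by (intro I_nonneg powr_cont) auto

text \<open>Young's inequality for \<open>f\<close> and \<open>u\<close> after normalization by
  \<nu> and \<open>e\<close>. The dual exponent \<open>q\<close> is large when \<open>p\<close> is
  close to 1; \<open>b powr q\<close> is dominated by 1 plus an even power of sufficiently high
  degree, for which \<open>Sobolev_even\<close> is available. The summand 1 accounts for the area in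
  the constant.\<close>

lemma Hoelder_Sobolev:
  assumes p: "1 < p"
  shows "\<exists>C>0. \<forall>u u1 u2 f. Dirichlet u u1 u2 \<longrightarrow> continuous_on K f \<longrightarrow>
     I (\<lambda>z. \<bar>u z * f z\<bar>) \<le> C * Np p f powr (1 / p) * sqrt (Energy u1 u2)"
proof -
  define q where "q = p / (p - 1)"
  have q: "1 < q" "1 / p + 1 / q = 1" using p unfolding q_def by (auto simp: field_simps)
  obtain n where n: "q \<le> real n" using real_arch_simple by blast
  define m where "m = Suc n"
  obtain Cm where Cm: "0 \<le> Cm" "\<And>u u1 u2. Dirichlet u u1 u2 \<Longrightarrow> I (\<lambda>z. u z ^ (2 * m)) \<le> Cm * Energy u1 u2 ^ m"
    using Sobolev_even[of n] unfolding m_def by blast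
  define C where "C = 1 + L * H + Cm"
  have Cpos: "0 < C" unfolding C_def using L_pos H_pos Cm(1) by (intro add_pos_nonneg) auto
  have "I (\<lambda>z. \<bar>u z * f z\<bar>) \<le> C * Np p f powr (1 / p) * sqrt (Energy u1 u2)"
    if u: "Dirichlet u u1 u2" and f: "continuous_on K f" for u u1 u2 f
  proof -
    note d = DirichletD[OF u]
    define N where "N = Np p f"
    define E where "E = Energy u1 u2"
    have N0: "0 \<le> N" unfolding N_def using p by (intro Np_nonneg f) auto
    have E0: "0 \<le> E" unfolding E_def by (rule Energy_nonneg[OF d(7,8)])
    have "I (\<lambda>z. \<bar>u z * f z\<bar>) \<le> N powr (1 / p) * (sqrt E * C)"
    proof (rule le_mult_limit)
      fix \<nu> assume \<nu>: "N powr (1 / p) < \<nu>"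
      have "I (\<lambda>z. \<bar>u z * f z\<bar>) \<le> sqrt E * (\<nu> * C)"
      proof (rule le_mult_limit)
        fix e assume e: "sqrt E < e"
        have \<nu>0: "0 < \<nu>" using \<nu> powr_ge_zero[of N "1/p"] by linarith
        have e0: "0 < e" using e real_sqrt_ge_zero[OF E0] by linarith
        have N1: "N \<le> \<nu> powr p"
        proof -
          have "N = (N powr (1 / p)) powr p" using p N0 by (simp add: powr_powr)
          also have "\<dots> \<le> \<nu> powr p" using \<nu> p by (intro powr_mono2) auto
          finally show ?thesis .
        qed
        have E1: "E ^ m \<le> e ^ (2 * m)"
        proof -
          have "E = (sqrt E)\<^sup>2" using E0 by simp
          also have "\<dots> \<le> e\<^sup>2" using e E0 by (intro power_mono) auto
          finally show ?thesis unfolding power_mult using E0 by (intro power_mono)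
        qed
        have pt: "\<bar>u z * f z\<bar> \<le> (e * \<nu>) * ((1 / \<nu> powr p) * \<bar>f z\<bar> powr p + 1 + (1 / e ^ (2 * m)) * u z ^ (2 * m))" for z
        proof -
          define a where "a = \<bar>f z\<bar> / \<nu>"
          define b where "b = \<bar>u z\<bar> / e"
          have ab: "0 \<le> a" "0 \<le> b" unfolding a_def b_def using \<nu>0 e0 by auto
          have "a * b \<le> a powr p / p + b powr q / q" by (rule Youngs_inequality[OF p q ab])
          also have "\<dots> \<le> a powr p + b powr q"
            using p q(1) by (intro add_mono) (auto simp: divide_le_eq mult_le_cancel_left1)
          also have "b powr q \<le> 1 + b ^ (2 * m)"
          proof (cases "b \<le> 1")
            case True
            have "b powr q \<le> 1" using True ab q(1) by (intro powr_le1) auto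
            then show ?thesis using ab by (simp add: add_increasing2)
          next
            case False
            have "b powr q \<le> b powr (real (2 * m))"
              using False n by (intro powr_mono) (auto simp: m_def)
            also have "\<dots> = b ^ (2 * m)" using False by (intro powr_realpow) auto
            finally show ?thesis by simp
          qed
          finally have "a * b \<le> a powr p + (1 + b ^ (2 * m))" by simp
          then have "(e * \<nu>) * (a * b) \<le> (e * \<nu>) * (a powr p + (1 + b ^ (2 * m)))"
            using e0 \<nu>0 by (intro mult_left_mono) auto
          moreover have "(e * \<nu>) * (a * b) = \<bar>u z * f z\<bar>"
            unfolding a_def b_def using e0 \<nu>0 by (simp add: abs_mult)
          moreover have "a powr p = (1 / \<nu> powr p) * \<bar>f z\<bar> powr p"
            unfolding a_def using \<nu>0 by (simp add: powr_divide)
          moreover have "b ^ (2 * m) = (1 / e ^ (2 * m)) * u z ^ (2 * m)"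
            unfolding b_def by (simp add: power_divide power_mult)
          ultimately show ?thesis by (simp add: add.assoc)
        qed
        have pc: "continuous_on K (\<lambda>z. \<bar>f z\<bar> powr p)" using p by (intro powr_cont f) auto
        have "I (\<lambda>z. \<bar>u z * f z\<bar>) \<le> I (\<lambda>z. (e * \<nu>) * ((1 / \<nu> powr p) * \<bar>f z\<bar> powr p + 1 + (1 / e ^ (2 * m)) * u z ^ (2 * m)))"
          by (rule I_mono) (intro continuous_intros d f pc pt)+
        also have "\<dots> = (e * \<nu>) * ((1 / \<nu> powr p) * N + 1 * (L * H) + (1 / e ^ (2 * m)) * I (\<lambda>z. u z ^ (2 * m)))"
          unfolding N_def Np_def I_const[of 1, symmetric]
          by (intro I_unique has_integral_add has_integral_mult_right I_has_integral continuous_intros d f pc)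
        also have "\<dots> \<le> (e * \<nu>) * (1 + 1 * (L * H) + Cm)"
        proof (intro mult_left_mono add_mono)
          show "(1 / \<nu> powr p) * N \<le> 1" using N1 \<nu>0 by simp
          have "I (\<lambda>z. u z ^ (2 * m)) \<le> Cm * e ^ (2 * m)"
            using order_trans[OF Cm(2)[OF u] mult_left_mono[OF E1 Cm(1), unfolded E_def]] .
          then show "(1 / e ^ (2 * m)) * I (\<lambda>z. u z ^ (2 * m)) \<le> Cm"
            using e0 by (simp add: divide_le_eq)
        qed (use e0 \<nu>0 L_pos H_pos in auto)
        also have "\<dots> = e * (\<nu> * C)" unfolding C_def by simp
        finally show "I (\<lambda>z. \<bar>u z * f z\<bar>) \<le> e * (\<nu> * C)" .
      qed
      then show "I (\<lambda>z. \<bar>u z * f z\<bar>) \<le> \<nu> * (sqrt E * C)" by (simp add: mult_ac)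
    qed
    then show ?thesis unfolding N_def E_def by (simp add: mult_ac)
  qed
  then show ?thesis using Cpos by blast
qed

lemma I_abs_le_Np:
  assumes p: "1 < p" and f: "continuous_on K f"
  shows "I (\<lambda>z. \<bar>f z\<bar>) \<le> (1 + L * H) * Np p f powr (1 / p)"
proof -
  define N where "N = Np p f"
  have N0: "0 \<le> N" unfolding N_def using p by (intro Np_nonneg f) auto
  have pc: "continuous_on K (\<lambda>z. \<bar>f z\<bar> powr p)" using p by (intro powr_cont f) auto
  have "I (\<lambda>z. \<bar>f z\<bar>) \<le> N powr (1 / p) * (1 + L * H)"
  proof (rule le_mult_limit)
    fix \<nu> assume \<nu>: "N powr (1 / p) < \<nu>"
    have \<nu>0: "0 < \<nu>" using \<nu> powr_ge_zero[of N "1/p"] by linarith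
    have N1: "N \<le> \<nu> powr p"
    proof -
      have "N = (N powr (1 / p)) powr p" using p N0 by (simp add: powr_powr)
      also have "\<dots> \<le> \<nu> powr p" using \<nu> p by (intro powr_mono2) auto
      finally show ?thesis .
    qed
    have "I (\<lambda>z. \<bar>f z\<bar>) \<le> I (\<lambda>z. \<nu> * ((1 / \<nu> powr p) * \<bar>f z\<bar> powr p + 1))"
    proof (rule I_mono)
      fix z
      define a where "a = \<bar>f z\<bar> / \<nu>"
      have a: "0 \<le> a" unfolding a_def using \<nu>0 by auto
      have "a \<le> a powr p + 1"
      proof (cases "a \<le> 1")
        case False
        then have "a powr 1 \<le> a powr p" using p by (intro powr_mono) auto
        then show ?thesis using a by simp
      qed (simp add: add_increasing)
      then have "\<nu> * a \<le> \<nu> * (a powr p + 1)" using \<nu>0 by simp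
      then show "\<bar>f z\<bar> \<le> \<nu> * ((1 / \<nu> powr p) * \<bar>f z\<bar> powr p + 1)"
        unfolding a_def using \<nu>0 by (simp add: powr_divide)
    qed (intro continuous_intros f pc)+
    also have "\<dots> = \<nu> * ((1 / \<nu> powr p) * N + 1 * (L * H))"
      unfolding N_def Np_def I_const[of 1, symmetric]
      by (intro I_unique has_integral_add has_integral_mult_right I_has_integral continuous_intros pc)
    also have "\<dots> \<le> \<nu> * (1 + 1 * (L * H))"
      using N1 \<nu>0 L_pos H_pos by (intro mult_left_mono add_mono) auto
    finally show "I (\<lambda>z. \<bar>f z\<bar>) \<le> \<nu> * (1 + L * H)" by simp
  qed
  then show ?thesis unfolding N_def by (simp add: mult.commute)
qed

end

section \<open>The convex dual\<close>

locale convex_dual =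
  fixes g g' G :: "real \<Rightarrow> real" and a b \<Lambda> :: real
  assumes ab: "a \<le> b" and \<Lambda>: "0 < \<Lambda>"
    and Gd: "\<And>x. x \<in> {a..b} \<Longrightarrow> (G has_real_derivative g x) (at x)"
    and gd: "\<And>x. x \<in> {a..b} \<Longrightarrow> (g has_real_derivative g' x) (at x)"
    and g': "\<And>x. x \<in> {a..b} \<Longrightarrow> 0 \<le> g' x" "\<And>x. x \<in> {a..b} \<Longrightarrow> g' x \<le> \<Lambda>"
begin

text \<open>The Legendre transform of a primitive of \<open>g\<close>, with the supremum restricted
  to \<open>{a..b}\<close>, later the range of the relative stream function. The restriction makes
  it finite and globally Lipschitz whatever \<open>g\<close> does elsewhere.\<close>

definition F :: "real \<Rightarrow> real" where
  "F s = (SUP \<tau>\<in>{a..b}. s * \<tau> - G \<tau>)"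

lemma g_mono:
  assumes "x \<in> {a..b}" "y \<in> {a..b}" "x \<le> y"
  shows "g x \<le> g y"
proof (rule DERIV_nonneg_imp_nondecreasing[OF assms(3)])
  fix t assume "x \<le> t" "t \<le> y"
  then have "t \<in> {a..b}" using assms by auto
  then show "\<exists>d. (g has_real_derivative d) (at t) \<and> 0 \<le> d" using gd g'(1) by blast
qed

text \<open>Cocoercivity of a monotone function with slope at most \<Lambda>. Up to a positive
  factor the difference of the two sides has derivative
  \<open>- 2 * (g s - g t) * (\<Lambda> - g' t)\<close> in \<open>t\<close>, so it attains its
  minimum, zero, at \<open>t = s\<close>.\<close>

lemma bregman:
  assumes s: "s \<in> {a..b}" and t: "t \<in> {a..b}"
  shows "(g s - g t)\<^sup>2 / (2 * \<Lambda>) \<le> g s * (s - t) - (G s - G t)"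
proof -
  define h where "h x = 2 * \<Lambda> * (g s * (s - x) - (G s - G x)) - (g s - g x)\<^sup>2" for x
  have hd: "(h has_real_derivative - 2 * ((g s - g x) * (\<Lambda> - g' x))) (at x)" if "x \<in> {a..b}" for x
    unfolding h_def[abs_def] using Gd[OF that] gd[OF that]
    by (auto intro!: derivative_eq_intros simp: algebra_simps)
  have "0 \<le> h t"
  proof (cases "t \<le> s")
    case True
    have "h s \<le> h t"
    proof (rule DERIV_nonpos_imp_nonincreasing[OF True])
      fix x assume x: "t \<le> x" "x \<le> s"
      then have xi: "x \<in> {a..b}" using s t by auto
      have "0 \<le> (g s - g x) * (\<Lambda> - g' x)"
        using g_mono[OF xi s] g'(2)[OF xi] x by (intro mult_nonneg_nonneg) auto
      then show "\<exists>y. (h has_real_derivative y) (at x) \<and> y \<le> 0"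
        by (intro exI[of _ "- 2 * ((g s - g x) * (\<Lambda> - g' x))"] conjI hd[OF xi]) linarith
    qed
    then show ?thesis unfolding h_def by simp
  next
    case False
    have "h s \<le> h t"
    proof (rule DERIV_nonneg_imp_nondecreasing[of s t])
      fix x assume x: "s \<le> x" "x \<le> t"
      then have xi: "x \<in> {a..b}" using s t by auto
      have "0 \<le> (g x - g s) * (\<Lambda> - g' x)"
        using g_mono[OF s xi] g'(2)[OF xi] x by (intro mult_nonneg_nonneg) auto
      then show "\<exists>y. (h has_real_derivative y) (at x) \<and> 0 \<le> y"
        by (intro exI[of _ "- 2 * ((g s - g x) * (\<Lambda> - g' x))"] conjI hd[OF xi]) (simp add: algebra_simps)
    qed (use False in simp)
    then show ?thesis unfolding h_def by simp
  qed
  then show ?thesis unfolding h_def using \<Lambda> by (simp add: divide_le_eq mult_ac)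
qed

lemma F_bdd: "bdd_above ((\<lambda>\<tau>. s * \<tau> - G \<tau>) ` {a..b})"
proof (rule compact_imp_bounded[THEN bounded_imp_bdd_above])
  have "continuous_on {a..b} G"
    using Gd by (meson DERIV_continuous_on has_field_derivative_at_within)
  then show "compact ((\<lambda>\<tau>. s * \<tau> - G \<tau>) ` {a..b})"
    by (intro compact_continuous_image continuous_intros) auto
qed

lemma F_upper: "\<tau> \<in> {a..b} \<Longrightarrow> s * \<tau> - G \<tau> \<le> F s"
  unfolding F_def by (rule cSUP_upper[OF _ F_bdd])

lemma F_Lipschitz: "\<bar>F s - F t\<bar> \<le> max \<bar>a\<bar> \<bar>b\<bar> * \<bar>s - t\<bar>"
proof -
  have *: "F s \<le> F t + max \<bar>a\<bar> \<bar>b\<bar> * \<bar>s - t\<bar>" for s t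
    unfolding F_def[of s]
  proof (rule cSUP_least)
    fix \<tau> assume \<tau>: "\<tau> \<in> {a..b}"
    then have "\<bar>\<tau>\<bar> \<le> max \<bar>a\<bar> \<bar>b\<bar>" by auto
    then have "\<bar>(s - t) * \<tau>\<bar> \<le> \<bar>s - t\<bar> * max \<bar>a\<bar> \<bar>b\<bar>" by (simp add: abs_mult mult_left_mono)
    then have "(s - t) * \<tau> \<le> \<bar>s - t\<bar> * max \<bar>a\<bar> \<bar>b\<bar>" by linarith
    then show "s * \<tau> - G \<tau> \<le> F t + max \<bar>a\<bar> \<bar>b\<bar> * \<bar>s - t\<bar>"
      using F_upper[OF \<tau>, of t] by (simp add: algebra_simps)
  qed (use ab in auto)
  show ?thesis using *[of s t] *[of t s] by (simp add: abs_minus_commute abs_le_iff)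
qed

lemma F_cont: "continuous_on S F"
proof (rule continuous_on_subset)
  have "(max \<bar>a\<bar> \<bar>b\<bar>)-lipschitz_on UNIV F"
    by (rule lipschitz_onI) (use F_Lipschitz in \<open>auto simp: dist_real_def\<close>)
  then show "continuous_on UNIV F" by (rule lipschitz_on_continuous_on)
qed simp

text \<open>Here \<open>t\<close> acts as a subgradient of \<open>F\<close> at \<open>g t\<close>,
  so \<open>F\<close> need not be differentiated and \<open>g\<close> need not be invertible. The
  intermediate value theorem writes \<open>s\<close> as \<open>g \<sigma>\<close>, and
  \<open>bregman\<close> at \<sigma> and \<open>t\<close> supplies the quadratic term.\<close>

lemma F_strongly_convex:
  assumes t: "t \<in> {a..b}" and s: "s \<in> {g a..g b}"
  shows "t * (s - g t) + (s - g t)\<^sup>2 / (2 * \<Lambda>) \<le> F s - F (g t)"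
proof -
  have "continuous_on {a..b} g"
    using gd by (meson DERIV_continuous_on has_field_derivative_at_within)
  then obtain \<sigma> where \<sigma>: "\<sigma> \<in> {a..b}" "g \<sigma> = s"
    using IVT'[of g a s b] s ab by auto
  have 1: "F (g t) \<le> g t * t - G t"
    unfolding F_def
  proof (rule cSUP_least)
    fix \<tau> assume \<tau>: "\<tau> \<in> {a..b}"
    have "0 \<le> (g t - g \<tau>)\<^sup>2 / (2 * \<Lambda>)" using \<Lambda> by simp
    with bregman[OF t \<tau>] show "g t * \<tau> - G \<tau> \<le> g t * t - G t"
      by (simp add: algebra_simps)
  qed (use ab in auto)
  have 2: "s * \<sigma> - G \<sigma> \<le> F s" by (rule F_upper[OF \<sigma>(1)])
  from bregman[OF \<sigma>(1) t] 1 2 show ?thesis unfolding \<sigma>(2) by (simp add: algebra_simps)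
qed

end

section \<open>Differential calculus on the strip\<close>

lemma partial_line:
  fixes f :: "'a::euclidean_space \<Rightarrow> real"
  assumes f: "f differentiable_on S" and T: "\<gamma> ` T \<subseteq> S" and s: "s \<in> T"
    and \<gamma>: "(\<gamma> has_vector_derivative b) (at s within T)"
  shows "((\<lambda>s. f (\<gamma> s)) has_real_derivative partial S b f (\<gamma> s)) (at s within T)"
proof -
  have "\<gamma> s \<in> S" using T s by auto
  then have "(f has_derivative frechet_derivative f (at (\<gamma> s) within S)) (at (\<gamma> s) within S)"
    using f unfolding differentiable_on_def by (simp add: frechet_derivative_works[symmetric])
  then have "(f has_derivative frechet_derivative f (at (\<gamma> s) within S)) (at (\<gamma> s) within \<gamma> ` T)"
    by (rule has_derivative_subset[OF _ T])
  from vector_derivative_diff_chain_within[OF \<gamma> this] show ?thesis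
    unfolding partial_def by (simp add: has_real_derivative_iff_has_vector_derivative o_def)
qed

lemma C2_D:
  assumes "Ck_on 2 S f" "b \<in> Basis"
  shows "f differentiable_on S" "continuous_on S f" "partial S b f differentiable_on S"
    "continuous_on S (partial S b f)"
    "c \<in> Basis \<Longrightarrow> continuous_on S (partial S c (partial S b f))"
  using assms by (auto simp: numeral_2_eq_2 intro: differentiable_imp_continuous_on)

lemma C1_D:
  assumes "Ck_on 1 S f"
  shows "f differentiable_on S" "continuous_on S f"
    "b \<in> Basis \<Longrightarrow> continuous_on S (partial S b f)"
  using assms by (auto intro: differentiable_imp_continuous_on)

lemma Basis2: "(1, 0) \<in> (Basis :: (real \<times> real) set)" "(0, 1) \<in> (Basis :: (real \<times> real) set)"
  by (auto simp: Basis_prod_def)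

lemma Basis3: "(1, 0, 0) \<in> (Basis :: (real \<times> real \<times> real) set)"
  "(0, 1, 0) \<in> (Basis :: (real \<times> real \<times> real) set)" "(0, 0, 1) \<in> (Basis :: (real \<times> real \<times> real) set)"
  by (auto simp: Basis_prod_def zero_prod_def)

lemma partial_strip:
  assumes "f differentiable_on cl_strip H" "y \<in> {0..H}"
  shows "((\<lambda>s. f (s, y)) has_real_derivative partial (cl_strip H) (1, 0) f (x, y)) (at x)"
    "((\<lambda>s. f (x, s)) has_real_derivative partial (cl_strip H) (0, 1) f (x, y)) (at y within {0..H})"
proof -
  have im: "range (\<lambda>s. (s, y)) \<subseteq> cl_strip H" "(\<lambda>s. (x, s)) ` {0..H} \<subseteq> cl_strip H"
    using assms(2) by (auto simp: cl_strip_def)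
  have "((\<lambda>s. (s, y)) has_vector_derivative (1, 0)) (at x)"
    "((\<lambda>s. (x, s)) has_vector_derivative (0, 1)) (at y within {0..H})"
    unfolding has_vector_derivative_def by (auto intro!: derivative_eq_intros)
  then show "((\<lambda>s. f (s, y)) has_real_derivative partial (cl_strip H) (1, 0) f (x, y)) (at x)"
    "((\<lambda>s. f (x, s)) has_real_derivative partial (cl_strip H) (0, 1) f (x, y)) (at y within {0..H})"
    using partial_line[OF assms(1) im(1), of x "(1, 0)"]
      partial_line[OF assms(1) im(2), of y "(0, 1)"] assms(2) by simp_all
qed

lemma partial_spacetime:
  assumes "f differentiable_on spacetime H" "y \<in> {0..H}"
  shows "((\<lambda>s. f (s, x, y)) has_real_derivative dt H f (t, x, y)) (at t)"
    "((\<lambda>s. f (t, s, y)) has_real_derivative dx1 H f (t, x, y)) (at x)"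
    "((\<lambda>s. f (t, x, s)) has_real_derivative dx2 H f (t, x, y)) (at y within {0..H})"
proof -
  have im: "range (\<lambda>s. (s, x, y)) \<subseteq> spacetime H" "range (\<lambda>s. (t, s, y)) \<subseteq> spacetime H"
    "(\<lambda>s. (t, x, s)) ` {0..H} \<subseteq> spacetime H"
    using assms(2) by (auto simp: cl_strip_def spacetime_def)
  have "((\<lambda>s. (s, x, y)) has_vector_derivative (1, 0, 0)) (at t)"
    "((\<lambda>s. (t, s, y)) has_vector_derivative (0, 1, 0)) (at x)"
    "((\<lambda>s. (t, x, s)) has_vector_derivative (0, 0, 1)) (at y within {0..H})"
    unfolding has_vector_derivative_def by (auto intro!: derivative_eq_intros simp: zero_prod_def)
  then show "((\<lambda>s. f (s, x, y)) has_real_derivative dt H f (t, x, y)) (at t)"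
    "((\<lambda>s. f (t, s, y)) has_real_derivative dx1 H f (t, x, y)) (at x)"
    "((\<lambda>s. f (t, x, s)) has_real_derivative dx2 H f (t, x, y)) (at y within {0..H})"
    using partial_line[OF assms(1) im(1), of t "(1, 0, 0)"]
      partial_line[OF assms(1) im(2), of x "(0, 1, 0)"]
      partial_line[OF assms(1) im(3), of y "(0, 0, 1)"] assms(2) by simp_all
qed

text \<open>Differentiating \<open>f x y - f x a = \<integral>\<^bsub>a\<^esub>\<^sup>y f2 x\<close> in \<open>x\<close> under the integral and
  then in \<open>y\<close> shows that the mixed derivatives agree, without assuming that \<open>f\<close> is \<open>C\<^sup>2\<close>.\<close>

lemma mixed_partials:
  fixes f f1 f2 f12 f21 :: "real \<Rightarrow> real \<Rightarrow> real"
  assumes ab: "a < b" and y: "y \<in> {a..b}"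
    and f1: "\<And>x y. y \<in> {a..b} \<Longrightarrow> ((\<lambda>x. f x y) has_real_derivative f1 x y) (at x)"
    and f2: "\<And>x y. y \<in> {a..b} \<Longrightarrow> ((\<lambda>y. f x y) has_real_derivative f2 x y) (at y within {a..b})"
    and f12: "\<And>x y. y \<in> {a..b} \<Longrightarrow> ((\<lambda>y. f1 x y) has_real_derivative f12 x y) (at y within {a..b})"
    and f21: "\<And>x y. y \<in> {a..b} \<Longrightarrow> ((\<lambda>x. f2 x y) has_real_derivative f21 x y) (at x)"
    and c2: "\<And>x. continuous_on {a..b} (f2 x)"
    and c21: "continuous_on (UNIV \<times> {a..b}) (\<lambda>(x, y). f21 x y)"
  shows "f12 x y = f21 x y"
proof -
  have eq: "f1 x y - f1 x a = integral {a..y} (f21 x)" if y: "y \<in> {a..b}" for y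
  proof (rule DERIV_unique)
    show "((\<lambda>x. f x y - f x a) has_real_derivative f1 x y - f1 x a) (at x)"
      using f1[of y x] f1[of a x] y ab by (auto intro!: derivative_intros)
    have sub: "{a..y} \<subseteq> {a..b}" using y by auto
    have "((\<lambda>x. integral (cbox a y) (f2 x)) has_real_derivative integral (cbox a y) (f21 x)) (at x within UNIV)"
    proof (rule leibniz_rule_field_derivative)
      show "continuous_on (UNIV \<times> cbox a y) (\<lambda>(x, t). f21 x t)"
        by (rule continuous_on_subset[OF c21]) (use sub in auto)
    next
      show "f2 x integrable_on cbox a y" for x
        unfolding box_real by (intro integrable_continuous_interval continuous_on_subset[OF c2 sub])
    qed (use sub f21 in auto)
    moreover have "integral (cbox a y) (f2 x) = f x y - f x a" for x
      unfolding box_real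
      by (rule FTC_continuous) (use y sub in \<open>auto intro: has_field_derivative_subset[OF f2 sub]\<close>)
    ultimately show "((\<lambda>x. f x y - f x a) has_real_derivative integral {a..y} (f21 x)) (at x)" by simp
  qed
  have s: "continuous_on {a..b} (f21 x)"
  proof -
    have "continuous_on {a..b} (\<lambda>y. (x, y))" by (intro continuous_intros)
    from continuous_on_compose2[OF c21 this] show ?thesis by auto
  qed
  have "((\<lambda>y. f1 x y - f1 x a) has_vector_derivative f21 x y) (at y within {a..b})"
    by (rule has_vector_derivative_transform[OF y _ integral_has_vector_derivative[OF s y]]) (use eq in auto)
  moreover have "((\<lambda>y. f1 x y - f1 x a) has_vector_derivative f12 x y) (at y within {a..b})"
    using f12[OF y, of x] by (auto simp: has_real_derivative_iff_has_vector_derivative[symmetric] intro!: derivative_eq_intros)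
  ultimately show ?thesis
    using vector_derivative_unique_within_closed_interval[of a b y] ab y by auto
qed

lemma cl_strip_closure: "0 < H \<Longrightarrow> closure (strip H) = cl_strip H"
  unfolding strip_def cl_strip_def by (simp add: closure_Times)

text \<open>The equations are given on the open strip. Integration by parts and the range of the
  vorticity involve the walls, to which this carries them.\<close>

lemma eq_on_cl_strip:
  fixes f g :: "real \<times> real \<Rightarrow> real"
  assumes "0 < H" "continuous_on (cl_strip H) f" "continuous_on (cl_strip H) g"
    "\<And>z. z \<in> strip H \<Longrightarrow> f z = g z" "z \<in> cl_strip H"
  shows "f z = g z"
proof -
  have "(\<lambda>z. f z - g z) z = 0"
    by (rule continuous_constant_on_closure[of "strip H"])
      (use assms in \<open>auto simp: cl_strip_closure intro!: continuous_intros\<close>)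
  then show ?thesis by simp
qed

lemma eq_on_spacetime:
  fixes f g :: "real \<times> real \<times> real \<Rightarrow> real"
  assumes "0 < H" "continuous_on (spacetime H) f" "continuous_on (spacetime H) g"
    "\<And>z. z \<in> UNIV \<times> strip H \<Longrightarrow> f z = g z" "z \<in> spacetime H"
  shows "f z = g z"
proof -
  have cl: "closure (UNIV \<times> strip H) = spacetime H"
    unfolding spacetime_def by (simp add: closure_Times cl_strip_closure[OF assms(1)])
  have "continuous_on (closure (UNIV \<times> strip H)) (\<lambda>z. f z - g z)"
    unfolding cl by (intro continuous_intros assms)
  from continuous_constant_on_closure[OF this, of 0 z] have "f z - g z = 0"
    using assms(4,5) cl by simp
  then show ?thesis by simp
qed

context channel
begin

lemma K_strip: "K \<subseteq> cl_strip H"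
  unfolding K_def cl_strip_def by auto

lemma K_cont: "continuous_on (cl_strip H) f \<Longrightarrow> continuous_on K f"
  by (rule continuous_on_subset[OF _ K_strip])

lemma D_strip:
  assumes "f differentiable_on cl_strip H"
  shows "continuous_on (cl_strip H) (partial (cl_strip H) (1, 0) f) \<Longrightarrow> D1 f (partial (cl_strip H) (1, 0) f)"
    "continuous_on (cl_strip H) (partial (cl_strip H) (0, 1) f) \<Longrightarrow> D2 f (partial (cl_strip H) (0, 1) f)"
proof -
  note c = K_cont[OF differentiable_imp_continuous_on[OF assms]]
  show "D1 f (partial (cl_strip H) (1, 0) f)" if "continuous_on (cl_strip H) (partial (cl_strip H) (1, 0) f)"
    unfolding D1_def
  proof (intro conjI c K_cont[OF that] ballI)
    fix x y assume "y \<in> {0..H}"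
    then show "((\<lambda>s. f (s, y)) has_real_derivative partial (cl_strip H) (1, 0) f (x, y)) (at x within {0..L})"
      by (rule has_field_derivative_at_within[OF partial_strip(1)[OF assms]])
  qed
  show "D2 f (partial (cl_strip H) (0, 1) f)" if "continuous_on (cl_strip H) (partial (cl_strip H) (0, 1) f)"
    unfolding D2_def
    by (intro conjI c K_cont[OF that] ballI) (rule partial_strip(2)[OF assms])
qed

lemma K_cont_time: "continuous_on (spacetime H) f \<Longrightarrow> continuous_on K (\<lambda>z. f (t, z))"
  by (erule continuous_on_compose2) (use K_strip in \<open>auto simp: spacetime_def intro!: continuous_intros\<close>)

lemma D_spacetime:
  assumes "f differentiable_on spacetime H"
  shows "continuous_on (spacetime H) (dx1 H f) \<Longrightarrow> D1 (\<lambda>z. f (t, z)) (\<lambda>z. dx1 H f (t, z))"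
    "continuous_on (spacetime H) (dx2 H f) \<Longrightarrow> D2 (\<lambda>z. f (t, z)) (\<lambda>z. dx2 H f (t, z))"
proof -
  note c = K_cont_time[OF differentiable_imp_continuous_on[OF assms]]
  show "D1 (\<lambda>z. f (t, z)) (\<lambda>z. dx1 H f (t, z))" if "continuous_on (spacetime H) (dx1 H f)"
    unfolding D1_def
  proof (intro conjI c K_cont_time[OF that] ballI)
    fix x y assume "y \<in> {0..H}"
    then show "((\<lambda>s. f (t, s, y)) has_real_derivative dx1 H f (t, x, y)) (at x within {0..L})"
      by (rule has_field_derivative_at_within[OF partial_spacetime(2)[OF assms]])
  qed
  show "D2 (\<lambda>z. f (t, z)) (\<lambda>z. dx2 H f (t, z))" if "continuous_on (spacetime H) (dx2 H f)"
    unfolding D2_def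
    by (intro conjI c K_cont_time[OF that] ballI) (rule partial_spacetime(3)[OF assms])
qed

lemma periodic_partial:
  assumes per: "x1_periodic L H f" and y: "y \<in> {0..H}"
    and d1: "\<And>x. ((\<lambda>s. f (s, y)) has_real_derivative f1 (x, y)) (at x)"
    and d2: "\<And>x. ((\<lambda>s. f (x, s)) has_real_derivative f2 (x, y)) (at y within {0..H})"
  shows "f1 (x + L, y) = f1 (x, y)" "f2 (x + L, y) = f2 (x, y)"
proof -
  have p: "f (s + L, r) = f (s, r)" if "r \<in> {0..H}" for s r
    using per that unfolding x1_periodic_def cl_strip_def by (auto dest!: bspec[of _ _ "(s, r)"])
  have "((\<lambda>s. f (s + L, y)) has_real_derivative f1 (x + L, y)) (at x)"
    using DERIV_shift[of "\<lambda>s. f (s, y)" "f1 (x + L, y)" x L] d1[of "x + L"] by simp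
  then have "((\<lambda>s. f (s, y)) has_real_derivative f1 (x + L, y)) (at x)"
    using p[OF y] by simp
  then show "f1 (x + L, y) = f1 (x, y)" using DERIV_unique d1 by blast
  have "((\<lambda>s. f (x, s)) has_vector_derivative f2 (x + L, y)) (at y within {0..H})"
    by (rule has_vector_derivative_transform[OF y _ d2[of "x + L", unfolded has_real_derivative_iff_has_vector_derivative]])
      (use p in auto)
  then show "f2 (x + L, y) = f2 (x, y)"
    using vector_derivative_unique_within_closed_interval[of 0 H y] H_pos y
      d2[of x, unfolded has_real_derivative_iff_has_vector_derivative] by auto
qed

definition Dt :: "(real \<times> real \<times> real \<Rightarrow> real) \<Rightarrow> (real \<times> real \<times> real \<Rightarrow> real) \<Rightarrow> bool" where
  "Dt f f' \<longleftrightarrow> continuous_on (spacetime H) f \<and> continuous_on (spacetime H) f' \<and>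
     (\<forall>t x. \<forall>y\<in>{0..H}. ((\<lambda>s. f (s, x, y)) has_real_derivative f' (t, x, y)) (at t))"

lemma Dt_mult: "Dt f f' \<Longrightarrow> Dt g g' \<Longrightarrow> Dt (\<lambda>z. f z * g z) (\<lambda>z. f' z * g z + f z * g' z)"
  unfolding Dt_def by (auto intro!: continuous_intros derivative_eq_intros simp: algebra_simps)

lemma Dt_add: "Dt f f' \<Longrightarrow> Dt g g' \<Longrightarrow> Dt (\<lambda>z. f z + g z) (\<lambda>z. f' z + g' z)"
  unfolding Dt_def by (auto intro!: continuous_intros derivative_eq_intros)

lemma Dt_diff: "Dt f f' \<Longrightarrow> Dt g g' \<Longrightarrow> Dt (\<lambda>z. f z - g z) (\<lambda>z. f' z - g' z)"
  unfolding Dt_def by (auto intro!: continuous_intros derivative_eq_intros)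

lemma Dt_power: "Dt f f' \<Longrightarrow> Dt (\<lambda>z. f z ^ n) (\<lambda>z. real n * f z ^ (n - 1) * f' z)"
  unfolding Dt_def by (auto intro!: continuous_intros derivative_eq_intros)

lemma Dt_spacetime:
  assumes "f differentiable_on spacetime H" "continuous_on (spacetime H) (dt H f)"
  shows "Dt f (dt H f)"
  unfolding Dt_def using assms differentiable_imp_continuous_on[OF assms(1)] partial_spacetime[OF assms(1)] by auto

lemma I_conserved:
  assumes D: "Dt f f'" and 0: "\<And>t. I (\<lambda>z. f' (t, z)) = 0"
  shows "I (\<lambda>z. f (t, z)) = I (\<lambda>z. f (0, z))"
proof -
  have "((\<lambda>t. I (\<lambda>z. f (t, z))) has_real_derivative I (\<lambda>z. f' (t, z))) (at t)" for t
  proof -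
    have "((\<lambda>t. integral (cbox (0, 0) (L, H)) (\<lambda>z. f (t, z))) has_real_derivative
       integral (cbox (0, 0) (L, H)) (\<lambda>z. f' (t, z))) (at t within UNIV)"
    proof (rule leibniz_rule_field_derivative)
      show "((\<lambda>t. f (t, z)) has_real_derivative f' (t, z)) (at t within UNIV)"
        if "z \<in> cbox (0, 0) (L, H)" for t z
        using D that unfolding Dt_def K_cbox[symmetric] by (cases z) (auto simp: mem_K)
      show "(\<lambda>z. f (t, z)) integrable_on cbox (0, 0) (L, H)" for t
        unfolding K_cbox[symmetric] using D by (intro K_integrable K_cont_time) (auto simp: Dt_def)
      have "continuous_on (UNIV \<times> K) f'"
        by (rule continuous_on_subset[of "spacetime H"])
          (use D K_strip in \<open>auto simp: Dt_def spacetime_def\<close>)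
      then show "continuous_on (UNIV \<times> cbox (0, 0) (L, H)) (\<lambda>(t, z). f' (t, z))"
        unfolding K_cbox[symmetric] by simp
    qed auto
    then show ?thesis unfolding I_def K_cbox by simp
  qed
  then show ?thesis using DERIV_isconst_all[of "\<lambda>t. I (\<lambda>z. f (t, z))" t 0] 0 by simp
qed

end

section \<open>Conservation laws of Euler flows\<close>

lemma Ck2_spacetime:
  assumes "Ck_on 2 (spacetime H) f"
  shows "f differentiable_on spacetime H" "continuous_on (spacetime H) f"
    "dt H f differentiable_on spacetime H" "continuous_on (spacetime H) (dt H f)"
    "dx1 H f differentiable_on spacetime H" "continuous_on (spacetime H) (dx1 H f)"
    "dx2 H f differentiable_on spacetime H" "continuous_on (spacetime H) (dx2 H f)"
    "continuous_on (spacetime H) (dt H (dt H f))" "continuous_on (spacetime H) (dx1 H (dt H f))"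
    "continuous_on (spacetime H) (dx2 H (dt H f))" "continuous_on (spacetime H) (dt H (dx1 H f))"
    "continuous_on (spacetime H) (dx1 H (dx1 H f))" "continuous_on (spacetime H) (dx2 H (dx1 H f))"
    "continuous_on (spacetime H) (dt H (dx2 H f))" "continuous_on (spacetime H) (dx1 H (dx2 H f))"
    "continuous_on (spacetime H) (dx2 H (dx2 H f))"
  using C2_D[OF assms Basis3(1)] C2_D[OF assms Basis3(2)] C2_D[OF assms Basis3(3)] Basis3 by blast+

lemma spacetime_slices:
  assumes "continuous_on (spacetime H) f"
  shows "continuous_on (UNIV \<times> {0..H}) (\<lambda>(x, y). f (t, x, y))"
    "continuous_on (UNIV \<times> {0..H}) (\<lambda>(t, y). f (t, x, y))"
    "y \<in> {0..H} \<Longrightarrow> continuous_on (UNIV \<times> A) (\<lambda>(t, x). f (t, x, y))"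
    "continuous_on {0..H} (\<lambda>y. f (t, x, y))"
    "y \<in> {0..H} \<Longrightarrow> continuous_on A (\<lambda>x. f (t, x, y))"
  unfolding split_def
  by (rule continuous_on_compose2[OF assms];
      auto intro!: continuous_intros simp: spacetime_def cl_strip_def)+

context channel
begin

lemma mixed_x1_x2:
  assumes "Ck_on 2 (spacetime H) v" and y: "y \<in> {0..H}"
  shows "dx2 H (dx1 H v) (t, x, y) = dx1 H (dx2 H v) (t, x, y)"
proof -
  note c = Ck2_spacetime[OF assms(1)]
  show ?thesis
    by (rule mixed_partials[of 0 H y "\<lambda>x y. v (t, x, y)" "\<lambda>x y. dx1 H v (t, x, y)" "\<lambda>x y. dx2 H v (t, x, y)"
          "\<lambda>x y. dx2 H (dx1 H v) (t, x, y)" "\<lambda>x y. dx1 H (dx2 H v) (t, x, y)"],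
      rule H_pos, rule y, rule partial_spacetime(2)[OF c(1)], assumption,
      rule partial_spacetime(3)[OF c(1)], assumption, rule partial_spacetime(3)[OF c(5)], assumption,
      rule partial_spacetime(2)[OF c(7)], assumption, rule spacetime_slices(4)[OF c(8)], rule spacetime_slices(1)[OF c(16)])
qed

lemma mixed_x1_t:
  assumes "Ck_on 2 (spacetime H) v" and y: "y \<in> {0..H}"
  shows "dx1 H (dt H v) (t, x, y) = dt H (dx1 H v) (t, x, y)"
proof -
  note c = Ck2_spacetime[OF assms(1)]
  show ?thesis
    by (rule mixed_partials[of "x - 1" "x + 1" x "\<lambda>t x. v (t, x, y)" "\<lambda>t x. dt H v (t, x, y)" "\<lambda>t x. dx1 H v (t, x, y)"
          "\<lambda>t x. dx1 H (dt H v) (t, x, y)" "\<lambda>t x. dt H (dx1 H v) (t, x, y)"],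
      simp, simp, rule partial_spacetime(1)[OF c(1) y],
      rule has_field_derivative_at_within[OF partial_spacetime(2)[OF c(1) y]],
      rule has_field_derivative_at_within[OF partial_spacetime(2)[OF c(3) y]],
      rule partial_spacetime(1)[OF c(5) y], rule spacetime_slices(5)[OF c(6) y], rule spacetime_slices(3)[OF c(12) y])
qed

lemma mixed_x2_t:
  assumes "Ck_on 2 (spacetime H) v" and y: "y \<in> {0..H}"
  shows "dx2 H (dt H v) (t, x, y) = dt H (dx2 H v) (t, x, y)"
proof -
  note c = Ck2_spacetime[OF assms(1)]
  show ?thesis
    by (rule mixed_partials[of 0 H y "\<lambda>t y. v (t, x, y)" "\<lambda>t y. dt H v (t, x, y)" "\<lambda>t y. dx2 H v (t, x, y)"
          "\<lambda>t y. dx2 H (dt H v) (t, x, y)" "\<lambda>t y. dt H (dx2 H v) (t, x, y)"],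
      rule H_pos, rule y, rule partial_spacetime(1)[OF c(1)], assumption,
      rule partial_spacetime(3)[OF c(1)], assumption, rule partial_spacetime(3)[OF c(3)], assumption,
      rule partial_spacetime(1)[OF c(7)], assumption, rule spacetime_slices(4)[OF c(8)], rule spacetime_slices(2)[OF c(15)])
qed

end

locale euler = channel +
  fixes v1 v2 P :: "real \<times> real \<times> real \<Rightarrow> real"
  assumes flow: "euler_flow L H v1 v2 P"
begin

abbreviation "S \<equiv> spacetime H"

lemma v1_C2: "Ck_on 2 S v1" and v2_C2: "Ck_on 2 S v2" and P_C1: "Ck_on 1 S P"
  using flow unfolding euler_flow_def by auto

lemmas v1_c = Ck2_spacetime[OF v1_C2]
lemmas v2_c = Ck2_spacetime[OF v2_C2]

lemma P_c: "P differentiable_on S" "continuous_on S P" "continuous_on S (dx1 H P)" "continuous_on S (dx2 H P)"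
  using C1_D[OF P_C1] Basis3 by auto

lemma mem_S: "(t, x, y) \<in> S \<longleftrightarrow> y \<in> {0..H}"
  unfolding spacetime_def cl_strip_def by auto

lemma euler_closed:
  assumes "z \<in> S"
  shows "dt H v1 z = - (v1 z * dx1 H v1 z + v2 z * dx2 H v1 z) - dx1 H P z"
    "dt H v2 z = - (v1 z * dx1 H v2 z + v2 z * dx2 H v2 z) - dx2 H P z"
    "dx2 H v2 z = - dx1 H v1 z"
proof -
  have e: "\<forall>z\<in>UNIV \<times> strip H.
        dt H v1 z + (v1 z * dx1 H v1 z + v2 z * dx2 H v1 z) = - dx1 H P z \<and>
        dt H v2 z + (v1 z * dx1 H v2 z + v2 z * dx2 H v2 z) = - dx2 H P z \<and>
        dx1 H v1 z + dx2 H v2 z = 0"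
    using flow unfolding euler_flow_def by (elim conjE) assumption
  show "dt H v1 z = - (v1 z * dx1 H v1 z + v2 z * dx2 H v1 z) - dx1 H P z"
    by (rule eq_on_spacetime[OF H_pos _ _ _ assms, of "dt H v1"
        "\<lambda>z. - (v1 z * dx1 H v1 z + v2 z * dx2 H v1 z) - dx1 H P z"])
      ((intro continuous_intros v1_c v2_c P_c)+, drule e[rule_format], linarith)
  show "dt H v2 z = - (v1 z * dx1 H v2 z + v2 z * dx2 H v2 z) - dx2 H P z"
    by (rule eq_on_spacetime[OF H_pos _ _ _ assms, of "dt H v2"
        "\<lambda>z. - (v1 z * dx1 H v2 z + v2 z * dx2 H v2 z) - dx2 H P z"])
      ((intro continuous_intros v1_c v2_c P_c)+, drule e[rule_format], linarith)
  show "dx2 H v2 z = - dx1 H v1 z"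
    by (rule eq_on_spacetime[OF H_pos _ _ _ assms, of "dx2 H v2" "\<lambda>z. - dx1 H v1 z"])
      ((intro continuous_intros v1_c v2_c P_c)+, drule e[rule_format], linarith)
qed

lemma v2_boundary: "v2 (t, x, 0) = 0" "v2 (t, x, H) = 0"
  using flow unfolding euler_flow_def by auto

lemma periodic:
  assumes y: "y \<in> {0..H}"
  shows "v1 (t, x + L, y) = v1 (t, x, y)" "v2 (t, x + L, y) = v2 (t, x, y)" "P (t, x + L, y) = P (t, x, y)"
    "dx1 H v2 (t, x + L, y) = dx1 H v2 (t, x, y)" "dx2 H v1 (t, x + L, y) = dx2 H v1 (t, x, y)"
proof -
  have per: "x1_periodic L H (\<lambda>x. v1 (t, x))" "x1_periodic L H (\<lambda>x. v2 (t, x))" "x1_periodic L H (\<lambda>x. P (t, x))"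
    using flow unfolding euler_flow_def by auto
  have "(x, y) \<in> cl_strip H" using y by (simp add: cl_strip_def)
  with per show "v1 (t, x + L, y) = v1 (t, x, y)" "v2 (t, x + L, y) = v2 (t, x, y)" "P (t, x + L, y) = P (t, x, y)"
    unfolding x1_periodic_def by (force dest!: bspec[of _ _ "(x, y)"])+
  show "dx1 H v2 (t, x + L, y) = dx1 H v2 (t, x, y)"
    by (rule periodic_partial(1)[OF per(2) y, of "\<lambda>x. dx1 H v2 (t, x)" "\<lambda>x. dx2 H v2 (t, x)"])
      (rule partial_spacetime[OF v2_c(1) y])+
  show "dx2 H v1 (t, x + L, y) = dx2 H v1 (t, x, y)"
    by (rule periodic_partial(2)[OF per(1) y, of "\<lambda>x. dx1 H v1 (t, x)" "\<lambda>x. dx2 H v1 (t, x)"])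
      (rule partial_spacetime[OF v1_c(1) y])+
qed

definition w :: "real \<times> real \<times> real \<Rightarrow> real" where
  "w z = dx1 H v2 z - dx2 H v1 z"

definition wt :: "real \<times> real \<times> real \<Rightarrow> real" where
  "wt z = dt H (dx1 H v2) z - dt H (dx2 H v1) z"

definition w1 :: "real \<times> real \<times> real \<Rightarrow> real" where
  "w1 z = dx1 H (dx1 H v2) z - dx1 H (dx2 H v1) z"

definition w2 :: "real \<times> real \<times> real \<Rightarrow> real" where
  "w2 z = dx2 H (dx1 H v2) z - dx2 H (dx2 H v1) z"

lemma w_vorticity: "vorticity H v1 v2 = w"
  unfolding w_def[abs_def] vorticity_def[abs_def] ..

lemma w_c: "continuous_on S w" "continuous_on S wt" "continuous_on S w1" "continuous_on S w2"
  unfolding w_def[abs_def] wt_def[abs_def] w1_def[abs_def] w2_def[abs_def]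
  by (intro continuous_intros v1_c v2_c)+

lemma w_Dt: "Dt w wt"
  unfolding w_def[abs_def] wt_def[abs_def]
  by (intro Dt_diff Dt_spacetime v1_c v2_c)

lemma w_D: "D1 (\<lambda>z. w (t, z)) (\<lambda>z. w1 (t, z))" "D2 (\<lambda>z. w (t, z)) (\<lambda>z. w2 (t, z))"
  unfolding w_def w1_def w2_def
  by (intro D1_diff D2_diff D_spacetime v1_c v2_c)+

lemma v_D:
  "D1 (\<lambda>z. v1 (t, z)) (\<lambda>z. dx1 H v1 (t, z))" "D2 (\<lambda>z. v1 (t, z)) (\<lambda>z. dx2 H v1 (t, z))"
  "D1 (\<lambda>z. v2 (t, z)) (\<lambda>z. dx1 H v2 (t, z))" "D2 (\<lambda>z. v2 (t, z)) (\<lambda>z. dx2 H v2 (t, z))"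
  "D1 (\<lambda>z. P (t, z)) (\<lambda>z. dx1 H P (t, z))" "D2 (\<lambda>z. P (t, z)) (\<lambda>z. dx2 H P (t, z))"
  by (intro D_spacetime v1_c v2_c P_c)+

lemma w_periodic: "y \<in> {0..H} \<Longrightarrow> w (t, x + L, y) = w (t, x, y)"
  unfolding w_def by (simp add: periodic)

lemma periodic0:
  assumes "y \<in> {0..H}"
  shows "v1 (t, 0, y) = v1 (t, L, y)" "v2 (t, 0, y) = v2 (t, L, y)" "P (t, 0, y) = P (t, L, y)" "w (t, 0, y) = w (t, L, y)"
    "dx1 H v2 (t, 0, y) = dx1 H v2 (t, L, y)" "dx2 H v1 (t, 0, y) = dx2 H v1 (t, L, y)"
  using periodic[OF assms, of t 0] w_periodic[OF assms, of t 0] by auto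

text \<open>The pressure is only C^1, so its second derivatives cannot be taken for granted. The
  momentum equations express its gradient through the velocity, which is C^2; hence both mixed
  derivatives exist, and \<open>mixed_partials\<close> equates them.\<close>

lemma vorticity_equation:
  assumes y: "y \<in> {0..H}"
  shows "wt (t, x, y) = - (v1 (t, x, y) * w1 (t, x, y) + v2 (t, x, y) * w2 (t, x, y))"
proof -
  define A1 where "A1 z = dt H v1 z + (v1 z * dx1 H v1 z + v2 z * dx2 H v1 z)" for z
  define A2 where "A2 z = dt H v2 z + (v1 z * dx1 H v2 z + v2 z * dx2 H v2 z)" for z
  define B1 where "B1 z = dx2 H (dt H v1) z + ((dx2 H v1 z * dx1 H v1 z + v1 z * dx2 H (dx1 H v1) z)
     + (dx2 H v2 z * dx2 H v1 z + v2 z * dx2 H (dx2 H v1) z))" for z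
  define B2 where "B2 z = dx1 H (dt H v2) z + ((dx1 H v1 z * dx1 H v2 z + v1 z * dx1 H (dx1 H v2) z)
     + (dx1 H v2 z * dx2 H v2 z + v2 z * dx1 H (dx2 H v2) z))" for z
  have P1: "dx1 H P (t, x, y) = - A1 (t, x, y)" "dx2 H P (t, x, y) = - A2 (t, x, y)" if "y \<in> {0..H}" for t x y
    unfolding A1_def A2_def using euler_closed(1,2)[of "(t, x, y)"] that by (auto simp: mem_S)
  note ps = partial_spacetime[OF v1_c(1)] partial_spacetime[OF v2_c(1)] partial_spacetime[OF v1_c(3)] partial_spacetime[OF v2_c(3)]
    partial_spacetime[OF v1_c(5)] partial_spacetime[OF v2_c(5)] partial_spacetime[OF v1_c(7)] partial_spacetime[OF v2_c(7)]
  have "- B1 (t, x, y) = - B2 (t, x, y)"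
  proof (rule mixed_partials[of 0 H y "\<lambda>x y. P (t, x, y)" "\<lambda>x y. - A1 (t, x, y)" "\<lambda>x y. - A2 (t, x, y)"
          "\<lambda>x y. - B1 (t, x, y)" "\<lambda>x y. - B2 (t, x, y)"])
    fix x y assume y: "y \<in> {0..H}"
    show "((\<lambda>x. P (t, x, y)) has_real_derivative - A1 (t, x, y)) (at x)"
      using partial_spacetime(2)[OF P_c(1) y] P1[OF y] by metis
    show "((\<lambda>y. P (t, x, y)) has_real_derivative - A2 (t, x, y)) (at y within {0..H})"
      using partial_spacetime(3)[OF P_c(1) y] P1[OF y] by metis
    show "((\<lambda>y. - A1 (t, x, y)) has_real_derivative - B1 (t, x, y)) (at y within {0..H})"
      unfolding A1_def B1_def
      by (rule DERIV_cong[OF DERIV_minus[OF DERIV_add[OF ps(9)[OF y] DERIV_add[OF DERIV_mult[OF ps(3)[OF y] ps(15)[OF y]]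
          DERIV_mult[OF ps(6)[OF y] ps(21)[OF y]]]]]]) (simp add: algebra_simps)
    show "((\<lambda>x. - A2 (t, x, y)) has_real_derivative - B2 (t, x, y)) (at x)"
      unfolding A2_def B2_def
      by (rule DERIV_cong[OF DERIV_minus[OF DERIV_add[OF ps(11)[OF y] DERIV_add[OF DERIV_mult[OF ps(2)[OF y] ps(17)[OF y]]
          DERIV_mult[OF ps(5)[OF y] ps(23)[OF y]]]]]]) (simp add: algebra_simps)
  next
    have "continuous_on S (\<lambda>z. - A2 z)" "continuous_on S (\<lambda>z. - B2 z)"
      unfolding A2_def B2_def by (intro continuous_intros v1_c v2_c)+
    from spacetime_slices(4)[OF this(1)] spacetime_slices(1)[OF this(2)]
    show "continuous_on {0..H} (\<lambda>y. - A2 (t, x, y))"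
      "continuous_on (UNIV \<times> {0..H}) (\<lambda>(x, y). - B2 (t, x, y))" for x by auto
  qed (use H_pos y in auto)
  then have B: "B1 (t, x, y) = B2 (t, x, y)" by simp
  have d: "dx2 H v2 (t, x, y) = - dx1 H v1 (t, x, y)" using euler_closed(3) y mem_S by blast
  show ?thesis
    using B unfolding B1_def B2_def wt_def w1_def w2_def d
      mixed_x1_x2[OF v1_C2 y] mixed_x1_x2[OF v2_C2 y] mixed_x1_t[OF v2_C2 y] mixed_x2_t[OF v1_C2 y]
    by (simp add: algebra_simps)
qed

text \<open>The common shape of all conservation laws below: the time derivative of a density is
  minus the divergence of a flux that is periodic in x_1 and whose normal component agrees on the
  two walls.\<close>

lemma I_divergence:
  assumes A: "D1 A A'" and B: "D2 B B'"
    and perA: "\<And>y. y \<in> {0..H} \<Longrightarrow> A (0, y) = A (L, y)"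
    and bdB: "\<And>x. x \<in> {0..L} \<Longrightarrow> B (x, 0) = B (x, H)"
    and eq: "\<And>x y. y \<in> {0..H} \<Longrightarrow> F (x, y) = - (A' (x, y) + B' (x, y))"
  shows "I F = 0"
proof -
  have "I F = I (\<lambda>z. (-1) * (A' z + B' z))"
    by (rule I_cong) (auto simp: mem_K eq)
  also have "\<dots> = (-1) * (I A' + I B')"
    unfolding I_cmult by (subst I_add[OF D_cont(2)[OF A] D_cont(4)[OF B]]) simp
  also have "\<dots> = 0" using I_D1[OF A perA] I_D2[OF B bdB] by simp
  finally show ?thesis .
qed

lemma div_free: "y \<in> {0..H} \<Longrightarrow> dx2 H v2 (t, x, y) = - dx1 H v1 (t, x, y)"
  using euler_closed(3) mem_S by blast

lemma vorticity_power_conserved: "I (\<lambda>z. w (t, z) ^ n) = I (\<lambda>z. w (0, z) ^ n)"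
proof (cases n)
  case 0
  then show ?thesis by simp
next
  case (Suc m)
  show ?thesis unfolding Suc
    apply (rule I_conserved[OF Dt_power[OF w_Dt]])
    subgoal for t
      by (rule I_divergence[OF D1_mult[OF v_D(1)[of t] D1_power[OF w_D(1)[of t]], of "Suc m"]
            D2_mult[OF v_D(4)[of t] D2_power[OF w_D(2)[of t]], of "Suc m"]])
        (simp_all add: periodic0 v2_boundary vorticity_equation div_free algebra_simps)
    done
qed

lemma momentum_conserved: "I (\<lambda>z. v1 (t, z)) = I (\<lambda>z. v1 (0, z))"
  apply (rule I_conserved[OF Dt_spacetime[OF v1_c(1,4)]])
  subgoal for t
    by (rule I_divergence[OF D1_add[OF D1_mult[OF v_D(1)[of t] v_D(1)[of t]] v_D(5)[of t]] D2_mult[OF v_D(2)[of t] v_D(4)[of t]]])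
      (simp_all add: periodic0 v2_boundary euler_closed(1) mem_S div_free algebra_simps)
  done

lemma energy_conserved:
  "I (\<lambda>z. v1 (t, z) * v1 (t, z) + v2 (t, z) * v2 (t, z)) = I (\<lambda>z. v1 (0, z) * v1 (0, z) + v2 (0, z) * v2 (0, z))"
proof -
  \<comment> \<open>The conserved density is |v|^2 without the factor 1/2, so its flux is v times
    |v|^2 + 2 P, and the pressure enters twice.\<close>
  note E1 = D1_add[OF D1_add[OF D1_mult[OF v_D(1) v_D(1)] D1_mult[OF v_D(3) v_D(3)]] D1_add[OF v_D(5) v_D(5)], of t t t t t t for t]
  note E2 = D2_add[OF D2_add[OF D2_mult[OF v_D(2) v_D(2)] D2_mult[OF v_D(4) v_D(4)]] D2_add[OF v_D(6) v_D(6)], of t t t t t t for t]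
  note T1 = Dt_spacetime[OF v1_c(1,4)] and T2 = Dt_spacetime[OF v2_c(1,4)]
  show ?thesis
    apply (rule I_conserved[OF Dt_add[OF Dt_mult[OF T1 T1] Dt_mult[OF T2 T2]]])
    subgoal for t
      by (rule I_divergence[OF D1_mult[OF v_D(1)[of t] E1[of t]] D2_mult[OF v_D(4)[of t] E2[of t]]])
        (simp_all add: periodic0 v2_boundary euler_closed(1,2) mem_S div_free algebra_simps)
    done
qed

text \<open>Transport of \<open>x_2 * w\<close> leaves the source \<open>v2 * w\<close>. By
  incompressibility this is itself a divergence, that of (v2^2 - v1^2) / 2 and - v1 v2, which
  explains the additional terms in the flux.\<close>

lemma impulse_conserved: "I (\<lambda>z. snd z * w (t, z)) = I (\<lambda>z. snd z * w (0, z))"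
proof -
  have yt: "Dt (\<lambda>z. snd (snd z)) (\<lambda>z. 0)"
    unfolding Dt_def by (auto intro!: continuous_intros)
  have y1: "D1 (\<lambda>z. snd z) (\<lambda>z. 0)" and y2: "D2 (\<lambda>z. snd z) (\<lambda>z. 1)"
    unfolding D1_def D2_def by (auto intro!: continuous_intros derivative_eq_intros)
  have half: "D1 (\<lambda>z. 1 / 2) (\<lambda>z. 0)"
    unfolding D1_def by (auto intro!: continuous_intros derivative_eq_intros)
  have "I (\<lambda>z. snd (snd (t, z)) * w (t, z)) = I (\<lambda>z. snd (snd (0::real, z)) * w (0, z))"
    apply (rule I_conserved[OF Dt_mult[OF yt w_Dt]])
    subgoal for t
      by (rule I_divergence[OF
          D1_diff[OF D1_add[OF D1_mult[OF y1 D1_mult[OF v_D(1)[of t] w_D(1)[of t]]] D1_mult[OF D1_mult[OF v_D(1)[of t] v_D(1)[of t]] half]]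
            D1_mult[OF D1_mult[OF v_D(3)[of t] v_D(3)[of t]] half]]
          D2_add[OF D2_mult[OF y2 D2_mult[OF v_D(4)[of t] w_D(2)[of t]]] D2_mult[OF v_D(2)[of t] v_D(4)[of t]]]])
      (simp_all add: periodic0 v2_boundary vorticity_equation div_free w_def algebra_simps)
    done
  then show ?thesis by simp
qed

text \<open>No flow map is used. Powers of the vorticity are conserved by the vorticity equation,
  and Weierstrass approximation on the compact union of the ranges at the two times extends this to
  every continuous \<open>h\<close>, in particular to truncations and to \<open>F\<close>.\<close>

theorem Casimir_conserved:
  assumes h: "continuous_on UNIV h"
  shows "I (\<lambda>z. h (w (t, z))) = I (\<lambda>z. h (w (0, z)))"
proof -
  have wK: "continuous_on K (\<lambda>z. w (s, z))" for s by (rule K_cont_time[OF w_c(1)])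
  have hK: "continuous_on K (\<lambda>z. h (w (s, z)))" for s
    by (rule continuous_on_compose2[OF h wK]) auto
  define R where "R = (\<lambda>z. w (t, z)) ` K \<union> (\<lambda>z. w (0, z)) ` K"
  have R: "compact R" unfolding R_def by (intro compact_Un compact_continuous_image wK compact_K)
  have close: "\<bar>I (\<lambda>z. h (w (t, z))) - I (\<lambda>z. h (w (0, z)))\<bar> \<le> e * (2 * (L * H))" if e: "0 < e" for e
  proof -
    obtain p where p: "real_polynomial_function p" "\<And>x. x \<in> R \<Longrightarrow> \<bar>h x - p x\<bar> < e"
      using Stone_Weierstrass_real_polynomial_function[OF R continuous_on_subset[OF h] e] by blast
    obtain a n where an: "p = (\<lambda>x. \<Sum>i\<le>n. a i * x ^ i)"
      using p(1) real_polynomial_function_iff_sum by blast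
    have pc: "continuous_on K (\<lambda>z. p (w (s, z)))" for s
      unfolding an by (intro continuous_intros wK)
    have pI: "I (\<lambda>z. p (w (s, z))) = (\<Sum>i\<le>n. a i * I (\<lambda>z. w (s, z) ^ i))" for s
      unfolding an by (intro I_unique has_integral_sum has_integral_mult_right I_has_integral continuous_intros wK) auto
    have ph: "\<bar>I (\<lambda>z. h (w (s, z))) - I (\<lambda>z. p (w (s, z)))\<bar> \<le> e * (L * H)" if s: "s = t \<or> s = 0" for s
    proof -
      have "\<bar>I (\<lambda>z. h (w (s, z)) - p (w (s, z)))\<bar> \<le> I (\<lambda>z. \<bar>h (w (s, z)) - p (w (s, z))\<bar>)"
        by (rule I_abs) (intro continuous_intros hK pc)
      also have "\<dots> \<le> I (\<lambda>z. e)"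
      proof (rule I_mono)
        fix z assume "z \<in> K"
        then have "w (s, z) \<in> R" using s unfolding R_def by auto
        from p(2)[OF this] show "\<bar>h (w (s, z)) - p (w (s, z))\<bar> \<le> e" by simp
      qed (intro continuous_intros hK pc)+
      finally show ?thesis unfolding I_const I_diff[OF hK pc] .
    qed
    have "I (\<lambda>z. p (w (t, z))) = I (\<lambda>z. p (w (0, z)))"
      unfolding pI by (simp add: vorticity_power_conserved[of t])
    with ph[of t] ph[of 0] show ?thesis by simp
  qed
  have "\<bar>I (\<lambda>z. h (w (t, z))) - I (\<lambda>z. h (w (0, z)))\<bar> \<le> 0 * (2 * (L * H))"
    by (rule le_mult_limit) (use close in auto)
  then show ?thesis by simp
qed

end

section \<open>The first eigenvalue\<close>

lemma partial_cong:
  assumes "\<And>x. x \<in> S \<Longrightarrow> f x = g x" "x \<in> S"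
  shows "partial S b f x = partial S b g x"
proof -
  have "(f has_derivative D) (at x within S) \<longleftrightarrow> (g has_derivative D) (at x within S)" for D
    using has_derivative_transform[of x S f g D] has_derivative_transform[of x S g f D] assms by auto
  then show ?thesis unfolding partial_def frechet_derivative_def by simp
qed

lemma differentiable_on_cong':
  assumes "\<And>x. x \<in> S \<Longrightarrow> f x = g x" "g differentiable_on S"
  shows "f differentiable_on S"
  using assms unfolding differentiable_on_def differentiable_def
  by (metis has_derivative_transform)

lemma Ck_on_cong:
  assumes "\<And>x. x \<in> S \<Longrightarrow> f x = g x" "Ck_on k S g"
  shows "Ck_on k S f"
  using assms
proof (induction k arbitrary: f g)
  case 0
  then show ?case by (simp cong: continuous_on_cong)
next
  case (Suc k)
  have "Ck_on k S (partial S b f)" if "b \<in> Basis" for b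
  proof (rule Suc.IH)
    show "partial S b f x = partial S b g x" if "x \<in> S" for x
      by (rule partial_cong[OF Suc.prems(1) that])
    show "Ck_on k S (partial S b g)" using Suc.prems(2) that by auto
  qed
  then show ?case using Suc.prems differentiable_on_cong'[of S f g] by auto
qed

lemma partial_strip_eq:
  assumes f: "f differentiable_on cl_strip H" and H: "0 < H" and y: "y \<in> {0..H}"
  shows "((\<lambda>s. f (s, y)) has_real_derivative a) (at x) \<Longrightarrow> partial (cl_strip H) (1, 0) f (x, y) = a"
    "((\<lambda>s. f (x, s)) has_real_derivative b) (at y within {0..H}) \<Longrightarrow> partial (cl_strip H) (0, 1) f (x, y) = b"
proof -
  show "partial (cl_strip H) (1, 0) f (x, y) = a" if "((\<lambda>s. f (s, y)) has_real_derivative a) (at x)"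
    using DERIV_unique[OF partial_strip(1)[OF f y] that] .
  show "partial (cl_strip H) (0, 1) f (x, y) = b" if "((\<lambda>s. f (x, s)) has_real_derivative b) (at y within {0..H})"
    using vector_derivative_unique_within_closed_interval[of 0 H y] H y
      partial_strip(2)[OF f y, of x] that unfolding has_real_derivative_iff_has_vector_derivative by auto
qed

text \<open>A product family closed under both partial derivatives, which act linearly on the
  coefficients. Smoothness of any order and the Laplacian of all candidate eigenfunctions follow
  from this closure.\<close>

definition Fam :: "real \<Rightarrow> real \<Rightarrow> real \<Rightarrow> real \<Rightarrow> real \<Rightarrow> real \<Rightarrow> real \<times> real \<Rightarrow> real" where
  "Fam j k c d a b z = (c * cos (j * fst z) + d * sin (j * fst z)) * (a * sin (k * snd z) + b * cos (k * snd z))"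

lemma Fam_differentiable: "Fam j k c d a b differentiable_on S"
proof -
  have "((\<lambda>z. (c * cos (j * fst z) + d * sin (j * fst z)) * (a * sin (k * snd z) + b * cos (k * snd z)))
     has_derivative (\<lambda>h. (c * cos (j * fst z) + d * sin (j * fst z)) * (a * (j' h z) + b * (k' h z))
        + (c * l' h z + d * m' h z) * (a * sin (k * snd z) + b * cos (k * snd z)))) (at z within S)"
    if "j' = (\<lambda>h z. (k * snd h) * cos (k * snd z))" "k' = (\<lambda>h z. (k * snd h) * - sin (k * snd z))"
      "l' = (\<lambda>h z. (j * fst h) * - sin (j * fst z))" "m' = (\<lambda>h z. (j * fst h) * cos (j * fst z))"
    for z j' k' l' m'
    unfolding that by (auto intro!: derivative_eq_intros simp: algebra_simps)
  then show ?thesis unfolding differentiable_on_def differentiable_def Fam_def[abs_def] by blast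
qed

lemma Fam_deriv:
  "((\<lambda>s. Fam j k c d a b (s, y)) has_real_derivative Fam j k (j * d) (- (j * c)) a b (x, y)) (at x)"
  "((\<lambda>s. Fam j k c d a b (x, s)) has_real_derivative Fam j k c d (- (k * b)) (k * a) (x, y)) (at y within T)"
  unfolding Fam_def by (auto intro!: derivative_eq_intros simp: algebra_simps)

lemma Fam_partial:
  assumes "0 < H" "z \<in> cl_strip H"
  shows "partial (cl_strip H) (1, 0) (Fam j k c d a b) z = Fam j k (j * d) (- (j * c)) a b z"
    "partial (cl_strip H) (0, 1) (Fam j k c d a b) z = Fam j k c d (- (k * b)) (k * a) z"
  using partial_strip_eq[OF Fam_differentiable assms(1), of "snd z"] Fam_deriv assms(2)
  by (cases z; auto simp: cl_strip_def)+

lemma Fam_Ck: "0 < H \<Longrightarrow> Ck_on n (cl_strip H) (Fam j k c d a b)"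
proof (induction n arbitrary: c d a b)
  case 0
  show ?case using differentiable_imp_continuous_on[OF Fam_differentiable] by simp
next
  case (Suc n)
  have "Ck_on n (cl_strip H) (partial (cl_strip H) v (Fam j k c d a b))" if "v \<in> Basis" for v
  proof -
    from that have "v = (1, 0) \<or> v = (0, 1)" by (auto simp: Basis_prod_def)
    then show ?thesis
      using Ck_on_cong[OF Fam_partial(1)[OF Suc.prems] Suc.IH[OF Suc.prems]]
        Ck_on_cong[OF Fam_partial(2)[OF Suc.prems] Suc.IH[OF Suc.prems]] by auto
  qed
  then show ?case using Fam_differentiable by auto
qed

lemma Fam_laplacian:
  assumes "0 < H" "z \<in> cl_strip H"
  shows "laplacian H (Fam j k c d a b) z = - (j\<^sup>2 + k\<^sup>2) * Fam j k c d a b z"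
proof -
  have "partial (cl_strip H) (1, 0) (partial (cl_strip H) (1, 0) (Fam j k c d a b)) z
      = partial (cl_strip H) (1, 0) (Fam j k (j * d) (- (j * c)) a b) z"
    by (rule partial_cong[OF Fam_partial(1)[OF assms(1)] assms(2)])
  moreover have "partial (cl_strip H) (0, 1) (partial (cl_strip H) (0, 1) (Fam j k c d a b)) z
      = partial (cl_strip H) (0, 1) (Fam j k c d (- (k * b)) (k * a)) z"
    by (rule partial_cong[OF Fam_partial(2)[OF assms(1)] assms(2)])
  ultimately show ?thesis
    unfolding laplacian_def Fam_partial[OF assms] by (simp add: Fam_def algebra_simps power2_eq_square)
qed

context channel
begin

lemma cell_negligible: "negligible (K - cell L H)" "cell L H \<subseteq> K"
proof -
  have "K - cell L H \<subseteq> cbox (0, 0) (L, H) - box (0, 0) (L, H)"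
    unfolding K_cbox[symmetric] cell_def by (auto simp: mem_box Basis_prod_def)
  then show "negligible (K - cell L H)"
    using negligible_frontier_interval negligible_subset by blast
  show "cell L H \<subseteq> K" unfolding cell_def K_def by auto
qed

lemma cell_integral:
  assumes f: "continuous_on K f"
  shows "(LINT x:cell L H|lborel. f x) = I f"
proof -
  have "set_integrable lborel K f"
    unfolding set_integrable_def using borel_integrable_compact[OF compact_K f]
    by (simp add: indicator_def if_distrib[of "\<lambda>c. c *\<^sub>R _"] cong: if_cong)
  then have "set_integrable lborel (cell L H) f"
    by (rule set_integrable_subset) (auto simp: cell_def cell_negligible[unfolded cell_def] intro!: borel_Times)
  then have "(LINT x:cell L H|lborel. f x) = integral (cell L H) f"
    by (rule set_borel_integral_eq_integral)
  also have "\<dots> = integral K f"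
    by (rule integral_spike_set) (use cell_negligible in \<open>auto intro: negligible_subset\<close>)
  finally show ?thesis unfolding I_def .
qed

lemma I_zero_imp:
  assumes f: "continuous_on K f" and nn: "\<And>z. z \<in> K \<Longrightarrow> 0 \<le> f z" and 0: "I f \<le> 0" and z: "z \<in> K"
  shows "f z = 0"
proof -
  have "I f = 0" using I_nonneg[OF f nn] 0 by linarith
  moreover have "box (0, 0) (L, H) \<noteq> {}" using L_pos H_pos by (auto simp: box_ne_empty Basis_prod_def)
  ultimately show ?thesis
    using integral_cbox_eq_0_iff[of "(0, 0)" "(L, H)" f] f nn z unfolding I_def K_cbox by auto
qed

lemma x1_periodic_shift:
  assumes "x1_periodic L H f" "y \<in> {0..H}"
  shows "f (x + L * of_int n, y) = f (x, y)"
proof -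
  have s: "f (x + L, y) = f (x, y)" for x
    using assms unfolding x1_periodic_def cl_strip_def by (auto dest!: bspec[of _ _ "(x, y)"])
  have nat: "f (x + L * of_nat n, y) = f (x, y)" for x and n :: nat
  proof (induction n)
    case (Suc n)
    have "f (x + L * of_nat (Suc n), y) = f ((x + L * of_nat n) + L, y)" by (simp add: algebra_simps)
    then show ?case using s Suc by simp
  qed simp
  show ?thesis
  proof (cases "0 \<le> n")
    case True
    then show ?thesis using nat[of x "nat n"] by simp
  next
    case False
    then show ?thesis using nat[of "x + L * of_int n" "nat (- n)"] by simp
  qed
qed

lemma x1_reduce:
  obtains n where "x + L * of_int n \<in> {0..L}"
proof
  have "of_int \<lfloor>x / L\<rfloor> * L \<le> x" "x < (of_int \<lfloor>x / L\<rfloor> + 1) * L"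
    using L_pos by (rule floor_divide_lower floor_divide_upper)+
  then have "L * of_int \<lfloor>x / L\<rfloor> \<le> x" "x \<le> L * of_int \<lfloor>x / L\<rfloor> + L"
    by (simp_all add: algebra_simps)
  then show "x + L * of_int (- \<lfloor>x / L\<rfloor>) \<in> {0..L}" by simp
qed

lemma Green:
  assumes V: "D1 V V1" "D2 V V2" and u: "D1 u1 u11" "D2 u2 u22"
    and per: "\<And>y. y \<in> {0..H} \<Longrightarrow> V (0, y) = V (L, y)" "\<And>y. y \<in> {0..H} \<Longrightarrow> u1 (0, y) = u1 (L, y)"
    and bd: "\<And>x. x \<in> {0..L} \<Longrightarrow> V (x, 0) = 0" "\<And>x. x \<in> {0..L} \<Longrightarrow> V (x, H) = 0"
  shows "I (\<lambda>z. V1 z * u1 z + V2 z * u2 z) = I (\<lambda>z. V z * - (u11 z + u22 z))"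
proof -
  note c = D_cont(1,2)[OF V(1)] D_cont(4)[OF V(2)] D_cont(1,2)[OF u(1)] D_cont(3,4)[OF u(2)]
  have "I (\<lambda>z. V1 z * u1 z + V z * u11 z) = 0"
    by (rule I_D1[OF D1_mult[OF V(1) u(1)]]) (simp add: per)
  moreover have "I (\<lambda>z. V2 z * u2 z + V z * u22 z) = 0"
    by (rule I_D2[OF D2_mult[OF V(2) u(2)]]) (simp add: bd)
  moreover have "I (\<lambda>z. V1 z * u1 z + V2 z * u2 z) = I (\<lambda>z. ((V1 z * u1 z + V z * u11 z) + (V2 z * u2 z + V z * u22 z)) + V z * - (u11 z + u22 z))"
    by (rule I_cong) (simp add: algebra_simps)
  moreover have "\<dots> = (I (\<lambda>z. V1 z * u1 z + V z * u11 z) + I (\<lambda>z. V2 z * u2 z + V z * u22 z)) + I (\<lambda>z. V z * - (u11 z + u22 z))"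
    by (intro I_unique has_integral_add I_has_integral continuous_intros c)
  ultimately show ?thesis by simp
qed

lemma Fam_D:
  "D1 (Fam j k c d a b) (Fam j k (j * d) (- (j * c)) a b)"
  "D2 (Fam j k c d a b) (Fam j k c d (- (k * b)) (k * a))"
  unfolding D1_def D2_def
  using Fam_deriv differentiable_imp_continuous_on[OF Fam_differentiable]
  by (auto intro: has_field_derivative_at_within)

lemma trig_Fam: "trig1 c d = Fam k1 k2 c d 1 0" "trig2 a b = Fam 0 (2 * k2) 1 0 a b"
  unfolding trig1_def[abs_def] trig2_def[abs_def] Fam_def[abs_def] by auto

lemma trig1_periodic: "trig1 c d (x + L, y) = trig1 c d (x, y)"
proof -
  have "k1 * (x + L) = k1 * x + 2 * pi" using k_mult by (simp add: algebra_simps)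
  then show ?thesis unfolding trig1_def by simp
qed

lemma trig_mean: "I (trig1 c d) = 0" "I (trig2 a b) = 0"
proof -
  have nz: "k1 \<noteq> 0" "k2 \<noteq> 0" using k_pos by auto
  show "I (trig1 c d) = 0"
  proof (rule I_D1)
    show "D1 (trig1 (- d / k1) (c / k1)) (trig1 c d)"
      using Fam_D(1)[of k1 k2 "- d / k1" "c / k1" 1 0] nz unfolding trig_Fam by simp
    show "trig1 (- d / k1) (c / k1) (0, y) = trig1 (- d / k1) (c / k1) (L, y)" for y
      using trig1_periodic[of _ _ 0] by simp
  qed
  show "I (trig2 a b) = 0"
  proof (rule I_D2)
    show "D2 (trig2 (b / (2 * k2)) (- a / (2 * k2))) (trig2 a b)"
      using Fam_D(2)[of 0 "2 * k2" 1 0 "b / (2 * k2)" "- a / (2 * k2)"] nz unfolding trig_Fam by simp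
    show "trig2 (b / (2 * k2)) (- a / (2 * k2)) (x, 0) = trig2 (b / (2 * k2)) (- a / (2 * k2)) (x, H)" for x
      unfolding trig2_def snd_conv k_mult by simp
  qed
qed

lemma strip_sub: "strip H \<subseteq> cl_strip H"
  unfolding strip_def cl_strip_def by auto

lemma trig_eigen: "trig1 c d \<in> eigenspace L H Lb" "trig2 a b \<in> eigenspace L H La"
proof -
  have "- laplacian H (trig1 c d) z = Lb * trig1 c d z" "- laplacian H (trig2 a b) z = La * trig2 a b z"
    if "z \<in> strip H" for z
    unfolding trig_Fam Lb_def La_def Fam_laplacian[OF H_pos subsetD[OF strip_sub that]]
    by (simp_all add: algebra_simps)
  moreover have "x1_periodic L H (trig1 c d)" "x1_periodic L H (trig2 a b)"
    unfolding x1_periodic_def using trig1_periodic by (auto simp: trig2_def)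
  moreover have "Ck_on 2 (cl_strip H) (trig1 c d)" "Ck_on 2 (cl_strip H) (trig2 a b)"
    unfolding trig_Fam by (rule Fam_Ck[OF H_pos])+
  moreover have "\<exists>c'. \<forall>x. trig1 c d (x, 0) = c' \<and> trig1 c d (x, H) = c'"
    unfolding trig1_def using k_mult by (intro exI[of _ 0]) simp
  moreover have "\<exists>c'. \<forall>x. trig2 a b (x, 0) = c' \<and> trig2 a b (x, H) = c'"
    unfolding trig2_def snd_conv k_mult by (intro exI[of _ b]) simp
  ultimately show "trig1 c d \<in> eigenspace L H Lb" "trig2 a b \<in> eigenspace L H La"
    unfolding eigenspace_def using trig_mean by (auto simp: cell_integral trig_cont)
qed

lemma Ck2_strip:
  assumes "Ck_on 2 (cl_strip H) u"
  defines "u1 \<equiv> partial (cl_strip H) (1, 0) u" and "u2 \<equiv> partial (cl_strip H) (0, 1) u"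
  defines "u11 \<equiv> partial (cl_strip H) (1, 0) u1" and "u22 \<equiv> partial (cl_strip H) (0, 1) u2"
  shows "D1 u u1" "D2 u u2" "D1 u1 u11" "D2 u2 u22"
    "continuous_on (cl_strip H) u" "continuous_on (cl_strip H) u11" "continuous_on (cl_strip H) u22"
    "laplacian H u z = u11 z + u22 z"
    "x1_periodic L H u \<Longrightarrow> y \<in> {0..H} \<Longrightarrow> u1 (0, y) = u1 (L, y)"
    "x1_periodic L H u \<Longrightarrow> x1_periodic L H u11" "x1_periodic L H u \<Longrightarrow> x1_periodic L H u22"
proof -
  note c = C2_D[OF assms(1) Basis2(1)] C2_D[OF assms(1) Basis2(2)]
  show "D1 u u1" "D2 u u2" "D1 u1 u11" "D2 u2 u22"
    unfolding u1_def u2_def u11_def u22_def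
    using D_strip c(5)[OF Basis2(1)] c(10)[OF Basis2(2)] c by blast+
  show "continuous_on (cl_strip H) u" "continuous_on (cl_strip H) u11" "continuous_on (cl_strip H) u22"
    unfolding u1_def u2_def u11_def u22_def using c Basis2 by blast+
  show "laplacian H u z = u11 z + u22 z"
    unfolding u1_def u2_def u11_def u22_def laplacian_def ..
  show "u1 (0, y) = u1 (L, y)" if "x1_periodic L H u" "y \<in> {0..H}"
    using periodic_partial(1)[OF that, of u1 u2 0] partial_strip[OF c(1) that(2)]
    unfolding u1_def u2_def by auto
  show "x1_periodic L H u11" "x1_periodic L H u22" if per: "x1_periodic L H u"
  proof -
    have u1: "x1_periodic L H u1" and u2: "x1_periodic L H u2"
      unfolding x1_periodic_def u1_def u2_def
      using periodic_partial[OF per, of _ "partial (cl_strip H) (1, 0) u" "partial (cl_strip H) (0, 1) u"] partial_strip[OF c(1)]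
      by (auto simp: cl_strip_def)
    show "x1_periodic L H u11"
      unfolding x1_periodic_def u11_def
      using periodic_partial(1)[OF u1, of _ "partial (cl_strip H) (1, 0) u1" "partial (cl_strip H) (0, 1) u1"]
        partial_strip[of u1] c(3) unfolding u1_def by (auto simp: cl_strip_def)
    show "x1_periodic L H u22"
      unfolding x1_periodic_def u22_def
      using periodic_partial(2)[OF u2, of _ "partial (cl_strip H) (1, 0) u2" "partial (cl_strip H) (0, 1) u2"]
        partial_strip[of u2] c(8) unfolding u2_def by (auto simp: cl_strip_def)
  qed
qed

text \<open>Subtracting the boundary constant makes \<open>u\<close> admissible in
  \<open>channel_Poincare_ge\<close>. Since \<open>u\<close> has mean zero, the constant drops out
  of Green's identity, and removing the mean of \<open>U\<close> gives back
  \<open>u\<close>.\<close>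

lemma eigenvalue_ge:
  assumes "is_eigenvalue L H \<Lambda>"
  shows "La1 \<le> \<Lambda>"
proof -
  obtain u z where u: "u \<in> eigenspace L H \<Lambda>" and z: "z \<in> cl_strip H" "u z \<noteq> 0"
    using assms unfolding is_eigenvalue_def by auto
  have per: "x1_periodic L H u" and C2: "Ck_on 2 (cl_strip H) u"
    and lap: "\<And>z. z \<in> strip H \<Longrightarrow> - laplacian H u z = \<Lambda> * u z"
    and int0: "(LINT x:cell L H|lborel. u x) = 0"
    using u unfolding eigenspace_def by auto
  obtain c where c: "\<And>x. u (x, 0) = c" "\<And>x. u (x, H) = c" using u unfolding eigenspace_def by auto
  note D = Ck2_strip[OF C2]
  define u1 where "u1 = partial (cl_strip H) (1, 0) u"
  define u2 where "u2 = partial (cl_strip H) (0, 1) u"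
  define u11 where "u11 = partial (cl_strip H) (1, 0) u1"
  define u22 where "u22 = partial (cl_strip H) (0, 1) u2"
  note D = D[folded u1_def u2_def, folded u11_def u22_def]
  note uc = D_cont(1)[OF D(1)]
  have Iu: "I u = 0" using int0 cell_integral[OF uc] by simp
  have per0: "u (0, y) = u (L, y)" if "y \<in> {0..H}" for y
    using x1_periodic_shift[OF per that, of 0 1] by simp
  have lap': "- (u11 z + u22 z) = \<Lambda> * u z" if z: "z \<in> cl_strip H" for z
    by (rule eq_on_cl_strip[OF H_pos _ _ _ z, of "\<lambda>z. - (u11 z + u22 z)" "\<lambda>z. \<Lambda> * u z"])
      (use lap D in \<open>auto intro!: continuous_intros\<close>)
  define U where "U z = u z - c" for z
  have const: "D1 (\<lambda>z. c) (\<lambda>z. 0)" "D2 (\<lambda>z. c) (\<lambda>z. 0)"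
    unfolding D1_def D2_def by (auto intro!: continuous_intros)
  have U: "D1 U u1" "D2 U u2"
    unfolding U_def[abs_def] using D1_diff[OF D(1) const(1)] D2_diff[OF D(2) const(2)] by auto
  note Uc = D_cont(1)[OF U(1)] D_cont(2)[OF U(1)] D_cont(4)[OF U(2)]
  have "Energy u1 u2 = I (\<lambda>z. u1 z * u1 z + u2 z * u2 z)"
    unfolding Energy_def using Uc by (subst I_add) (auto intro!: continuous_intros simp: power2_eq_square)
  also have "\<dots> = I (\<lambda>z. U z * - (u11 z + u22 z))"
    by (rule Green[OF U D(3,4)]) (use per0 D(9)[OF per] c in \<open>auto simp: U_def\<close>)
  also have "\<dots> = I (\<lambda>z. \<Lambda> * (u z)\<^sup>2 - \<Lambda> * c * u z)"
  proof (rule I_cong)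
    fix x y assume "(x, y) \<in> K"
    then have "(x, y) \<in> cl_strip H" using K_strip by auto
    from lap'[OF this] show "U (x, y) * - (u11 (x, y) + u22 (x, y)) = \<Lambda> * (u (x, y))\<^sup>2 - \<Lambda> * c * u (x, y)"
      by (simp add: U_def power2_eq_square algebra_simps)
  qed
  also have "\<dots> = \<Lambda> * I (\<lambda>z. (u z)\<^sup>2) - \<Lambda> * c * I u"
    by (intro I_unique has_integral_diff has_integral_mult_right I_has_integral continuous_intros uc)
  finally have E: "Energy u1 u2 = \<Lambda> * I (\<lambda>z. (u z)\<^sup>2)" using Iu by simp
  have "I U = I u - I (\<lambda>z. c)" unfolding U_def by (rule I_diff) (intro continuous_intros uc)+
  then have mU: "mean U = - c" unfolding mean_def I_const Iu using L_pos H_pos by simp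
  have "La1 * I (\<lambda>z. (U z - mean U)\<^sup>2) \<le> Energy u1 u2"
    by (rule channel_Poincare_ge[OF U]) (use per0 c in \<open>auto simp: U_def\<close>)
  then have "La1 * I (\<lambda>z. (u z)\<^sup>2) \<le> \<Lambda> * I (\<lambda>z. (u z)\<^sup>2)" unfolding E mU by (simp add: U_def)
  moreover have "0 < I (\<lambda>z. (u z)\<^sup>2)"
  proof (rule ccontr)
    assume "\<not> ?thesis"
    then have 0: "u z = 0" if "z \<in> K" for z
      using I_zero_imp[of "\<lambda>z. (u z)\<^sup>2" z] that uc by (auto intro!: continuous_intros)
    obtain x y where xy: "z = (x, y)" by (cases z)
    then have y: "y \<in> {0..H}" using z by (auto simp: cl_strip_def)
    obtain n where "x + L * of_int n \<in> {0..L}" by (rule x1_reduce)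
    then have "u (x + L * of_int n, y) = 0" using 0 y by (simp add: mem_K)
    then show False using x1_periodic_shift[OF per y, of x n] z xy by simp
  qed
  ultimately show ?thesis by simp
qed

lemma Lambda1_eq: "Lambda1 L H = La1"
  unfolding Lambda1_def
proof (rule Least_equality)
  have "is_eigenvalue L H Lb"
    unfolding is_eigenvalue_def
  proof (intro bexI)
    show "trig1 1 0 (0, H / 2) \<noteq> 0" unfolding trig1_def using k_mult by simp
    show "(0, H / 2) \<in> cl_strip H" unfolding cl_strip_def using H_pos by simp
  qed (rule trig_eigen)
  moreover have "is_eigenvalue L H La"
    unfolding is_eigenvalue_def
  proof (intro bexI)
    show "trig2 0 1 (0, 0) \<noteq> 0" unfolding trig2_def by simp
    show "(0, 0) \<in> cl_strip H" unfolding cl_strip_def using H_pos by simp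
  qed (rule trig_eigen)
  ultimately show "is_eigenvalue L H La1" unfolding La1_def min_def by auto
qed (rule eigenvalue_ge)

end

section \<open>Decomposition of the steady flow\<close>

context channel
begin

lemma DERIV_within_unique:
  assumes "(f has_real_derivative a) (at y within {0..H})" "(f has_real_derivative b) (at y within {0..H})"
    "y \<in> {0..H}"
  shows "a = b"
  using vector_derivative_unique_within_closed_interval[of 0 H y] H_pos assms
  unfolding has_real_derivative_iff_has_vector_derivative by auto

text \<open>The derivative of the left side in \<open>h\<close> is \<open>f (L + h) - f h\<close>,
  which is zero.\<close>

lemma integral_periodic_shift:
  fixes f :: "real \<Rightarrow> real"
  assumes d: "\<And>x. (f has_real_derivative f' x) (at x)" and c: "continuous_on UNIV f'"
    and per: "\<And>x. f (x + L) = f x"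
  shows "integral {0..L} (\<lambda>x. f (x + h)) = integral {0..L} f"
proof -
  have fc: "continuous_on UNIV f" using d by (auto intro!: DERIV_continuous_on)
  have "((\<lambda>h. integral {0..L} (\<lambda>x. f (x + h))) has_real_derivative 0) (at h)" for h
  proof -
    have "((\<lambda>h. integral (cbox 0 L) (\<lambda>x. f (x + h))) has_real_derivative integral (cbox 0 L) (\<lambda>x. f' (x + h))) (at h within UNIV)"
    proof (rule leibniz_rule_field_derivative)
      show "((\<lambda>h. f (x + h)) has_real_derivative f' (x + h)) (at h within UNIV)" for x h
        using DERIV_shift[of f "f' (x + h)" h x] d[of "x + h"] by (simp add: add.commute)
      show "(\<lambda>x. f (x + h)) integrable_on cbox 0 L" for h
        unfolding box_real by (intro integrable_continuous_interval continuous_on_compose2[OF fc] continuous_intros) auto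
      show "continuous_on (UNIV \<times> cbox 0 L) (\<lambda>(h, x). f' (x + h))"
        unfolding split_def by (intro continuous_on_compose2[OF c] continuous_intros) auto
    qed auto
    moreover have "integral {0..L} (\<lambda>x. f' (x + h)) = f (L + h) - f (0 + h)"
    proof (rule FTC_continuous)
      show "((\<lambda>x. f (x + h)) has_real_derivative f' (x + h)) (at x within {0..L})" for x
        using DERIV_shift[of f "f' (x + h)" x h] d[of "x + h"] by (auto intro: has_field_derivative_at_within)
    qed (use L_pos in simp)
    ultimately show ?thesis using per[of h] by (simp add: add.commute)
  qed
  then show ?thesis
    using DERIV_isconst_all[of "\<lambda>h. integral {0..L} (\<lambda>x. f (x + h))" h 0] by simp
qed

end

locale steady = channel +
  fixes lam :: real and \<psi> :: "real \<times> real \<Rightarrow> real" and g :: "real \<Rightarrow> real"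
  assumes \<psi>_per: "x1_periodic L H \<psi>" and \<psi>_C2: "Ck_on 2 (cl_strip H) \<psi>"
    and g_C1: "g C1_differentiable_on UNIV"
    and pde: "\<And>x1 x2. (x1, x2) \<in> strip H \<Longrightarrow> - laplacian H \<psi> (x1, x2) = g (\<psi> (x1, x2) - lam * x2)"
    and bot: "\<exists>c. \<forall>x1. \<psi> (x1, 0) = c" and top: "\<exists>c. \<forall>x1. \<psi> (x1, H) = c"
    and g'_nonneg: "\<And>x1 x2. (x1, x2) \<in> cl_strip H \<Longrightarrow> 0 \<le> deriv g (\<psi> (x1, x2) - lam * x2)"
    and g'_le: "\<And>x1 x2. (x1, x2) \<in> cl_strip H \<Longrightarrow> deriv g (\<psi> (x1, x2) - lam * x2) \<le> Lambda1 L H"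
begin

definition "\<psi>1 = partial (cl_strip H) (1, 0) \<psi>"
definition "\<psi>2 = partial (cl_strip H) (0, 1) \<psi>"
definition "\<psi>11 = partial (cl_strip H) (1, 0) \<psi>1"
definition "\<psi>22 = partial (cl_strip H) (0, 1) \<psi>2"

lemmas \<psi>_D = Ck2_strip[OF \<psi>_C2, folded \<psi>1_def \<psi>2_def, folded \<psi>11_def \<psi>22_def]

definition wb :: "real \<times> real \<Rightarrow> real" where
  "wb z = - laplacian H \<psi> z"

definition \<phi> :: "real \<times> real \<Rightarrow> real" where
  "\<phi> z = \<psi> z - lam * snd z"

lemma wb_eq: "wb z = - (\<psi>11 z + \<psi>22 z)"
  unfolding wb_def by (simp add: \<psi>_D(8))

lemma wb_cont: "continuous_on (cl_strip H) wb"
  unfolding wb_eq[abs_def] by (intro continuous_intros \<psi>_D)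

lemma \<phi>_cont: "continuous_on (cl_strip H) \<phi>"
  unfolding \<phi>_def[abs_def] by (intro continuous_intros \<psi>_D)

lemma \<phi>_periodic: "x1_periodic L H \<phi>"
  using \<psi>_per unfolding x1_periodic_def \<phi>_def by auto

lemma g_deriv: "(g has_real_derivative deriv g x) (at x)"
  using g_C1 unfolding C1_differentiable_on_eq
  by (simp add: DERIV_deriv_iff_real_differentiable)

lemma g_cont: "continuous_on S g"
  using g_deriv by (meson DERIV_continuous_on has_field_derivative_at_within)

lemma wb_g: "z \<in> cl_strip H \<Longrightarrow> wb z = g (\<phi> z)"
proof (rule eq_on_cl_strip[OF H_pos wb_cont])
  show "continuous_on (cl_strip H) (\<lambda>z. g (\<phi> z))"
    by (rule continuous_on_compose2[OF g_cont \<phi>_cont]) auto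
  show "wb z = g (\<phi> z)" if "z \<in> strip H" for z
    using pde[of "fst z" "snd z"] that unfolding wb_def \<phi>_def by simp
qed

definition "\<phi>min = Inf (\<phi> ` K)"
definition "\<phi>max = Sup (\<phi> ` K)"

text \<open>The bounds on \<open>deriv g\<close> are assumed at values of \<phi> only. Since these
  values fill a compact interval, the bounds hold on all of it, which is what the convex dual
  requires.\<close>

lemma \<phi>_range: "\<phi> ` cl_strip H = {\<phi>min..\<phi>max}" "\<phi>min \<le> \<phi>max"
proof -
  have sub: "\<phi> ` cl_strip H = \<phi> ` K"
  proof
    show "\<phi> ` K \<subseteq> \<phi> ` cl_strip H" using K_strip by auto
    show "\<phi> ` cl_strip H \<subseteq> \<phi> ` K"
    proof
      fix t assume "t \<in> \<phi> ` cl_strip H"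
      then obtain x y where xy: "t = \<phi> (x, y)" "y \<in> {0..H}" unfolding cl_strip_def by auto
      obtain n where "x + L * of_int n \<in> {0..L}" by (rule x1_reduce)
      then have "(x + L * of_int n, y) \<in> K" using xy by (simp add: mem_K)
      then show "t \<in> \<phi> ` K" using x1_periodic_shift[OF \<phi>_periodic xy(2), of x n] xy(1) by (metis imageI)
    qed
  qed
  have ne: "\<phi> ` K \<noteq> {}" using L_pos H_pos unfolding K_def by auto
  have comp: "compact (\<phi> ` K)" by (rule compact_continuous_image[OF K_cont[OF \<phi>_cont] compact_K])
  have "connected (\<phi> ` K)"
    by (rule connected_continuous_image[OF K_cont[OF \<phi>_cont]]) (simp add: K_cbox convex_connected)
  then have "\<phi> ` K = {\<phi>min..\<phi>max}"
    unfolding \<phi>min_def \<phi>max_def using comp ne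
    by (metis connected_compact_interval_1 interval_cbox cInf_atLeastAtMost cSup_atLeastAtMost atLeastatMost_empty_iff2)
  then show "\<phi> ` cl_strip H = {\<phi>min..\<phi>max}" "\<phi>min \<le> \<phi>max" using sub ne by auto
qed

lemma g'_range:
  assumes "t \<in> {\<phi>min..\<phi>max}"
  shows "0 \<le> deriv g t" "deriv g t \<le> La1"
proof -
  obtain x y where "t = \<phi> (x, y)" "(x, y) \<in> cl_strip H" using assms \<phi>_range(1) by (metis imageE surj_pair)
  then show "0 \<le> deriv g t" "deriv g t \<le> La1"
    using g'_nonneg[of x y] g'_le[of x y] unfolding \<phi>_def Lambda1_eq by auto
qed

lemma g_lipschitz:
  assumes s: "s \<in> {\<phi>min..\<phi>max}" and t: "t \<in> {\<phi>min..\<phi>max}"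
  shows "(g s - g t) * (s - t) \<le> La1 * (s - t)\<^sup>2"
  using s t
proof (induction s t rule: linorder_wlog)
  case (le s t)
  show ?case
  proof (cases "s = t")
    case False
    then have st: "s < t" using le by simp
    obtain z where z: "s < z" "z < t" "g t - g s = (t - s) * deriv g z"
      using MVT2[OF st, of g "deriv g"] g_deriv by auto
    have "deriv g z \<le> La1" using g'_range(2)[of z] z le by auto
    then have "deriv g z * (s - t)\<^sup>2 \<le> La1 * (s - t)\<^sup>2" by (intro mult_right_mono) auto
    moreover have "g s - g t = deriv g z * (s - t)"
      using z(3) by (simp add: algebra_simps)
    then have "(g s - g t) * (s - t) = deriv g z * (s - t)\<^sup>2"
      by (simp add: power2_eq_square)
    ultimately show ?thesis by simp
  qed simp
next
  case (sym s t)
  then show ?case by (simp add: power2_commute[of t s] algebra_simps)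
qed

lemma \<psi>_pd:
  assumes "y \<in> {0..H}"
  shows "((\<lambda>s. \<psi> (s, y)) has_real_derivative \<psi>1 (x, y)) (at x)"
    "((\<lambda>s. \<psi> (x, s)) has_real_derivative \<psi>2 (x, y)) (at y within {0..H})"
    "((\<lambda>s. \<psi>1 (s, y)) has_real_derivative \<psi>11 (x, y)) (at x)"
    "((\<lambda>s. \<psi>2 (x, s)) has_real_derivative \<psi>22 (x, y)) (at y within {0..H})"
  using partial_strip[OF _ assms] C2_D[OF \<psi>_C2] Basis2
  unfolding \<psi>1_def \<psi>2_def \<psi>11_def \<psi>22_def by blast+

lemma \<psi>_pc: "continuous_on (cl_strip H) \<psi>" "continuous_on (cl_strip H) \<psi>1" "continuous_on (cl_strip H) \<psi>2"
  using C2_D[OF \<psi>_C2] Basis2 unfolding \<psi>1_def \<psi>2_def by blast+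

lemma \<psi>_shift:
  assumes "y \<in> {0..H}"
  shows "\<psi> (x + L, y) = \<psi> (x, y)" "\<psi>1 (x + L, y) = \<psi>1 (x, y)"
proof -
  show "\<psi> (x + L, y) = \<psi> (x, y)" using x1_periodic_shift[OF \<psi>_per assms, of x 1] by simp
  show "\<psi>1 (x + L, y) = \<psi>1 (x, y)"
    by (rule periodic_partial(1)[OF \<psi>_per assms]) (rule \<psi>_pd[OF assms])+
qed

lemma shift_cont: "continuous_on (cl_strip H) f \<Longrightarrow> continuous_on K (\<lambda>z. f (fst z + h, snd z))"
  by (erule continuous_on_compose2) (auto intro!: continuous_intros simp: K_def cl_strip_def)

text \<open>Horizontal translates of \<open>\<phi>\<close> solve the same equation. The difference of two of them vanishes
  on the boundary and has mean zero in \<open>x\<^sub>1\<close>, so it must attain equality in the Poincare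
  inequality; no derivative of the equation is needed.\<close>

lemma translation_difference:
  "\<exists>c d. (La1 < Lb \<longrightarrow> c = 0 \<and> d = 0) \<and> (\<forall>x\<in>{0..L}. \<forall>y\<in>{0..H}. \<psi> (x + h, y) - \<psi> (x, y) = trig1 c d (x, y))"
proof -
  define sh where "sh f z = f (fst z + h, snd z) - f z" for f :: "real \<times> real \<Rightarrow> real" and z
  have shc: "continuous_on (cl_strip H) f \<Longrightarrow> continuous_on K (sh f)" for f
    unfolding sh_def[abs_def] by (intro continuous_intros shift_cont K_cont)
  have der: "((\<lambda>s. sh \<psi> (s, y)) has_real_derivative sh \<psi>1 (x, y)) (at x within {0..L})"
    "((\<lambda>s. sh \<psi>1 (s, y)) has_real_derivative sh \<psi>11 (x, y)) (at x within {0..L})"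
    if y: "y \<in> {0..H}" for x y
  proof -
    show "((\<lambda>s. sh \<psi> (s, y)) has_real_derivative sh \<psi>1 (x, y)) (at x within {0..L})"
      using DERIV_diff[OF _ \<psi>_pd(1)[OF y, of x], of "\<lambda>s. \<psi> (s + h, y)" "\<psi>1 (x + h, y)"]
        DERIV_shift[of "\<lambda>s. \<psi> (s, y)" "\<psi>1 (x + h, y)" x h] \<psi>_pd(1)[OF y, of "x + h"]
      unfolding sh_def by (auto intro: has_field_derivative_at_within)
    show "((\<lambda>s. sh \<psi>1 (s, y)) has_real_derivative sh \<psi>11 (x, y)) (at x within {0..L})"
      using DERIV_diff[OF _ \<psi>_pd(3)[OF y, of x], of "\<lambda>s. \<psi>1 (s + h, y)" "\<psi>11 (x + h, y)"]
        DERIV_shift[of "\<lambda>s. \<psi>1 (s, y)" "\<psi>11 (x + h, y)" x h] \<psi>_pd(3)[OF y, of "x + h"]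
      unfolding sh_def by (auto intro: has_field_derivative_at_within)
  qed
  have D1: "D1 (sh \<psi>) (sh \<psi>1)" "D1 (sh \<psi>1) (sh \<psi>11)"
    unfolding D1_def using der shc \<psi>_pc \<psi>_D(6) by blast+
  have D2: "D2 (sh \<psi>) (sh \<psi>2)" "D2 (sh \<psi>2) (sh \<psi>22)"
    unfolding D2_def sh_def fst_conv snd_conv
    using shc[unfolded sh_def[abs_def]] \<psi>_pc \<psi>_D(7) DERIV_diff[OF \<psi>_pd(2) \<psi>_pd(2)] DERIV_diff[OF \<psi>_pd(4) \<psi>_pd(4)]
    by blast+
  have per: "sh \<psi> (0, y) = sh \<psi> (L, y)" "sh \<psi>1 (0, y) = sh \<psi>1 (L, y)" if "y \<in> {0..H}" for y
    unfolding sh_def using \<psi>_shift[OF that, of 0] \<psi>_shift[OF that, of h] by (auto simp: add.commute)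
  have bd: "sh \<psi> (x, 0) = 0" "sh \<psi> (x, H) = 0" for x
    unfolding sh_def using bot top by auto
  have mean: "integral {0..L} (\<lambda>x. sh \<psi> (x, y)) = 0" if y: "y \<in> {0..H}" for y
  proof -
    have c1: "continuous_on UNIV (\<lambda>x. \<psi>1 (x, y))" "continuous_on UNIV (\<lambda>x. \<psi> (x, y))"
      using y by (auto intro!: continuous_on_compose2[OF \<psi>_pc(2)] continuous_on_compose2[OF \<psi>_pc(1)] continuous_intros simp: cl_strip_def)
    have "integral {0..L} (\<lambda>x. sh \<psi> (x, y)) = integral {0..L} (\<lambda>x. \<psi> (x + h, y)) - integral {0..L} (\<lambda>x. \<psi> (x, y))"
      unfolding sh_def fst_conv snd_conv
      by (intro Henstock_Kurzweil_Integration.integral_diff integrable_continuous_interval continuous_on_compose2[OF c1(2)] continuous_intros) auto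
    also have "integral {0..L} (\<lambda>x. \<psi> (x + h, y)) = integral {0..L} (\<lambda>x. \<psi> (x, y))"
      by (rule integral_periodic_shift[OF \<psi>_pd(1)[OF y] c1(1) \<psi>_shift(1)[OF y]])
    finally show ?thesis by simp
  qed
  note c = shc[OF \<psi>_pc(1)] shc[OF \<psi>_pc(2)] shc[OF \<psi>_pc(3)]
  have "Energy (sh \<psi>1) (sh \<psi>2) = I (\<lambda>z. sh \<psi>1 z * sh \<psi>1 z + sh \<psi>2 z * sh \<psi>2 z)"
    unfolding Energy_def using c by (subst I_add) (auto intro!: continuous_intros simp: power2_eq_square)
  also have "\<dots> = I (\<lambda>z. sh \<psi> z * - (sh \<psi>11 z + sh \<psi>22 z))"
    by (rule Green[OF D1(1) D2(1) D1(2) D2(2)]) (use per bd in auto)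
  also have "\<dots> \<le> I (\<lambda>z. La1 * (sh \<psi> z)\<^sup>2)"
  proof (rule I_mono)
    fix z assume "z \<in> K"
    then obtain x y where xy: "z = (x, y)" "y \<in> {0..H}" unfolding K_def by auto
    have m: "(x + h, y) \<in> cl_strip H" "(x, y) \<in> cl_strip H" using xy by (auto simp: cl_strip_def)
    then have r: "\<phi> (x + h, y) \<in> {\<phi>min..\<phi>max}" "\<phi> (x, y) \<in> {\<phi>min..\<phi>max}" using \<phi>_range(1) by blast+
    have "sh \<psi> z * - (sh \<psi>11 z + sh \<psi>22 z) = (\<phi> (x + h, y) - \<phi> (x, y)) * (wb (x + h, y) - wb (x, y))"
      unfolding wb_eq sh_def \<phi>_def xy by (simp add: algebra_simps)
    also have "\<dots> \<le> La1 * (\<phi> (x + h, y) - \<phi> (x, y))\<^sup>2"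
      using g_lipschitz[OF r] unfolding wb_g[OF m(1)] wb_g[OF m(2)] by (simp add: mult.commute)
    also have "\<dots> = La1 * (sh \<psi> z)\<^sup>2" unfolding sh_def \<phi>_def xy by simp
    finally show "sh \<psi> z * - (sh \<psi>11 z + sh \<psi>22 z) \<le> La1 * (sh \<psi> z)\<^sup>2" .
  qed (intro continuous_intros c shc \<psi>_D)+
  finally have E: "Energy (sh \<psi>1) (sh \<psi>2) \<le> La1 * I (\<lambda>z. (sh \<psi> z)\<^sup>2)" unfolding I_cmult .
  \<comment> \<open>The difference has mean zero on every horizontal line, so only the modes
    depending on x_1 can occur.\<close>
  obtain c0 d0 where cd: "I (\<lambda>z. (sh \<psi> z - trig1 c0 d0 z)\<^sup>2) \<le> Cgap * (Energy (sh \<psi>1) (sh \<psi>2) - Lb * I (\<lambda>z. (sh \<psi> z)\<^sup>2))"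
    using Poincare_mean_zero[OF D1(1) D2(1) per(1) bd mean] unfolding Energy_def by auto
  have V0: "0 \<le> I (\<lambda>z. (sh \<psi> z)\<^sup>2)" by (intro I_nonneg continuous_intros c) simp
  define c where "c = (if La1 < Lb then 0 else c0)"
  define d where "d = (if La1 < Lb then 0 else d0)"
  have vT: "I (\<lambda>z. (sh \<psi> z - trig1 c d z)\<^sup>2) = (if La1 < Lb then I (\<lambda>z. (sh \<psi> z)\<^sup>2) else I (\<lambda>z. (sh \<psi> z - trig1 c0 d0 z)\<^sup>2))"
    unfolding c_def d_def by (simp add: trig1_def)
  have "I (\<lambda>z. (sh \<psi> z - trig1 c d z)\<^sup>2)
     \<le> (Cgap + (if La1 < Lb then 1 / (Lb - La1) else 0)) * (Energy (sh \<psi>1) (sh \<psi>2) - La1 * I (\<lambda>z. (sh \<psi> z)\<^sup>2))"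
    by (rule bound_cases(1)[OF cd _ Cgap_pos V0 _ vT order_refl])
      (auto simp: La1_def intro!: I_nonneg continuous_intros shc \<psi>_pc trig_cont)
  also have "\<dots> \<le> 0"
    using E Cgap_pos by (intro mult_nonneg_nonpos) auto
  finally have 0: "I (\<lambda>z. (sh \<psi> z - trig1 c d z)\<^sup>2) \<le> 0" .
  have "sh \<psi> z = trig1 c d z" if "z \<in> K" for z
  proof -
    have "continuous_on K (\<lambda>z. (sh \<psi> z - trig1 c d z)\<^sup>2)"
      by (intro continuous_intros shc \<psi>_pc trig_cont)
    from I_zero_imp[OF this _ 0 that] show ?thesis by simp
  qed
  then show ?thesis
    by (intro exI[of _ c] exI[of _ d]) (auto simp: sh_def mem_K c_def d_def)
qed

text \<open>Averaging the translation identity over \<open>h\<close> in a period turns its left side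
  into \<open>havg \<psi> y - \<psi> (x, y)\<close>; thus \<open>c\<close> and \<open>d\<close> are
  minus the averages of the coefficients \<open>C\<close> and \<open>D\<close>. These are integrable
  because evaluation at the points (0, H/2) and (L/4, H/2) expresses them continuously through
  \<psi>.\<close>

lemma decomposition:
  "\<exists>c d. (La1 < Lb \<longrightarrow> c = 0 \<and> d = 0) \<and> (\<forall>x. \<forall>y\<in>{0..H}. \<psi> (x, y) = trig1 c d (x, y) + havg \<psi> y)"
proof -
  have "\<forall>h. \<exists>c d. (La1 < Lb \<longrightarrow> c = 0 \<and> d = 0) \<and> (\<forall>x\<in>{0..L}. \<forall>y\<in>{0..H}. \<psi> (x + h, y) - \<psi> (x, y) = trig1 c d (x, y))"
    using translation_difference by blast
  then obtain C D where CD: "\<And>h. La1 < Lb \<Longrightarrow> C h = 0 \<and> D h = 0"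
    "\<And>h x y. x \<in> {0..L} \<Longrightarrow> y \<in> {0..H} \<Longrightarrow> \<psi> (x + h, y) - \<psi> (x, y) = trig1 (C h) (D h) (x, y)"
    by metis
  have H2: "H / 2 \<in> {0..H}" and L4: "0 \<in> {0..L}" "L / 4 \<in> {0..L}" using L_pos H_pos by auto
  have kL4: "k1 * (L / 4) = pi / 2" using k_mult(1) by (simp add: field_simps)
  have Ch: "C h = \<psi> (0 + h, H / 2) - \<psi> (0, H / 2)" for h
    using CD(2)[OF L4(1) H2, of h] k_mult unfolding trig1_def by simp
  have Dh: "D h = \<psi> (L / 4 + h, H / 2) - \<psi> (L / 4, H / 2)" for h
    using CD(2)[OF L4(2) H2, of h] k_mult unfolding trig1_def fst_conv snd_conv kL4 by simp
  have \<psi>c: "continuous_on A (\<lambda>h. \<psi> (x + h, y))" if "y \<in> {0..H}" for A x y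
    using that by (intro continuous_on_compose2[OF \<psi>_pc(1)] continuous_intros) (auto simp: cl_strip_def)
  have Cc: "continuous_on {0..L} C" and Dc: "continuous_on {0..L} D"
    unfolding Ch[abs_def] Dh[abs_def] by (intro continuous_intros \<psi>c H2)+
  define c where "c = - integral {0..L} C / L"
  define d where "d = - integral {0..L} D / L"
  have K: "\<psi> (x, y) = trig1 c d (x, y) + havg \<psi> y" if x: "x \<in> {0..L}" and y: "y \<in> {0..H}" for x y
  proof -
    have c1: "continuous_on UNIV (\<lambda>x. \<psi>1 (x, y))"
      using y by (auto intro!: continuous_on_compose2[OF \<psi>_pc(2)] continuous_intros simp: cl_strip_def)
    have "integral {0..L} (\<lambda>h. \<psi> (h + x, y)) = integral {0..L} (\<lambda>x. \<psi> (x, y))"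
      by (rule integral_periodic_shift[OF \<psi>_pd(1)[OF y] c1 \<psi>_shift(1)[OF y]])
    then have "L * havg \<psi> y = integral {0..L} (\<lambda>h. \<psi> (x + h, y))"
      unfolding havg_def using L_pos by (simp add: add.commute)
    also have "\<dots> = integral {0..L} (\<lambda>h. \<psi> (x, y) + (cos (k1 * x) * sin (k2 * y)) * C h + (sin (k1 * x) * sin (k2 * y)) * D h)"
      using CD(2)[OF x y] unfolding trig1_def by (auto intro!: Henstock_Kurzweil_Integration.integral_cong simp: algebra_simps)
    also have "\<dots> = L * \<psi> (x, y) + (cos (k1 * x) * sin (k2 * y)) * integral {0..L} C + (sin (k1 * x) * sin (k2 * y)) * integral {0..L} D"
      using has_integral_const_real[of "\<psi> (x, y)" 0 L] L_pos
      by (intro integral_unique has_integral_add has_integral_mult_right integrable_integral integrable_continuous_interval Cc Dc) simp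
    also have "\<dots> = L * \<psi> (x, y) - L * trig1 c d (x, y)"
      unfolding trig1_def c_def d_def using L_pos by (simp add: algebra_simps)
    finally have "L * havg \<psi> y = L * (\<psi> (x, y) - trig1 c d (x, y))" by (simp add: algebra_simps)
    then show ?thesis using L_pos by simp
  qed
  have tper: "x1_periodic L H (trig1 c d)"
    using trig1_periodic unfolding x1_periodic_def by auto
  have "\<psi> (x, y) = trig1 c d (x, y) + havg \<psi> y" if y: "y \<in> {0..H}" for x y
  proof -
    obtain n where n: "x + L * of_int n \<in> {0..L}" by (rule x1_reduce)
    show ?thesis
      using K[OF n y] x1_periodic_shift[OF \<psi>_per y, of x n] x1_periodic_shift[OF tper y, of x n] by simp
  qed
  moreover have "La1 < Lb \<longrightarrow> c = 0 \<and> d = 0"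
  proof
    assume "La1 < Lb"
    then have "C = (\<lambda>h. 0)" "D = (\<lambda>h. 0)" using CD(1) by auto
    then show "c = 0 \<and> d = 0" unfolding c_def d_def by simp
  qed
  ultimately show ?thesis by blast
qed

text \<open>Instead of differentiating \<open>havg \<psi>\<close> twice, the proof uses that \<psi>
  minus its trigonometric part does not depend on x_1: uniqueness of derivatives shows the same for
  the x_2-derivatives, so \<open>ws\<close> can be read off at x_1 = 0. The eigenvalue
  \<open>Lb\<close> multiplies the trigonometric coefficients.\<close>

lemma wb_decomposition:
  "\<exists>c d ws. (La1 < Lb \<longrightarrow> c = 0 \<and> d = 0) \<and> continuous_on {0..H} ws \<and>
     (\<forall>x. \<forall>y\<in>{0..H}. wb (x, y) = trig1 c d (x, y) + ws y)"
proof -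
  obtain c d where cd: "La1 < Lb \<longrightarrow> c = 0 \<and> d = 0"
    "\<And>x y. y \<in> {0..H} \<Longrightarrow> \<psi> (x, y) = trig1 c d (x, y) + havg \<psi> y"
    using decomposition by blast
  define F where "F = Fam k1 k2"
  have F: "trig1 c d = F c d 1 0" unfolding trig_Fam F_def ..
  have x11: "\<psi>11 (x, y) = - (k1\<^sup>2 * trig1 c d (x, y))" if y: "y \<in> {0..H}" for x y
  proof -
    have "((\<lambda>s. F c d 1 0 (s, y) + havg \<psi> y) has_real_derivative F (k1 * d) (- (k1 * c)) 1 0 (x, y)) (at x)" for x
      using DERIV_add[OF Fam_deriv(1)[of k1 k2 c d 1 0 y x] DERIV_const[of "havg \<psi> y"]] unfolding F_def by simp
    then have "\<psi>1 (x, y) = F (k1 * d) (- (k1 * c)) 1 0 (x, y)" for x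
      using DERIV_unique[OF \<psi>_pd(1)[OF y, of x]] cd(2)[OF y] unfolding F by simp
    then have "\<psi>11 (x, y) = F (k1 * (- (k1 * c))) (- (k1 * (k1 * d))) 1 0 (x, y)"
      using DERIV_unique[OF \<psi>_pd(3)[OF y, of x]] Fam_deriv(1)[of k1 k2 "k1 * d" "- (k1 * c)" 1 0 y x] unfolding F_def by simp
    then show ?thesis unfolding F F_def Fam_def by (simp add: algebra_simps power2_eq_square)
  qed
  have x22: "\<psi>22 (x, y) + k2\<^sup>2 * trig1 c d (x, y) = \<psi>22 (0, y) + k2\<^sup>2 * trig1 c d (0, y)" if y: "y \<in> {0..H}" for x y
  proof -
    have 1: "\<psi>2 (x, y) - F c d 0 k2 (x, y) = \<psi>2 (0, y) - F c d 0 k2 (0, y)" if y: "y \<in> {0..H}" for y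
    proof (rule DERIV_within_unique[OF _ _ y])
      have *: "((\<lambda>s. \<psi> (x, s) - F c d 1 0 (x, s)) has_real_derivative \<psi>2 (x, y) - F c d 0 k2 (x, y)) (at y within {0..H})" for x
        using DERIV_diff[OF \<psi>_pd(2)[OF y, of x] Fam_deriv(2)[of k1 k2 c d 1 0 x y]] unfolding F_def by simp
      show "((\<lambda>s. \<psi> (x, s) - F c d 1 0 (x, s)) has_real_derivative \<psi>2 (x, y) - F c d 0 k2 (x, y)) (at y within {0..H})"
        by (rule *)
      show "((\<lambda>s. \<psi> (x, s) - F c d 1 0 (x, s)) has_real_derivative \<psi>2 (0, y) - F c d 0 k2 (0, y)) (at y within {0..H})"
        unfolding has_real_derivative_iff_has_vector_derivative
        by (rule has_vector_derivative_transform[OF y _ *[of 0, unfolded has_real_derivative_iff_has_vector_derivative]])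
          (use cd(2) in \<open>auto simp: F\<close>)
    qed
    have "\<psi>22 (x, y) - F c d (- (k2 * k2)) 0 (x, y) = \<psi>22 (0, y) - F c d (- (k2 * k2)) 0 (0, y)"
    proof (rule DERIV_within_unique[OF _ _ y])
      have *: "((\<lambda>s. \<psi>2 (x, s) - F c d 0 k2 (x, s)) has_real_derivative \<psi>22 (x, y) - F c d (- (k2 * k2)) 0 (x, y)) (at y within {0..H})" for x
        using DERIV_diff[OF \<psi>_pd(4)[OF y, of x] Fam_deriv(2)[of k1 k2 c d 0 k2 x y]] unfolding F_def by simp
      show "((\<lambda>s. \<psi>2 (x, s) - F c d 0 k2 (x, s)) has_real_derivative \<psi>22 (x, y) - F c d (- (k2 * k2)) 0 (x, y)) (at y within {0..H})"
        by (rule *)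
      show "((\<lambda>s. \<psi>2 (x, s) - F c d 0 k2 (x, s)) has_real_derivative \<psi>22 (0, y) - F c d (- (k2 * k2)) 0 (0, y)) (at y within {0..H})"
        unfolding has_real_derivative_iff_has_vector_derivative
        by (rule has_vector_derivative_transform[OF y _ *[of 0, unfolded has_real_derivative_iff_has_vector_derivative]])
          (use 1 in auto)
    qed
    then show ?thesis unfolding F F_def Fam_def by (simp add: power2_eq_square algebra_simps)
  qed
  define ws where "ws y = wb (0, y) - trig1 (Lb * c) (Lb * d) (0, y)" for y
  have "continuous_on {0..H} ws"
    unfolding ws_def using L_pos
    by (intro continuous_intros slice2[OF K_cont[OF wb_cont]] slice2[OF trig_cont(1)]) auto
  moreover have "wb (x, y) = trig1 (Lb * c) (Lb * d) (x, y) + ws y" if y: "y \<in> {0..H}" for x y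
  proof -
    have s: "trig1 (Lb * c) (Lb * d) z = (k1\<^sup>2 + k2\<^sup>2) * trig1 c d z" for z
      unfolding trig1_def Lb_def by (simp add: algebra_simps)
    show ?thesis unfolding ws_def wb_eq s using x11[OF y, of x] x11[OF y, of 0] x22[OF y, of x]
      by (simp add: algebra_simps)
  qed
  ultimately show ?thesis using cd(1) by (intro exI[of _ "Lb * c"] exI[of _ "Lb * d"] exI[of _ ws]) auto
qed

theorem part_i: "\<exists>\<psi>e\<in>E1 L H. \<exists>\<psi>s :: real \<Rightarrow> real. \<forall>(x1, x2)\<in>cl_strip H. \<psi> (x1, x2) = \<psi>e (x1, x2) + \<psi>s x2"
proof -
  obtain c d where cd: "La1 < Lb \<longrightarrow> c = 0 \<and> d = 0"
    "\<And>x y. y \<in> {0..H} \<Longrightarrow> \<psi> (x, y) = trig1 c d (x, y) + havg \<psi> y"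
    using decomposition by blast
  have "trig1 c d \<in> E1 L H"
  proof (cases "La1 < Lb")
    case True
    then have "La1 = La" unfolding La1_def by auto
    moreover have "trig1 c d = trig2 0 0" using cd(1) True unfolding trig1_def[abs_def] trig2_def[abs_def] by simp
    ultimately show ?thesis using trig_eigen(2)[of 0 0] unfolding E1_def Lambda1_eq by simp
  next
    case False
    then have "La1 = Lb" unfolding La1_def by auto
    then show ?thesis using trig_eigen(1) unfolding E1_def Lambda1_eq by simp
  qed
  then show ?thesis using cd(2) by (intro bexI[of _ "trig1 c d"] exI[of _ "havg \<psi>"]) (auto simp: cl_strip_def)
qed

end

section \<open>The stream function of an Euler flow\<close>

context channel
begin

text \<open>Bounded partial derivatives give a joint Lipschitz bound. The stream function is built
  as an integral in x_2, and this is how its joint continuity is obtained.\<close>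

lemma continuous_on_partials:
  assumes c: "continuous_on K u1" "continuous_on K u2"
    and d1: "\<And>x y. x \<in> {0..L} \<Longrightarrow> y \<in> {0..H} \<Longrightarrow> ((\<lambda>s. u (s, y)) has_real_derivative u1 (x, y)) (at x within {0..L})"
    and d2: "\<And>x y. x \<in> {0..L} \<Longrightarrow> y \<in> {0..H} \<Longrightarrow> ((\<lambda>s. u (x, s)) has_real_derivative u2 (x, y)) (at y within {0..H})"
  shows "continuous_on K u"
proof -
  obtain M1 where M1: "\<And>z. z \<in> K \<Longrightarrow> norm (u1 z) \<le> M1"
    using compact_imp_bounded[OF compact_continuous_image[OF c(1) compact_K]] by (auto simp: bounded_iff)
  obtain M2 where M2: "\<And>z. z \<in> K \<Longrightarrow> norm (u2 z) \<le> M2"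
    using compact_imp_bounded[OF compact_continuous_image[OF c(2) compact_K]] by (auto simp: bounded_iff)
  define M where "M = \<bar>M1\<bar> + \<bar>M2\<bar>"
  have "M-lipschitz_on K u"
  proof (rule lipschitz_onI)
    fix z z' assume z: "z \<in> K" "z' \<in> K"
    obtain x y x' y' where e: "z = (x, y)" "z' = (x', y')" by (cases z, cases z')
    have m: "x \<in> {0..L}" "y \<in> {0..H}" "x' \<in> {0..L}" "y' \<in> {0..H}" using z unfolding e mem_K by auto
    have "norm (u (x, y) - u (x', y)) \<le> \<bar>M1\<bar> * norm (x - x')"
      by (rule field_differentiable_bound[of "{0..L}" "\<lambda>s. u (s, y)" "\<lambda>s. u1 (s, y)"])
        (use m d1 M1 in \<open>auto simp: mem_K intro: order_trans[OF _ abs_ge_self]\<close>)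
    moreover have "norm (u (x', y) - u (x', y')) \<le> \<bar>M2\<bar> * norm (y - y')"
      by (rule field_differentiable_bound[of "{0..H}" "\<lambda>s. u (x', s)" "\<lambda>s. u2 (x', s)"])
        (use m d2 M2 in \<open>auto simp: mem_K intro: order_trans[OF _ abs_ge_self]\<close>)
    moreover have "norm (x - x') \<le> dist z z'" "norm (y - y') \<le> dist z z'"
      using dist_fst_le[of z z'] dist_snd_le[of z z'] unfolding e by (auto simp: dist_real_def)
    then have "\<bar>M1\<bar> * norm (x - x') + \<bar>M2\<bar> * norm (y - y') \<le> M * dist z z'"
      unfolding M_def distrib_right by (intro add_mono mult_left_mono) auto
    ultimately show "dist (u z) (u z') \<le> M * dist z z'" unfolding e dist_real_def real_norm_def by linarith
  qed (simp add: M_def)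
  then show ?thesis by (rule lipschitz_on_continuous_on)
qed

end

context euler
begin

definition stream :: "real \<Rightarrow> real \<times> real \<Rightarrow> real" where
  "stream t z = integral {0..snd z} (\<lambda>s. v1 (t, fst z, s))"

lemma stream_d1:
  assumes y: "y \<in> {0..H}"
  shows "((\<lambda>s. stream t (s, y)) has_real_derivative - v2 (t, x, y)) (at x)"
proof -
  have sub: "{0..y} \<subseteq> {0..H}" using y by auto
  have "((\<lambda>x. integral (cbox 0 y) (\<lambda>s. v1 (t, x, s))) has_real_derivative integral (cbox 0 y) (\<lambda>s. dx1 H v1 (t, x, s))) (at x within UNIV)"
  proof (rule leibniz_rule_field_derivative)
    show "((\<lambda>x. v1 (t, x, s)) has_real_derivative dx1 H v1 (t, x, s)) (at x within UNIV)" if "s \<in> cbox 0 y" for x s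
      using partial_spacetime(2)[OF v1_c(1), of s t x] that y by auto
    show "(\<lambda>s. v1 (t, x, s)) integrable_on cbox 0 y" for x
      unfolding box_real by (intro integrable_continuous_interval continuous_on_subset[OF spacetime_slices(4)[OF v1_c(2)] sub])
    show "continuous_on (UNIV \<times> cbox 0 y) (\<lambda>(x, s). dx1 H v1 (t, x, s))"
      by (rule continuous_on_subset[OF spacetime_slices(1)[OF v1_c(6)]]) (use sub in auto)
  qed auto
  moreover have "integral {0..y} (\<lambda>s. dx1 H v1 (t, x, s)) = - v2 (t, x, y) - - v2 (t, x, 0)"
  proof (rule FTC_continuous)
    fix s assume "s \<in> {0..y}"
    then have s: "s \<in> {0..H}" using sub by auto
    show "((\<lambda>s. - v2 (t, x, s)) has_real_derivative dx1 H v1 (t, x, s)) (at s within {0..y})"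
      using DERIV_minus[OF partial_spacetime(3)[OF v2_c(1) s, of t x]] div_free[OF s] sub
      by (auto intro: has_field_derivative_subset)
  qed (use y in auto)
  ultimately show ?thesis unfolding stream_def by (simp add: v2_boundary)
qed

lemma stream_d2:
  assumes y: "y \<in> {0..H}"
  shows "((\<lambda>s. stream t (x, s)) has_real_derivative v1 (t, x, y)) (at y within {0..H})"
  unfolding stream_def fst_conv snd_conv has_real_derivative_iff_has_vector_derivative
  by (rule integral_has_vector_derivative[OF spacetime_slices(4)[OF v1_c(2)] y])

lemma stream_D: "D1 (stream t) (\<lambda>z. - v2 (t, z))" "D2 (stream t) (\<lambda>z. v1 (t, z))"
proof -
  have c: "continuous_on K (\<lambda>z. - v2 (t, z))" "continuous_on K (\<lambda>z. v1 (t, z))"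
    using D_cont(1)[OF v_D(3)] D_cont(1)[OF v_D(1)] by (auto intro!: continuous_intros)
  have d: "((\<lambda>s. stream t (s, y)) has_real_derivative - v2 (t, x, y)) (at x within {0..L})" if "y \<in> {0..H}" for x y
    by (rule has_field_derivative_at_within[OF stream_d1[OF that]])
  have "continuous_on K (stream t)"
    by (rule continuous_on_partials[OF c d stream_d2])
  then show "D1 (stream t) (\<lambda>z. - v2 (t, z))" "D2 (stream t) (\<lambda>z. v1 (t, z))"
    unfolding D1_def D2_def using c d stream_d2 by auto
qed

lemma stream_periodic: "y \<in> {0..H} \<Longrightarrow> stream t (0, y) = stream t (L, y)"
  unfolding stream_def by (auto intro!: Henstock_Kurzweil_Integration.integral_cong simp: periodic0)

definition flux :: real where "flux = I (\<lambda>z. v1 (0, z)) / L"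

text \<open>The value does not depend on \<open>x\<close> because v2 vanishes on the wall, nor on
  \<open>t\<close> because the total momentum is conserved.\<close>

lemma flux: "stream t (x, H) = flux"
proof -
  have Hm: "H \<in> {0..H}" using H_pos by simp
  have "\<And>x. ((\<lambda>s. stream t (s, H)) has_real_derivative 0) (at x)"
    using stream_d1[OF Hm, of t] by (simp add: v2_boundary)
  then have c: "stream t (x, H) = stream t (y, H)" for x y
    using DERIV_isconst_all[of "\<lambda>s. stream t (s, H)" x y] by blast
  have "I (\<lambda>z. v1 (t, z)) = integral {0..L} (\<lambda>x. stream t (x, H))"
    unfolding stream_def by (subst I_iterated[OF D_cont(1)[OF v_D(1)]]) simp
  also have "\<dots> = integral {0..L} (\<lambda>s. stream t (x, H))"
    by (rule Henstock_Kurzweil_Integration.integral_cong) (rule c)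
  also have "\<dots> = L * stream t (x, H)" using L_pos by simp
  finally show ?thesis unfolding flux_def momentum_conserved[of t, symmetric] using L_pos by simp
qed

lemma stream_time_cont:
  assumes y: "y \<in> {0..H}"
  shows "continuous_on UNIV (\<lambda>t. integral {0..L} (\<lambda>x. stream t (x, y)))"
proof -
  have "continuous_on (UNIV \<times> cbox 0 y) (\<lambda>(p, s). v1 (fst p, snd p, s))"
    unfolding split_def
    by (rule continuous_on_compose2[OF v1_c(2)]) (use y in \<open>auto intro!: continuous_intros simp: mem_S\<close>)
  from integral_continuous_on_param[OF this]
  have c: "continuous_on UNIV (\<lambda>p. stream (fst p) (snd p, y))" unfolding stream_def by simp
  have "continuous_on (UNIV \<times> cbox 0 L) (\<lambda>(t, x). stream t (x, y))"
    using continuous_on_subset[OF c, of "UNIV \<times> cbox 0 L"] by (simp add: split_def)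
  from integral_continuous_on_param[OF this] show ?thesis by simp
qed

end

section \<open>The perturbation of the steady flow and its invariants\<close>

locale steady_euler = steady L H lam \<psi> g + euler L H v1 v2 P
  for L H lam :: real and \<psi> :: "real \<times> real \<Rightarrow> real" and g :: "real \<Rightarrow> real"
    and v1 v2 P :: "real \<times> real \<times> real \<Rightarrow> real"
begin

definition "\<phi>b = \<phi> (0, 0)"
definition "\<phi>t = \<phi> (0, H)"
definition "\<kappa> = (flux - (\<phi>t - \<phi>b)) / H"
definition "\<phi>2 z = \<psi>2 z - lam"

lemma \<phi>_D: "D1 \<phi> \<psi>1" "D2 \<phi> \<phi>2" "D2 \<phi>2 \<psi>22"
proof -
  have "D1 (\<lambda>z. lam * snd z) (\<lambda>z. 0)" "D2 (\<lambda>z. lam * snd z) (\<lambda>z. lam)" "D2 (\<lambda>z. lam) (\<lambda>z. 0)"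
    unfolding D1_def D2_def by (auto intro!: continuous_intros derivative_eq_intros)
  from D1_diff[OF \<psi>_D(1) this(1)] D2_diff[OF \<psi>_D(2) this(2)] D2_diff[OF \<psi>_D(4) this(3)]
  show "D1 \<phi> \<psi>1" "D2 \<phi> \<phi>2" "D2 \<phi>2 \<psi>22" unfolding \<phi>_def[abs_def] \<phi>2_def[abs_def] by auto
qed

lemma \<phi>_boundary: "\<phi> (x, 0) = \<phi>b" "\<phi> (x, H) = \<phi>t"
  using bot top unfolding \<phi>_def \<phi>b_def \<phi>t_def by auto

text \<open>The velocity perturbation, seen in the frame moving with speed \<open>\<kappa>\<close>, in which its flux vanishes.\<close>

definition chi :: "real \<Rightarrow> real \<times> real \<Rightarrow> real" where
  "chi t z = stream t z - \<kappa> * snd z - (\<phi> z - \<phi>b)"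

definition "chi1 t z = - v2 (t, z) - \<psi>1 z"
definition "chi2 t z = v1 (t, z) - \<kappa> - \<phi>2 z"

definition zeta :: "real \<Rightarrow> real \<times> real \<Rightarrow> real" where
  "zeta t z = w (t, z) - wb z"

lemma chi_D:
  "D1 (chi t) (chi1 t)" "D2 (chi t) (chi2 t)"
  "D1 (chi1 t) (\<lambda>z. - dx1 H v2 (t, z) - \<psi>11 z)" "D2 (chi2 t) (\<lambda>z. dx2 H v1 (t, z) - \<psi>22 z)"
proof -
  have a: "D1 (\<lambda>z. \<kappa> * snd z) (\<lambda>z. 0)" "D2 (\<lambda>z. \<kappa> * snd z) (\<lambda>z. \<kappa>)" "D2 (\<lambda>z. \<kappa>) (\<lambda>z. 0)"
    "D1 (\<lambda>z. \<phi>b) (\<lambda>z. 0)" "D2 (\<lambda>z. \<phi>b) (\<lambda>z. 0)"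
    unfolding D1_def D2_def by (auto intro!: continuous_intros derivative_eq_intros)
  show "D1 (chi t) (chi1 t)" "D2 (chi t) (chi2 t)"
    unfolding chi_def[abs_def] chi1_def[abs_def] chi2_def[abs_def]
    using D1_diff[OF D1_diff[OF stream_D(1) a(1)] D1_diff[OF \<phi>_D(1) a(4)]]
      D2_diff[OF D2_diff[OF stream_D(2) a(2)] D2_diff[OF \<phi>_D(2) a(5)]] by simp_all
  show "D1 (chi1 t) (\<lambda>z. - dx1 H v2 (t, z) - \<psi>11 z)"
    unfolding chi1_def[abs_def] by (rule D1_diff[OF D1_uminus[OF v_D(3)] \<psi>_D(3)])
  show "D2 (chi2 t) (\<lambda>z. dx2 H v1 (t, z) - \<psi>22 z)"
    unfolding chi2_def[abs_def] using D2_diff[OF D2_diff[OF v_D(2) a(3)] \<phi>_D(3)] by simp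
qed

lemma \<phi>_periodic0: "y \<in> {0..H} \<Longrightarrow> \<phi> (0, y) = \<phi> (L, y)"
  using x1_periodic_shift[OF \<phi>_periodic, of y 0 1] by simp

lemma chi_Dirichlet: "Dirichlet (chi t) (chi1 t) (chi2 t)"
  unfolding Dirichlet_def
proof (intro conjI ballI chi_D)
  show "chi t (0, y) = chi t (L, y)" if "y \<in> {0..H}" for y
    unfolding chi_def using stream_periodic[OF that] \<phi>_periodic0[OF that] by simp
  show "chi t (x, 0) = 0" for x
    unfolding chi_def by (simp add: \<phi>_boundary stream_def)
  show "chi t (x, H) = 0" for x
    unfolding chi_def using H_pos by (simp add: \<phi>_boundary flux \<kappa>_def)
qed

lemma chi1_periodic: "y \<in> {0..H} \<Longrightarrow> chi1 t (0, y) = chi1 t (L, y)"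
  unfolding chi1_def using \<psi>_D(9)[OF \<psi>_per] periodic0 by auto

lemma zeta_laplacian: "- ((- dx1 H v2 (t, z) - \<psi>11 z) + (dx2 H v1 (t, z) - \<psi>22 z)) = zeta t z"
  unfolding zeta_def wb_eq w_def by simp

lemma zeta_cont: "continuous_on K (zeta t)"
  unfolding zeta_def[abs_def] by (intro continuous_intros K_cont_time w_c K_cont wb_cont)

lemma chi_cont: "continuous_on K (chi t)" "continuous_on K (chi1 t)" "continuous_on K (chi2 t)"
  using DirichletD(6,7,8)[OF chi_Dirichlet] .

lemma Energy_chi: "Energy (chi1 t) (chi2 t) = I (\<lambda>z. chi t z * zeta t z)"
proof -
  note d = DirichletD[OF chi_Dirichlet[of t]]
  have "Energy (chi1 t) (chi2 t) = I (\<lambda>z. chi1 t z * chi1 t z + chi2 t z * chi2 t z)"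
    unfolding Energy_def using chi_cont by (subst I_add) (auto intro!: continuous_intros simp: power2_eq_square)
  also have "\<dots> = I (\<lambda>z. chi t z * - ((- dx1 H v2 (t, z) - \<psi>11 z) + (dx2 H v1 (t, z) - \<psi>22 z)))"
    by (rule Green[OF d(1,2) chi_D(3,4) d(3) chi1_periodic d(4,5)])
  finally show ?thesis unfolding zeta_laplacian .
qed

lemma zeta_mean_conserved: "I (zeta t) = I (zeta 0)"
proof -
  have "I (zeta t) = I (\<lambda>z. w (t, z)) - I wb" for t
    unfolding zeta_def[abs_def] by (rule I_diff) (intro K_cont_time w_c K_cont wb_cont)+
  then show ?thesis using vorticity_power_conserved[of t 1] by simp
qed

lemma zeta_impulse_conserved: "I (\<lambda>z. snd z * zeta t z) = I (\<lambda>z. snd z * zeta 0 z)"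
proof -
  have "I (\<lambda>z. snd z * zeta t z) = I (\<lambda>z. snd z * w (t, z)) - I (\<lambda>z. snd z * wb z)" for t
    unfolding zeta_def right_diff_distrib by (rule I_diff) (intro continuous_intros K_cont_time w_c K_cont wb_cont)+
  then show ?thesis using impulse_conserved[of t] by simp
qed

text \<open>The kinetic energy relative to speed \<kappa> is a combination of energy and momentum,
  hence conserved. In its expansion the cross term is integrated by parts against \<open>V\<close>,
  which is \<phi> minus the linear interpolation of its wall values. The linear part pairs
  \<open>zeta\<close> only with 1 and x_2, that is with the conserved mean and impulse.\<close>

lemma pseudo_energy_conserved:
  "Energy (chi1 t) (chi2 t) / 2 + I (\<lambda>z. \<phi> z * zeta t z) = Energy (chi1 0) (chi2 0) / 2 + I (\<lambda>z. \<phi> z * zeta 0 z)"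
proof -
  define l where "l = (\<phi>t - \<phi>b) / H"
  define V where "V z = \<phi> z - (\<phi>b + l * snd z)" for z
  define V2 where "V2 z = \<phi>2 z - l" for z
  have "D1 (\<lambda>z. \<phi>b + l * snd z) (\<lambda>z. 0)" "D2 (\<lambda>z. \<phi>b + l * snd z) (\<lambda>z. l)"
    unfolding D1_def D2_def by (auto intro!: continuous_intros derivative_eq_intros)
  from D1_diff[OF \<phi>_D(1) this(1)] D2_diff[OF \<phi>_D(2) this(2)]
  have V: "D1 V \<psi>1" "D2 V V2" unfolding V_def[abs_def] V2_def[abs_def] by auto
  note c = D_cont(1,2)[OF V(1)] D_cont(4)[OF V(2)] D_cont(1)[OF \<phi>_D(1)] D_cont(4)[OF \<phi>_D(2)]
    D_cont(1)[OF v_D(1)] D_cont(1)[OF v_D(3)]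
  have G: "I (\<lambda>z. \<psi>1 z * chi1 t z + V2 z * chi2 t z) = I (\<lambda>z. V z * zeta t z)" for t
  proof -
    have "I (\<lambda>z. \<psi>1 z * chi1 t z + V2 z * chi2 t z)
        = I (\<lambda>z. V z * - ((- dx1 H v2 (t, z) - \<psi>11 z) + (dx2 H v1 (t, z) - \<psi>22 z)))"
    proof (rule Green[OF V chi_D(3,4)])
      show "V (0, y) = V (L, y)" if "y \<in> {0..H}" for y unfolding V_def using \<phi>_periodic0[OF that] by simp
      show "V (x, 0) = 0" "V (x, H) = 0" for x unfolding V_def l_def using H_pos by (auto simp: \<phi>_boundary)
    qed (rule chi1_periodic)
    then show ?thesis unfolding zeta_laplacian .
  qed
  have chi2_0: "I (chi2 t) = 0" for t
    by (rule I_D2[OF chi_D(2)]) (use DirichletD(4,5)[OF chi_Dirichlet] in auto)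
  have main: "I (\<lambda>z. v1 (t, z) * v1 (t, z) + v2 (t, z) * v2 (t, z)) - 2 * \<kappa> * I (\<lambda>z. v1 (t, z)) + \<kappa>\<^sup>2 * (L * H)
     = Energy \<psi>1 \<phi>2 + Energy (chi1 t) (chi2 t) + 2 * (I (\<lambda>z. \<phi> z * zeta t z) - (\<phi>b * I (zeta t) + l * I (\<lambda>z. snd z * zeta t z)))" for t
  proof -
    have "I (\<lambda>z. v1 (t, z) * v1 (t, z) + v2 (t, z) * v2 (t, z)) - 2 * \<kappa> * I (\<lambda>z. v1 (t, z)) + I (\<lambda>z. \<kappa>\<^sup>2)
      = I (\<lambda>z. (v1 (t, z) * v1 (t, z) + v2 (t, z) * v2 (t, z)) - 2 * \<kappa> * v1 (t, z) + \<kappa>\<^sup>2)"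
      by (rule I_unique[symmetric], intro has_integral_add has_integral_diff has_integral_mult_right I_has_integral continuous_intros c)
    also have "\<dots> = I (\<lambda>z. ((\<psi>1 z)\<^sup>2 + (\<phi>2 z)\<^sup>2) + ((chi1 t z)\<^sup>2 + (chi2 t z)\<^sup>2)
        + 2 * ((\<psi>1 z * chi1 t z + V2 z * chi2 t z) + l * chi2 t z))"
    proof (rule I_cong)
      fix x y :: real
      define r where "r = (x, y)"
      have e: "v1 (t, r) = chi2 t r + \<kappa> + \<phi>2 r" "v2 (t, r) = - chi1 t r - \<psi>1 r"
        unfolding chi1_def chi2_def by auto
      show "(v1 (t, x, y) * v1 (t, x, y) + v2 (t, x, y) * v2 (t, x, y)) - 2 * \<kappa> * v1 (t, x, y) + \<kappa>\<^sup>2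
        = ((\<psi>1 (x, y))\<^sup>2 + (\<phi>2 (x, y))\<^sup>2) + ((chi1 t (x, y))\<^sup>2 + (chi2 t (x, y))\<^sup>2)
        + 2 * ((\<psi>1 (x, y) * chi1 t (x, y) + V2 (x, y) * chi2 t (x, y)) + l * chi2 t (x, y))"
        unfolding r_def[symmetric] e V2_def by (simp add: algebra_simps power2_eq_square)
    qed
    also have "\<dots> = (I (\<lambda>z. (\<psi>1 z)\<^sup>2) + I (\<lambda>z. (\<phi>2 z)\<^sup>2)) + (I (\<lambda>z. (chi1 t z)\<^sup>2) + I (\<lambda>z. (chi2 t z)\<^sup>2))
        + 2 * (I (\<lambda>z. \<psi>1 z * chi1 t z + V2 z * chi2 t z) + l * I (chi2 t))"
      by (rule I_unique, intro has_integral_add has_integral_mult_right I_has_integral continuous_intros c chi_cont)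
    also have "I (\<lambda>z. \<psi>1 z * chi1 t z + V2 z * chi2 t z) = I (\<lambda>z. \<phi> z * zeta t z - (\<phi>b * zeta t z + l * (snd z * zeta t z)))"
      unfolding G V_def by (rule I_cong) (simp add: algebra_simps)
    also have "\<dots> = I (\<lambda>z. \<phi> z * zeta t z) - (\<phi>b * I (zeta t) + l * I (\<lambda>z. snd z * zeta t z))"
      by (rule I_unique, intro has_integral_add has_integral_diff has_integral_mult_right I_has_integral continuous_intros c zeta_cont)
    finally show ?thesis unfolding I_const Energy_def chi2_0 by simp
  qed
  show ?thesis
    using main[of t] main[of 0] energy_conserved[of t] momentum_conserved[of t]
      zeta_mean_conserved[of t] zeta_impulse_conserved[of t] by simp
qed

lemma chi_time_cont: "continuous_on UNIV (\<lambda>t. havg (chi t) (H / 2))"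
proof -
  have Hm: "H / 2 \<in> {0..H}" using H_pos by auto
  have "integral {0..L} (\<lambda>x. chi t (x, H / 2)) = integral {0..L} (\<lambda>x. stream t (x, H / 2))
      - integral {0..L} (\<lambda>x. \<kappa> * (H / 2) + (\<phi> (x, H / 2) - \<phi>b))" for t
    unfolding chi_def snd_conv diff_diff_eq
    by (intro Henstock_Kurzweil_Integration.integral_diff integrable_continuous_interval continuous_intros
        slice1[OF D_cont(1)[OF stream_D(1)] Hm] slice1[OF K_cont[OF \<phi>_cont] Hm])
  then show ?thesis unfolding havg_def using L_pos by (auto intro!: continuous_intros stream_time_cont[OF Hm])
qed

end

section \<open>Stability up to the first eigenspace\<close>

lemma sqrt_bound:
  fixes D c :: real
  assumes "0 \<le> D" "D \<le> c * sqrt D" "0 \<le> c"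
  shows "sqrt D \<le> c"
proof (cases "D = 0")
  case False
  then have "0 < sqrt D" using assms by simp
  moreover have "sqrt D * sqrt D \<le> c * sqrt D" using assms by simp
  ultimately show ?thesis by (metis mult_right_le_imp_le)
qed (use assms in simp)

context channel
begin

lemma I_weighted:
  assumes f: "continuous_on K f" and h: "continuous_on K h" and m: "\<And>z. z \<in> K \<Longrightarrow> \<bar>h z\<bar> \<le> m"
    and le: "I (\<lambda>z. \<bar>f z\<bar>) \<le> c" and m0: "0 \<le> m"
  shows "\<bar>I (\<lambda>z. h z * f z)\<bar> \<le> m * c"
proof -
  have "\<bar>I (\<lambda>z. h z * f z)\<bar> \<le> I (\<lambda>z. \<bar>h z * f z\<bar>)"
    by (rule I_abs) (intro continuous_intros f h)
  also have "\<dots> \<le> I (\<lambda>z. m * \<bar>f z\<bar>)"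
    by (rule I_mono) (use m in \<open>auto intro!: continuous_intros f h simp: abs_mult mult_right_mono\<close>)
  also have "\<dots> \<le> m * c" unfolding I_cmult using le m0 by (rule mult_left_mono)
  finally show ?thesis .
qed

end

context steady
begin

definition "gmin = g \<phi>min"
definition "gmax = g \<phi>max"
definition "Mg = max \<bar>gmin\<bar> \<bar>gmax\<bar>"
definition "M\<phi> = max \<bar>\<phi>min\<bar> \<bar>\<phi>max\<bar>"

definition clamp :: "real \<Rightarrow> real" where
  "clamp s = max gmin (min gmax s)"

lemma antiderivative: "\<exists>G. \<forall>x\<in>{\<phi>min..\<phi>max}. (G has_real_derivative g x) (at x)"
proof -
  \<comment> \<open>The lower limit is placed one unit below \<open>\<phi>min\<close>, so that every
    point of the range is interior and the derivative two-sided, even when the range is a single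
    point.\<close>
  define G where "G x = integral {\<phi>min - 1..x} g" for x
  have "(G has_real_derivative g x) (at x)" if "x \<in> {\<phi>min..\<phi>max}" for x
  proof -
    have "(G has_vector_derivative g x) (at x within {\<phi>min - 1..\<phi>max + 1})"
      unfolding G_def by (rule integral_has_vector_derivative[OF g_cont]) (use that in auto)
    moreover have "at x within {\<phi>min - 1..\<phi>max + 1} = at x"
      by (rule at_within_interior) (use that in auto)
    ultimately show ?thesis by (simp add: has_real_derivative_iff_has_vector_derivative)
  qed
  then show ?thesis by blast
qed

definition "Gprim = (SOME G. \<forall>x\<in>{\<phi>min..\<phi>max}. (G has_real_derivative g x) (at x))"

sublocale convex_dual g "deriv g" Gprim \<phi>min \<phi>max La1
proof
  show "(Gprim has_real_derivative g x) (at x)" if "x \<in> {\<phi>min..\<phi>max}" for x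
    using someI_ex[OF antiderivative] that unfolding Gprim_def by blast
qed (use \<phi>_range(2) La1_pos g_deriv g'_range in auto)

lemma gmin_le_gmax: "gmin \<le> gmax"
  unfolding gmin_def gmax_def using g_mono[of \<phi>min \<phi>max] \<phi>_range(2) by simp

lemma clamp_range: "clamp s \<in> {gmin..gmax}"
  unfolding clamp_def using gmin_le_gmax by auto

lemma clamp_lipschitz: "\<bar>clamp s - clamp t\<bar> \<le> \<bar>s - t\<bar>"
  unfolding clamp_def by (simp add: max_def min_def)

lemma clamp_id: "s \<in> {gmin..gmax} \<Longrightarrow> clamp s = s"
  unfolding clamp_def by auto

lemma clamp_dist: "t \<in> {gmin..gmax} \<Longrightarrow> \<bar>s - clamp s\<bar> \<le> \<bar>s - t\<bar>"
  unfolding clamp_def by (auto simp: max_def min_def)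

lemma clamp_cont: "continuous_on S clamp"
  unfolding clamp_def[abs_def] by (intro continuous_intros)

lemma range_bound: "s \<in> {gmin..gmax} \<Longrightarrow> \<bar>s\<bar> \<le> Mg"
  unfolding Mg_def by auto

lemma \<phi>_mem: "z \<in> K \<Longrightarrow> \<phi> z \<in> {\<phi>min..\<phi>max}"
  using \<phi>_range(1) K_strip by blast

lemma \<phi>_bound: "z \<in> K \<Longrightarrow> \<bar>\<phi> z\<bar> \<le> M\<phi>"
  using \<phi>_mem[of z] unfolding M\<phi>_def by auto

lemma wb_mem: "z \<in> K \<Longrightarrow> wb z \<in> {gmin..gmax}"
  using \<phi>_mem[of z] wb_g[of z] K_strip g_mono[of \<phi>min "\<phi> z"] g_mono[of "\<phi> z" \<phi>max] \<phi>_range(2)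
  unfolding gmin_def gmax_def by auto

lemma M_nonneg: "0 \<le> Mg" "0 \<le> M\<phi>"
  unfolding Mg_def M\<phi>_def by auto

text \<open>Each constant multiplies \<nu>, the initial distance in L^p, except that
  \<open>c6\<close> bounds the root of the perturbation energy and \<open>c7\<close> the mean of
  \<open>chi\<close>. \<open>c1\<close> passes from L^p to L^1, \<open>c5\<close> belongs to
  \<open>excess\<close>, \<open>c8\<close> to \<open>defects\<close>, \<open>c9\<close> to the
  distance from the eigenspace, \<open>c10\<close> to the initial cosine coefficient.\<close>

definition "c1 = 1 + L * H"
definition "c5 = 6 * M\<phi> * c1"
definition "c6 p CH = 2 * Mg * (CH * (L * H) powr (1 / p)) + CH"
definition "c7 p CH = CH * (L * H) powr (1 / p) * c6 p CH / (L * H)"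
definition "c8 p CH = c5 + 2 * (CH * c6 p CH) + 4 * (c7 p CH * c1)"
definition "c9 p CH = 2 * (La1 * c8 p CH) + 2 * La1\<^sup>2 * (CP * c8 p CH)"
definition "c10 CH = La1 * (sqrt (L * H) * CH) / L"
definition "Cst p CH = c9 p CH + 2 * Mg * c1 + 3 * Mg\<^sup>2 * c1 + 2 * H * c1 + c10 CH"

text \<open>All that the rigidity argument knows about an Euler flow at a fixed time. From here on
  the question is finite-dimensional, and time enters only through the continuity of
  \<open>b\<close>.\<close>

definition state :: "real \<Rightarrow> (real \<times> real \<Rightarrow> real) \<Rightarrow> real \<Rightarrow> real \<Rightarrow> real \<Rightarrow> real \<Rightarrow> bool" where
  "state \<delta> \<eta> a b c d \<longleftrightarrow> continuous_on K \<eta> \<and> (\<forall>z\<in>K. \<bar>\<eta> z\<bar> \<le> Mg) \<and>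
     I (\<lambda>z. (\<eta> z - wb z - (trig2 a b z + trig1 c d z))\<^sup>2) \<le> \<delta> \<and>
     \<bar>I (\<lambda>z. \<eta> z ^ 2) - I (\<lambda>z. wb z ^ 2)\<bar> \<le> \<delta> \<and> \<bar>I (\<lambda>z. \<eta> z ^ 3) - I (\<lambda>z. wb z ^ 3)\<bar> \<le> \<delta> \<and>
     \<bar>I (\<lambda>z. snd z * (\<eta> z - wb z))\<bar> \<le> \<delta> \<and>
     (La1 < La \<longrightarrow> a = 0 \<and> b = 0) \<and> (La1 < Lb \<longrightarrow> c = 0 \<and> d = 0)"

end

context steady_euler
begin

text \<open>The truncation \<open>eta\<close> of the vorticity to the range of \<open>wb\<close> is bounded, takes values where
  the convex dual is strongly convex, and stays close to the vorticity for all times because the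
  distance \<open>\<integral>|w - eta|\<^sup>p\<close> is a Casimir.\<close>

definition eta :: "real \<Rightarrow> real \<times> real \<Rightarrow> real" where
  "eta t z = clamp (w (t, z))"

definition "rho t z = w (t, z) - eta t z"
definition "bb t z = eta t z - wb z"

lemma w_K: "continuous_on K (\<lambda>z. w (t, z))"
  by (rule K_cont_time[OF w_c(1)])

lemma wb_K: "continuous_on K wb"
  by (rule K_cont[OF wb_cont])

lemma \<phi>_K: "continuous_on K \<phi>"
  by (rule K_cont[OF \<phi>_cont])

lemma eta_cont: "continuous_on K (eta t)"
  unfolding eta_def[abs_def] by (rule continuous_on_compose2[OF clamp_cont w_K]) auto

lemma rho_cont: "continuous_on K (rho t)"
  unfolding rho_def[abs_def] by (intro continuous_intros w_K eta_cont)

lemma bb_cont: "continuous_on K (bb t)"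
  unfolding bb_def[abs_def] by (intro continuous_intros wb_K eta_cont)

lemma zeta_split: "zeta t z = bb t z + rho t z"
  unfolding zeta_def bb_def rho_def by simp

lemma eta_mem: "eta t z \<in> {gmin..gmax}"
  unfolding eta_def by (rule clamp_range)

lemma bb_bound: "z \<in> K \<Longrightarrow> \<bar>bb t z\<bar> \<le> 2 * Mg"
  using range_bound[OF eta_mem[of t z]] range_bound[OF wb_mem[of z]] unfolding bb_def by linarith

lemma bb0_le: "z \<in> K \<Longrightarrow> \<bar>bb 0 z\<bar> \<le> \<bar>zeta 0 z\<bar>"
  using clamp_lipschitz[of "w (0, z)" "wb z"] clamp_id[OF wb_mem[of z]] unfolding bb_def zeta_def eta_def by simp

context
  fixes p CH \<nu> :: real
  assumes p: "1 < p" and CH: "0 < CH"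
    and HS: "\<And>u u1 u2 f. Dirichlet u u1 u2 \<Longrightarrow> continuous_on K f \<Longrightarrow>
     I (\<lambda>z. \<bar>u z * f z\<bar>) \<le> CH * Np p f powr (1 / p) * sqrt (Energy u1 u2)"
    and \<nu>: "\<nu> = Np p (zeta 0) powr (1 / p)" and \<nu>1: "\<nu> \<le> 1"
begin

lemma \<nu>0: "0 \<le> \<nu>"
  unfolding \<nu> by simp

lemma LH: "0 < L * H" "0 < c1"
  using L_pos H_pos by (auto simp: c1_def add_pos_pos)

definition "D t = Energy (chi1 t) (chi2 t)"

lemma D0: "0 \<le> D t"
  unfolding D_def by (rule Energy_nonneg[OF chi_cont(2,3)])

lemma zeta0_L1: "I (\<lambda>z. \<bar>zeta 0 z\<bar>) \<le> c1 * \<nu>"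
  using I_abs_le_Np[OF p zeta_cont[of 0]] unfolding \<nu> c1_def .

text \<open>At time 0, clamping is the nearest-point projection onto an interval that contains the
  values of \<open>wb\<close>, so the distance to the interval is at most the distance to
  \<open>wb\<close>.\<close>

lemma Np_rho: "Np p (rho t) \<le> Np p (zeta 0)"
proof -
  have "continuous_on UNIV (\<lambda>s. \<bar>s - clamp s\<bar> powr p)"
    by (rule continuous_on_powr') (use p in \<open>auto intro!: continuous_intros clamp_cont\<close>)
  from Casimir_conserved[OF this, of t]
  have "Np p (rho t) = Np p (rho 0)"
    unfolding Np_def rho_def eta_def .
  also have "\<dots> \<le> Np p (zeta 0)"
    unfolding Np_def
  proof (rule I_mono)
    fix z assume z: "z \<in> K"
    have "\<bar>rho 0 z\<bar> \<le> \<bar>zeta 0 z\<bar>"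
      using clamp_dist[OF wb_mem[OF z]] unfolding rho_def eta_def zeta_def .
    then show "\<bar>rho 0 z\<bar> powr p \<le> \<bar>zeta 0 z\<bar> powr p" using p by (intro powr_mono2) auto
  qed (use p in \<open>auto intro!: powr_cont rho_cont zeta_cont\<close>)
  finally show ?thesis .
qed

lemma Np_rho_root: "Np p (rho t) powr (1 / p) \<le> \<nu>"
  unfolding \<nu> using p by (intro powr_mono2 Np_rho Np_nonneg rho_cont) auto

lemma rho_L1: "I (\<lambda>z. \<bar>rho t z\<bar>) \<le> c1 * \<nu>"
proof -
  have "I (\<lambda>z. \<bar>rho t z\<bar>) \<le> c1 * Np p (rho t) powr (1 / p)"
    using I_abs_le_Np[OF p rho_cont] unfolding c1_def .
  also have "\<dots> \<le> c1 * \<nu>" using Np_rho_root LH by (intro mult_left_mono) auto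
  finally show ?thesis .
qed

text \<open>The energy equals the pairing of \<open>chi\<close> with \<open>zeta\<close>, which is
  at most a constant times \<nu> times the root of the same energy; one factor cancels.\<close>

lemma sqrt_D_0: "sqrt (D 0) \<le> CH * \<nu>"
proof (rule sqrt_bound[OF D0])
  have "D 0 \<le> \<bar>I (\<lambda>z. chi 0 z * zeta 0 z)\<bar>" unfolding D_def Energy_chi by simp
  also have "\<dots> \<le> I (\<lambda>z. \<bar>chi 0 z * zeta 0 z\<bar>)"
    by (rule I_abs) (intro continuous_intros chi_cont zeta_cont)
  also have "\<dots> \<le> CH * \<nu> * sqrt (D 0)" unfolding \<nu> D_def by (rule HS[OF chi_Dirichlet zeta_cont])
  finally show "D 0 \<le> CH * \<nu> * sqrt (D 0)" .
qed (use CH \<nu>0 in auto)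

text \<open>\<phi> is a subgradient of \<open>F\<close> at \<open>wb = g \<phi>\<close>, so
  \<open>F_strongly_convex\<close> holds pointwise and can be integrated. The integral of
  \<open>F\<close> over the truncated vorticity is a Casimir, and at time 0 the Lipschitz constant
  \<open>M\<phi>\<close> of \<open>F\<close> bounds its difference from the steady value.\<close>

lemma \<phi>b_bound: "I (\<lambda>z. \<phi> z * bb t z) + I (\<lambda>z. (bb t z)\<^sup>2) / (2 * La1) \<le> M\<phi> * (c1 * \<nu>)"
proof -
  have FT: "continuous_on UNIV (\<lambda>s. F (clamp s))"
    by (rule continuous_on_compose2[OF F_cont clamp_cont]) auto
  have Fc: "continuous_on K (\<lambda>z. F (eta t z))" for t
    by (rule continuous_on_compose2[OF F_cont eta_cont]) auto
  have Fwb: "continuous_on K (\<lambda>z. F (wb z))"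
    by (rule continuous_on_compose2[OF F_cont wb_K]) auto
  have "I (\<lambda>z. \<phi> z * bb t z + (1 / (2 * La1)) * (bb t z)\<^sup>2) = I (\<lambda>z. \<phi> z * bb t z) + 1 / (2 * La1) * I (\<lambda>z. (bb t z)\<^sup>2)"
    by (intro I_unique has_integral_add has_integral_mult_right I_has_integral continuous_intros \<phi>_K bb_cont)
  then have "I (\<lambda>z. \<phi> z * bb t z) + I (\<lambda>z. (bb t z)\<^sup>2) / (2 * La1) = I (\<lambda>z. \<phi> z * bb t z + (1 / (2 * La1)) * (bb t z)\<^sup>2)"
    by simp
  also have "\<dots> \<le> I (\<lambda>z. F (eta t z) - F (wb z))"
  proof (rule I_mono)
    fix z assume z: "z \<in> K"
    then have zs: "z \<in> cl_strip H" using K_strip by auto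
    have "\<phi> z * (eta t z - g (\<phi> z)) + (eta t z - g (\<phi> z))\<^sup>2 / (2 * La1) \<le> F (eta t z) - F (g (\<phi> z))"
      by (rule F_strongly_convex[OF \<phi>_mem[OF z]]) (use eta_mem in \<open>auto simp: gmin_def gmax_def\<close>)
    then show "\<phi> z * bb t z + (1 / (2 * La1)) * (bb t z)\<^sup>2 \<le> F (eta t z) - F (wb z)"
      unfolding bb_def wb_g[OF zs] by simp
  qed (intro continuous_intros \<phi>_K bb_cont Fc Fwb)+
  also have "\<dots> = I (\<lambda>z. F (eta t z)) - I (\<lambda>z. F (wb z))" by (rule I_diff[OF Fc Fwb])
  also have "I (\<lambda>z. F (eta t z)) = I (\<lambda>z. F (eta 0 z))"
    unfolding eta_def by (rule Casimir_conserved[OF FT])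
  also have "I (\<lambda>z. F (eta 0 z)) - I (\<lambda>z. F (wb z)) = I (\<lambda>z. F (eta 0 z) - F (wb z))"
    by (rule I_diff[OF Fc Fwb, symmetric])
  also have "\<dots> \<le> I (\<lambda>z. M\<phi> * \<bar>zeta 0 z\<bar>)"
  proof (rule I_mono)
    fix z assume z: "z \<in> K"
    have "F (eta 0 z) - F (wb z) \<le> M\<phi> * \<bar>eta 0 z - wb z\<bar>"
      using F_Lipschitz[of "eta 0 z" "wb z"] unfolding M\<phi>_def by linarith
    also have "\<dots> \<le> M\<phi> * \<bar>zeta 0 z\<bar>"
      using bb0_le[OF z] M_nonneg unfolding bb_def by (intro mult_left_mono) auto
    finally show "F (eta 0 z) - F (wb z) \<le> M\<phi> * \<bar>zeta 0 z\<bar>" .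
  qed (intro continuous_intros Fc Fwb zeta_cont)+
  also have "\<dots> \<le> M\<phi> * (c1 * \<nu>)" unfolding I_cmult using zeta0_L1 M_nonneg by (intro mult_left_mono) auto
  finally show ?thesis .
qed

text \<open>The linear term, \<phi> against \<open>bb\<close>, is eliminated between
  \<open>\<phi>b_bound\<close> and the conserved pseudo-energy. Only quadratic terms and errors
  linear in \<nu> remain, and the initial energy enters with the favourable sign.\<close>

lemma excess: "I (\<lambda>z. (bb t z)\<^sup>2) / La1 - D t \<le> c5 * \<nu>"
proof -
  have "I (\<lambda>z. \<phi> z * zeta t z) = I (\<lambda>z. \<phi> z * bb t z) + I (\<lambda>z. \<phi> z * rho t z)"
    unfolding zeta_split distrib_left by (rule I_add) (intro continuous_intros \<phi>_K bb_cont rho_cont)+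
  moreover have "D t / 2 + I (\<lambda>z. \<phi> z * zeta t z) = D 0 / 2 + I (\<lambda>z. \<phi> z * zeta 0 z)"
    unfolding D_def by (rule pseudo_energy_conserved)
  moreover have "\<bar>I (\<lambda>z. \<phi> z * rho t z)\<bar> \<le> M\<phi> * (c1 * \<nu>)"
    by (rule I_weighted[OF rho_cont \<phi>_K \<phi>_bound rho_L1 M_nonneg(2)])
  moreover have "\<bar>I (\<lambda>z. \<phi> z * zeta 0 z)\<bar> \<le> M\<phi> * (c1 * \<nu>)"
    by (rule I_weighted[OF zeta_cont \<phi>_K \<phi>_bound zeta0_L1 M_nonneg(2)])
  moreover note \<phi>b_bound[of t] D0[of 0] 
  ultimately have "I (\<lambda>z. (bb t z)\<^sup>2) / (2 * La1) - D t / 2 \<le> 3 * (M\<phi> * (c1 * \<nu>))" by linarith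
  moreover have "I (\<lambda>z. (bb t z)\<^sup>2) / (2 * La1) = I (\<lambda>z. (bb t z)\<^sup>2) / La1 / 2" by simp
  ultimately have "I (\<lambda>z. (bb t z)\<^sup>2) / La1 - D t \<le> 6 * (M\<phi> * (c1 * \<nu>))" by linarith
  then show ?thesis unfolding c5_def by (simp add: algebra_simps)
qed

lemma chi_L1: "I (\<lambda>z. \<bar>chi t z\<bar>) \<le> CH * (L * H) powr (1 / p) * sqrt (D t)"
proof -
  have "Np p (\<lambda>z. 1) = L * H" unfolding Np_def using I_const[of 1] by simp
  then show ?thesis using HS[OF chi_Dirichlet[of t] continuous_on_const[of _ 1]] unfolding D_def by simp
qed

lemma c_nonneg: "0 \<le> c5" "0 \<le> c6 p CH" "0 \<le> c7 p CH" "0 \<le> c8 p CH" "0 \<le> c9 p CH" "0 \<le> c10 CH"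
proof -
  show c5: "0 \<le> c5" unfolding c5_def using M_nonneg LH by simp
  show c6: "0 \<le> c6 p CH" unfolding c6_def using M_nonneg CH by (intro add_nonneg_nonneg mult_nonneg_nonneg) auto
  show c7: "0 \<le> c7 p CH" unfolding c7_def using c6 CH LH by (intro divide_nonneg_pos mult_nonneg_nonneg) auto
  show c8: "0 \<le> c8 p CH" unfolding c8_def using c5 c6 c7 CH LH by (intro add_nonneg_nonneg mult_nonneg_nonneg) auto
  show "0 \<le> c9 p CH" unfolding c9_def using c8 La1_pos CP_pos by (intro add_nonneg_nonneg mult_nonneg_nonneg) auto
  show "0 \<le> c10 CH" unfolding c10_def using La1_pos CH LH L_pos by (intro divide_nonneg_pos mult_nonneg_nonneg) auto
qed

lemma chi_rho: "I (\<lambda>z. \<bar>chi t z * rho t z\<bar>) \<le> CH * \<nu> * sqrt (D t)"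
proof -
  have "I (\<lambda>z. \<bar>chi t z * rho t z\<bar>) \<le> CH * Np p (rho t) powr (1 / p) * sqrt (D t)"
    unfolding D_def by (rule HS[OF chi_Dirichlet rho_cont])
  also have "\<dots> \<le> CH * \<nu> * sqrt (D t)"
    using Np_rho_root CH D0 by (intro mult_right_mono mult_left_mono) auto
  finally show ?thesis .
qed

lemma D_split: "D t = I (\<lambda>z. bb t z * chi t z) + I (\<lambda>z. chi t z * rho t z)"
  unfolding D_def Energy_chi zeta_split distrib_left mult.commute[of "bb _ _"]
  by (rule I_add) (intro continuous_intros chi_cont bb_cont rho_cont)+

text \<open>An a priori bound valid for all times, which uses only that \<open>bb\<close> is
  bounded. It makes the pairing of \<open>chi\<close> with the truncation error of order
  \<nu>.\<close>

lemma sqrt_D: "sqrt (D t) \<le> c6 p CH"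
proof (rule sqrt_bound[OF D0 _ c_nonneg(2)])
  have "I (\<lambda>z. bb t z * chi t z) \<le> 2 * Mg * (CH * (L * H) powr (1 / p) * sqrt (D t))"
    using I_weighted[OF chi_cont(1) bb_cont bb_bound chi_L1, of t t] M_nonneg by simp
  moreover have "\<bar>I (\<lambda>z. chi t z * rho t z)\<bar> \<le> CH * \<nu> * sqrt (D t)"
    using I_abs[of "\<lambda>z. chi t z * rho t z"] chi_rho[of t] chi_cont rho_cont by (force intro!: continuous_intros)
  moreover have "CH * \<nu> * sqrt (D t) \<le> CH * 1 * sqrt (D t)"
    using \<nu>1 CH D0 by (intro mult_right_mono mult_left_mono) auto
  ultimately have "D t \<le> 2 * Mg * (CH * (L * H) powr (1 / p) * sqrt (D t)) + CH * sqrt (D t)"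
    using D_split[of t] by simp
  then show "D t \<le> c6 p CH * sqrt (D t)" unfolding c6_def by (simp add: algebra_simps)
qed

lemma chi_rho': "\<bar>I (\<lambda>z. chi t z * rho t z)\<bar> \<le> CH * c6 p CH * \<nu>"
proof -
  have "\<bar>I (\<lambda>z. chi t z * rho t z)\<bar> \<le> CH * \<nu> * sqrt (D t)"
    using I_abs[of "\<lambda>z. chi t z * rho t z"] chi_rho[of t] chi_cont rho_cont by (force intro!: continuous_intros)
  also have "\<dots> \<le> CH * \<nu> * c6 p CH" using sqrt_D CH \<nu>0 by (intro mult_left_mono) auto
  finally show ?thesis by (simp add: mult_ac)
qed

lemma mean_chi: "\<bar>mean (chi t)\<bar> \<le> c7 p CH"
proof -
  have "\<bar>I (chi t)\<bar> \<le> CH * (L * H) powr (1 / p) * c6 p CH"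
  proof -
    have "\<bar>I (chi t)\<bar> \<le> CH * (L * H) powr (1 / p) * sqrt (D t)"
      using I_abs[OF chi_cont(1)] chi_L1 by (rule order_trans)
    also have "\<dots> \<le> CH * (L * H) powr (1 / p) * c6 p CH" using sqrt_D CH by (intro mult_left_mono) auto
    finally show ?thesis .
  qed
  then show ?thesis unfolding mean_def c7_def using LH(1) by (simp add: divide_right_mono)
qed

lemma I_bb: "\<bar>I (bb t)\<bar> \<le> 2 * (c1 * \<nu>)"
proof -
  have "I (zeta t) = I (bb t) + I (rho t)"
    unfolding zeta_split[abs_def] by (rule I_add[OF bb_cont rho_cont])
  moreover have "\<bar>I (rho t)\<bar> \<le> c1 * \<nu>" using I_abs[OF rho_cont] rho_L1 by (rule order_trans)
  moreover have "\<bar>I (zeta t)\<bar> \<le> c1 * \<nu>"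
    unfolding zeta_mean_conserved[of t] using I_abs[OF zeta_cont] zeta0_L1 by (rule order_trans)
  ultimately show ?thesis by linarith
qed

text \<open>Completing the square splits the conserved excess into two nonnegative defects.\<close>

lemma defects:
  "I (\<lambda>z. (bb t z - La1 * (chi t z - mean (chi t)))\<^sup>2) / La1 + (D t - La1 * I (\<lambda>z. (chi t z - mean (chi t))\<^sup>2)) \<le> c8 p CH * \<nu>"
proof -
  define m where "m = mean (chi t)"
  have "I (\<lambda>z. (bb t z - La1 * (chi t z - m))\<^sup>2) = I (\<lambda>z. (bb t z)\<^sup>2 - (2 * La1) * (bb t z * chi t z) + (2 * La1 * m) * bb t z + La1\<^sup>2 * (chi t z - m)\<^sup>2)"
    by (rule I_cong) (simp add: algebra_simps power2_eq_square)
  also have "\<dots> = I (\<lambda>z. (bb t z)\<^sup>2) - (2 * La1) * I (\<lambda>z. bb t z * chi t z) + (2 * La1 * m) * I (bb t) + La1\<^sup>2 * I (\<lambda>z. (chi t z - m)\<^sup>2)"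
    by (intro I_unique has_integral_add has_integral_diff has_integral_mult_right I_has_integral continuous_intros bb_cont chi_cont)
  finally have "I (\<lambda>z. (bb t z - La1 * (chi t z - m))\<^sup>2) / La1
      = I (\<lambda>z. (bb t z)\<^sup>2) / La1 - 2 * I (\<lambda>z. bb t z * chi t z) + 2 * (m * I (bb t)) + La1 * I (\<lambda>z. (chi t z - m)\<^sup>2)"
    using La1_pos by (simp add: field_simps power2_eq_square)
  then have "I (\<lambda>z. (bb t z - La1 * (chi t z - m))\<^sup>2) / La1 + (D t - La1 * I (\<lambda>z. (chi t z - m)\<^sup>2))
     = (I (\<lambda>z. (bb t z)\<^sup>2) / La1 - D t) + 2 * I (\<lambda>z. chi t z * rho t z) + 2 * (m * I (bb t))"
    using D_split[of t] by simp
  moreover have "m * I (bb t) \<le> c7 p CH * (2 * (c1 * \<nu>))"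
  proof -
    have "m * I (bb t) \<le> \<bar>m\<bar> * \<bar>I (bb t)\<bar>" by (metis abs_ge_self abs_mult)
    also have "\<dots> \<le> c7 p CH * (2 * (c1 * \<nu>))"
      using mean_chi I_bb c_nonneg unfolding m_def by (intro mult_mono) auto
    finally show ?thesis .
  qed
  ultimately have "I (\<lambda>z. (bb t z - La1 * (chi t z - m))\<^sup>2) / La1 + (D t - La1 * I (\<lambda>z. (chi t z - m)\<^sup>2))
     \<le> c5 * \<nu> + 2 * (CH * c6 p CH * \<nu>) + 2 * (c7 p CH * (2 * (c1 * \<nu>)))"
    using excess[of t] chi_rho'[of t] by linarith
  also have "\<dots> = c8 p CH * \<nu>" unfolding c8_def by (simp add: algebra_simps)
  finally show ?thesis unfolding m_def .
qed

text \<open>The cosine coefficient that \<open>channel_Poincare\<close> prescribes for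
  \<open>chi\<close>, times \<open>La1\<close>. It is a value of the horizontal average at
  mid-height, from which its continuity in time can be read off.\<close>

definition "bf t = (if La1 < La then 0 else La1 * (- havg (chi t) (H / 2) / 2))"

lemma bf_cont: "continuous_on UNIV bf"
  unfolding bf_def[abs_def] by (cases "La1 < La") (auto intro!: continuous_intros chi_time_cont)

text \<open>The value of \<open>chi\<close> at mid-height is bounded by its vertical variation from
  the wall, hence by the root of the initial energy, which is of order \<nu>.\<close>

lemma bf_0: "\<bar>bf 0\<bar> \<le> c10 CH * \<nu>"
proof -
  note d = DirichletD[OF chi_Dirichlet[of 0]]
  have Hm: "H / 2 \<in> {0..H}" "0 \<in> {0..H}" using H_pos by auto
  have ac: "continuous_on K (\<lambda>z. \<bar>chi2 0 z\<bar>)" by (intro continuous_intros chi_cont)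
  have "\<bar>integral {0..L} (\<lambda>x. chi 0 (x, H / 2))\<bar> \<le> integral {0..L} (\<lambda>x. integral {0..H} (\<lambda>y. \<bar>chi2 0 (x, y)\<bar>))"
    using integral_norm_bound_integral[of "\<lambda>x. chi 0 (x, H / 2)" "{0..L}" "\<lambda>x. integral {0..H} (\<lambda>y. \<bar>chi2 0 (x, y)\<bar>)"]
      C1_Icc_variation[OF D2_C1[OF d(2)] Hm(1) Hm(2)] d(4)
    by (auto intro!: integrable_continuous_interval slice1[OF d(6) Hm(1)] integral2_continuous[OF ac])
  also have "\<dots> = I (\<lambda>z. \<bar>chi2 0 z\<bar>)" by (rule I_iterated[OF ac, symmetric])
  also have "\<dots> \<le> sqrt (L * H) * (CH * \<nu>)"
  proof -
    have "(I (\<lambda>z. 1 * \<bar>chi2 0 z\<bar>))\<^sup>2 \<le> I (\<lambda>z. 1\<^sup>2) * I (\<lambda>z. \<bar>chi2 0 z\<bar>\<^sup>2)"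
      by (rule I_Cauchy_Schwarz) (intro continuous_intros ac)+
    also have "\<dots> \<le> (L * H) * D 0"
    proof -
      have "I (\<lambda>z. \<bar>chi2 0 z\<bar>\<^sup>2) \<le> D 0" using Energy_nonneg[OF d(7,8)] unfolding D_def Energy_def by simp
      from mult_left_mono[OF this, of "L * H"] show ?thesis using I_const[of 1] LH by simp
    qed
    finally have "I (\<lambda>z. \<bar>chi2 0 z\<bar>) \<le> sqrt ((L * H) * D 0)" by (simp add: real_le_rsqrt)
    also have "\<dots> \<le> sqrt (L * H) * (CH * \<nu>)"
      unfolding real_sqrt_mult[of "L * H"] using sqrt_D_0 LH by (intro mult_left_mono) auto
    finally show ?thesis .
  qed
  finally have "\<bar>havg (chi 0) (H / 2)\<bar> \<le> sqrt (L * H) * (CH * \<nu>) / L"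
    unfolding havg_def using L_pos by (simp add: divide_right_mono)
  then have "La1 * \<bar>havg (chi 0) (H / 2)\<bar> \<le> La1 * (sqrt (L * H) * (CH * \<nu>) / L)"
    using La1_pos by (intro mult_left_mono) auto
  also have "\<dots> = c10 CH * \<nu>" unfolding c10_def by simp
  finally have *: "La1 * \<bar>havg (chi 0) (H / 2)\<bar> \<le> c10 CH * \<nu>" .
  have "\<bar>bf 0\<bar> \<le> La1 * \<bar>havg (chi 0) (H / 2)\<bar>"
    unfolding bf_def using La1_pos by (auto simp: abs_mult)
  with * show ?thesis by simp
qed

text \<open>Each of the two nonnegative defects is small. The first puts \<open>bb\<close> close to
  \<open>La1\<close> times the centred \<open>chi\<close>; the second, by the remainder in
  \<open>channel_Poincare\<close>, puts the centred \<open>chi\<close> close to the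
  eigenspace.\<close>

lemma near_eigenspace:
  "\<exists>a c d. (La1 < La \<longrightarrow> a = 0) \<and> (La1 < Lb \<longrightarrow> c = 0 \<and> d = 0) \<and>
     I (\<lambda>z. (bb t z - (trig2 a (bf t) z + trig1 c d z))\<^sup>2) \<le> c9 p CH * \<nu>"
proof -
  define m where "m = mean (chi t)"
  define b where "b = (if La1 < La then 0 else - havg (chi t) (H / 2) / 2)"
  note d = DirichletD[OF chi_Dirichlet[of t]]
  obtain a c d where acd: "La1 < La \<longrightarrow> a = 0" "La1 < Lb \<longrightarrow> c = 0 \<and> d = 0"
    "I (\<lambda>z. (chi t z - m - (trig2 a b z + trig1 c d z))\<^sup>2) \<le> CP * (D t - La1 * I (\<lambda>z. (chi t z - m)\<^sup>2))"
    using channel_Poincare[OF d(1-5)] unfolding m_def b_def D_def by blast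
  define X where "X = I (\<lambda>z. (bb t z - La1 * (chi t z - m))\<^sup>2)"
  define Y where "Y = D t - La1 * I (\<lambda>z. (chi t z - m)\<^sup>2)"
  define f where "f z = bb t z - La1 * (chi t z - m)" for z
  define h where "h z = La1 * (chi t z - m - (trig2 a b z + trig1 c d z))" for z
  have fc: "continuous_on K f" and hc: "continuous_on K h"
    unfolding f_def h_def by (intro continuous_intros bb_cont chi_cont trig_cont)+
  have XY: "X / La1 + Y \<le> c8 p CH * \<nu>"
    unfolding X_def Y_def m_def by (rule defects)
  have X0: "0 \<le> X" unfolding X_def by (intro I_nonneg continuous_intros bb_cont chi_cont) simp
  have Y0: "0 \<le> Y"
    unfolding Y_def m_def D_def using channel_Poincare_ge[OF d(1-5)] by simp
  have X1: "X \<le> La1 * c8 p CH * \<nu>"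
  proof -
    have "X / La1 \<le> c8 p CH * \<nu>" using XY Y0 by simp
    then show ?thesis using La1_pos by (simp add: divide_le_eq mult_ac)
  qed
  have Y1: "Y \<le> c8 p CH * \<nu>"
    using XY divide_nonneg_pos[OF X0 La1_pos] by linarith
  have "trig2 (La1 * a) (bf t) z + trig1 (La1 * c) (La1 * d) z = La1 * (trig2 a b z + trig1 c d z)" for z
    unfolding trig1_def trig2_def bf_def b_def by (simp add: algebra_simps)
  then have "I (\<lambda>z. (bb t z - (trig2 (La1 * a) (bf t) z + trig1 (La1 * c) (La1 * d) z))\<^sup>2) = I (\<lambda>z. (f z + h z)\<^sup>2)"
    unfolding f_def h_def by (simp add: algebra_simps)
  also have "\<dots> \<le> 2 * I (\<lambda>z. (f z)\<^sup>2) + 2 * I (\<lambda>z. (h z)\<^sup>2)" by (rule I_sum_sq[OF fc hc])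
  also have "I (\<lambda>z. (f z)\<^sup>2) = X" unfolding f_def X_def ..
  also have "I (\<lambda>z. (h z)\<^sup>2) = La1\<^sup>2 * I (\<lambda>z. (chi t z - m - (trig2 a b z + trig1 c d z))\<^sup>2)"
    unfolding h_def power_mult_distrib I_cmult ..
  also have "2 * X + 2 * (La1\<^sup>2 * I (\<lambda>z. (chi t z - m - (trig2 a b z + trig1 c d z))\<^sup>2))
      \<le> 2 * (La1 * c8 p CH * \<nu>) + 2 * (La1\<^sup>2 * (CP * (c8 p CH * \<nu>)))"
    using X1 order_trans[OF acd(3)[folded Y_def] mult_left_mono[OF Y1 less_imp_le[OF CP_pos]]]
    by (intro add_mono mult_left_mono) auto
  also have "\<dots> = c9 p CH * \<nu>" unfolding c9_def by (simp add: algebra_simps)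
  finally show ?thesis using acd(1,2)
    by (intro exI[of _ "La1 * a"] exI[of _ "La1 * c"] exI[of _ "La1 * d"]) auto
qed

text \<open>Composing \<open>h\<close> with the truncation gives a continuous Casimir, so the
  comparison with \<open>wb\<close> can be made at time 0. Both functions take values in
  \<open>{gmin..gmax}\<close>, where \<open>h\<close> is Lipschitz.\<close>

lemma moment_diff:
  assumes h: "continuous_on UNIV h" and lip: "\<And>s r. s \<in> {gmin..gmax} \<Longrightarrow> r \<in> {gmin..gmax} \<Longrightarrow> \<bar>h s - h r\<bar> \<le> m * \<bar>s - r\<bar>"
    and m: "0 \<le> m"
  shows "\<bar>I (\<lambda>z. h (eta t z)) - I (\<lambda>z. h (wb z))\<bar> \<le> m * c1 * \<nu>"
proof -
  have hT: "continuous_on UNIV (\<lambda>s. h (clamp s))"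
    by (rule continuous_on_compose2[OF h clamp_cont]) auto
  have hc: "continuous_on K (\<lambda>z. h (eta 0 z))" "continuous_on K (\<lambda>z. h (wb z))"
    by (rule continuous_on_compose2[OF h eta_cont] continuous_on_compose2[OF h wb_K]; simp)+
  have "I (\<lambda>z. h (eta t z)) = I (\<lambda>z. h (eta 0 z))"
    unfolding eta_def by (rule Casimir_conserved[OF hT])
  then have "\<bar>I (\<lambda>z. h (eta t z)) - I (\<lambda>z. h (wb z))\<bar> = \<bar>I (\<lambda>z. h (eta 0 z) - h (wb z))\<bar>"
    by (simp add: I_diff[OF hc])
  also have "\<dots> \<le> I (\<lambda>z. \<bar>h (eta 0 z) - h (wb z)\<bar>)" by (rule I_abs) (intro continuous_intros hc)
  also have "\<dots> \<le> I (\<lambda>z. m * \<bar>zeta 0 z\<bar>)"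
  proof (rule I_mono)
    fix z assume z: "z \<in> K"
    have "\<bar>h (eta 0 z) - h (wb z)\<bar> \<le> m * \<bar>eta 0 z - wb z\<bar>" by (rule lip[OF eta_mem wb_mem[OF z]])
    also have "\<dots> \<le> m * \<bar>zeta 0 z\<bar>"
      using bb0_le[OF z] m unfolding bb_def by (intro mult_left_mono) auto
    finally show "\<bar>h (eta 0 z) - h (wb z)\<bar> \<le> m * \<bar>zeta 0 z\<bar>" .
  qed (intro continuous_intros hc zeta_cont)+
  also have "\<dots> \<le> m * (c1 * \<nu>)" unfolding I_cmult using zeta0_L1 m by (rule mult_left_mono)
  finally show ?thesis by (simp add: mult_ac)
qed

lemma state_exists: "\<exists>a c d. state (Cst p CH * \<nu>) (eta t) a (bf t) c d"
proof -
  obtain a c d where acd: "La1 < La \<longrightarrow> a = 0" "La1 < Lb \<longrightarrow> c = 0 \<and> d = 0"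
    "I (\<lambda>z. (bb t z - (trig2 a (bf t) z + trig1 c d z))\<^sup>2) \<le> c9 p CH * \<nu>"
    using near_eigenspace by blast
  have pos: "0 \<le> c9 p CH" "0 \<le> 2 * Mg * c1" "0 \<le> 3 * Mg\<^sup>2 * c1" "0 \<le> 2 * H * c1" "0 \<le> c10 CH"
    using c_nonneg M_nonneg LH H_pos by auto
  have le: "c9 p CH * \<nu> \<le> Cst p CH * \<nu>" "2 * Mg * c1 * \<nu> \<le> Cst p CH * \<nu>" "3 * Mg\<^sup>2 * c1 * \<nu> \<le> Cst p CH * \<nu>"
    "2 * H * c1 * \<nu> \<le> Cst p CH * \<nu>"
    unfolding Cst_def using pos \<nu>0 by (intro mult_right_mono; linarith)+
  have m2: "\<bar>I (\<lambda>z. eta t z ^ 2) - I (\<lambda>z. wb z ^ 2)\<bar> \<le> 2 * Mg * c1 * \<nu>"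
  proof (rule moment_diff)
    fix s r assume sr: "s \<in> {gmin..gmax}" "r \<in> {gmin..gmax}"
    have "\<bar>s ^ 2 - r ^ 2\<bar> = \<bar>s + r\<bar> * \<bar>s - r\<bar>" unfolding abs_mult[symmetric] by (simp add: power2_eq_square algebra_simps)
    also have "\<dots> \<le> 2 * Mg * \<bar>s - r\<bar>" using range_bound[OF sr(1)] range_bound[OF sr(2)] by (intro mult_right_mono) auto
    finally show "\<bar>s ^ 2 - r ^ 2\<bar> \<le> 2 * Mg * \<bar>s - r\<bar>" .
  qed (use M_nonneg in \<open>auto intro!: continuous_intros\<close>)
  have m3: "\<bar>I (\<lambda>z. eta t z ^ 3) - I (\<lambda>z. wb z ^ 3)\<bar> \<le> 3 * Mg\<^sup>2 * c1 * \<nu>"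
  proof (rule moment_diff)
    fix s r assume sr: "s \<in> {gmin..gmax}" "r \<in> {gmin..gmax}"
    note b = range_bound[OF sr(1)] range_bound[OF sr(2)]
    have "\<bar>s * s\<bar> \<le> Mg * Mg" "\<bar>s * r\<bar> \<le> Mg * Mg" "\<bar>r * r\<bar> \<le> Mg * Mg"
      unfolding abs_mult using b M_nonneg by (intro mult_mono; simp)+
    then have "\<bar>s * s + s * r + r * r\<bar> \<le> 3 * Mg\<^sup>2" unfolding power2_eq_square by linarith
    moreover have "\<bar>s ^ 3 - r ^ 3\<bar> = \<bar>s * s + s * r + r * r\<bar> * \<bar>s - r\<bar>"
      unfolding abs_mult[symmetric] by (simp add: power3_eq_cube algebra_simps)
    ultimately show "\<bar>s ^ 3 - r ^ 3\<bar> \<le> 3 * Mg\<^sup>2 * \<bar>s - r\<bar>" by (simp add: mult_right_mono)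
  qed (use M_nonneg in \<open>auto intro!: continuous_intros\<close>)
  have sc: "continuous_on K (\<lambda>z. snd z)" by (intro continuous_intros)
  have sb: "\<bar>snd z\<bar> \<le> H" if "z \<in> K" for z using that unfolding K_def by auto
  have "I (\<lambda>z. snd z * zeta t z) = I (\<lambda>z. snd z * bb t z) + I (\<lambda>z. snd z * rho t z)"
    unfolding zeta_split distrib_left by (rule I_add) (intro continuous_intros bb_cont rho_cont)+
  moreover have "\<bar>I (\<lambda>z. snd z * rho t z)\<bar> \<le> H * (c1 * \<nu>)"
    by (rule I_weighted[OF rho_cont sc sb rho_L1]) (use H_pos in auto)
  moreover have "\<bar>I (\<lambda>z. snd z * zeta t z)\<bar> \<le> H * (c1 * \<nu>)"
    unfolding zeta_impulse_conserved[of t]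
    by (rule I_weighted[OF zeta_cont sc sb zeta0_L1]) (use H_pos in auto)
  ultimately have my: "\<bar>I (\<lambda>z. snd z * bb t z)\<bar> \<le> 2 * H * c1 * \<nu>" by simp
  have "state (Cst p CH * \<nu>) (eta t) a (bf t) c d"
    unfolding state_def
    using acd(1,2) order_trans[OF acd(3) le(1), unfolded bb_def] order_trans[OF m2 le(2)] order_trans[OF m3 le(3)]
      order_trans[OF my le(4), unfolded bb_def] eta_cont range_bound[OF eta_mem]
    by (auto simp: bf_def)
  then show ?thesis by blast
qed

lemma bf_0': "\<bar>bf 0\<bar> \<le> Cst p CH * \<nu>"
proof -
  have pos: "0 \<le> c9 p CH" "0 \<le> 2 * Mg * c1" "0 \<le> 3 * Mg\<^sup>2 * c1" "0 \<le> 2 * H * c1"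
    using c_nonneg M_nonneg LH H_pos by auto
  then have "c10 CH * \<nu> \<le> Cst p CH * \<nu>" unfolding Cst_def using \<nu>0 by (intro mult_right_mono) linarith+
  then show ?thesis using bf_0 by simp
qed

end

end

context steady
begin

text \<open>The constant is fixed before the Euler flow, which is the uniformity that stability
  demands. The flow-dependent locale is interpreted inside the proof, separately for each
  flow.\<close>

theorem state_summary:
  assumes p: "1 < p"
  shows "\<exists>C\<ge>0. \<forall>v1 v2 P. euler_flow L H v1 v2 P \<longrightarrow>
     (\<forall>\<nu>. \<nu> = Np p (\<lambda>z. vorticity H v1 v2 (0, z) - wb z) powr (1 / p) \<longrightarrow> \<nu> \<le> 1 \<longrightarrow>
     (\<exists>bf. continuous_on UNIV bf \<and> \<bar>bf 0\<bar> \<le> C * \<nu> \<and>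
       (\<forall>t::real. \<exists>\<eta> a c d. state (C * \<nu>) \<eta> a (bf t) c d \<and>
          continuous_on K (\<lambda>z. vorticity H v1 v2 (t, z)) \<and>
          Np p (\<lambda>z. vorticity H v1 v2 (t, z) - \<eta> z) powr (1 / p) \<le> \<nu>)))"
proof -
  obtain CH where CH: "0 < CH" "\<And>u u1 u2 f. Dirichlet u u1 u2 \<Longrightarrow> continuous_on K f \<Longrightarrow>
     I (\<lambda>z. \<bar>u z * f z\<bar>) \<le> CH * Np p f powr (1 / p) * sqrt (Energy u1 u2)"
    using Hoelder_Sobolev[OF p] by blast
  define C where "C = \<bar>Cst p CH\<bar>"
  have mono: "state \<delta>' \<eta> a b c d" if "state \<delta> \<eta> a b c d" "\<delta> \<le> \<delta>'" for \<delta> \<delta>' \<eta> a b c d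
    using that unfolding state_def by auto
  have "\<exists>bf. continuous_on UNIV bf \<and> \<bar>bf 0\<bar> \<le> C * \<nu> \<and>
       (\<forall>t::real. \<exists>\<eta> a c d. state (C * \<nu>) \<eta> a (bf t) c d \<and>
          continuous_on K (\<lambda>z. vorticity H v1 v2 (t, z)) \<and>
          Np p (\<lambda>z. vorticity H v1 v2 (t, z) - \<eta> z) powr (1 / p) \<le> \<nu>)"
    if e: "euler_flow L H v1 v2 P" and \<nu>: "\<nu> = Np p (\<lambda>z. vorticity H v1 v2 (0, z) - wb z) powr (1 / p)" "\<nu> \<le> 1"
    for v1 v2 P \<nu>
  proof -
    interpret E: steady_euler L H lam \<psi> g v1 v2 P
      by unfold_locales (rule e)
    have \<nu>': "\<nu> = Np p (E.zeta 0) powr (1 / p)"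
      unfolding \<nu>(1) E.zeta_def[abs_def] E.w_vorticity ..
    note a = p CH \<nu>' \<nu>(2)
    have n0: "0 \<le> \<nu>" unfolding \<nu>(1) by simp
    then have le: "Cst p CH * \<nu> \<le> C * \<nu>" unfolding C_def by (intro mult_right_mono) auto
    show ?thesis
    proof (intro exI[of _ E.bf] conjI allI)
      show "continuous_on UNIV E.bf" by (rule E.bf_cont[OF a])
      show "\<bar>E.bf 0\<bar> \<le> C * \<nu>" using E.bf_0'[OF a] le by simp
      fix t
      obtain a' c d where st: "state (Cst p CH * \<nu>) (E.eta t) a' (E.bf t) c d"
        using E.state_exists[OF a] by blast
      show "\<exists>\<eta> a c d. state (C * \<nu>) \<eta> a (E.bf t) c d \<and>
          continuous_on K (\<lambda>z. vorticity H v1 v2 (t, z)) \<and>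
          Np p (\<lambda>z. vorticity H v1 v2 (t, z) - \<eta> z) powr (1 / p) \<le> \<nu>"
        using mono[OF st le] E.Np_rho_root[OF a, of t] E.w_K[of t]
        unfolding E.w_vorticity E.rho_def[abs_def] by blast
    qed
  qed
  then show ?thesis by (intro exI[of _ C]) (auto simp: C_def)
qed

end

section \<open>Trigonometric integrals and moments of the first modes\<close>

context channel
begin

definition "qf y = cos (2 * k2 * y)"
definition "sf y = sin (k2 * y)"
definition "pf y = sin (2 * k2 * y)"

lemma vert_cont: "continuous_on S qf" "continuous_on S sf" "continuous_on S pf"
  unfolding qf_def sf_def pf_def by (intro continuous_intros)+

lemma sf_sq: "sf y * sf y = (1 - qf y) / 2"
  unfolding sf_def qf_def using cos_double_sin[of "k2 * y"] by (simp add: mult.assoc power2_eq_square)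

lemma vert_has:
  "(qf has_integral 0) {0..H}" "(pf has_integral 0) {0..H}"
  "((\<lambda>y. qf y * qf y) has_integral H / 2) {0..H}"
  "((\<lambda>y. pf y * pf y) has_integral H / 2) {0..H}"
  "((\<lambda>y. pf y * qf y) has_integral 0) {0..H}"
proof -
  \<comment> \<open>In a channel of period \<open>H\<close> the horizontal wave number is
    \<open>2 * k2\<close>, so the integrals already computed in x_1 can be reused in x_2.\<close>
  have ch: "channel H H" using H_pos by unfold_locales
  have k: "channel.k1 H = 2 * k2" unfolding channel.k1_def[OF ch] k2_def by simp
  note t = channel.trig_integrals[OF ch, unfolded k, folded qf_def[abs_def] pf_def[abs_def]]
  show "(qf has_integral 0) {0..H}" "(pf has_integral 0) {0..H}"
    "((\<lambda>y. qf y * qf y) has_integral H / 2) {0..H}"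
    "((\<lambda>y. pf y * pf y) has_integral H / 2) {0..H}"
    "((\<lambda>y. pf y * qf y) has_integral 0) {0..H}"
    using t unfolding has_integral_integrable_integral qf_def pf_def
    by (auto intro!: integrable_continuous_interval continuous_intros)
qed

lemma ss_has: "((\<lambda>y. sf y * sf y) has_integral H / 2) {0..H}"
proof -
  have "((\<lambda>y. (1 - qf y) / 2) has_integral (H - 0) / 2) {0..H}"
    by (intro has_integral_divide has_integral_diff vert_has) (use has_integral_const_real[of "1::real" 0 H] H_pos in simp)
  then show ?thesis unfolding sf_sq by simp
qed

lemma qss_has: "((\<lambda>y. qf y * (sf y * sf y)) has_integral - H / 4) {0..H}"
proof -
  have "((\<lambda>y. (qf y - qf y * qf y) / 2) has_integral (0 - H / 2) / 2) {0..H}"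
    by (intro has_integral_divide has_integral_diff vert_has)
  then show ?thesis unfolding sf_sq by (simp add: algebra_simps)
qed

text \<open>The cube of the cosine changes sign under translation by half a period.\<close>

lemma qqq_has: "((\<lambda>y. qf y * (qf y * qf y)) has_integral 0) {0..H}"
proof -
  have c: "continuous_on {0..H} (\<lambda>y. qf y * (qf y * qf y))" by (intro continuous_intros vert_cont)
  have "2 * k2 * (y + H / 2) = 2 * k2 * y + pi" for y using k_mult by (simp add: algebra_simps)
  then have "qf (y + H / 2) = - qf y" for y unfolding qf_def by simp
  then have "integral {0..H} (\<lambda>y. qf y * (qf y * qf y)) = 0"
    using integral_fold_half[OF c H_pos] by simp
  then show ?thesis using c unfolding has_integral_integrable_integral
    by (auto intro: integrable_continuous_interval)
qed

text \<open>The weight x_2 pairs nontrivially with the sine and not at all with the cosine. This is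
  why the impulse fixes one of the two vertical coefficients and is blind to the other.\<close>

lemma y_has: "((\<lambda>y. y * pf y) has_integral - H / (2 * k2)) {0..H}" "((\<lambda>y. y * qf y) has_integral 0) {0..H}"
proof -
  have nz: "k2 \<noteq> 0" using k_pos by simp
  have "integral {0..H} (\<lambda>y. y * pf y) = (sin (2 * k2 * H) / (2 * k2)\<^sup>2 - H * cos (2 * k2 * H) / (2 * k2))
      - (sin (2 * k2 * 0) / (2 * k2)\<^sup>2 - 0 * cos (2 * k2 * 0) / (2 * k2))"
    unfolding pf_def
    by (rule FTC_continuous) (use H_pos nz in \<open>auto intro!: derivative_eq_intros simp: field_simps power2_eq_square\<close>)
  then have 1: "integral {0..H} (\<lambda>y. y * pf y) = - H / (2 * k2)" unfolding k_mult(3) by simp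
  have "integral {0..H} (\<lambda>y. y * qf y) = (cos (2 * k2 * H) / (2 * k2)\<^sup>2 + H * sin (2 * k2 * H) / (2 * k2))
      - (cos (2 * k2 * 0) / (2 * k2)\<^sup>2 + 0 * sin (2 * k2 * 0) / (2 * k2))"
    unfolding qf_def
    by (rule FTC_continuous) (use H_pos nz in \<open>auto intro!: derivative_eq_intros simp: field_simps power2_eq_square\<close>)
  then have 2: "integral {0..H} (\<lambda>y. y * qf y) = 0" unfolding k_mult(3) by simp
  show "((\<lambda>y. y * pf y) has_integral - H / (2 * k2)) {0..H}" "((\<lambda>y. y * qf y) has_integral 0) {0..H}"
    using 1 2 unfolding has_integral_integrable_integral
    by (auto intro!: integrable_continuous_interval continuous_intros vert_cont)
qed

definition "Xf C D x = C * cos (k1 * x) + D * sin (k1 * x)"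

lemma Xf_cont: "continuous_on S (Xf C D)"
  unfolding Xf_def[abs_def] by (intro continuous_intros)

lemma Xf_integrals:
  "integral {0..L} (Xf C D) = 0"
  "integral {0..L} (\<lambda>x. Xf C D x * Xf C D x) = L / 2 * (C\<^sup>2 + D\<^sup>2)"
  "integral {0..L} (\<lambda>x. Xf C D x * Xf C D x * Xf C D x) = 0"
proof -
  have k: "k1 * (x + L / 2) = k1 * x + pi" for x using k_mult by (simp add: algebra_simps)
  have sh: "Xf C D (x + L / 2) = - Xf C D x" for x unfolding Xf_def k by simp
  show "integral {0..L} (Xf C D) = 0" "integral {0..L} (\<lambda>x. Xf C D x * Xf C D x * Xf C D x) = 0"
    by (subst integral_fold_half[OF _ L_pos]; simp add: sh continuous_on_mult Xf_cont)+
  have h: "((\<lambda>x. cos (k1 * x) * cos (k1 * x)) has_integral L / 2) {0..L}"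
      "((\<lambda>x. sin (k1 * x) * sin (k1 * x)) has_integral L / 2) {0..L}"
      "((\<lambda>x. sin (k1 * x) * cos (k1 * x)) has_integral 0) {0..L}"
    unfolding has_integral_integrable_integral
    by (auto simp: trig_integrals intro!: integrable_continuous_interval continuous_intros)
  have "((\<lambda>x. C\<^sup>2 * (cos (k1 * x) * cos (k1 * x)) + D\<^sup>2 * (sin (k1 * x) * sin (k1 * x)) + (2 * C * D) * (sin (k1 * x) * cos (k1 * x)))
      has_integral C\<^sup>2 * (L / 2) + D\<^sup>2 * (L / 2) + (2 * C * D) * 0) {0..L}"
    by (intro has_integral_add has_integral_mult_right h)
  from integral_unique[OF this] show "integral {0..L} (\<lambda>x. Xf C D x * Xf C D x) = L / 2 * (C\<^sup>2 + D\<^sup>2)"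
    unfolding Xf_def by (simp add: algebra_simps power2_eq_square)
qed

lemma trig1_X: "trig1 C D z = Xf C D (fst z) * sf (snd z)"
  unfolding trig1_def Xf_def sf_def ..

lemma trig2_pq: "trig2 a b z = a * pf (snd z) + b * qf (snd z)"
  unfolding trig2_def pf_def qf_def ..

text \<open>Odd powers of the horizontal factor integrate to zero over a period, so the moments see
  the amplitude \<open>C^2 + D^2\<close> and never the phase. In the third moment the amplitude is
  coupled to \<open>h\<close> through the square of \<open>sf\<close>.\<close>

lemma moments:
  assumes h: "continuous_on {0..H} h"
  shows "I (\<lambda>z. (h (snd z) + trig1 C D z) ^ 2) = L * integral {0..H} (\<lambda>y. h y * h y) + L * H / 4 * (C\<^sup>2 + D\<^sup>2)"
    "I (\<lambda>z. (h (snd z) + trig1 C D z) ^ 3) = L * integral {0..H} (\<lambda>y. h y * h y * h y)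
        + 3 / 2 * L * (C\<^sup>2 + D\<^sup>2) * integral {0..H} (\<lambda>y. h y * (sf y * sf y))"
    "I (\<lambda>z. snd z * (h (snd z) + trig1 C D z)) = L * integral {0..H} (\<lambda>y. y * h y)"
proof -
  let ?X = "Xf C D"
  note k = cont_snd[OF h] cont_fst[OF Xf_cont] cont_snd[OF vert_cont(2)]
  have "(h (snd z) + trig1 C D z) ^ 2 = h (snd z) * h (snd z) + 2 * (?X (fst z) * (h (snd z) * sf (snd z)))
      + (?X (fst z) * ?X (fst z)) * (sf (snd z) * sf (snd z))" for z
    unfolding trig1_X by (simp add: power2_eq_square algebra_simps)
  then have "I (\<lambda>z. (h (snd z) + trig1 C D z) ^ 2) = I (\<lambda>z. h (snd z) * h (snd z)) + 2 * I (\<lambda>z. ?X (fst z) * (h (snd z) * sf (snd z)))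
      + I (\<lambda>z. (?X (fst z) * ?X (fst z)) * (sf (snd z) * sf (snd z)))"
    by (simp only:) (intro I_unique has_integral_add has_integral_mult_right I_has_integral continuous_intros k)
  also have "I (\<lambda>z. h (snd z) * h (snd z)) = L * integral {0..H} (\<lambda>y. h y * h y)"
    by (rule I_snd[of "\<lambda>y. h y * h y"]) (intro continuous_intros h)
  also have "I (\<lambda>z. ?X (fst z) * (h (snd z) * sf (snd z))) = 0"
    using I_prod[OF Xf_cont, of "\<lambda>y. h y * sf y" C D] h vert_cont by (simp add: Xf_integrals continuous_on_mult)
  also have "I (\<lambda>z. (?X (fst z) * ?X (fst z)) * (sf (snd z) * sf (snd z))) = L / 2 * (C\<^sup>2 + D\<^sup>2) * (H / 2)"
    using I_prod[of "\<lambda>x. ?X x * ?X x" "\<lambda>y. sf y * sf y"] vert_cont Xf_cont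
    by (simp add: Xf_integrals continuous_on_mult integral_unique[OF ss_has])
  finally show "I (\<lambda>z. (h (snd z) + trig1 C D z) ^ 2) = L * integral {0..H} (\<lambda>y. h y * h y) + L * H / 4 * (C\<^sup>2 + D\<^sup>2)"
    by simp
  have "(h (snd z) + trig1 C D z) ^ 3 = h (snd z) * h (snd z) * h (snd z) + 3 * (?X (fst z) * (h (snd z) * h (snd z) * sf (snd z)))
      + 3 * ((?X (fst z) * ?X (fst z)) * (h (snd z) * (sf (snd z) * sf (snd z))))
      + (?X (fst z) * ?X (fst z) * ?X (fst z)) * (sf (snd z) * sf (snd z) * sf (snd z))" for z
    unfolding trig1_X by (simp add: power3_eq_cube algebra_simps)
  then have "I (\<lambda>z. (h (snd z) + trig1 C D z) ^ 3) = I (\<lambda>z. h (snd z) * h (snd z) * h (snd z)) + 3 * I (\<lambda>z. ?X (fst z) * (h (snd z) * h (snd z) * sf (snd z)))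
      + 3 * I (\<lambda>z. (?X (fst z) * ?X (fst z)) * (h (snd z) * (sf (snd z) * sf (snd z))))
      + I (\<lambda>z. (?X (fst z) * ?X (fst z) * ?X (fst z)) * (sf (snd z) * sf (snd z) * sf (snd z)))"
    by (simp only:) (intro I_unique has_integral_add has_integral_mult_right I_has_integral continuous_intros k)
  also have "I (\<lambda>z. h (snd z) * h (snd z) * h (snd z)) = L * integral {0..H} (\<lambda>y. h y * h y * h y)"
    by (rule I_snd[of "\<lambda>y. h y * h y * h y"]) (intro continuous_intros h)
  also have "I (\<lambda>z. ?X (fst z) * (h (snd z) * h (snd z) * sf (snd z))) = 0"
    using I_prod[OF Xf_cont, of "\<lambda>y. h y * h y * sf y" C D] h vert_cont by (simp add: Xf_integrals continuous_on_mult)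
  also have "I (\<lambda>z. (?X (fst z) * ?X (fst z)) * (h (snd z) * (sf (snd z) * sf (snd z))))
      = L / 2 * (C\<^sup>2 + D\<^sup>2) * integral {0..H} (\<lambda>y. h y * (sf y * sf y))"
    using I_prod[of "\<lambda>x. ?X x * ?X x" "\<lambda>y. h y * (sf y * sf y)"] vert_cont Xf_cont h
    by (simp add: Xf_integrals continuous_on_mult)
  also have "I (\<lambda>z. (?X (fst z) * ?X (fst z) * ?X (fst z)) * (sf (snd z) * sf (snd z) * sf (snd z))) = 0"
    using I_prod[of "\<lambda>x. ?X x * ?X x * ?X x" "\<lambda>y. sf y * sf y * sf y"] vert_cont Xf_cont
    by (simp add: Xf_integrals continuous_on_mult)
  finally show "I (\<lambda>z. (h (snd z) + trig1 C D z) ^ 3) = L * integral {0..H} (\<lambda>y. h y * h y * h y)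
        + 3 / 2 * L * (C\<^sup>2 + D\<^sup>2) * integral {0..H} (\<lambda>y. h y * (sf y * sf y))"
    by simp
  have "snd z * (h (snd z) + trig1 C D z) = snd z * h (snd z) + ?X (fst z) * (snd z * sf (snd z))" for z
    unfolding trig1_X by (simp add: algebra_simps)
  then have "I (\<lambda>z. snd z * (h (snd z) + trig1 C D z)) = I (\<lambda>z. snd z * h (snd z)) + I (\<lambda>z. ?X (fst z) * (snd z * sf (snd z)))"
    by (simp only:) (intro I_unique has_integral_add I_has_integral continuous_intros k)
  also have "I (\<lambda>z. snd z * h (snd z)) = L * integral {0..H} (\<lambda>y. y * h y)"
    by (rule I_snd[of "\<lambda>y. y * h y"]) (intro continuous_intros h)
  also have "I (\<lambda>z. ?X (fst z) * (snd z * sf (snd z))) = 0"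
    using I_prod[OF Xf_cont, of "\<lambda>y. y * sf y" C D] vert_cont by (simp add: Xf_integrals continuous_on_mult)
  finally show "I (\<lambda>z. snd z * (h (snd z) + trig1 C D z)) = L * integral {0..H} (\<lambda>y. y * h y)" by simp
qed

lemma I_abs_sqrt:
  assumes f: "continuous_on K f" and le: "I (\<lambda>z. (f z)\<^sup>2) \<le> \<delta>"
  shows "I (\<lambda>z. \<bar>f z\<bar>) \<le> sqrt (L * H) * sqrt \<delta>"
proof -
  have "(I (\<lambda>z. 1 * \<bar>f z\<bar>))\<^sup>2 \<le> I (\<lambda>z. 1\<^sup>2) * I (\<lambda>z. \<bar>f z\<bar>\<^sup>2)"
    by (rule I_Cauchy_Schwarz) (intro continuous_intros f)+
  also have "\<dots> \<le> (L * H) * \<delta>"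
    using I_const[of 1] mult_left_mono[OF le, of "L * H"] L_pos H_pos by simp
  finally show ?thesis by (simp add: real_le_rsqrt real_sqrt_mult[symmetric])
qed

end

section \<open>Rigidity within the first eigenspace\<close>

lemma polar:
  fixes c d :: real
  obtains \<theta> where "c = sqrt (c\<^sup>2 + d\<^sup>2) * cos \<theta>" "d = sqrt (c\<^sup>2 + d\<^sup>2) * sin \<theta>"
proof (cases "c = 0 \<and> d = 0")
  case False
  define r where "r = sqrt (c\<^sup>2 + d\<^sup>2)"
  have r: "0 < r" unfolding r_def using False by (simp add: sum_power2_gt_zero_iff)
  have "(c / r)\<^sup>2 + (d / r)\<^sup>2 = 1"
  proof -
    have "c\<^sup>2 + d\<^sup>2 = r\<^sup>2" unfolding r_def by simp
    then show ?thesis unfolding power_divide add_divide_distrib[symmetric] using r by simp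
  qed
  then obtain t where "c / r = cos t" "d / r = sin t" using sincos_total_2pi by metis
  then have "c = r * cos t" "d = r * sin t" using r by (auto simp: field_simps)
  then show ?thesis using that unfolding r_def by blast
qed (use that in simp)

lemma sqrt_diff_le:
  fixes x y :: real
  assumes "0 \<le> x" "0 \<le> y"
  shows "\<bar>sqrt x - sqrt y\<bar> \<le> sqrt \<bar>x - y\<bar>"
proof (rule real_le_rsqrt)
  have "\<bar>sqrt x - sqrt y\<bar>\<^sup>2 \<le> \<bar>sqrt x - sqrt y\<bar> * (sqrt x + sqrt y)"
    unfolding power2_eq_square using assms by (intro mult_left_mono) (auto simp: abs_le_iff)
  also have "\<dots> = \<bar>(sqrt x - sqrt y) * (sqrt x + sqrt y)\<bar>" using assms by (simp add: abs_mult)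
  also have "(sqrt x - sqrt y) * (sqrt x + sqrt y) = x - y" using assms by (simp add: algebra_simps)
  finally show "\<bar>sqrt x - sqrt y\<bar>\<^sup>2 \<le> \<bar>x - y\<bar>" .
qed

lemma trapped:
  fixes f :: "real \<Rightarrow> real"
  assumes f: "continuous_on UNIV f" and 0: "\<bar>f 0\<bar> < r" and ne: "\<And>t. f t \<noteq> r" "\<And>t. f t \<noteq> - r"
  shows "\<bar>f t\<bar> < r"
proof (rule ccontr)
  assume n: "\<not> \<bar>f t\<bar> < r"
  have c: "connected (range f)" by (rule connected_continuous_image[OF f]) simp
  have "{f 0..f t} \<subseteq> range f" "{f t..f 0} \<subseteq> range f"
    by (rule connected_contains_Icc[OF c]; simp)+
  moreover have "r \<in> {f 0..f t} \<or> - r \<in> {f t..f 0}" using n 0 by auto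
  ultimately show False using ne by (metis imageE subsetD)
qed

text \<open>A nonzero polynomial has finitely many zeros, so some radius avoids them and their
  negatives. The zero at the origin may be degenerate: \<open>a1\<close> is arbitrary.\<close>

lemma cubic_zeros_isolated:
  fixes a1 a2 a3 r :: real
  assumes nz: "a2 \<noteq> 0 \<or> a3 \<noteq> 0" and r: "0 < r"
  defines "f \<equiv> \<lambda>x. a1 * x + a2 * x\<^sup>2 + a3 * x ^ 3"
  obtains s where "0 < s" "s \<le> r" "f s \<noteq> 0" "f (- s) \<noteq> 0"
proof -
  define c where "c i = [0, a1, a2, a3] ! i" for i
  have fc: "f x = (\<Sum>i\<le>3. c i * x ^ i)" for x
    unfolding f_def c_def by (simp add: numeral_eq_Suc algebra_simps)
  have "finite {x. f x = 0}"
    unfolding fc polyfun_finite_roots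
  proof -
    have "c 2 = a2" "c 3 = a3" unfolding c_def by (simp_all add: numeral_eq_Suc)
    then show "\<exists>i\<le>3. c i \<noteq> 0" using nz by (metis numeral_le_iff order_refl semiring_norm(69,72) one_le_numeral eval_nat_numeral(3) le_SucI)
  qed
  then have "finite ({x. f x = 0} \<union> uminus ` {x. f x = 0})" by simp
  moreover have "infinite {0<..r}" using r by simp
  ultimately obtain s where s: "s \<in> {0<..r}" "s \<notin> {x. f x = 0} \<union> uminus ` {x. f x = 0}"
    by (meson finite_subset subsetI)
  then have "f (- s) \<noteq> 0" by (auto simp: image_iff)
  then show ?thesis using s that[of s] by auto
qed

context channel
begin

lemma Lp_norm_Np:
  assumes "continuous_on K f" "0 < p"
  shows "Lp_norm L H p f = Np p f powr (1 / p)"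
  unfolding Lp_norm_def Np_def using cell_integral[OF powr_cont[OF assms]] by simp

lemma trig1_add: "trig1 (c + c') (d + d') z = trig1 c d z + trig1 c' d' z"
  unfolding trig1_def by (simp add: algebra_simps)

lemma trig_bound: "\<bar>trig1 c d z\<bar> \<le> \<bar>c\<bar> + \<bar>d\<bar>" "\<bar>trig2 a b z\<bar> \<le> \<bar>a\<bar> + \<bar>b\<bar>"
proof -
  have *: "\<bar>x * u\<bar> \<le> \<bar>x\<bar>" if "\<bar>u\<bar> \<le> 1" for x u :: real
    using that by (simp add: abs_mult mult_left_le)
  have "\<bar>trig1 c d z\<bar> \<le> \<bar>c * cos (k1 * fst z) + d * sin (k1 * fst z)\<bar>"
    unfolding trig1_def by (rule *) simp
  also have "\<dots> \<le> \<bar>c\<bar> + \<bar>d\<bar>"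
    using *[of "cos (k1 * fst z)" c] *[of "sin (k1 * fst z)" d] abs_triangle_ineq[of "c * cos (k1 * fst z)" "d * sin (k1 * fst z)"]
    by simp
  finally show "\<bar>trig1 c d z\<bar> \<le> \<bar>c\<bar> + \<bar>d\<bar>" .
  show "\<bar>trig2 a b z\<bar> \<le> \<bar>a\<bar> + \<bar>b\<bar>"
    unfolding trig2_def
    using *[of "sin (2 * k2 * snd z)" a] *[of "cos (2 * k2 * snd z)" b]
      abs_triangle_ineq[of "a * sin (2 * k2 * snd z)" "b * cos (2 * k2 * snd z)"] by simp
qed

text \<open>In polar form both functions are an amplitude times the cosine of a shifted phase times
  the same vertical factor. The translation \<alpha> aligns the phases, so only the amplitudes
  differ; it becomes the translation along the orbit.\<close>

lemma trig1_rotate: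
  "\<exists>\<alpha>. \<forall>x y. \<bar>trig1 C D (x, y) - trig1 c d (x + \<alpha>, y)\<bar> \<le> \<bar>sqrt (C\<^sup>2 + D\<^sup>2) - sqrt (c\<^sup>2 + d\<^sup>2)\<bar>"
proof -
  obtain \<theta>1 where 1: "C = sqrt (C\<^sup>2 + D\<^sup>2) * cos \<theta>1" "D = sqrt (C\<^sup>2 + D\<^sup>2) * sin \<theta>1" by (rule polar)
  obtain \<theta>0 where 0: "c = sqrt (c\<^sup>2 + d\<^sup>2) * cos \<theta>0" "d = sqrt (c\<^sup>2 + d\<^sup>2) * sin \<theta>0" by (rule polar)
  define R where "R = sqrt (C\<^sup>2 + D\<^sup>2)"
  define R0 where "R0 = sqrt (c\<^sup>2 + d\<^sup>2)"
  define \<alpha> where "\<alpha> = (\<theta>0 - \<theta>1) / k1"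
  have t: "trig1 (r * cos \<theta>) (r * sin \<theta>) (x, y) = r * (cos (k1 * x - \<theta>) * sin (k2 * y))" for r \<theta> x y
    unfolding trig1_def by (simp add: cos_diff algebra_simps)
  have "\<bar>trig1 C D (x, y) - trig1 c d (x + \<alpha>, y)\<bar> \<le> \<bar>R - R0\<bar>" for x y
  proof -
    have "k1 * (x + \<alpha>) - \<theta>0 = k1 * x - \<theta>1" unfolding \<alpha>_def using k_pos by (simp add: field_simps)
    then have "trig1 c d (x + \<alpha>, y) = R0 * (cos (k1 * x - \<theta>1) * sin (k2 * y))"
      using t[of R0 \<theta>0 "x + \<alpha>" y] 0[folded R0_def] by simp
    moreover have "trig1 C D (x, y) = R * (cos (k1 * x - \<theta>1) * sin (k2 * y))"
      using t[of R \<theta>1 x y] 1[folded R_def] by simp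
    ultimately have "\<bar>trig1 C D (x, y) - trig1 c d (x + \<alpha>, y)\<bar> = \<bar>R - R0\<bar> * (\<bar>cos (k1 * x - \<theta>1)\<bar> * \<bar>sin (k2 * y)\<bar>)"
      unfolding abs_mult[symmetric] by (simp add: algebra_simps)
    also have "\<dots> \<le> \<bar>R - R0\<bar> * 1"
      by (intro mult_left_mono mult_le_one) auto
    finally show ?thesis by simp
  qed
  then show ?thesis unfolding R_def R0_def by blast
qed

end

context steady
begin

context
  fixes c0 d0 :: real and ws :: "real \<Rightarrow> real"
begin

definition "R0 = c0\<^sup>2 + d0\<^sup>2"
definition "\<beta> = integral {0..H} (\<lambda>y. ws y * qf y)"
definition "\<gamma>1 = integral {0..H} (\<lambda>y. ws y * ws y * qf y)"
definition "\<gamma>2 = integral {0..H} (\<lambda>y. ws y * (qf y * qf y))"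
definition "\<sigma>0 = integral {0..H} (\<lambda>y. ws y * (sf y * sf y))"

text \<open>Eliminating \<open>R = (c0 + c)\<^sup>2 + (d0 + d)\<^sup>2\<close> between the conservation of the second and the third
  moment of the vorticity leaves a cubic equation for \<open>b\<close>. Its leading coefficient \<open>3 H / 4\<close> does
  not depend on the flow, so that the zero at \<open>b = 0\<close> is isolated.\<close>

definition pol :: "real \<Rightarrow> real" where
  "pol b = (if La1 < Lb then 2 * \<beta> * b + H / 2 * b\<^sup>2 + 0 * b ^ 3
     else (3 * \<gamma>1 - 12 / H * \<beta> * \<sigma>0 - 3 * H / 8 * R0) * b + (3 * \<gamma>2 - 3 * \<sigma>0 + 3 * \<beta>) * b\<^sup>2 + 3 * H / 4 * b ^ 3)"

text \<open>The difference of second moments from \<open>moment_differences\<close>, multiplied by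
  \<open>4 / (H * L)\<close>. When it is small, the amplitude of the x_1-dependent mode is
  determined by \<open>b\<close>.\<close>

definition defect :: "real \<Rightarrow> real \<Rightarrow> real \<Rightarrow> real" where
  "defect b c d = (c0 + c)\<^sup>2 + (d0 + d)\<^sup>2 - R0 + 8 / H * \<beta> * b + 2 * b\<^sup>2"

text \<open>If \<open>La1 < Lb\<close>, no mode depends on x_1 and the second moment alone gives a
  quadratic with leading coefficient \<open>H / 2\<close>. Otherwise the cubic coefficient
  \<open>3 * H / 4\<close> is the one known to be nonzero.\<close>

lemma pol_isolated:
  assumes "0 < r"
  obtains s where "0 < s" "s \<le> r" "pol s \<noteq> 0" "pol (- s) \<noteq> 0"
proof (cases "La1 < Lb")
  case True
  then show ?thesis
    using cubic_zeros_isolated[of "H / 2" 0 r "2 * \<beta>"] assms H_pos that unfolding pol_def by auto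
next
  case False
  then show ?thesis
    using cubic_zeros_isolated[of "3 * \<gamma>2 - 3 * \<sigma>0 + 3 * \<beta>" "3 * H / 4" r "3 * \<gamma>1 - 12 / H * \<beta> * \<sigma>0 - 3 * H / 8 * R0"]
      assms H_pos that unfolding pol_def by auto
qed

context
  assumes cd0: "La1 < Lb \<Longrightarrow> c0 = 0 \<and> d0 = 0" and wsc: "continuous_on {0..H} ws"
    and wbd: "\<And>x y. y \<in> {0..H} \<Longrightarrow> wb (x, y) = trig1 c0 d0 (x, y) + ws y"
begin

text \<open>The sine component is absent from \<open>u0\<close>, since the impulse makes it
  negligible. The cube of \<open>qf\<close> integrates to zero, and the only cubic contribution
  comes from the term \<open>b * R\<close>: the second moment supplies \<open>- 2 * b^2\<close> in
  \<open>R\<close>, which turns \<open>- 3 / 8 * H * b * R\<close> into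
  \<open>3 / 4 * H * b^3\<close>.\<close>

lemma moment_differences:
  fixes b c d :: real
  defines "u0 \<equiv> \<lambda>z. (ws (snd z) + b * qf (snd z)) + trig1 (c0 + c) (d0 + d) z"
    and "R \<equiv> (c0 + c)\<^sup>2 + (d0 + d)\<^sup>2"
  shows "I (\<lambda>z. u0 z ^ 2) - I (\<lambda>z. wb z ^ 2) = L * (2 * b * \<beta> + b\<^sup>2 * (H / 2) + H / 4 * (R - R0))"
    "I (\<lambda>z. u0 z ^ 3) - I (\<lambda>z. wb z ^ 3)
      = L * (3 * b * \<gamma>1 + 3 * b\<^sup>2 * \<gamma>2 + 3 / 2 * (R - R0) * \<sigma>0 - 3 / 8 * H * b * R)"
proof -
  define h where "h y = ws y + b * qf y" for y
  have hc: "continuous_on {0..H} h" unfolding h_def by (intro continuous_intros wsc vert_cont)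
  note ii = integrable_integral[OF integrable_continuous_interval]
  have h2: "integral {0..H} (\<lambda>y. h y * h y) = integral {0..H} (\<lambda>y. ws y * ws y) + (2 * b) * \<beta> + b\<^sup>2 * (H / 2)"
  proof -
    have "((\<lambda>y. ws y * ws y + (2 * b) * (ws y * qf y) + b\<^sup>2 * (qf y * qf y)) has_integral
       integral {0..H} (\<lambda>y. ws y * ws y) + (2 * b) * \<beta> + b\<^sup>2 * (H / 2)) {0..H}"
      unfolding \<beta>_def by (intro has_integral_add has_integral_mult_right vert_has ii continuous_intros wsc vert_cont)
    from integral_unique[OF this] show ?thesis unfolding h_def by (simp add: algebra_simps power2_eq_square)
  qed
  have h3: "integral {0..H} (\<lambda>y. h y * h y * h y) = integral {0..H} (\<lambda>y. ws y * ws y * ws y) + (3 * b) * \<gamma>1 + (3 * b\<^sup>2) * \<gamma>2 + b ^ 3 * 0"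
  proof -
    have "((\<lambda>y. ws y * ws y * ws y + (3 * b) * (ws y * ws y * qf y) + (3 * b\<^sup>2) * (ws y * (qf y * qf y)) + b ^ 3 * (qf y * (qf y * qf y))) has_integral
       integral {0..H} (\<lambda>y. ws y * ws y * ws y) + (3 * b) * \<gamma>1 + (3 * b\<^sup>2) * \<gamma>2 + b ^ 3 * 0) {0..H}"
      unfolding \<gamma>1_def \<gamma>2_def by (intro has_integral_add has_integral_mult_right qqq_has ii continuous_intros wsc vert_cont)
    from integral_unique[OF this] show ?thesis unfolding h_def by (simp add: algebra_simps power2_eq_square power3_eq_cube)
  qed
  have hs: "integral {0..H} (\<lambda>y. h y * (sf y * sf y)) = \<sigma>0 + b * (- H / 4)"
  proof -
    have "((\<lambda>y. ws y * (sf y * sf y) + b * (qf y * (sf y * sf y))) has_integral \<sigma>0 + b * (- H / 4)) {0..H}"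
      unfolding \<sigma>0_def by (intro has_integral_add has_integral_mult_right qss_has ii continuous_intros wsc vert_cont)
    from integral_unique[OF this] show ?thesis unfolding h_def by (simp add: algebra_simps)
  qed
  have wbI: "I (\<lambda>z. wb z ^ n) = I (\<lambda>z. (ws (snd z) + trig1 c0 d0 z) ^ n)" for n
    by (rule I_cong) (use wbd in \<open>auto simp: mem_K add.commute\<close>)
  note m = moments[OF hc, of "c0 + c" "d0 + d", folded R_def] moments[OF wsc, of c0 d0, folded R0_def]
  have u: "u0 = (\<lambda>z. h (snd z) + trig1 (c0 + c) (d0 + d) z)" unfolding u0_def h_def ..
  show "I (\<lambda>z. u0 z ^ 2) - I (\<lambda>z. wb z ^ 2) = L * (2 * b * \<beta> + b\<^sup>2 * (H / 2) + H / 4 * (R - R0))"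
    unfolding u wbI m(1,4) h2 by (simp add: field_simps)
  show "I (\<lambda>z. u0 z ^ 3) - I (\<lambda>z. wb z ^ 3)
      = L * (3 * b * \<gamma>1 + 3 * b\<^sup>2 * \<gamma>2 + 3 / 2 * (R - R0) * \<sigma>0 - 3 / 8 * H * b * R)"
    unfolding u wbI m(2,5) h3 hs \<sigma>0_def[symmetric] by (simp add: field_simps)
qed

text \<open>The state controls a squared L^2 distance by \<delta>, hence an L^1 distance by the root
  of \<delta>; the moments inherit this order because all functions involved are uniformly bounded.
  The constants follow the proof: \<open>B\<close> bounds the coefficients, \<open>Ca\<close> the
  impulse, \<open>C2\<close> and \<open>C3\<close> the second and third moments.\<close>

lemma state_bounds:
  "\<exists>C\<ge>0. \<forall>\<delta> \<eta> a b c d. 0 \<le> \<delta> \<longrightarrow> \<delta> \<le> 1 \<longrightarrow> state \<delta> \<eta> a b c d \<longrightarrow>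
     \<bar>a\<bar> \<le> C * sqrt \<delta> \<and> \<bar>pol b\<bar> \<le> C * sqrt \<delta> \<and> \<bar>defect b c d\<bar> \<le> C * sqrt \<delta> \<and>
     (\<forall>z\<in>K. \<bar>\<eta> z - wb z - (trig2 a b z + trig1 c d z)\<bar> \<le> C)"
proof -
  have LH: "0 < L * H" using L_pos H_pos by simp
  define A where "A = 2 + 2 * ((2 * Mg)\<^sup>2 * (L * H))"
  define B where "B = sqrt (4 * A / (L * H))"
  define q2 where "q2 = sqrt (L * H)"
  define Ca where "Ca = 2 * k2 / (L * H) * (1 + H * q2)"
  define M1 where "M1 = Mg + 5 * B"
  define C1 where "C1 = q2 + L * H * Ca"
  define C2 where "C2 = 1 + 2 * M1 * C1"
  define C3 where "C3 = 1 + 3 * M1\<^sup>2 * C1"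
  define Cd where "Cd = 4 / (H * L) * C2"
  define Cp where "Cp = C2 / L + C3 / L + 3 / 2 * \<bar>\<sigma>0\<bar> * Cd + 3 * H / 8 * B * Cd"
  define C where "C = Ca + Cp + Cd + (2 * Mg + 4 * B)"
  have A0: "0 \<le> A" unfolding A_def using LH by simp
  have B0: "0 \<le> B" unfolding B_def using A0 LH by simp
  have q0: "0 \<le> q2" unfolding q2_def using LH by simp
  have Ca0: "0 \<le> Ca" unfolding Ca_def using LH k_pos q0 H_pos by simp
  have M0: "0 \<le> M1" unfolding M1_def using M_nonneg B0 by simp
  have C10: "0 \<le> C1" unfolding C1_def using q0 Ca0 LH by simp
  have C20: "0 \<le> C2" "0 \<le> C3" unfolding C2_def C3_def using M0 C10 by simp_all
  have Cd0: "0 \<le> Cd" unfolding Cd_def using C20 L_pos H_pos by simp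
  have Cp0: "0 \<le> Cp" unfolding Cp_def using C20 Cd0 B0 L_pos H_pos by simp
  have Cle: "Ca \<le> C" "Cp \<le> C" "Cd \<le> C" "2 * Mg + 4 * B \<le> C" "0 \<le> C"
    unfolding C_def using Ca0 Cp0 Cd0 B0 M_nonneg by auto
  have wbK: "continuous_on K wb" by (rule K_cont[OF wb_cont])
  have main: "\<bar>a\<bar> \<le> C * sqrt \<delta> \<and> \<bar>pol b\<bar> \<le> C * sqrt \<delta> \<and> \<bar>defect b c d\<bar> \<le> C * sqrt \<delta> \<and>
     (\<forall>z\<in>K. \<bar>\<eta> z - wb z - (trig2 a b z + trig1 c d z)\<bar> \<le> C)"
    if \<delta>: "0 \<le> \<delta>" "\<delta> \<le> 1" and st: "state \<delta> \<eta> a b c d" for \<delta> \<eta> a b c d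
  proof -
    define s where "s = sqrt \<delta>"
    have s0: "0 \<le> s" unfolding s_def using \<delta> by simp
    have \<delta>s: "\<delta> \<le> s"
    proof -
      have "\<delta> * \<delta> \<le> \<delta>" using \<delta> by (simp add: mult_left_le)
      then show ?thesis unfolding s_def by (simp add: real_le_rsqrt power2_eq_square)
    qed
    have \<eta>c: "continuous_on K \<eta>" and \<eta>b: "\<And>z. z \<in> K \<Longrightarrow> \<bar>\<eta> z\<bar> \<le> Mg"
      and near: "I (\<lambda>z. (\<eta> z - wb z - (trig2 a b z + trig1 c d z))\<^sup>2) \<le> \<delta>"
      and m2: "\<bar>I (\<lambda>z. \<eta> z ^ 2) - I (\<lambda>z. wb z ^ 2)\<bar> \<le> \<delta>" and m3: "\<bar>I (\<lambda>z. \<eta> z ^ 3) - I (\<lambda>z. wb z ^ 3)\<bar> \<le> \<delta>"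
      and my: "\<bar>I (\<lambda>z. snd z * (\<eta> z - wb z))\<bar> \<le> \<delta>" and cdz: "La1 < Lb \<longrightarrow> c = 0 \<and> d = 0"
      using st unfolding state_def by auto
    define e where "e z = trig2 a b z + trig1 c d z" for z
    define wa where "wa y = a * pf y + b * qf y" for y
    have ewa: "e z = wa (snd z) + trig1 c d z" for z unfolding e_def wa_def trig2_pq ..
    have wac: "continuous_on {0..H} wa" unfolding wa_def by (intro continuous_intros vert_cont)
    have ec: "continuous_on K e" unfolding e_def by (intro continuous_intros trig_cont)
    define f where "f z = \<eta> z - wb z - e z" for z
    have fc: "continuous_on K f" unfolding f_def by (intro continuous_intros \<eta>c wbK ec)
    have f2: "I (\<lambda>z. (f z)\<^sup>2) \<le> \<delta>" using near unfolding f_def e_def .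
    have diffb: "\<bar>\<eta> z - wb z\<bar> \<le> 2 * Mg" if "z \<in> K" for z
      using \<eta>b[OF that] range_bound[OF wb_mem[OF that]] by linarith
    have "I (\<lambda>z. (e z)\<^sup>2) = L * H / 2 * (a\<^sup>2 + b\<^sup>2) + L * H / 4 * (c\<^sup>2 + d\<^sup>2)"
    proof -
      have "((\<lambda>y. a\<^sup>2 * (pf y * pf y) + b\<^sup>2 * (qf y * qf y) + (2 * a * b) * (pf y * qf y)) has_integral
          a\<^sup>2 * (H / 2) + b\<^sup>2 * (H / 2) + (2 * a * b) * 0) {0..H}"
        by (intro has_integral_add has_integral_mult_right vert_has)
      from integral_unique[OF this]
      have "integral {0..H} (\<lambda>y. wa y * wa y) = H / 2 * (a\<^sup>2 + b\<^sup>2)"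
        unfolding wa_def by (simp add: algebra_simps power2_eq_square)
      then show ?thesis unfolding ewa moments(1)[OF wac] by simp
    qed
    moreover have "I (\<lambda>z. (e z)\<^sup>2) \<le> A"
    proof -
      have "I (\<lambda>z. (e z)\<^sup>2) = I (\<lambda>z. (- f z + (\<eta> z - wb z))\<^sup>2)" unfolding f_def by simp
      also have "\<dots> \<le> 2 * I (\<lambda>z. (- f z)\<^sup>2) + 2 * I (\<lambda>z. (\<eta> z - wb z)\<^sup>2)"
        by (rule I_sum_sq) (intro continuous_intros fc \<eta>c wbK)+
      also have "I (\<lambda>z. (- f z)\<^sup>2) \<le> 1" using f2 \<delta> by simp
      also have "I (\<lambda>z. (\<eta> z - wb z)\<^sup>2) \<le> I (\<lambda>z. (2 * Mg)\<^sup>2)"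
      proof (rule I_mono)
        show "(\<eta> z - wb z)\<^sup>2 \<le> (2 * Mg)\<^sup>2" if "z \<in> K" for z
          using diffb[OF that] by (metis abs_le_square_iff abs_of_nonneg abs_ge_zero order_trans)
      qed (intro continuous_intros \<eta>c wbK)+
      finally show ?thesis unfolding I_const A_def by simp
    qed
    ultimately have sq: "L * H / 2 * (a\<^sup>2 + b\<^sup>2) + L * H / 4 * (c\<^sup>2 + d\<^sup>2) \<le> A" by simp
    \<comment> \<open>The modes are mutually orthogonal with squared norms at least
      \<open>L * H / 4\<close>, so the L^2 bound on \<open>e\<close> bounds every
      coefficient.\<close>
    have coef: "\<bar>x\<bar> \<le> B" if "x\<^sup>2 \<le> a\<^sup>2 + b\<^sup>2 + c\<^sup>2 + d\<^sup>2" for x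
    proof -
      have "0 \<le> L * H / 4 * (a\<^sup>2 + b\<^sup>2)" using LH by simp
      then have "L * H / 4 * (a\<^sup>2 + b\<^sup>2 + c\<^sup>2 + d\<^sup>2) \<le> A" using sq by (simp add: algebra_simps)
      moreover have "L * H / 4 * x\<^sup>2 \<le> L * H / 4 * (a\<^sup>2 + b\<^sup>2 + c\<^sup>2 + d\<^sup>2)"
        using that LH by (intro mult_left_mono) auto
      ultimately have "L * H / 4 * x\<^sup>2 \<le> A" by simp
      then have "x\<^sup>2 \<le> 4 * A / (L * H)" using LH by (simp add: field_simps)
      then show ?thesis unfolding B_def by (simp add: real_le_rsqrt)
    qed
    have ab: "\<bar>a\<bar> \<le> B" "\<bar>b\<bar> \<le> B" "\<bar>c\<bar> \<le> B" "\<bar>d\<bar> \<le> B" by (rule coef; simp)+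
    have eb: "\<bar>e z\<bar> \<le> 4 * B" for z
      using trig_bound(1)[of c d z] trig_bound(2)[of a b z] ab unfolding e_def by linarith
    have fb: "\<bar>f z\<bar> \<le> 2 * Mg + 4 * B" if "z \<in> K" for z
      using diffb[OF that] eb[of z] unfolding f_def by linarith
    have f1: "I (\<lambda>z. \<bar>f z\<bar>) \<le> q2 * s"
      unfolding q2_def s_def by (rule I_abs_sqrt[OF fc f2])
    have a_bound: "\<bar>a\<bar> \<le> Ca * s"
    proof -
      have sc: "continuous_on K (\<lambda>z. snd z)" by (intro continuous_intros)
      have "((\<lambda>y. a * (y * pf y) + b * (y * qf y)) has_integral a * (- H / (2 * k2)) + b * 0) {0..H}"
        by (intro has_integral_add has_integral_mult_right y_has)
      from integral_unique[OF this] have "integral {0..H} (\<lambda>y. y * wa y) = - (a * H / (2 * k2))"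
        unfolding wa_def by (simp add: algebra_simps)
      then have Ie: "I (\<lambda>z. snd z * e z) = - (a * L * H / (2 * k2))"
        unfolding ewa moments(3)[OF wac] by simp
      have "I (\<lambda>z. snd z * (\<eta> z - wb z)) = I (\<lambda>z. snd z * f z + snd z * e z)"
        unfolding f_def by (simp add: algebra_simps)
      also have "\<dots> = I (\<lambda>z. snd z * f z) + I (\<lambda>z. snd z * e z)"
        by (rule I_add) (intro continuous_intros fc ec)+
      finally have "a * L * H / (2 * k2) = I (\<lambda>z. snd z * f z) - I (\<lambda>z. snd z * (\<eta> z - wb z))"
        unfolding Ie by simp
      moreover have "\<bar>I (\<lambda>z. snd z * f z)\<bar> \<le> H * (q2 * s)"
        by (rule I_weighted[OF fc sc _ f1]) (use H_pos in \<open>auto simp: K_def\<close>)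
      ultimately have "\<bar>a * L * H / (2 * k2)\<bar> \<le> H * (q2 * s) + \<delta>" using my by linarith
      also have "\<dots> \<le> (1 + H * q2) * s" using \<delta>s by (simp add: algebra_simps)
      finally have "\<bar>a\<bar> * (L * H / (2 * k2)) \<le> (1 + H * q2) * s"
        using L_pos H_pos k_pos by (simp add: abs_mult)
      then have "\<bar>a\<bar> \<le> (1 + H * q2) * s / (L * H / (2 * k2))"
        using LH k_pos by (subst pos_le_divide_eq) auto
      also have "\<dots> = Ca * s" unfolding Ca_def by simp
      finally show ?thesis .
    qed
    \<comment> \<open>The comparison function whose moments are explicit: the steady vorticity plus
      the eigenspace component, with the sine part removed at a cost of order |a|.\<close>
    define u0 where "u0 z = (ws (snd z) + b * qf (snd z)) + trig1 (c0 + c) (d0 + d) z" for z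
    have u0c: "continuous_on K u0"
      unfolding u0_def[abs_def] by (intro continuous_intros cont_snd[OF wsc] cont_snd[OF vert_cont(1)] trig_cont)
    have u0: "u0 z = wb z + e z - a * pf (snd z)" if "z \<in> K" for z
    proof -
      have "wb z = trig1 c0 d0 z + ws (snd z)" using wbd[of "snd z" "fst z"] that unfolding K_def by auto
      then show ?thesis unfolding u0_def e_def trig2_pq trig1_add by simp
    qed
    have apf: "\<bar>a * pf y\<bar> \<le> \<bar>a\<bar>" for y
      unfolding pf_def abs_mult by (rule mult_left_le) auto
    have u0b: "\<bar>u0 z\<bar> \<le> M1" if "z \<in> K" for z
      using u0[OF that] range_bound[OF wb_mem[OF that]] eb[of z] apf[of "snd z"] ab unfolding M1_def by linarith
    have \<eta>b': "\<bar>\<eta> z\<bar> \<le> M1" if "z \<in> K" for z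
      using \<eta>b[OF that] B0 unfolding M1_def by linarith
    have d1: "I (\<lambda>z. \<bar>\<eta> z - u0 z\<bar>) \<le> C1 * s"
    proof -
      have "I (\<lambda>z. \<bar>\<eta> z - u0 z\<bar>) \<le> I (\<lambda>z. \<bar>f z\<bar> + \<bar>a\<bar>)"
      proof (rule I_mono)
        fix z assume z: "z \<in> K"
        show "\<bar>\<eta> z - u0 z\<bar> \<le> \<bar>f z\<bar> + \<bar>a\<bar>"
          unfolding u0[OF z] f_def using apf[of "snd z"] by linarith
      qed (intro continuous_intros \<eta>c u0c fc)+
      also have "\<dots> = I (\<lambda>z. \<bar>f z\<bar>) + I (\<lambda>z. \<bar>a\<bar>)" by (rule I_add) (intro continuous_intros fc)+
      also have "\<dots> \<le> q2 * s + Ca * s * (L * H)"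
        unfolding I_const using f1 a_bound LH by (intro add_mono mult_right_mono) auto
      finally show ?thesis unfolding C1_def by (simp add: algebra_simps)
    qed
    have mom: "\<bar>I (\<lambda>z. u0 z ^ n) - I (\<lambda>z. wb z ^ n)\<bar> \<le> (1 + k * C1) * s"
      if mn: "\<bar>I (\<lambda>z. \<eta> z ^ n) - I (\<lambda>z. wb z ^ n)\<bar> \<le> \<delta>" and k0: "0 \<le> k"
        and lip: "\<And>x y. \<bar>x\<bar> \<le> M1 \<Longrightarrow> \<bar>y\<bar> \<le> M1 \<Longrightarrow> \<bar>x ^ n - y ^ n\<bar> \<le> k * \<bar>x - y\<bar>" for n k
    proof -
      have "\<bar>I (\<lambda>z. \<eta> z ^ n) - I (\<lambda>z. u0 z ^ n)\<bar> = \<bar>I (\<lambda>z. \<eta> z ^ n - u0 z ^ n)\<bar>"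
        by (subst I_diff) (auto intro!: continuous_intros \<eta>c u0c)
      also have "\<dots> \<le> I (\<lambda>z. \<bar>\<eta> z ^ n - u0 z ^ n\<bar>)" by (rule I_abs) (intro continuous_intros \<eta>c u0c)
      also have "\<dots> \<le> I (\<lambda>z. k * \<bar>\<eta> z - u0 z\<bar>)"
        by (rule I_mono) (auto intro!: continuous_intros \<eta>c u0c lip \<eta>b' u0b)
      also have "\<dots> \<le> k * (C1 * s)" unfolding I_cmult using d1 k0 by (rule mult_left_mono)
      finally have "\<bar>I (\<lambda>z. u0 z ^ n) - I (\<lambda>z. wb z ^ n)\<bar> \<le> k * (C1 * s) + s" using mn \<delta>s by linarith
      then show ?thesis by (simp add: algebra_simps)
    qed
    have sec: "\<bar>I (\<lambda>z. u0 z ^ 2) - I (\<lambda>z. wb z ^ 2)\<bar> \<le> C2 * s"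
      unfolding C2_def
    proof (rule mom[OF m2])
      fix x y :: real assume xy: "\<bar>x\<bar> \<le> M1" "\<bar>y\<bar> \<le> M1"
      have "\<bar>x ^ 2 - y ^ 2\<bar> = \<bar>x + y\<bar> * \<bar>x - y\<bar>" unfolding abs_mult[symmetric] by (simp add: power2_eq_square algebra_simps)
      also have "\<dots> \<le> 2 * M1 * \<bar>x - y\<bar>" using xy by (intro mult_right_mono) auto
      finally show "\<bar>x ^ 2 - y ^ 2\<bar> \<le> 2 * M1 * \<bar>x - y\<bar>" .
    qed (use M0 in simp)
    have thd: "\<bar>I (\<lambda>z. u0 z ^ 3) - I (\<lambda>z. wb z ^ 3)\<bar> \<le> C3 * s"
      unfolding C3_def
    proof (rule mom[OF m3])
      fix x y :: real assume xy: "\<bar>x\<bar> \<le> M1" "\<bar>y\<bar> \<le> M1"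
      have "\<bar>x * x\<bar> \<le> M1 * M1" "\<bar>x * y\<bar> \<le> M1 * M1" "\<bar>y * y\<bar> \<le> M1 * M1"
        unfolding abs_mult using xy M0 by (intro mult_mono; simp)+
      then have "\<bar>x * x + x * y + y * y\<bar> \<le> 3 * M1\<^sup>2" unfolding power2_eq_square by linarith
      moreover have "\<bar>x ^ 3 - y ^ 3\<bar> = \<bar>x * x + x * y + y * y\<bar> * \<bar>x - y\<bar>"
        unfolding abs_mult[symmetric] by (simp add: power3_eq_cube algebra_simps)
      ultimately show "\<bar>x ^ 3 - y ^ 3\<bar> \<le> 3 * M1\<^sup>2 * \<bar>x - y\<bar>" by (simp add: mult_right_mono)
    qed (use M0 in simp)
    define R where "R = (c0 + c)\<^sup>2 + (d0 + d)\<^sup>2"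
    define S2 where "S2 = 2 * b * \<beta> + b\<^sup>2 * (H / 2) + H / 4 * (R - R0)"
    define S3 where "S3 = 3 * b * \<gamma>1 + 3 * b\<^sup>2 * \<gamma>2 + 3 / 2 * (R - R0) * \<sigma>0 - 3 / 8 * H * b * R"
    define r where "r = defect b c d"
    have "I (\<lambda>z. u0 z ^ 2) - I (\<lambda>z. wb z ^ 2) = L * S2" "I (\<lambda>z. u0 z ^ 3) - I (\<lambda>z. wb z ^ 3) = L * S3"
      unfolding S2_def S3_def R_def u0_def by (rule moment_differences)+
    then have LS: "\<bar>L * S2\<bar> \<le> C2 * s" "\<bar>L * S3\<bar> \<le> C3 * s" using sec thd by simp_all
    have S2: "\<bar>S2\<bar> \<le> C2 / L * s" using LS(1) L_pos by (simp add: abs_mult field_simps)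
    have S3: "\<bar>S3\<bar> \<le> C3 / L * s" using LS(2) L_pos by (simp add: abs_mult field_simps)
    have rS: "r = 4 / H * S2"
      unfolding r_def defect_def S2_def R_def using H_pos by (simp add: field_simps)
    have r: "\<bar>r\<bar> \<le> Cd * s"
    proof -
      have "\<bar>r\<bar> = 4 / H * \<bar>S2\<bar>" unfolding rS abs_mult using H_pos by simp
      also have "\<dots> \<le> 4 / H * (C2 / L * s)" using S2 H_pos by (intro mult_left_mono) auto
      also have "\<dots> = Cd * s" unfolding Cd_def by simp
      finally show ?thesis .
    qed
    have "\<bar>pol b\<bar> \<le> Cp * s"
    proof (cases "La1 < Lb")
      case True
      then have "R = 0" "R0 = 0" unfolding R_def R0_def using cd0 cdz by auto
      then have "pol b = S2" unfolding pol_def S2_def using True by simp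
      then have "\<bar>pol b\<bar> \<le> C2 / L * s" using S2 by simp
      also have "\<dots> \<le> Cp * s" unfolding Cp_def using s0 C20 Cd0 B0 L_pos H_pos by (intro mult_right_mono) auto
      finally show ?thesis .
    next
      case False
      \<comment> \<open>The second moment, solved for \<open>R\<close> with error \<open>r\<close>,
        is inserted into the third. What remains is \<open>pol b\<close> plus multiples of
        \<open>r\<close> with bounded coefficients.\<close>
      have Re: "R = R0 + r - 8 / H * \<beta> * b - 2 * b\<^sup>2" unfolding r_def defect_def R_def by simp
      have "pol b = S3 - 3 / 2 * \<sigma>0 * r + 3 * H / 8 * b * r"
        unfolding S3_def pol_def Re using False H_pos by (simp add: field_simps power2_eq_square power3_eq_cube)
      then have "\<bar>pol b\<bar> \<le> \<bar>S3\<bar> + 3 / 2 * \<bar>\<sigma>0\<bar> * \<bar>r\<bar> + 3 * H / 8 * \<bar>b\<bar> * \<bar>r\<bar>"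
        using H_pos abs_triangle_ineq4[of S3 "3 / 2 * \<sigma>0 * r"] abs_triangle_ineq[of "S3 - 3 / 2 * \<sigma>0 * r" "3 * H / 8 * b * r"]
        by (simp add: abs_mult)
      also have "\<dots> \<le> C3 / L * s + 3 / 2 * \<bar>\<sigma>0\<bar> * (Cd * s) + 3 * H / 8 * B * (Cd * s)"
        using S3 r ab B0 H_pos by (intro add_mono mult_mono mult_left_mono) auto
      also have "\<dots> = (C3 / L + 3 / 2 * \<bar>\<sigma>0\<bar> * Cd + 3 * H / 8 * B * Cd) * s" by (simp add: algebra_simps)
      also have "\<dots> \<le> Cp * s" unfolding Cp_def using s0 C20 L_pos by (intro mult_right_mono) auto
      finally show ?thesis .
    qed
    moreover have "Ca * s \<le> C * s" "Cp * s \<le> C * s" "Cd * s \<le> C * s"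
      using Cle s0 by (auto intro!: mult_right_mono)
    ultimately show ?thesis
      using a_bound r fb Cle(4) unfolding s_def r_def f_def e_def by (auto intro: order_trans)
  qed
  show ?thesis by (intro exI[of _ C]) (use main Cle in blast)
qed

end

end

end

section \<open>Orbital stability in L^p\<close>

lemma abs_powr_sum3:
  fixes x y z p :: real
  assumes "0 < p"
  shows "\<bar>x + y + z\<bar> powr p \<le> 3 powr p * (\<bar>x\<bar> powr p + \<bar>y\<bar> powr p + \<bar>z\<bar> powr p)"
proof -
  define m where "m = max \<bar>x\<bar> (max \<bar>y\<bar> \<bar>z\<bar>)"
  have "\<bar>x + y + z\<bar> \<le> 3 * m" unfolding m_def by linarith
  then have "\<bar>x + y + z\<bar> powr p \<le> (3 * m) powr p" using assms by (intro powr_mono2) auto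
  also have "\<dots> = 3 powr p * m powr p" by (rule powr_mult)
  also have "m powr p \<le> \<bar>x\<bar> powr p + \<bar>y\<bar> powr p + \<bar>z\<bar> powr p"
    unfolding m_def max_def by auto
  finally show ?thesis by simp
qed

text \<open>Treats exponents below and above 2 alike: values under the threshold \<tau> are
  estimated by it, and those above satisfy \<open>1 \<le> x^2 / \<tau>^2\<close>, as in Chebyshev's
  inequality.\<close>

lemma powr_le_square:
  fixes x M p \<tau> :: real
  assumes p: "0 < p" and x: "\<bar>x\<bar> \<le> M" and \<tau>: "0 < \<tau>"
  shows "\<bar>x\<bar> powr p \<le> \<tau> powr p + M powr p / \<tau>\<^sup>2 * x\<^sup>2"
proof (cases "\<bar>x\<bar> \<le> \<tau>")
  case True
  then have "\<bar>x\<bar> powr p \<le> \<tau> powr p" using p by (intro powr_mono2) auto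
  then show ?thesis by (simp add: add_increasing2)
next
  case False
  have "\<tau>\<^sup>2 \<le> x\<^sup>2" using False \<tau> by (simp add: abs_le_square_iff[symmetric])
  then have "1 \<le> x\<^sup>2 / \<tau>\<^sup>2" using \<tau> by simp
  have "\<bar>x\<bar> powr p \<le> M powr p" using x p by (intro powr_mono2) auto
  also have "\<dots> \<le> M powr p * (x\<^sup>2 / \<tau>\<^sup>2)"
    using mult_left_mono[OF \<open>1 \<le> x\<^sup>2 / \<tau>\<^sup>2\<close>, of "M powr p"] by simp
  finally show ?thesis by (simp add: add_increasing)
qed

context steady
begin

lemma orbit_close:
  assumes p: "1 < p" and \<rho>: "0 < \<rho>"
  shows "\<exists>\<nu>0>0. \<exists>C\<ge>0. \<forall>v1 v2 P. euler_flow L H v1 v2 P \<longrightarrow>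
     (\<forall>\<nu>. \<nu> = Np p (\<lambda>z. vorticity H v1 v2 (0, z) - wb z) powr (1 / p) \<longrightarrow> \<nu> < \<nu>0 \<longrightarrow>
       (\<forall>t::real. \<exists>\<alpha> f1 f2 f3. continuous_on K f1 \<and> continuous_on K f2 \<and> continuous_on K f3 \<and>
          (\<forall>z\<in>K. vorticity H v1 v2 (t, z) - wb (z + (\<alpha>, 0)) = f1 z + f2 z + f3 z) \<and>
          Np p f1 powr (1 / p) \<le> \<nu> \<and>
          I (\<lambda>z. (f2 z)\<^sup>2) \<le> C * \<nu> \<and> (\<forall>z\<in>K. \<bar>f2 z\<bar> \<le> C) \<and>
          (\<forall>z\<in>K. \<bar>f3 z\<bar> \<le> \<rho>)))"
proof -
  obtain c0 d0 ws where cd0: "La1 < Lb \<Longrightarrow> c0 = 0 \<and> d0 = 0" and wsc: "continuous_on {0..H} ws"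
    and wbd: "\<And>x y. y \<in> {0..H} \<Longrightarrow> wb (x, y) = trig1 c0 d0 (x, y) + ws y"
    using wb_decomposition by blast
  note asm = cd0 wsc wbd
  define pl where "pl = pol c0 d0 ws"
  define be where "be = \<beta> ws"
  obtain C1 where C1: "0 \<le> C1" and summary: "\<forall>v1 v2 P. euler_flow L H v1 v2 P \<longrightarrow>
     (\<forall>\<nu>. \<nu> = Np p (\<lambda>z. vorticity H v1 v2 (0, z) - wb z) powr (1 / p) \<longrightarrow> \<nu> \<le> 1 \<longrightarrow>
     (\<exists>bf. continuous_on UNIV bf \<and> \<bar>bf 0\<bar> \<le> C1 * \<nu> \<and>
       (\<forall>t::real. \<exists>\<eta> a c d. state (C1 * \<nu>) \<eta> a (bf t) c d \<and>
          continuous_on K (\<lambda>z. vorticity H v1 v2 (t, z)) \<and>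
          Np p (\<lambda>z. vorticity H v1 v2 (t, z) - \<eta> z) powr (1 / p) \<le> \<nu>)))"
    using state_summary[OF p] by (elim exE conjE) (rule that)
  obtain C2 where C2: "0 \<le> C2" and bounds': "\<forall>\<delta> \<eta> a b c d. 0 \<le> \<delta> \<longrightarrow> \<delta> \<le> 1 \<longrightarrow> state \<delta> \<eta> a b c d \<longrightarrow>
     \<bar>a\<bar> \<le> C2 * sqrt \<delta> \<and> \<bar>pl b\<bar> \<le> C2 * sqrt \<delta> \<and> \<bar>defect c0 d0 ws b c d\<bar> \<le> C2 * sqrt \<delta> \<and>
     (\<forall>z\<in>K. \<bar>\<eta> z - wb z - (trig2 a b z + trig1 c d z)\<bar> \<le> C2)"
    by (rule exE[OF state_bounds[OF asm]], assumption, assumption, elim conjE)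
      (rule that, assumption, unfold pl_def)
  note bounds = bounds'[rule_format]
  define m where "m = 8 / H * \<bar>be\<bar> + 2"
  have m2: "2 \<le> m" unfolding m_def using H_pos by simp
  \<comment> \<open>For |b| at most \<open>r\<close>, the term in \<open>trig2\<close> is at most
    \<open>\<rho> / 3\<close>. Because \<open>r \<le> 1\<close>, the terms in \<open>b\<close>
    change the squared amplitude by at most \<open>r * m\<close>, which is at most
    \<open>\<rho>^2 / 18\<close>.\<close>
  define r where "r = min 1 (min (\<rho> / 3) (\<rho>\<^sup>2 / (18 * m)))"
  have r: "0 < r" "r \<le> 1" "r \<le> \<rho> / 3" "r * m \<le> \<rho>\<^sup>2 / 18"
  proof -
    show "0 < r" "r \<le> 1" "r \<le> \<rho> / 3" unfolding r_def using \<rho> m2 by auto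
    have "r \<le> \<rho>\<^sup>2 / (18 * m)" unfolding r_def by simp
    then show "r * m \<le> \<rho>\<^sup>2 / 18" using m2 by (simp add: field_simps)
  qed
  obtain s where s: "0 < s" "s \<le> r" "pl s \<noteq> 0" "pl (- s) \<noteq> 0"
    unfolding pl_def by (rule pol_isolated[OF r(1)])
  \<comment> \<open>A lower bound for |pl| at the two ends of the trap: once |pl| stays below
    \<open>q\<close> along the flow, \<open>bf\<close> can take neither value \<open>s\<close> nor
    \<open>- s\<close>. The other two entries make \<open>a\<close> and \<open>defect\<close> small
    enough for the final count.\<close>
  define q where "q = min (min \<bar>pl s\<bar> \<bar>pl (- s)\<bar>) (min (\<rho> / 3) (\<rho>\<^sup>2 / 18))"
  have q: "0 < q" "q \<le> \<bar>pl s\<bar>" "q \<le> \<bar>pl (- s)\<bar>" "q \<le> \<rho> / 3" "q \<le> \<rho>\<^sup>2 / 18"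
    unfolding q_def using s \<rho> by auto
  define \<delta>0 where "\<delta>0 = min 1 (min s ((q / (C2 + 1))\<^sup>2))"
  have \<delta>0: "0 < \<delta>0" unfolding \<delta>0_def using s q C2 by simp
  define \<nu>0 where "\<nu>0 = min 1 (\<delta>0 / (C1 + 1))"
  have \<nu>0: "0 < \<nu>0" unfolding \<nu>0_def using \<delta>0 C1 by simp
  define C where "C = C1 + C2"
  have "\<exists>\<alpha> f1 f2 f3. continuous_on K f1 \<and> continuous_on K f2 \<and> continuous_on K f3 \<and>
          (\<forall>z\<in>K. vorticity H v1 v2 (t, z) - wb (z + (\<alpha>, 0)) = f1 z + f2 z + f3 z) \<and>
          Np p f1 powr (1 / p) \<le> \<nu> \<and>
          I (\<lambda>z. (f2 z)\<^sup>2) \<le> C * \<nu> \<and> (\<forall>z\<in>K. \<bar>f2 z\<bar> \<le> C) \<and>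
          (\<forall>z\<in>K. \<bar>f3 z\<bar> \<le> \<rho>)"
    if e: "euler_flow L H v1 v2 P" and \<nu>: "\<nu> = Np p (\<lambda>z. vorticity H v1 v2 (0, z) - wb z) powr (1 / p)" "\<nu> < \<nu>0"
    for v1 v2 P \<nu> t
  proof -
    have n0: "0 \<le> \<nu>" unfolding \<nu>(1) by simp
    have n1: "\<nu> \<le> 1" using \<nu>(2) unfolding \<nu>0_def by simp
    define \<delta> where "\<delta> = C1 * \<nu>"
    have d0: "0 \<le> \<delta>" unfolding \<delta>_def using C1 n0 by simp
    have dlt: "\<delta> < \<delta>0"
    proof -
      have "\<nu> < \<delta>0 / (C1 + 1)" using \<nu>(2) unfolding \<nu>0_def by simp
      then have "(C1 + 1) * \<nu> < \<delta>0" using C1 by (simp add: pos_less_divide_eq mult.commute)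
      then show ?thesis unfolding \<delta>_def using n0 by (simp add: algebra_simps)
    qed
    then have d1: "\<delta> \<le> 1" "\<delta> < s" unfolding \<delta>0_def by auto
    have small: "C2 * sqrt \<delta> < q"
    proof -
      have "\<delta> < (q / (C2 + 1))\<^sup>2" using dlt unfolding \<delta>0_def by simp
      then have "sqrt \<delta> < q / (C2 + 1)"
        using real_sqrt_less_mono[of \<delta> "(q / (C2 + 1))\<^sup>2"] q C2 by simp
      then have "(C2 + 1) * sqrt \<delta> < q" using C2 by (simp add: pos_less_divide_eq mult.commute)
      then have "C2 * sqrt \<delta> + sqrt \<delta> < q" by (simp add: algebra_simps)
      then show ?thesis using real_sqrt_ge_zero[OF d0] by linarith
    qed
    obtain bf where bf: "continuous_on UNIV bf" "\<bar>bf 0\<bar> \<le> \<delta>"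
      and st: "\<And>t. \<exists>\<eta> a c d. state \<delta> \<eta> a (bf t) c d \<and>
          continuous_on K (\<lambda>z. vorticity H v1 v2 (t, z)) \<and>
          Np p (\<lambda>z. vorticity H v1 v2 (t, z) - \<eta> z) powr (1 / p) \<le> \<nu>"
    proof -
      have "\<exists>bf. continuous_on UNIV bf \<and> \<bar>bf 0\<bar> \<le> C1 * \<nu> \<and>
         (\<forall>t::real. \<exists>\<eta> a c d. state (C1 * \<nu>) \<eta> a (bf t) c d \<and>
          continuous_on K (\<lambda>z. vorticity H v1 v2 (t, z)) \<and>
          Np p (\<lambda>z. vorticity H v1 v2 (t, z) - \<eta> z) powr (1 / p) \<le> \<nu>)"
        by (rule summary[rule_format, OF e \<nu>(1) n1])
      then show ?thesis unfolding \<delta>_def[symmetric] by (elim exE conjE) (rule that, assumption, assumption, erule spec)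
    qed
    have plb: "\<bar>pl (bf t)\<bar> < q" for t
    proof -
      obtain \<eta> a c d where "state \<delta> \<eta> a (bf t) c d" using st[of t] by blast
      from bounds[OF d0 d1(1) this] small show ?thesis by simp
    qed
    have b: "\<bar>bf t\<bar> < s"
    proof (rule trapped[OF bf(1)])
      show "\<bar>bf 0\<bar> < s" using bf(2) d1 by simp
      show "bf t \<noteq> s" for t using plb[of t] q(2) by auto
      show "bf t \<noteq> - s" for t using plb[of t] q(3) by auto
    qed
    obtain \<eta> a c d where sta: "state \<delta> \<eta> a (bf t) c d"
      and wc: "continuous_on K (\<lambda>z. vorticity H v1 v2 (t, z))"
      and near: "Np p (\<lambda>z. vorticity H v1 v2 (t, z) - \<eta> z) powr (1 / p) \<le> \<nu>"
      using st[of t] by blast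
    note B = bounds[OF d0 d1(1) sta]
    define R where "R = (c0 + c)\<^sup>2 + (d0 + d)\<^sup>2"
    define R' where "R' = c0\<^sup>2 + d0\<^sup>2"
    have "\<bar>R - R'\<bar> \<le> \<rho>\<^sup>2 / 9"
    proof -
      have "R - R' = defect c0 d0 ws (bf t) c d - 8 / H * be * bf t - 2 * (bf t)\<^sup>2"
        unfolding defect_def R0_def R_def R'_def be_def by simp
      moreover have "\<bar>8 / H * be * bf t\<bar> \<le> 8 / H * \<bar>be\<bar> * r"
        unfolding abs_mult using b s(2) H_pos by (intro mult_mono) auto
      moreover have "(bf t)\<^sup>2 \<le> r"
      proof -
        have "\<bar>bf t\<bar> * \<bar>bf t\<bar> \<le> r * 1" using b s(2) r by (intro mult_mono) auto
        then show ?thesis by (simp add: power2_eq_square)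
      qed
      moreover have "0 \<le> (bf t)\<^sup>2" by simp
      ultimately have "\<bar>R - R'\<bar> \<le> q + (8 / H * \<bar>be\<bar> * r + 2 * r)" using B small by linarith
      also have "8 / H * \<bar>be\<bar> * r + 2 * r = r * m" unfolding m_def by (simp add: algebra_simps)
      also have "q + r * m \<le> \<rho>\<^sup>2 / 9" using q(5) r(4) by linarith
      finally show ?thesis .
    qed
    \<comment> \<open>The amplitudes are square roots of \<open>R\<close> and \<open>R'\<close>, and
      \<open>R'\<close> may be zero. The Hoelder bound of the square root also covers a purely
      vertical steady flow, at the price of a squared tolerance.\<close>
    then have "sqrt \<bar>R - R'\<bar> \<le> sqrt (\<rho>\<^sup>2 / 9)" by (rule real_sqrt_le_mono)
    also have "\<dots> = \<rho> / 3" using \<rho> by (simp add: real_sqrt_divide)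
    finally have sR: "\<bar>sqrt R - sqrt R'\<bar> \<le> \<rho> / 3"
      using sqrt_diff_le[of R R'] unfolding R_def R'_def by simp
    obtain \<alpha> where \<alpha>: "\<And>x y. \<bar>trig1 (c0 + c) (d0 + d) (x, y) - trig1 c0 d0 (x + \<alpha>, y)\<bar> \<le> \<bar>sqrt R - sqrt R'\<bar>"
      using trig1_rotate[of "c0 + c" "d0 + d" c0 d0] unfolding R_def R'_def by blast
    have wbK: "continuous_on K wb" by (rule K_cont[OF wb_cont])
    have \<eta>c: "continuous_on K \<eta>" and f2I: "I (\<lambda>z. (\<eta> z - wb z - (trig2 a (bf t) z + trig1 c d z))\<^sup>2) \<le> \<delta>"
      using sta unfolding state_def by auto
    have shw: "continuous_on K (\<lambda>z. wb (z + (\<alpha>, 0)))"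
      using shift_cont[OF wb_cont, of \<alpha>] by (simp add: plus_prod_def)
    define f1 where "f1 z = vorticity H v1 v2 (t, z) - \<eta> z" for z
    define f2 where "f2 z = \<eta> z - wb z - (trig2 a (bf t) z + trig1 c d z)" for z
    define f3 where "f3 z = wb z + (trig2 a (bf t) z + trig1 c d z) - wb (z + (\<alpha>, 0))" for z
    have f3: "\<bar>f3 z\<bar> \<le> \<rho>" if z: "z \<in> K" for z
    proof -
      obtain x y where xy: "z = (x, y)" "y \<in> {0..H}" using z unfolding K_def by auto
      have "f3 z = trig2 a (bf t) z + (trig1 (c0 + c) (d0 + d) (x, y) - trig1 c0 d0 (x + \<alpha>, y))"
        unfolding f3_def xy(1) using wbd[OF xy(2), of x] wbd[OF xy(2), of "x + \<alpha>"]
        by (simp add: trig1_add)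
      moreover have "\<bar>trig2 a (bf t) z\<bar> \<le> \<rho> / 3 + \<rho> / 3"
        using trig_bound(2)[of a "bf t" z] B small q(4) b s(2) r(3) by linarith
      ultimately show ?thesis using \<alpha>[of x y] sR by linarith
    qed
    have "C2 \<le> C" "\<delta> \<le> C * \<nu>" unfolding C_def \<delta>_def using C1 C2 n0 by (auto intro!: mult_right_mono)
    moreover have "continuous_on K f1" "continuous_on K f2" "continuous_on K f3"
      unfolding f1_def f2_def f3_def by (intro continuous_intros wc \<eta>c wbK trig_cont shw)+
    moreover have "\<forall>z\<in>K. \<bar>f2 z\<bar> \<le> C" unfolding f2_def using B \<open>C2 \<le> C\<close> by fastforce
    moreover have "\<forall>z\<in>K. vorticity H v1 v2 (t, z) - wb (z + (\<alpha>, 0)) = f1 z + f2 z + f3 z"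
      unfolding f1_def f2_def f3_def by simp
    moreover have "Np p f1 powr (1 / p) \<le> \<nu>" unfolding f1_def by (rule near)
    moreover have "I (\<lambda>z. (f2 z)\<^sup>2) \<le> C * \<nu>" unfolding f2_def using f2I \<open>\<delta> \<le> C * \<nu>\<close> by (rule order_trans)
    ultimately show ?thesis using f3
      by (intro exI[of _ \<alpha>] exI[of _ f1] exI[of _ f2] exI[of _ f3]) simp
  qed
  then show ?thesis
    using \<nu>0 C1 C2 by (intro exI[of _ \<nu>0] conjI exI[of _ C]; (simp add: C_def)?)
qed

theorem part_ii:
  assumes p: "1 < p"
  shows "orbitally_stable L H p wb"
  unfolding orbitally_stable_def
proof (intro allI impI)
  fix \<epsilon> :: real assume \<epsilon>: "0 < \<epsilon>"
  have p0: "0 < p" using p by simp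
  have LH: "0 < L * H" using L_pos H_pos by simp
  \<comment> \<open>Four contributions of size at most \<open>k\<close> will be added, one of them
    strictly smaller: \<open>f1\<close>, the square term of \<open>f2\<close>, and twice
    \<open>\<rho> powr p\<close> times the area. The denominator 5 leaves room, and
    \<open>3 powr p\<close> is lost in splitting the sum of three functions.\<close>
  define k where "k = \<epsilon> powr p / (5 * 3 powr p)"
  have k: "0 < k" unfolding k_def using \<epsilon> by simp
  define \<rho> where "\<rho> = (k / (L * H)) powr (1 / p)"
  have \<rho>: "0 < \<rho>" "\<rho> powr p = k / (L * H)" unfolding \<rho>_def using k LH p by (auto simp: powr_powr)
  obtain \<nu>0 C where \<nu>0: "0 < \<nu>0" and C: "0 \<le> C" and main: "\<forall>v1 v2 P. euler_flow L H v1 v2 P \<longrightarrow>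
     (\<forall>\<nu>. \<nu> = Np p (\<lambda>z. vorticity H v1 v2 (0, z) - wb z) powr (1 / p) \<longrightarrow> \<nu> < \<nu>0 \<longrightarrow>
       (\<forall>t::real. \<exists>\<alpha> f1 f2 f3. continuous_on K f1 \<and> continuous_on K f2 \<and> continuous_on K f3 \<and>
          (\<forall>z\<in>K. vorticity H v1 v2 (t, z) - wb (z + (\<alpha>, 0)) = f1 z + f2 z + f3 z) \<and>
          Np p f1 powr (1 / p) \<le> \<nu> \<and>
          I (\<lambda>z. (f2 z)\<^sup>2) \<le> C * \<nu> \<and> (\<forall>z\<in>K. \<bar>f2 z\<bar> \<le> C) \<and>
          (\<forall>z\<in>K. \<bar>f3 z\<bar> \<le> \<rho>)))"
    using orbit_close[OF p \<rho>(1)] by (elim exE conjE) (rule that)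
  define X where "X = C powr p / \<rho>\<^sup>2 * C"
  have X: "0 \<le> X" unfolding X_def using C by simp
  define \<delta> where "\<delta> = min \<nu>0 (min (k powr (1 / p)) (k / (X + 1)))"
  have \<delta>: "0 < \<delta>" "\<delta> \<le> \<nu>0" "\<delta> \<le> k powr (1 / p)" "\<delta> \<le> k / (X + 1)"
    unfolding \<delta>_def using \<nu>0 k X by auto
  show "\<exists>\<delta>>0. \<forall>v1 v2 P. euler_flow L H v1 v2 P \<longrightarrow>
        Lp_norm L H p (\<lambda>x. vorticity H v1 v2 (0, x) - wb x) < \<delta> \<longrightarrow>
        (\<forall>t. \<exists>\<alpha>. Lp_norm L H p (\<lambda>x. vorticity H v1 v2 (t, x) - wb (x + (\<alpha>, 0))) < \<epsilon>)"
  proof (rule exI[of _ \<delta>], intro conjI \<delta>(1) allI impI)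
    fix v1 v2 P t
    assume e: "euler_flow L H v1 v2 P" and small: "Lp_norm L H p (\<lambda>x. vorticity H v1 v2 (0, x) - wb x) < \<delta>"
    interpret E: euler L H v1 v2 P by unfold_locales (rule e)
    have wK: "continuous_on K (\<lambda>z. vorticity H v1 v2 (t, z))" for t
      unfolding E.w_vorticity by (rule K_cont_time[OF E.w_c(1)])
    define \<nu> where "\<nu> = Np p (\<lambda>z. vorticity H v1 v2 (0, z) - wb z) powr (1 / p)"
    have n: "\<nu> < \<delta>" unfolding \<nu>_def
      using small by (subst (asm) Lp_norm_Np) (auto intro!: continuous_on_diff wK K_cont[OF wb_cont] p0)
    have n0: "0 \<le> \<nu>" unfolding \<nu>_def by simp
    have "\<exists>\<alpha> f1 f2 f3. continuous_on K f1 \<and> continuous_on K f2 \<and> continuous_on K f3 \<and>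
          (\<forall>z\<in>K. vorticity H v1 v2 (t, z) - wb (z + (\<alpha>, 0)) = f1 z + f2 z + f3 z) \<and>
          Np p f1 powr (1 / p) \<le> \<nu> \<and>
          I (\<lambda>z. (f2 z)\<^sup>2) \<le> C * \<nu> \<and> (\<forall>z\<in>K. \<bar>f2 z\<bar> \<le> C) \<and>
          (\<forall>z\<in>K. \<bar>f3 z\<bar> \<le> \<rho>)"
      by (rule main[rule_format, OF e \<nu>_def]) (use n \<delta>(2) in simp)
    then obtain \<alpha> f1 f2 f3 where A: "continuous_on K f1 \<and> continuous_on K f2 \<and> continuous_on K f3 \<and>
          (\<forall>z\<in>K. vorticity H v1 v2 (t, z) - wb (z + (\<alpha>, 0)) = f1 z + f2 z + f3 z) \<and>
          Np p f1 powr (1 / p) \<le> \<nu> \<and>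
          I (\<lambda>z. (f2 z)\<^sup>2) \<le> C * \<nu> \<and> (\<forall>z\<in>K. \<bar>f2 z\<bar> \<le> C) \<and>
          (\<forall>z\<in>K. \<bar>f3 z\<bar> \<le> \<rho>)"
      by (elim exE) (rule that)
    have f: "continuous_on K f1" "continuous_on K f2" "continuous_on K f3"
      and eq: "\<And>z. z \<in> K \<Longrightarrow> vorticity H v1 v2 (t, z) - wb (z + (\<alpha>, 0)) = f1 z + f2 z + f3 z"
      and 1: "Np p f1 powr (1 / p) \<le> \<nu>" and 2: "I (\<lambda>z. (f2 z)\<^sup>2) \<le> C * \<nu>" "\<And>z. z \<in> K \<Longrightarrow> \<bar>f2 z\<bar> \<le> C"
      and 3: "\<And>z. z \<in> K \<Longrightarrow> \<bar>f3 z\<bar> \<le> \<rho>"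
      using A by simp_all
    define g where "g z = vorticity H v1 v2 (t, z) - wb (z + (\<alpha>, 0))" for z
    have gc: "continuous_on K g"
      unfolding g_def using shift_cont[OF wb_cont, of \<alpha>] wK by (auto simp: plus_prod_def intro!: continuous_intros)
    note pc = powr_cont[OF f(1) p0]
    have N1: "Np p f1 < k"
    proof -
      have "Np p f1 = (Np p f1 powr (1 / p)) powr p" using p Np_nonneg[OF f(1) p0] by (simp add: powr_powr)
      also have "\<dots> \<le> \<nu> powr p" using 1 p by (intro powr_mono2) auto
      also have "\<dots> < (k powr (1 / p)) powr p" using n \<delta>(3) n0 p by (intro powr_less_mono2) auto
      also have "\<dots> = k" using p k by (simp add: powr_powr)
      finally show ?thesis .
    qed
    have N2: "C powr p / \<rho>\<^sup>2 * I (\<lambda>z. (f2 z)\<^sup>2) \<le> k"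
    proof -
      have "C powr p / \<rho>\<^sup>2 * I (\<lambda>z. (f2 z)\<^sup>2) \<le> C powr p / \<rho>\<^sup>2 * (C * \<nu>)"
        using 2(1) by (intro mult_left_mono) auto
      also have "\<dots> = X * \<nu>" unfolding X_def by simp
      also have "\<dots> \<le> (X + 1) * (k / (X + 1))"
        using n \<delta>(4) n0 X by (intro mult_mono) auto
      also have "\<dots> = k" using X by simp
      finally show ?thesis .
    qed
    have "Np p g \<le> I (\<lambda>z. 3 powr p * (\<bar>f1 z\<bar> powr p + (\<rho> powr p + C powr p / \<rho>\<^sup>2 * (f2 z)\<^sup>2) + \<rho> powr p))"
      unfolding Np_def
    proof (rule I_mono)
      fix z assume z: "z \<in> K"
      have "\<bar>g z\<bar> powr p \<le> 3 powr p * (\<bar>f1 z\<bar> powr p + \<bar>f2 z\<bar> powr p + \<bar>f3 z\<bar> powr p)"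
        unfolding g_def eq[OF z] by (rule abs_powr_sum3[OF p0])
      also have "\<dots> \<le> 3 powr p * (\<bar>f1 z\<bar> powr p + (\<rho> powr p + C powr p / \<rho>\<^sup>2 * (f2 z)\<^sup>2) + \<rho> powr p)"
        using powr_le_square[OF p0 2(2)[OF z] \<rho>(1)] 3[OF z] p
        by (intro mult_left_mono add_mono order_refl powr_mono2) auto
      finally show "\<bar>g z\<bar> powr p \<le> 3 powr p * (\<bar>f1 z\<bar> powr p + (\<rho> powr p + C powr p / \<rho>\<^sup>2 * (f2 z)\<^sup>2) + \<rho> powr p)" .
    qed (intro powr_cont[OF gc p0] continuous_intros f pc)+
    also have "\<dots> = 3 powr p * (Np p f1 + (\<rho> powr p * (L * H) + C powr p / \<rho>\<^sup>2 * I (\<lambda>z. (f2 z)\<^sup>2)) + \<rho> powr p * (L * H))"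
      unfolding Np_def I_const[of "\<rho> powr p", symmetric]
      by (intro I_unique has_integral_add has_integral_mult_right I_has_integral continuous_intros f pc)
    also have "\<dots> < 3 powr p * (k + (k + k) + k)"
      using N1 N2 \<rho>(2) LH by (intro mult_strict_left_mono) auto
    also have "\<dots> < 3 powr p * (5 * k)" using k by simp
    also have "\<dots> = \<epsilon> powr p" unfolding k_def by simp
    finally have "Np p g powr (1 / p) < (\<epsilon> powr p) powr (1 / p)"
      using p Np_nonneg[OF gc p0] by (intro powr_less_mono2) auto
    also have "\<dots> = \<epsilon>" using p \<epsilon> by (simp add: powr_powr)
    finally have "Lp_norm L H p g < \<epsilon>" by (simp add: Lp_norm_Np[OF gc p0])
    then show "\<exists>\<alpha>. Lp_norm L H p (\<lambda>x. vorticity H v1 v2 (t, x) - wb (x + (\<alpha>, 0))) < \<epsilon>"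
      unfolding g_def by blast
  qed
qed

end

theorem theorem1p3:
  fixes L H lam p :: real and \<psi> :: "real \<times> real \<Rightarrow> real" and g :: "real \<Rightarrow> real"
  assumes "L > 0" and "H > 0"
    and "x1_periodic L H \<psi>" and "Ck_on 2 (cl_strip H) \<psi>"
    and "g C1_differentiable_on UNIV"
    and "\<And>x1 x2. (x1, x2) \<in> strip H \<Longrightarrow>
           - laplacian H \<psi> (x1, x2) = g (\<psi> (x1, x2) - lam * x2)"
    and "\<exists>c. \<forall>x1. \<psi> (x1, 0) = c" and "\<exists>c. \<forall>x1. \<psi> (x1, H) = c"
    and "1 < p"
    and "\<And>x1 x2. (x1, x2) \<in> cl_strip H \<Longrightarrow> 0 \<le> deriv g (\<psi> (x1, x2) - lam * x2)"
    and "\<And>x1 x2. (x1, x2) \<in> cl_strip H \<Longrightarrow> deriv g (\<psi> (x1, x2) - lam * x2) \<le> Lambda1 L H"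
  shows "(\<exists>\<psi>e\<in>E1 L H. \<exists>\<psi>s :: real \<Rightarrow> real.
            \<forall>(x1, x2)\<in>cl_strip H. \<psi> (x1, x2) = \<psi>e (x1, x2) + \<psi>s x2)
       \<and> orbitally_stable L H p (\<lambda>x. - laplacian H \<psi> x)"
proof -
  interpret steady L H lam \<psi> g
    by unfold_locales (use assms in auto)
  show ?thesis
    using part_i part_ii[OF \<open>1 < p\<close>] unfolding wb_def[abs_def] by blast
qed

end
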